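(* Let $V\in C^2([0,+\infty),\mathbb{R})$ be strictly positive on $[0,+\infty)$ or strictly negative on $[0,+\infty)$, and let $T>0$ be such that $T>2m_f\sup_{t\geq 0}V(t)^2$. Then there exists a unique evolution system $U(t,s)$, $0\leq s\leq t$, in $\mathcal{H}$ satisfying: (i) $U(t,s)D(\mathcal{A}_0(s))=D(\mathcal{A}_0(t))$ for every $0\leq s\leq t$; (ii) for every $s\geq 0$ and every $f\in D(\mathcal{A}_0(s))$, the function $t\mapsto U(t,s)f$ is continuously differentiable on $[s,+\infty)$ with values in $\mathcal{H}$ (with respect to the norm of $\mathcal{H}$), and $$\frac{d}{dt}U(t,s)f=\mathcal{A}(t)U(t,s)f .$$
   Context: Let $L,m_p,m_f,EI,c>0$ be constants ($EI$ denotes a single constant, the bending stiffness). Subscripts $x$ and $t$ denote derivatives in space and time. Define $$\mathcal{V}=\{w\in H^2((0,L),\mathbb{R}) : w(0)=0\},\qquad \mathcal{H}=\{(w,v): w\in\mathcal{V},\ v\in L^2((0,L),\mathbb{R})\},$$ where $\mathcal{H}$ is the Hilbert space with scalar product $\langle (w_1,v_1),(w_2,v_2)\rangle_{\mathcal{H}}=\int_0^L\big(\partial_x^2w_1\,\partial_x^2w_2+\partial_xw_1\,\partial_xw_2+v_1v_2\big)\,dx$. For $t\geq 0$, let $\mathcal{A}_0(t)$ be the operator in $\mathcal{H}$ $$\mathcal{A}_0(t)(w,v)=\Big(v,\ -\tfrac{EI}{m_p+2m_f}w_{xxxx}+\tfrac{T-2m_fV(t)^2}{m_p+2m_f}w_{xx}-\tfrac{4m_fV(t)}{m_p+2m_f}v_x\Big)$$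 with domain $$D(\mathcal{A}_0(t))=\{(w,v)\in\mathcal{H}: w\in\mathcal{V}\cap H^4((0,L),\mathbb{R}),\ v\in\mathcal{V},\ w_{xx}(0)=w_{xx}(L)=0,\ 2m_fV(t)v(L)=-EI\,w_{xxx}(L)+(T-2m_fV(t)^2)w_x(L)\}.$$ Let $B(t)$ be the bounded operator in $\mathcal{H}$ $$B(t)(w,v)=\Big(0,\ -\tfrac{c}{m_p+2m_f}v-\tfrac{2m_fV_t(t)}{m_p+2m_f}w_x\Big),$$ and set $\mathcal{A}(t)=\mathcal{A}_0(t)+B(t)$ with domain $D(\mathcal{A}_0(t))$. With $v=w_t$, the equation $\frac{d}{dt}(w,v)=\mathcal{A}(t)(w,v)$ is the beam equation $$(m_p+2m_f)w_{tt}+EI\,w_{xxxx}-(T-2m_fV(t)^2)w_{xx}+c\,w_t+2m_fV_t(t)w_x+4m_fV(t)w_{xt}=0,\quad 0<x<L,\ t>0,$$ with boundary conditions $w_{xx}(0,t)=w_{xx}(L,t)=w(0,t)=0$ and $EI\,w_{xxx}(L,t)-(T-2m_fV(t)^2)w_x(L,t)+2m_fV(t)w_t(L,t)=0$. A two-parameter family of bounded linear operators $U(t,s)$, $0\leq s\leq t$, on $\mathcal{H}$ is called an evolution system if: $U(s,s)=I$ for every $s\geq0$; $U(t,r)U(r,s)=U(t,s)$ for every $0\leq s\leq r\leq t$; and for every $f\in\mathcal{H}$ the function $(t,s)\mapsto U(t,s)f$ is continuous with respect to the norm of $\mathcal{H}$ for $0\leq s\leq t$. *)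

theory Defs
  imports "HOL-Analysis.Analysis"
begin

section \<open>Square-integrable functions on the line\<close>

definition square_integrable :: "(real \<Rightarrow> real) \<Rightarrow> bool" where
  "square_integrable f \<longleftrightarrow> f \<in> borel_measurable borel \<and> integrable lborel (\<lambda>x. (f x)\<^sup>2)"

definition l2_rel :: "(real \<Rightarrow> real) \<Rightarrow> (real \<Rightarrow> real) \<Rightarrow> bool" where
  "l2_rel f g \<longleftrightarrow> square_integrable f \<and> square_integrable g \<and> (AE x in lborel. f x = g x)"

quotient_type l2 = "real \<Rightarrow> real" / partial: l2_rel
proof (rule part_equivpI)
  show "\<exists>x. l2_rel x x"
    by (rule exI[of _ "\<lambda>_. 0"]) (simp add: l2_rel_def square_integrable_def)
  show "symp l2_rel"
    by (auto intro!: sympI simp: l2_rel_def elim: AE_mp)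
  show "transp l2_rel"
  proof (rule transpI)
    fix f g h assume "l2_rel f g" "l2_rel g h"
    then have "AE x in lborel. f x = g x" "AE x in lborel. g x = h x"
      by (simp_all add: l2_rel_def)
    then have "AE x in lborel. f x = h x" by eventually_elim simp
    with \<open>l2_rel f g\<close> \<open>l2_rel g h\<close> show "l2_rel f h" by (simp add: l2_rel_def)
  qed
qed

lemma square_integrable_mult:
  assumes "square_integrable f" "square_integrable g"
  shows "integrable lborel (\<lambda>x. f x * g x)"
proof (rule Bochner_Integration.integrable_bound)
  show "integrable lborel (\<lambda>x. (f x)\<^sup>2 + (g x)\<^sup>2)"
    using assms by (simp add: square_integrable_def)
  show "(\<lambda>x. f x * g x) \<in> borel_measurable lborel"
    using assms by (auto simp: square_integrable_def)
  have "\<bar>a * b\<bar> \<le> a\<^sup>2 + b\<^sup>2" for a b :: real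
  proof -
    have "2 * \<bar>a\<bar> * \<bar>b\<bar> \<le> \<bar>a\<bar>\<^sup>2 + \<bar>b\<bar>\<^sup>2" by (rule sum_squares_bound)
    moreover have "0 \<le> \<bar>a\<bar> * \<bar>b\<bar>" by simp
    ultimately have "\<bar>a\<bar> * \<bar>b\<bar> \<le> \<bar>a\<bar>\<^sup>2 + \<bar>b\<bar>\<^sup>2" by linarith
    then show ?thesis by (simp add: abs_mult)
  qed
  then show "AE x in lborel. norm (f x * g x) \<le> norm ((f x)\<^sup>2 + (g x)\<^sup>2)" by simp
qed

lemma square_integrable_add:
  assumes "square_integrable f" "square_integrable g"
  shows "square_integrable (\<lambda>x. f x + g x)"
  using assms square_integrable_mult[OF assms]
  by (auto simp: square_integrable_def power2_sum mult.assoc)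

lemma square_integrable_scale:
  "square_integrable f \<Longrightarrow> square_integrable (\<lambda>x. c * f x)"
  by (auto simp: square_integrable_def power_mult_distrib)

lemma square_integrable_zero: "square_integrable (\<lambda>_. 0)"
  by (simp add: square_integrable_def)

instantiation l2 :: real_inner
begin

lift_definition zero_l2 :: l2 is "\<lambda>_. 0"
  by (simp add: l2_rel_def square_integrable_zero)

lift_definition plus_l2 :: "l2 \<Rightarrow> l2 \<Rightarrow> l2" is "\<lambda>f g x. f x + g x"
  by (auto simp: l2_rel_def intro: square_integrable_add)

lift_definition scaleR_l2 :: "real \<Rightarrow> l2 \<Rightarrow> l2" is "\<lambda>c f x. c * f x"
  by (auto simp: l2_rel_def intro: square_integrable_scale)

lift_definition uminus_l2 :: "l2 \<Rightarrow> l2" is "\<lambda>f x. - f x"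
  using square_integrable_scale[of _ "-1"] by (auto simp: l2_rel_def)

definition minus_l2 :: "l2 \<Rightarrow> l2 \<Rightarrow> l2" where "minus_l2 f g = f + (- g)"

lift_definition inner_l2 :: "l2 \<Rightarrow> l2 \<Rightarrow> real" is "\<lambda>f g. \<integral>x. f x * g x \<partial>lborel"
proof -
  fix f f' g g' assume A: "l2_rel f f'" "l2_rel g g'"
  then have "AE x in lborel. f x = f' x" "AE x in lborel. g x = g' x"
    by (simp_all add: l2_rel_def)
  then have "AE x in lborel. f x * g x = f' x * g' x" by eventually_elim simp
  then show "(\<integral>x. f x * g x \<partial>lborel) = (\<integral>x. f' x * g' x \<partial>lborel)"
    using A by (intro integral_cong_AE) (auto simp: l2_rel_def square_integrable_def)
qed

definition norm_l2 :: "l2 \<Rightarrow> real" where "norm_l2 f = sqrt (f \<bullet> f)"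
definition dist_l2 :: "l2 \<Rightarrow> l2 \<Rightarrow> real" where "dist_l2 f g = norm (f - g)"
definition sgn_l2 :: "l2 \<Rightarrow> l2" where "sgn_l2 f = inverse (norm f) *\<^sub>R f"
definition uniformity_l2 :: "(l2 \<times> l2) filter" where
  "uniformity_l2 = (INF e\<in>{0 <..}. principal {(f, g). dist f g < e})"
definition open_l2 :: "l2 set \<Rightarrow> bool" where
  "open_l2 S \<longleftrightarrow> (\<forall>f\<in>S. \<forall>\<^sub>F (f', g) in uniformity. f' = f \<longrightarrow> g \<in> S)"

instance
proof
  fix f g h :: l2 and a b :: real
  show "f + g + h = f + (g + h)"
    by transfer (auto simp: l2_rel_def add.assoc intro!: square_integrable_add)
  show "f + g = g + f"
    by transfer (auto simp: l2_rel_def add.commute intro!: square_integrable_add)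
  show "0 + f = f"
    by transfer (auto simp: l2_rel_def)
  show "- f + f = 0"
    by transfer (auto simp: l2_rel_def square_integrable_zero)
  show "f - g = f + - g" by (rule minus_l2_def)
  show "a *\<^sub>R (f + g) = a *\<^sub>R f + a *\<^sub>R g"
    by transfer (auto simp: l2_rel_def algebra_simps
        intro!: square_integrable_add square_integrable_scale)
  show "(a + b) *\<^sub>R f = a *\<^sub>R f + b *\<^sub>R f"
    by transfer (auto simp: l2_rel_def ring_distribs
        intro!: square_integrable_add square_integrable_scale
                square_integrable_scale[where c = "a + b", unfolded ring_distribs])
  show "a *\<^sub>R b *\<^sub>R f = (a * b) *\<^sub>R f"
    by transfer (auto simp: l2_rel_def mult.assoc
        intro!: square_integrable_scale square_integrable_scale[where c = "a * b", unfolded mult.assoc])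
  show "1 *\<^sub>R f = f" by transfer (auto simp: l2_rel_def)
  show "dist f g = norm (f - g)" by (rule dist_l2_def)
  show "sgn f = inverse (norm f) *\<^sub>R f" by (rule sgn_l2_def)
  show "(uniformity :: (l2 \<times> l2) filter) = (INF e\<in>{0 <..}. principal {(f, g). dist f g < e})"
    by (rule uniformity_l2_def)
  show "open S \<longleftrightarrow> (\<forall>f\<in>S. \<forall>\<^sub>F (f', g) in uniformity. f' = f \<longrightarrow> g \<in> S)" for S :: "l2 set"
    by (rule open_l2_def)
  show "f \<bullet> g = g \<bullet> f" by transfer (simp add: mult.commute)
  show "(f + g) \<bullet> h = f \<bullet> h + g \<bullet> h"
    by transfer (simp add: l2_rel_def ring_distribs square_integrable_mult)
  show "(a *\<^sub>R f) \<bullet> g = a * (f \<bullet> g)"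
    by transfer (simp add: l2_rel_def mult.assoc)
  show "0 \<le> f \<bullet> f" by transfer simp
  show "f \<bullet> f = 0 \<longleftrightarrow> f = 0"
  proof (transfer)
    fix f assume "l2_rel f f"
    then have f: "square_integrable f" by (simp add: l2_rel_def)
    have "(\<integral>x. f x * f x \<partial>lborel) = 0 \<longleftrightarrow> (AE x in lborel. f x * f x = 0)"
      using square_integrable_mult[OF f f] by (intro integral_nonneg_eq_0_iff_AE) auto
    then show "((\<integral>x. f x * f x \<partial>lborel) = 0) = l2_rel f (\<lambda>_. 0)"
      using f by (simp add: l2_rel_def square_integrable_zero)
  qed
  show "norm f = sqrt (f \<bullet> f)" by (rule norm_l2_def)
qed

end


section \<open>Sobolev spaces on a bounded interval\<close>

text \<open>
  The space \<open>L\<^sup>2((0, L))\<close> is realised inside the type \<open>l2\<close> by extension by zero, so that its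
  scalar product is the one of the ambient type.
\<close>

definition L2_on :: "real \<Rightarrow> l2 set" where
  "L2_on L = {f. AE x in lborel. x \<notin> {0<..<L} \<longrightarrow> rep_l2 f x = 0}"

definition test_function :: "real \<Rightarrow> (real \<Rightarrow> real) \<Rightarrow> bool" where
  "test_function L \<phi> \<longleftrightarrow>
     (\<forall>k. (deriv ^^ k) \<phi> differentiable_on UNIV) \<and>
     compact (closure {x. \<phi> x \<noteq> 0}) \<and> closure {x. \<phi> x \<noteq> 0} \<subseteq> {0<..<L}"

definition has_weak_deriv :: "real \<Rightarrow> nat \<Rightarrow> l2 \<Rightarrow> l2 \<Rightarrow> bool" where
  "has_weak_deriv L k f g \<longleftrightarrow> f \<in> L2_on L \<and> g \<in> L2_on L \<and>
     (\<forall>\<phi>. test_function L \<phi> \<longrightarrow>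
        (\<integral>x. rep_l2 f x * (deriv ^^ k) \<phi> x \<partial>lborel) =
        (-1) ^ k * (\<integral>x. rep_l2 g x * \<phi> x \<partial>lborel))"

definition sobolev :: "real \<Rightarrow> nat \<Rightarrow> l2 set" where
  "sobolev L k = {f \<in> L2_on L. \<forall>j\<le>k. \<exists>g. has_weak_deriv L j f g}"

definition weak_deriv :: "real \<Rightarrow> nat \<Rightarrow> l2 \<Rightarrow> l2" where
  "weak_deriv L k f = (THE g. has_weak_deriv L k f g)"

text \<open>
  Point values, also at the end points \<open>0\<close> and \<open>L\<close>, are those of the representative that is
  continuous on the closed interval; it exists and is unique for elements of \<open>sobolev L 1\<close>
  when \<open>0 < L\<close>.
\<close>

definition point_value :: "real \<Rightarrow> l2 \<Rightarrow> real \<Rightarrow> real" where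
  "point_value L f x = (THE y. \<exists>g. continuous_on {0..L} g \<and>
     (AE \<xi> in lborel. \<xi> \<in> {0<..<L} \<longrightarrow> rep_l2 f \<xi> = g \<xi>) \<and> y = g x)"


section \<open>The state space\<close>

definition V_space :: "real \<Rightarrow> l2 set" where
  "V_space L = {w \<in> sobolev L 2. point_value L w 0 = 0}"

definition H_space :: "real \<Rightarrow> (l2 \<times> l2) set" where
  "H_space L = V_space L \<times> L2_on L"

definition H_inner :: "real \<Rightarrow> l2 \<times> l2 \<Rightarrow> l2 \<times> l2 \<Rightarrow> real" where
  "H_inner L = (\<lambda>(w\<^sub>1, v\<^sub>1) (w\<^sub>2, v\<^sub>2).
     weak_deriv L 2 w\<^sub>1 \<bullet> weak_deriv L 2 w\<^sub>2 + weak_deriv L 1 w\<^sub>1 \<bullet> weak_deriv L 1 w\<^sub>2 + v\<^sub>1 \<bullet> v\<^sub>2)"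

definition H_norm :: "real \<Rightarrow> l2 \<times> l2 \<Rightarrow> real" where
  "H_norm L z = sqrt (H_inner L z z)"

text \<open>
  The norm \<open>H_norm L\<close> is stronger than the norm which the product type \<open>l2 \<times> l2\<close> carries.
  All topological notions below refer to \<open>H_norm L\<close>; only the vector space operations of the
  product type are used.
\<close>

definition H_tendsto :: "real \<Rightarrow> ('a \<Rightarrow> l2 \<times> l2) \<Rightarrow> l2 \<times> l2 \<Rightarrow> 'a filter \<Rightarrow> bool" where
  "H_tendsto L u z F \<longleftrightarrow> z \<in> H_space L \<and> (\<forall>\<^sub>F x in F. u x \<in> H_space L) \<and>
     ((\<lambda>x. H_norm L (u x - z)) \<longlongrightarrow> 0) F"

definition H_continuous_on :: "real \<Rightarrow> 'a::topological_space set \<Rightarrow> ('a \<Rightarrow> l2 \<times> l2) \<Rightarrow> bool" where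
  "H_continuous_on L S u \<longleftrightarrow> (\<forall>x\<in>S. H_tendsto L u (u x) (at x within S))"

definition H_has_derivative ::
    "real \<Rightarrow> (real \<Rightarrow> l2 \<times> l2) \<Rightarrow> l2 \<times> l2 \<Rightarrow> real \<Rightarrow> real set \<Rightarrow> bool" where
  "H_has_derivative L u z t S \<longleftrightarrow> u t \<in> H_space L \<and>
     H_tendsto L (\<lambda>r. (u r - u t) /\<^sub>R (r - t)) z (at t within S)"

definition H_bounded_linear :: "real \<Rightarrow> (l2 \<times> l2 \<Rightarrow> l2 \<times> l2) \<Rightarrow> bool" where
  "H_bounded_linear L P \<longleftrightarrow>
     (\<forall>f\<in>H_space L. P f \<in> H_space L) \<and>
     (\<forall>f\<in>H_space L. \<forall>g\<in>H_space L. P (f + g) = P f + P g) \<and>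
     (\<forall>a. \<forall>f\<in>H_space L. P (a *\<^sub>R f) = a *\<^sub>R P f) \<and>
     (\<exists>K. \<forall>f\<in>H_space L. H_norm L (P f) \<le> K * H_norm L f)"

definition evolution_system :: "real \<Rightarrow> (real \<Rightarrow> real \<Rightarrow> l2 \<times> l2 \<Rightarrow> l2 \<times> l2) \<Rightarrow> bool" where
  "evolution_system L U \<longleftrightarrow>
     (\<forall>s t. 0 \<le> s \<and> s \<le> t \<longrightarrow> H_bounded_linear L (U t s)) \<and>
     (\<forall>s\<ge>0. \<forall>f\<in>H_space L. U s s f = f) \<and>
     (\<forall>s r t. 0 \<le> s \<and> s \<le> r \<and> r \<le> t \<longrightarrow> (\<forall>f\<in>H_space L. U t r (U r s f) = U t s f)) \<and>
     (\<forall>f\<in>H_space L. H_continuous_on L {(t, s). 0 \<le> s \<and> s \<le> t} (\<lambda>(t, s). U t s f))"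


section \<open>The operators of the beam equation\<close>

text \<open>
  The velocity is only given on \<open>[0, \<infinity>)\<close>, hence its derivatives are taken within that set
  (one-sided at \<open>0\<close>).
\<close>

definition deriv_halfline :: "(real \<Rightarrow> real) \<Rightarrow> real \<Rightarrow> real" where
  "deriv_halfline V t = vector_derivative V (at t within {0..})"

definition C2_halfline :: "(real \<Rightarrow> real) \<Rightarrow> bool" where
  "C2_halfline V \<longleftrightarrow> V differentiable_on {0..} \<and> deriv_halfline V differentiable_on {0..} \<and>
     continuous_on {0..} (deriv_halfline (deriv_halfline V))"

definition A0 :: "real \<Rightarrow> real \<Rightarrow> real \<Rightarrow> real \<Rightarrow> real \<Rightarrow> (real \<Rightarrow> real) \<Rightarrow> real
    \<Rightarrow> l2 \<times> l2 \<Rightarrow> l2 \<times> l2" where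
  "A0 L m\<^sub>p m\<^sub>f EI T V t = (\<lambda>(w, v).
     (v, - (EI / (m\<^sub>p + 2 * m\<^sub>f)) *\<^sub>R weak_deriv L 4 w
         + ((T - 2 * m\<^sub>f * (V t)\<^sup>2) / (m\<^sub>p + 2 * m\<^sub>f)) *\<^sub>R weak_deriv L 2 w
         - (4 * m\<^sub>f * V t / (m\<^sub>p + 2 * m\<^sub>f)) *\<^sub>R weak_deriv L 1 v))"

definition dom_A0 :: "real \<Rightarrow> real \<Rightarrow> real \<Rightarrow> real \<Rightarrow> (real \<Rightarrow> real) \<Rightarrow> real \<Rightarrow> (l2 \<times> l2) set" where
  "dom_A0 L m\<^sub>f EI T V t = {(w, v) \<in> H_space L.
     w \<in> V_space L \<inter> sobolev L 4 \<and> v \<in> V_space L \<and>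
     point_value L (weak_deriv L 2 w) 0 = 0 \<and> point_value L (weak_deriv L 2 w) L = 0 \<and>
     2 * m\<^sub>f * V t * point_value L v L =
       - EI * point_value L (weak_deriv L 3 w) L
       + (T - 2 * m\<^sub>f * (V t)\<^sup>2) * point_value L (weak_deriv L 1 w) L}"

definition B_op :: "real \<Rightarrow> real \<Rightarrow> real \<Rightarrow> real \<Rightarrow> (real \<Rightarrow> real) \<Rightarrow> real
    \<Rightarrow> l2 \<times> l2 \<Rightarrow> l2 \<times> l2" where
  "B_op L m\<^sub>p m\<^sub>f c V t = (\<lambda>(w, v).
     (0, - (c / (m\<^sub>p + 2 * m\<^sub>f)) *\<^sub>R v
         - (2 * m\<^sub>f * deriv_halfline V t / (m\<^sub>p + 2 * m\<^sub>f)) *\<^sub>R weak_deriv L 1 w))"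

definition A_op :: "real \<Rightarrow> real \<Rightarrow> real \<Rightarrow> real \<Rightarrow> real \<Rightarrow> real \<Rightarrow> (real \<Rightarrow> real) \<Rightarrow> real
    \<Rightarrow> l2 \<times> l2 \<Rightarrow> l2 \<times> l2" where
  "A_op L m\<^sub>p m\<^sub>f EI c T V t z = A0 L m\<^sub>p m\<^sub>f EI T V t z + B_op L m\<^sub>p m\<^sub>f c V t z"

definition beam_evolution :: "real \<Rightarrow> real \<Rightarrow> real \<Rightarrow> real \<Rightarrow> real \<Rightarrow> real \<Rightarrow> (real \<Rightarrow> real)
    \<Rightarrow> (real \<Rightarrow> real \<Rightarrow> l2 \<times> l2 \<Rightarrow> l2 \<times> l2) \<Rightarrow> bool" where
  "beam_evolution L m\<^sub>p m\<^sub>f EI c T V U \<longleftrightarrow>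
     evolution_system L U \<and>
     (\<forall>s t. 0 \<le> s \<and> s \<le> t \<longrightarrow> U t s ` dom_A0 L m\<^sub>f EI T V s = dom_A0 L m\<^sub>f EI T V t) \<and>
     (\<forall>s\<ge>0. \<forall>f\<in>dom_A0 L m\<^sub>f EI T V s.
        (\<forall>t\<ge>s. H_has_derivative L (\<lambda>r. U r s f) (A_op L m\<^sub>p m\<^sub>f EI c T V t (U t s f)) t {s..}) \<and>
        H_continuous_on L {s..} (\<lambda>t. A_op L m\<^sub>p m\<^sub>f EI c T V t (U t s f)))"

end

theory Submission imports Defs begin

text \<open>
  The energy of the beam is conserved up to bounded terms, and the proof turns this into a
  construction. The obstacle is that the domain of \<open>A\<^sub>0(t)\<close> depends on \<open>t\<close> through the boundary
  condition at \<open>L\<close>; it is overcome by never working with \<open>A\<^sub>0(t)\<close> but only with its inverse.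

  \<^bold>\<open>Coordinates.\<close> An element \<open>w\<close> of \<open>\<V>\<close> is determined by \<open>p = (w\<^sub>x\<^sub>x, w\<^sub>x(0))\<close>: if \<open>I\<close> denotes
  the primitive vanishing at \<open>0\<close> and \<open>e\<close> the function \<open>1\<close> on \<open>(0, L)\<close>, then \<open>w\<^sub>x = D p\<close> with
  \<open>D (m, \<mu>) = I m + \<mu> e\<close>, and \<open>w = W p = I (D p)\<close>. A state is a triple \<open>x = ((m, \<mu>), v)\<close>, and the
  product norm of these coordinates is equivalent to the norm of \<open>\<H>\<close>. Write
  \<open>M = m\<^sub>p + 2 m\<^sub>f\<close>, \<open>k = 2 m\<^sub>f V\<close> and \<open>b = T - 2 m\<^sub>f V\<^sup>2\<close>, so that \<open>b\<close> is bounded below by a positive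
  constant. Multiplying the equation \<open>A\<^sub>0(t) u = g\<close> by test functions and integrating by parts, where
  the boundary conditions account for all boundary terms, gives \<open>Q(t) u = S(t) g\<close> with bounded operators:
  \<open>Q(t)\<close> is symmetric and coercive (it represents the energy
  \<open>EI |w\<^sub>x\<^sub>x|\<^sup>2 + b |w\<^sub>x|\<^sup>2 + M |v|\<^sup>2\<close>) and \<open>S(t)\<close> is antisymmetric. Hence \<open>R(t) = Q(t)\<^sup>-\<^sup>1 S(t)\<close> is
  the inverse of \<open>A\<^sub>0(t)\<close>, and it is skew for the energy (\<open>A0_iff\<close>, \<open>S_skew\<close>).

  \<^bold>\<open>The moving domain.\<close> As \<open>V\<close> has no zero, there are continuously differentiable families \<open>N\<close> and \<open>\<sigma>\<close>
  of bounded operators with \<open>R' = R N - \<sigma> R\<close> (\<open>R'_eq\<close>). If \<open>u' = z + B u\<close> and \<open>u = R z\<close>, then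
  differentiating \<open>u = R z\<close> shows that \<open>y = z + (\<sigma> + B) u\<close> lies in the domain again and that
  \<open>y' = R\<^sup>-\<^sup>1 y\<close> plus terms bounded by \<open>y\<close> and \<open>u\<close>. So the equation for \<open>y\<close>, that is, essentially
  for the time derivative of \<open>u\<close>, has the same form as the equation for \<open>u\<close>.

  \<^bold>\<open>Construction.\<close> Replace \<open>R\<^sup>-\<^sup>1\<close> by the bounded operators \<open>(R - \<epsilon>)\<^sup>-\<^sup>1\<close>, which are the Yosida
  approximations, and solve the resulting ordinary differential equations. One energy estimate (\<open>energy_estimate\<close>)
  controls everything. Applied to \<open>u\<^sub>\<epsilon>\<close> it gives stability; applied to \<open>y\<^sub>\<epsilon>\<close> it bounds
  \<open>z\<^sub>\<epsilon> = (R - \<epsilon>)\<^sup>-\<^sup>1 u\<^sub>\<epsilon>\<close> (\<open>generator_part_bound\<close>); with that bound, applied to \<open>u\<^sub>\<epsilon> - u\<^sub>\<delta>\<close>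
  it yields a Cauchy sequence (\<open>approx_sol_converges\<close>). Finally \<open>y\<^sub>\<epsilon>\<close> is compared with
  the solutions of an auxiliary equation of the same type, whose convergence is already known; this shows
  that \<open>z\<^sub>\<epsilon>\<close> converges uniformly, so the limit of \<open>u\<^sub>\<epsilon>\<close> is a strong solution
  (\<open>approx_limit_strong_sol\<close>).

  The assumptions are invariant under reversal of time, hence the solution operators are invertible and
  map the domains onto each other (\<open>evolution_family_exists\<close>). Uniqueness holds on the dense domains by the
  energy estimate and everywhere by boundedness (\<open>beam_evolution_unique\<close>).
\<close>

section \<open>Bounded operators and linear differential equations\<close>

text \<open>
  The theorem of Lax and Milgram: \<open>T x = y\<close> is the fixed point equation for
  \<open>x \<mapsto> x - s (T x - y)\<close>, and coercivity makes this map a contraction when \<open>s\<close> is small.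
\<close>

lemma coercive_blinfun_inverse:
  fixes T :: "'a::{real_inner,banach} \<Rightarrow>\<^sub>L 'a"
  assumes "c > 0" and coercive: "\<And>x. c * (x \<bullet> x) \<le> T x \<bullet> x"
  obtains Ti where "T o\<^sub>L Ti = id_blinfun" "Ti o\<^sub>L T = id_blinfun" "norm Ti \<le> 1 / c"
proof -
  define K where "K = norm T + c"
  have K: "c \<le> K" "norm T \<le> K" "K > 0" using \<open>c > 0\<close> by (auto simp: K_def intro: add_nonneg_pos)
  \<comment> \<open>This \<open>s\<close> minimises the bound \<open>1 - 2 s c + s\<^sup>2 K\<^sup>2\<close> for the square of the contraction factor.\<close>
  define s where "s = c / K\<^sup>2"
  define q where "q = sqrt (1 - c\<^sup>2 / K\<^sup>2)"
  have below: "c * norm x \<le> norm (T x)" for x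
  proof (cases "x = 0")
    case False
    have "c * (norm x)\<^sup>2 \<le> norm (T x) * norm x"
      using coercive[of x] norm_cauchy_schwarz[of "T x" x] by (simp add: dot_square_norm)
    with False show ?thesis by (simp add: power2_eq_square)
  qed simp
  have "c\<^sup>2 \<le> K\<^sup>2" using K \<open>c > 0\<close> by (intro power_mono) auto
  then have q: "0 \<le> q" "q < 1" using \<open>c > 0\<close> K by (auto simp: q_def)
  have contr: "norm (x - s *\<^sub>R T x) \<le> q * norm x" for x
  proof -
    have "(norm (x - s *\<^sub>R T x))\<^sup>2 = x \<bullet> x - 2 * s * (T x \<bullet> x) + s\<^sup>2 * (norm (T x))\<^sup>2"
      unfolding power2_norm_eq_inner[of "x - s *\<^sub>R T x"] power2_norm_eq_inner[of "T x"]
      by (simp add: inner_diff_left inner_diff_right inner_commute[of x "T x"] power2_eq_square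
          right_diff_distrib)
    also have "\<dots> \<le> x \<bullet> x - 2 * s * (c * (x \<bullet> x)) + s\<^sup>2 * (K * norm x)\<^sup>2"
    proof -
      have "norm (T x) \<le> K * norm x" using norm_blinfun[of T x] K
        by (meson mult_right_mono norm_ge_zero order_trans)
      then have "(norm (T x))\<^sup>2 \<le> (K * norm x)\<^sup>2" by (intro power_mono) auto
      moreover have "s \<ge> 0" using \<open>c > 0\<close> by (simp add: s_def)
      ultimately show ?thesis
        using mult_left_mono[OF coercive[of x], of s] mult_left_mono[of "(norm (T x))\<^sup>2" "(K * norm x)\<^sup>2" "s\<^sup>2"]
        by (auto simp: algebra_simps)
    qed
    also have "\<dots> = (1 - c\<^sup>2 / K\<^sup>2) * (norm x)\<^sup>2"
      using K by (simp add: s_def dot_square_norm field_simps power2_eq_square)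
    finally have "norm (x - s *\<^sub>R T x) \<le> sqrt ((1 - c\<^sup>2 / K\<^sup>2) * (norm x)\<^sup>2)"
      by (rule real_le_rsqrt)
    then show ?thesis by (simp add: q_def real_sqrt_mult)
  qed
  have "\<exists>x. T x = y" for y
  proof -
    have "\<exists>!x. x - s *\<^sub>R (T x - y) = x"
    proof (rule banach_fix_type[OF q], intro allI)
      fix x z
      have "norm ((x - z) - s *\<^sub>R T (x - z)) \<le> q * norm (x - z)" by (rule contr)
      then show "dist (x - s *\<^sub>R (T x - y)) (z - s *\<^sub>R (T z - y)) \<le> q * dist x z"
        by (simp add: dist_norm blinfun.bilinear_simps algebra_simps)
    qed
    then show ?thesis using K \<open>c > 0\<close> by (auto simp: s_def)
  qed
  then obtain g where g: "\<And>y. T (g y) = y" by metis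
  have inj: "x = z" if "T x = T z" for x z
    using below[of "x - z"] that \<open>c > 0\<close>
    by (simp add: blinfun.bilinear_simps mult_le_0_iff)
  have gb: "norm (g y) \<le> norm y * (1 / c)" for y
    using below[of "g y"] \<open>c > 0\<close> by (simp add: g field_simps)
  have "bounded_linear g"
    by (rule bounded_linear_intro[where K = "1 / c"])
       (rule inj, simp add: g blinfun.add_right blinfun.scaleR_right, rule inj,
        simp add: g blinfun.add_right blinfun.scaleR_right, rule gb)
  then have ap: "blinfun_apply (Blinfun g) = g" by (rule bounded_linear_Blinfun_apply)
  show ?thesis
  proof (rule that[of "Blinfun g"])
    show "T o\<^sub>L Blinfun g = id_blinfun" by (rule blinfun_eqI) (simp add: ap g)
    show "Blinfun g o\<^sub>L T = id_blinfun" by (rule blinfun_eqI) (simp add: ap inj g)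
    show "norm (Blinfun g) \<le> 1 / c"
      using \<open>c > 0\<close> gb by (intro norm_blinfun_bound) (auto simp: ap mult.commute)
  qed
qed

lemma has_vector_derivative_iff_quotient:
  "(f has_vector_derivative d) (at t within S) \<longleftrightarrow>
    ((\<lambda>r. (f r - f t) /\<^sub>R (r - t)) \<longlongrightarrow> d) (at t within S)"
proof -
  have "norm ((f r - f t) - (r - t) *\<^sub>R d) / norm (r - t) = norm ((f r - f t) /\<^sub>R (r - t) - d)"
    if "r \<noteq> t" for r
  proof -
    have "(f r - f t) - (r - t) *\<^sub>R d = (r - t) *\<^sub>R ((f r - f t) /\<^sub>R (r - t) - d)"
      using that by (simp add: scaleR_diff_right)
    then show ?thesis using that by simp
  qed
  then have "((\<lambda>r. norm ((f r - f t) - (r - t) *\<^sub>R d) / norm (r - t)) \<longlongrightarrow> 0) (at t within S) \<longleftrightarrow>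
    ((\<lambda>r. norm ((f r - f t) /\<^sub>R (r - t) - d)) \<longlongrightarrow> 0) (at t within S)"
    by (intro filterlim_cong refl) (auto simp: eventually_at_filter)
  then show ?thesis
    unfolding has_vector_derivative_def has_derivative_iff_norm
    by (simp add: bounded_linear_scaleR_left tendsto_norm_zero_iff LIM_zero_iff)
qed

text \<open>
  The difference quotient of the inverse is \<open>- G(s) ((F(s) - F(t)) / (s - t)) G(t)\<close>. The bound on \<open>G\<close>
  gives the continuity of \<open>G\<close> that is needed to pass to the limit.
\<close>

lemma has_vector_derivative_blinfun_inverse:
  fixes F G :: "real \<Rightarrow> 'a::real_normed_vector \<Rightarrow>\<^sub>L 'a"
  assumes F: "(F has_vector_derivative F') (at t within S)"
    and inv: "\<And>s. s \<in> S \<Longrightarrow> F s o\<^sub>L G s = id_blinfun" "\<And>s. s \<in> S \<Longrightarrow> G s o\<^sub>L F s = id_blinfun"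
    and bound: "\<And>s. s \<in> S \<Longrightarrow> norm (G s) \<le> K" and "t \<in> S"
  shows "(G has_vector_derivative - (G t o\<^sub>L F' o\<^sub>L G t)) (at t within S)"
proof -
  have diff: "G s - G t = - (G s o\<^sub>L (F s - F t) o\<^sub>L G t)" if "s \<in> S" for s
  proof (rule blinfun_eqI)
    fix x
    have "G s (F s y) = y" "F t (G t y) = y" for y
      using inv[OF that] inv[OF \<open>t \<in> S\<close>] by (metis blinfun_apply_blinfun_compose blinfun_apply_id_blinfun)+
    then show "(G s - G t) x = (- (G s o\<^sub>L (F s - F t) o\<^sub>L G t)) x"
      by (simp add: blinfun.bilinear_simps)
  qed
  have Fq: "((\<lambda>r. (F r - F t) /\<^sub>R (r - t)) \<longlongrightarrow> F') (at t within S)"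
    using F by (simp add: has_vector_derivative_iff_quotient)
  have "continuous (at t within S) F" using F by (rule has_vector_derivative_continuous)
  then have F0: "((\<lambda>r. F r - F t) \<longlongrightarrow> 0) (at t within S)" 
    unfolding continuous_within by (rule LIM_zero)
  have Gt: "(G \<longlongrightarrow> G t) (at t within S)"
  proof (rule LIM_zero_cancel, rule Lim_null_comparison)
    show "\<forall>\<^sub>F s in at t within S. norm (G s - G t) \<le> K * norm (F s - F t) * norm (G t)"
      unfolding eventually_at_filter
    proof (intro always_eventually allI impI)
      fix s assume "s \<in> S"
      have "norm (G s - G t) \<le> norm (G s) * norm (F s - F t) * norm (G t)"
        unfolding diff[OF \<open>s \<in> S\<close>]
        by (simp, meson norm_blinfun_compose mult_right_mono norm_ge_zero order_trans)
      also have "\<dots> \<le> K * norm (F s - F t) * norm (G t)"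
        by (intro mult_right_mono bound \<open>s \<in> S\<close> norm_ge_zero)
      finally show "norm (G s - G t) \<le> K * norm (F s - F t) * norm (G t)" .
    qed
    show "((\<lambda>s. K * norm (F s - F t) * norm (G t)) \<longlongrightarrow> 0) (at t within S)"
      using tendsto_mult[OF tendsto_mult[OF tendsto_const tendsto_norm_zero[OF F0]] tendsto_const] by simp
  qed
  have "((\<lambda>r. - (G r o\<^sub>L ((F r - F t) /\<^sub>R (r - t)) o\<^sub>L G t)) \<longlongrightarrow> - (G t o\<^sub>L F' o\<^sub>L G t)) (at t within S)"
    by (intro tendsto_minus bounded_bilinear.tendsto[OF bounded_bilinear_blinfun_compose] Gt Fq tendsto_const)
  moreover have "\<forall>\<^sub>F r in at t within S. - (G r o\<^sub>L ((F r - F t) /\<^sub>R (r - t)) o\<^sub>L G t) = (G r - G t) /\<^sub>R (r - t)"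
    unfolding eventually_at_filter
    by (intro always_eventually allI impI blinfun_eqI) (auto simp: diff blinfun.bilinear_simps)
  ultimately show ?thesis
    unfolding has_vector_derivative_iff_quotient by (rule Lim_transform_eventually)
qed

text \<open>
  By the mean value theorem, \<open>exp (- C (s - a)) \<phi>(s) - \<integral> e\<close> is nonincreasing. A one-sided
  bound on \<open>\<phi>'\<close> is enough, which matters below because only the sign of some energy terms is known.
\<close>

lemma gronwall_inequality:
  fixes \<phi> :: "real \<Rightarrow> real"
  assumes "a \<le> t"
    and deriv: "\<And>s. s \<in> {a..t} \<Longrightarrow> (\<phi> has_vector_derivative \<phi>' s) (at s within {a..t})"
    and bound: "\<And>s. s \<in> {a..t} \<Longrightarrow> \<phi>' s \<le> C * \<phi> s + e s"
    and e: "continuous_on {a..t} e" "\<And>s. s \<in> {a..t} \<Longrightarrow> 0 \<le> e s" and "C \<ge> 0"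
  shows "\<phi> t \<le> exp (C * (t - a)) * (\<phi> a + integral {a..t} e)"
proof -
  define \<psi> where "\<psi> s = exp (- C * (s - a)) * \<phi> s - integral {a..s} e" for s
  define \<psi>' where "\<psi>' s = exp (- C * (s - a)) * (\<phi>' s - C * \<phi> s) - e s" for s
  have d: "(\<psi> has_vector_derivative \<psi>' s) (at s within {a..t})" if "s \<in> {a..t}" for s
    unfolding \<psi>_def \<psi>'_def
    using deriv[OF that] integral_has_vector_derivative[OF e(1) that]
    by (auto intro!: derivative_eq_intros simp: has_real_derivative_iff_has_vector_derivative[symmetric] algebra_simps)
  have "\<psi> t \<le> \<psi> a"
  proof (cases "a < t")
    case True
    obtain \<xi> where \<xi>: "\<xi> \<in> {a<..<t}" "\<psi> t - \<psi> a = (t - a) * \<psi>' \<xi>"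
      using mvt_simple[OF True, of \<psi> "\<lambda>s x. x * \<psi>' s"] d
      by (auto simp: has_vector_derivative_def)
    have "exp (- C * (\<xi> - a)) * (\<phi>' \<xi> - C * \<phi> \<xi>) \<le> exp (- C * (\<xi> - a)) * e \<xi>"
      using bound[of \<xi>] \<xi> by (intro mult_left_mono) auto
    also have "\<dots> \<le> 1 * e \<xi>" using \<xi> \<open>C \<ge> 0\<close> e(2)[of \<xi>] by (intro mult_right_mono) auto
    finally have "\<psi>' \<xi> \<le> 0" by (simp add: \<psi>'_def)
    then have "(t - a) * \<psi>' \<xi> \<le> 0" using True by (simp add: mult_le_0_iff)
    then show ?thesis using \<xi> by linarith
  qed (use \<open>a \<le> t\<close> in simp)
  then have "exp (- C * (t - a)) * \<phi> t \<le> \<phi> a + integral {a..t} e" by (simp add: \<psi>_def)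
  then have "exp (C * (t - a)) * (exp (- C * (t - a)) * \<phi> t) \<le> exp (C * (t - a)) * (\<phi> a + integral {a..t} e)"
    by (intro mult_left_mono) auto
  then show ?thesis by (simp add: mult.assoc[symmetric] exp_add[symmetric])
qed

text \<open>
  Picard iteration in the weighted supremum norm of \<open>exp (- 2 K t) u(t)\<close>, in which the integral
  operator is a contraction on the whole interval at once. Functions on \<open>{0..\<tau>}\<close> are extended
  constantly so that the complete space of bounded continuous functions on the line can be used.
\<close>

lemma linear_ode_exists:
  fixes F :: "real \<Rightarrow> 'a::banach \<Rightarrow>\<^sub>L 'a"
  assumes "\<tau> \<ge> 0" and F: "continuous_on {0..\<tau>} F" and h: "continuous_on {0..\<tau>} h"
  obtains u where "u 0 = f"
    "\<And>t. t \<in> {0..\<tau>} \<Longrightarrow> (u has_vector_derivative F t (u t) + h t) (at t within {0..\<tau>})"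
proof -
  obtain K where K: "K > 0" "\<And>t. t \<in> {0..\<tau>} \<Longrightarrow> norm (F t) \<le> K"
    using compact_imp_bounded[OF compact_continuous_image[OF F compact_Icc]]
    by (auto simp: bounded_pos)
  define l where "l = 2 * K"
  define cl where "cl t = max 0 (min t \<tau>)" for t :: real
  define rhs where "rhs v r = F r (exp (l * r) *\<^sub>R v r) + h r" for v r
  define P where "P v t = exp (- l * cl t) *\<^sub>R (f + integral {0..cl t} (rhs v))" for v t
  have cl: "cl t \<in> {0..\<tau>}" for t using \<open>\<tau> \<ge> 0\<close> by (auto simp: cl_def)
  have rhs: "continuous_on {0..\<tau>} (rhs v)" if "continuous_on UNIV v" for v
    unfolding rhs_def
    by (intro continuous_intros bounded_bilinear.continuous_on[OF bounded_bilinear_blinfun_apply] F h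
        continuous_on_subset[OF that]) auto
  have Pc: "P v \<in> bcontfun" if v: "continuous_on UNIV v" for v
  proof -
    define g where "g t = exp (- l * t) *\<^sub>R (f + integral {0..t} (rhs v))" for t
    have g: "continuous_on {0..\<tau>} g"
      unfolding g_def
      by (intro continuous_intros indefinite_integral_continuous_1 integrable_continuous_real rhs v)
    have Pg: "P v = (\<lambda>t. g (cl t))" by (auto simp: P_def g_def)
    have "continuous_on UNIV (P v)"
      unfolding Pg
      by (rule continuous_on_compose2[OF g]) (use cl in \<open>auto simp: cl_def intro!: continuous_intros\<close>)
    moreover have "bounded (range (P v))"
      using compact_imp_bounded[OF compact_continuous_image[OF g compact_Icc]]
      by (rule bounded_subset) (use cl in \<open>auto simp: Pg\<close>)
    ultimately show ?thesis by (simp add: bcontfun_def)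
  qed
  define T where "T v = Bcontfun (P (apply_bcontfun v))" for v :: "real \<Rightarrow>\<^sub>C 'a"
  have T: "apply_bcontfun (T v) = P (apply_bcontfun v)" for v
    unfolding T_def by (rule Bcontfun_inverse[OF Pc]) auto
  have "\<exists>!v. T v = v"
  proof (rule banach_fix_type[of "1 / 2"], simp, simp, intro allI)
    fix v w :: "real \<Rightarrow>\<^sub>C 'a"
    show "dist (T v) (T w) \<le> 1 / 2 * dist v w"
    proof (rule dist_bound)
      fix t
      define c where "c = cl t"
      have c: "0 \<le> c" "c \<le> \<tau>" "{0..c} \<subseteq> {0..\<tau>}" using cl[of t] by (auto simp: c_def)
      have int: "rhs (apply_bcontfun v) integrable_on {0..c}" for v :: "real \<Rightarrow>\<^sub>C 'a"
        using c by (intro integrable_continuous_real continuous_on_subset[OF rhs]) auto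
      have exp_int: "((\<lambda>r. K * dist v w * exp (l * r)) has_integral
          K * dist v w * (exp (l * c) / l) - K * dist v w * (exp (l * 0) / l)) {0..c}"
        using c K
        by (intro fundamental_theorem_of_calculus)
           (auto intro!: derivative_eq_intros simp: l_def has_real_derivative_iff_has_vector_derivative[symmetric])
      have "norm (integral {0..c} (rhs v) - integral {0..c} (rhs w)) =
          norm (integral {0..c} (\<lambda>r. rhs v r - rhs w r))"
        using int by (simp add: integral_diff)
      also have "\<dots> \<le> integral {0..c} (\<lambda>r. K * dist v w * exp (l * r))"
      proof (rule integral_norm_bound_integral)
        show "(\<lambda>r. rhs v r - rhs w r) integrable_on {0..c}" by (intro integrable_diff int)
        show "(\<lambda>r. K * dist v w * exp (l * r)) integrable_on {0..c}" using exp_int by blast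
        fix r assume r: "r \<in> {0..c}"
        have "norm (rhs v r - rhs w r) = norm (F r (exp (l * r) *\<^sub>R (v r - w r)))"
          by (simp add: rhs_def blinfun.bilinear_simps algebra_simps)
        also have "\<dots> \<le> norm (F r) * norm (exp (l * r) *\<^sub>R (v r - w r))" by (rule norm_blinfun)
        also have "\<dots> \<le> K * (exp (l * r) * dist v w)"
          using r c K dist_bounded[of v r w] by (intro mult_mono) (auto simp: dist_norm)
        finally show "norm (rhs v r - rhs w r) \<le> K * dist v w * exp (l * r)" by (simp add: mult_ac)
      qed
      also have "\<dots> \<le> dist v w / 2 * exp (l * c)"
        unfolding integral_unique[OF exp_int] using K by (simp add: l_def field_simps)
      finally have "exp (- l * c) * norm (integral {0..c} (rhs v) - integral {0..c} (rhs w))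
          \<le> exp (- l * c) * (dist v w / 2 * exp (l * c))" by (intro mult_left_mono) auto
      also have "\<dots> = dist v w / 2" by (simp add: mult_ac exp_minus)
      finally have "norm (exp (- l * c) *\<^sub>R (integral {0..c} (rhs v) - integral {0..c} (rhs w))) \<le> dist v w / 2"
        by simp
      then show "dist (T v t) (T w t) \<le> 1 / 2 * dist v w"
        by (simp add: T P_def c_def[symmetric] dist_norm algebra_simps)
    qed
  qed
  then obtain v where v: "T v = v" by blast
  define u where "u t = exp (l * t) *\<^sub>R v t" for t
  have u: "u t = f + integral {0..t} (\<lambda>r. F r (u r) + h r)" if "t \<in> {0..\<tau>}" for t
  proof -
    have "cl t = t" using that by (auto simp: cl_def)
    then have "v t = exp (- l * t) *\<^sub>R (f + integral {0..t} (rhs v))"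
      using fun_cong[OF T[of v], of t] by (simp add: v P_def)
    then show ?thesis unfolding u_def rhs_def by (simp add: exp_minus)
  qed
  show ?thesis
  proof (rule that[of u])
    show "u 0 = f" using u[of 0] \<open>\<tau> \<ge> 0\<close> by simp
    fix t assume t: "t \<in> {0..\<tau>}"
    have "continuous_on {0..\<tau>} (\<lambda>r. F r (u r) + h r)"
      using rhs[of v] by (simp add: rhs_def u_def)
    from integral_has_vector_derivative[OF this t]
    have "((\<lambda>t. f + integral {0..t} (\<lambda>r. F r (u r) + h r)) has_vector_derivative F t (u t) + h t) (at t within {0..\<tau>})"
      by (auto intro!: derivative_eq_intros)
    then show "(u has_vector_derivative F t (u t) + h t) (at t within {0..\<tau>})"
      by (rule has_vector_derivative_weaken) (use t u in auto)
  qed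
qed

section \<open>Continuously differentiable curves\<close>

definition C1_on :: "real set \<Rightarrow> (real \<Rightarrow> 'b::real_normed_vector) \<Rightarrow> (real \<Rightarrow> 'b) \<Rightarrow> bool" where
  "C1_on I f f' \<longleftrightarrow> (\<forall>t\<in>I. (f has_vector_derivative f' t) (at t within I)) \<and> continuous_on I f'"

lemma C1_onD:
  assumes "C1_on I f f'"
  shows "t \<in> I \<Longrightarrow> (f has_vector_derivative f' t) (at t within I)"
    and "continuous_on I f'" and "continuous_on I f"
  using assms by (auto simp: C1_on_def continuous_on_eq_continuous_within intro: has_vector_derivative_continuous)

lemma C1_on_subset:
  "C1_on S f f' \<Longrightarrow> T \<subseteq> S \<Longrightarrow> C1_on T f f'"
  by (auto simp: C1_on_def intro: has_vector_derivative_within_subset continuous_on_subset)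

lemma C1_on_uminus: "C1_on S f f' \<Longrightarrow> C1_on S (\<lambda>t. - f t) (\<lambda>t. - f' t)"
  by (auto simp: C1_on_def intro!: has_vector_derivative_minus continuous_on_minus)

lemma C1_on_const: "C1_on S (\<lambda>_. c) (\<lambda>_. 0)"
  by (simp add: C1_on_def)

lemma C1_on_add: "C1_on S f f' \<Longrightarrow> C1_on S g g' \<Longrightarrow> C1_on S (\<lambda>t. f t + g t) (\<lambda>t. f' t + g' t)"
  by (auto simp: C1_on_def intro!: has_vector_derivative_add continuous_intros)

lemma C1_on_bilinear:
  assumes "bounded_bilinear bl" "C1_on S f f'" "C1_on S g g'"
  shows "C1_on S (\<lambda>t. bl (f t) (g t)) (\<lambda>t. bl (f t) (g' t) + bl (f' t) (g t))"
  unfolding C1_on_def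
  by (intro conjI ballI bounded_bilinear.has_vector_derivative[OF assms(1)] C1_onD(1)[OF assms(2)] C1_onD(1)[OF assms(3)]
      continuous_on_add bounded_bilinear.continuous_on[OF assms(1)] C1_onD(2,3)[OF assms(2)] C1_onD(2,3)[OF assms(3)])

lemmas C1_on_scaleR = C1_on_bilinear[OF bounded_bilinear_scaleR]
  and C1_on_compose = C1_on_bilinear[OF bounded_bilinear_blinfun_compose]

lemma C1_on_divide:
  fixes f g :: "real \<Rightarrow> real"
  assumes f: "C1_on S f f'" and g: "C1_on S g g'" and nz: "\<And>t. t \<in> S \<Longrightarrow> g t \<noteq> 0"
  shows "C1_on S (\<lambda>t. f t / g t) (\<lambda>t. (f' t * g t - f t * g' t) / (g t * g t))"
  unfolding C1_on_def
proof (intro conjI ballI)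
  fix t assume t: "t \<in> S"
  show "((\<lambda>t. f t / g t) has_vector_derivative (f' t * g t - f t * g' t) / (g t * g t)) (at t within S)"
    using DERIV_divide[OF C1_onD(1)[OF f t, folded has_real_derivative_iff_has_vector_derivative]
        C1_onD(1)[OF g t, folded has_real_derivative_iff_has_vector_derivative] nz[OF t]]
    by (simp add: has_real_derivative_iff_has_vector_derivative)
qed (intro continuous_intros C1_onD(2,3)[OF f] C1_onD(2,3)[OF g], use nz in auto)

lemma C1_on_scaleR_const: "C1_on S f f' \<Longrightarrow> C1_on S (\<lambda>t. f t *\<^sub>R c) (\<lambda>t. f' t *\<^sub>R c)"
  using C1_on_scaleR[OF _ C1_on_const[of S c], of f f'] by simp

lemma continuous_on_Icc_bound:
  fixes f :: "real \<Rightarrow> 'b::real_normed_vector"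
  assumes "continuous_on {a..b} f"
  obtains K where "K \<ge> 0" "\<And>t. t \<in> {a..b} \<Longrightarrow> norm (f t) \<le> K"
proof -
  obtain K where "K > 0" "\<forall>x\<in>{a..b}. norm (f x) \<le> K"
    using compact_imp_bounded[OF compact_continuous_image[OF assms compact_Icc]]
    by (auto simp: bounded_pos)
  then show ?thesis by (intro that[of K]) auto
qed

lemma norm_blinfun_le: "norm f \<le> K \<Longrightarrow> norm (blinfun_apply f x) \<le> K * norm x"
  using norm_blinfun[of f x] by (meson mult_right_mono norm_ge_zero order_trans)

text \<open>
  The moving average \<open>(1 / \<delta>) \<integral>\<^bsub>t\<^esub>\<^bsup>t + \<delta>\<^esup> h\<close> is continuously differentiable and close to \<open>h\<close> by uniform
  continuity.
\<close>

lemma C1_approximation: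
  fixes h :: "real \<Rightarrow> 'b::banach"
  assumes h: "continuous_on {0..\<tau>} h" and "0 \<le> \<tau>" "0 < e"
  obtains k k' where "C1_on {0..\<tau>} k k'" "\<And>t. t \<in> {0..\<tau>} \<Longrightarrow> norm (h t - k t) \<le> e"
proof -
  define hh where "hh t = h (max 0 (min t \<tau>))" for t
  have hh: "continuous_on S hh" for S
    unfolding hh_def
    by (rule continuous_on_compose2[OF h]) (use \<open>0 \<le> \<tau>\<close> in \<open>auto intro!: continuous_intros\<close>)
  have "uniformly_continuous_on {0..\<tau>} h" using h by (simp add: compact_uniformly_continuous)
  then obtain d where d: "d > 0" "\<And>s t. \<lbrakk>s \<in> {0..\<tau>}; t \<in> {0..\<tau>}; dist t s < d\<rbrakk> \<Longrightarrow> dist (h t) (h s) < e"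
    using \<open>0 < e\<close> by (meson uniformly_continuous_onE)
  define \<delta> where "\<delta> = d / 2"
  have \<delta>: "\<delta> > 0" "\<delta> < d" using d by (auto simp: \<delta>_def)
  have close: "norm (hh s - h t) \<le> e" if "t \<in> {0..\<tau>}" "s \<in> {t..t + \<delta>}" for s t
  proof -
    have "dist (h (max 0 (min s \<tau>))) (h t) < e"
      by (rule d(2)) (use that \<delta> \<open>0 \<le> \<tau>\<close> in \<open>auto simp: dist_real_def\<close>)
    then show ?thesis by (simp add: hh_def dist_norm)
  qed
  define H where "H t = integral {0..t} hh" for t
  have H: "(H has_vector_derivative hh t) (at t within {0..\<tau> + \<delta>})" if "t \<in> {0..\<tau> + \<delta>}" for t
    unfolding H_def by (rule integral_has_vector_derivative[OF hh that])
  define k where "k t = (H (t + \<delta>) - H t) /\<^sub>R \<delta>" for t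
  define k' where "k' t = (hh (t + \<delta>) - hh t) /\<^sub>R \<delta>" for t
  show ?thesis
  proof (rule that[of k k'])
    have "(k has_vector_derivative k' t) (at t within {0..\<tau>})" if t: "t \<in> {0..\<tau>}" for t
    proof -
      have 1: "(H has_vector_derivative hh t) (at t within {0..\<tau>})"
        by (rule has_vector_derivative_within_subset[OF H]) (use t \<delta> in auto)
      have "(H has_vector_derivative hh (t + \<delta>)) (at (t + \<delta>) within (\<lambda>s. s + \<delta>) ` {0..\<tau>})"
        by (rule has_vector_derivative_within_subset[OF H]) (use t \<delta> in auto)
      then have "((H \<circ> (\<lambda>s. s + \<delta>)) has_vector_derivative 1 *\<^sub>R hh (t + \<delta>)) (at t within {0..\<tau>})"
        by (intro vector_diff_chain_within) (auto intro!: derivative_eq_intros)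
      then have 2: "((\<lambda>s. H (s + \<delta>)) has_vector_derivative hh (t + \<delta>)) (at t within {0..\<tau>})"
        by (simp add: o_def)
      show ?thesis
        unfolding k_def k'_def using 
          bounded_linear.has_vector_derivative[OF bounded_linear_scaleR_right has_vector_derivative_diff[OF 2 1]]
        by simp
    qed
    moreover have "continuous_on {0..\<tau>} k'"
      unfolding k'_def
      by (intro continuous_intros hh continuous_on_compose2[OF hh]) auto
    ultimately show "C1_on {0..\<tau>} k k'" by (simp add: C1_on_def)
    fix t assume t: "t \<in> {0..\<tau>}"
    have int: "hh integrable_on {a..b}" for a b by (rule integrable_continuous_real[OF hh])
    have "H (t + \<delta>) - H t = integral {t..t + \<delta>} hh"
      using Henstock_Kurzweil_Integration.integral_combine[where f = hh and a = 0 and c = t and b = "t + \<delta>"] t \<delta> int unfolding H_def by (simp add: algebra_simps)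
    then have "\<delta> *\<^sub>R (k t - h t) = integral {t..t + \<delta>} hh - \<delta> *\<^sub>R h t"
      using \<delta> by (simp add: k_def algebra_simps)
    also have "\<dots> = integral {t..t + \<delta>} (\<lambda>s. hh s - h t)"
      by (subst integral_diff) (use int \<delta> in auto)
    finally have "norm (\<delta> *\<^sub>R (k t - h t)) = norm (integral {t..t + \<delta>} (\<lambda>s. hh s - h t))" by simp
    also have "\<dots> \<le> integral {t..t + \<delta>} (\<lambda>s. e)"
      using close[OF t] int by (intro integral_norm_bound_integral integrable_diff) auto
    also have "\<dots> = \<delta> * e" using \<delta> by simp
    finally show "norm (h t - k t) \<le> e" using \<delta> by (simp add: norm_minus_commute)
  qed
qed

section \<open>Families of skew generators given by their inverses\<close>

text \<open>
  The generator at time \<open>t\<close> is the inverse of the injective operator \<open>R t\<close>, hence unbounded in general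
  with domain \<open>range (R t)\<close>; it is perturbed by the bounded operator \<open>B t\<close>. The assumption
  \<open>skew\<close> says that the generator is skew for the inner product represented by \<open>Q t\<close>, and \<open>R'_eq\<close>
  restricts the way in which the domain may move: up to the bounded operators \<open>N\<close> and \<open>\<sigma>\<close>, the
  derivative of \<open>R\<close> factors through \<open>R\<close> on either side.
\<close>

locale skew_family =
  fixes \<tau> q :: real and Q Q' R R' N N' \<sigma> \<sigma>' B B' :: "real \<Rightarrow> 'a::{real_inner,banach} \<Rightarrow>\<^sub>L 'a"
  assumes \<tau>: "0 \<le> \<tau>" and q: "0 < q"
    and Q: "C1_on {0..\<tau>} Q Q'" and R: "C1_on {0..\<tau>} R R'" and N: "C1_on {0..\<tau>} N N'"
    and \<sigma>: "C1_on {0..\<tau>} \<sigma> \<sigma>'" and B: "C1_on {0..\<tau>} B B'"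
    and Q_sym: "t \<in> {0..\<tau>} \<Longrightarrow> Q t x \<bullet> y = x \<bullet> Q t y"
    and Q_coercive: "t \<in> {0..\<tau>} \<Longrightarrow> q * (x \<bullet> x) \<le> Q t x \<bullet> x"
    and skew: "t \<in> {0..\<tau>} \<Longrightarrow> Q t (R t x) \<bullet> x = 0"
    and R_inj: "t \<in> {0..\<tau>} \<Longrightarrow> R t x = 0 \<Longrightarrow> x = 0"
    and R'_eq: "t \<in> {0..\<tau>} \<Longrightarrow> R' t = (R t o\<^sub>L N t) - (\<sigma> t o\<^sub>L R t)"
begin

lemma Q_R_orthogonal: "t \<in> {0..\<tau>} \<Longrightarrow> Q t x \<bullet> R t x = 0"
  using skew[of t x] Q_sym[of t x "R t x"] by (simp add: inner_commute)

lemma uniform_bound: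
  obtains K where "K \<ge> 1" "\<And>t. t \<in> {0..\<tau>} \<Longrightarrow> norm (Q t) \<le> K"
    "\<And>t. t \<in> {0..\<tau>} \<Longrightarrow> norm (Q' t) \<le> K"
    "\<And>t. t \<in> {0..\<tau>} \<Longrightarrow> norm (N t) \<le> K" "\<And>t. t \<in> {0..\<tau>} \<Longrightarrow> norm (\<sigma> t) \<le> K"
    "\<And>t. t \<in> {0..\<tau>} \<Longrightarrow> norm (\<sigma>' t) \<le> K"
proof -
  obtain K1 where 1: "K1 \<ge> 0" "\<And>t. t \<in> {0..\<tau>} \<Longrightarrow> norm (Q t) \<le> K1"
    by (rule continuous_on_Icc_bound[OF C1_onD(3)[OF Q]]) blast
  obtain K2 where 2: "K2 \<ge> 0" "\<And>t. t \<in> {0..\<tau>} \<Longrightarrow> norm (Q' t) \<le> K2"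
    by (rule continuous_on_Icc_bound[OF C1_onD(2)[OF Q]]) blast
  obtain K3 where 3: "K3 \<ge> 0" "\<And>t. t \<in> {0..\<tau>} \<Longrightarrow> norm (N t) \<le> K3"
    by (rule continuous_on_Icc_bound[OF C1_onD(3)[OF N]]) blast
  obtain K4 where 4: "K4 \<ge> 0" "\<And>t. t \<in> {0..\<tau>} \<Longrightarrow> norm (\<sigma> t) \<le> K4"
    by (rule continuous_on_Icc_bound[OF C1_onD(3)[OF \<sigma>]]) blast
  obtain K5 where 5: "K5 \<ge> 0" "\<And>t. t \<in> {0..\<tau>} \<Longrightarrow> norm (\<sigma>' t) \<le> K5"
    by (rule continuous_on_Icc_bound[OF C1_onD(2)[OF \<sigma>]]) blast
  show ?thesis
  proof (rule that[of "1 + K1 + K2 + K3 + K4 + K5"])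
    have nn: "K1 \<ge> 0" "K2 \<ge> 0" "K3 \<ge> 0" "K4 \<ge> 0" "K5 \<ge> 0" by fact+
    then show "1 \<le> 1 + K1 + K2 + K3 + K4 + K5" by simp
    fix t assume t: "t \<in> {0..\<tau>}"
    show "norm (Q t) \<le> 1 + K1 + K2 + K3 + K4 + K5" "norm (Q' t) \<le> 1 + K1 + K2 + K3 + K4 + K5"
      "norm (N t) \<le> 1 + K1 + K2 + K3 + K4 + K5" "norm (\<sigma> t) \<le> 1 + K1 + K2 + K3 + K4 + K5"
      "norm (\<sigma>' t) \<le> 1 + K1 + K2 + K3 + K4 + K5"
      using nn 1(2)[OF t] 2(2)[OF t] 3(2)[OF t] 4(2)[OF t] 5(2)[OF t] by linarith+
  qed
qed

text \<open>
  The common form of the equations to which the energy estimate is applied: \<open>u' = z + g\<close>, where \<open>z\<close> is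
  the generator applied to \<open>u\<close> up to the defect \<open>r = u - R z\<close>. The function \<open>d\<close> collects the
  errors. For the defect \<open>r = - \<epsilon> z\<close> of the approximations, \<open>Q z \<bullet> r\<close> is not positive, so
  that this defect costs nothing.
\<close>

definition energy_data ::
    "real \<Rightarrow> real \<Rightarrow> real \<Rightarrow> (real \<Rightarrow> 'a) \<Rightarrow> (real \<Rightarrow> 'a) \<Rightarrow> (real \<Rightarrow> 'a) \<Rightarrow> (real \<Rightarrow> 'a) \<Rightarrow> (real \<Rightarrow> real) \<Rightarrow> bool" where
  "energy_data M a t u z r g d \<longleftrightarrow> 0 \<le> a \<and> a \<le> t \<and> t \<le> \<tau> \<and> continuous_on {a..t} d \<and>
     (\<forall>s\<in>{a..t}. (u has_vector_derivative z s + g s) (at s within {a..t}) \<and>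
        u s = R s (z s) + r s \<and> Q s (z s) \<bullet> r s \<le> (d s)\<^sup>2 \<and>
        norm (g s) \<le> M * norm (u s) + d s \<and> 0 \<le> d s)"

text \<open>
  In the derivative of \<open>Q u \<bullet> u\<close> the unbounded contribution is \<open>2 (Q z \<bullet> u) = 2 (Q z \<bullet> r)\<close>, because
  \<open>Q z \<bullet> R z = 0\<close>. What remains is bounded by the energy itself and by \<open>d\<^sup>2\<close>, and Gronwall's inequality
  applies. The constant depends only on \<open>M\<close> and the locale, not on the data.
\<close>

lemma energy_estimate:
  assumes "M \<ge> 0"
  obtains C where "C > 0"
    "\<And>a t u z r g d. energy_data M a t u z r g d
      \<Longrightarrow> (norm (u t))\<^sup>2 \<le> C * ((norm (u a))\<^sup>2 + integral {a..t} (\<lambda>s. (d s)\<^sup>2))"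
proof -
  obtain K where K: "K \<ge> 1" "\<And>t. t \<in> {0..\<tau>} \<Longrightarrow> norm (Q t) \<le> K" "\<And>t. t \<in> {0..\<tau>} \<Longrightarrow> norm (Q' t) \<le> K"
    by (rule uniform_bound) blast
  define C0 where "C0 = (2 * K + 2 * K * M) / q"
  have C0: "C0 \<ge> 0" using K q \<open>M \<ge> 0\<close> by (auto simp: C0_def intro!: divide_nonneg_pos)
  define C where "C = exp (C0 * \<tau>) * (2 + K) / q"
  show ?thesis
  proof (rule that[of C])
    show "C > 0" using K q by (simp add: C_def)
    fix a t :: real and u z r g :: "real \<Rightarrow> 'a" and d :: "real \<Rightarrow> real"
    assume "energy_data M a t u z r g d"
    then have at: "0 \<le> a" "a \<le> t" "t \<le> \<tau>"
      and du: "\<And>s. s \<in> {a..t} \<Longrightarrow> (u has_vector_derivative z s + g s) (at s within {a..t})"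
      and ur: "\<And>s. s \<in> {a..t} \<Longrightarrow> u s = R s (z s) + r s"
      and zr: "\<And>s. s \<in> {a..t} \<Longrightarrow> Q s (z s) \<bullet> r s \<le> (d s)\<^sup>2"
      and g: "\<And>s. s \<in> {a..t} \<Longrightarrow> norm (g s) \<le> M * norm (u s) + d s"
      and d0: "\<And>s. s \<in> {a..t} \<Longrightarrow> 0 \<le> d s"
      and dc: "continuous_on {a..t} d"
      unfolding energy_data_def by blast+
    have sub: "s \<in> {0..\<tau>}" if "s \<in> {a..t}" for s using that at by auto
    define \<phi> where "\<phi> s = Q s (u s) \<bullet> u s" for s
    define \<phi>' where "\<phi>' s = Q' s (u s) \<bullet> u s + 2 * (Q s (z s + g s) \<bullet> u s)" for s
    have d\<phi>: "(\<phi> has_vector_derivative \<phi>' s) (at s within {a..t})" if s: "s \<in> {a..t}" for s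
    proof -
      have "(Q has_vector_derivative Q' s) (at s within {a..t})"
        by (rule has_vector_derivative_within_subset[OF C1_onD(1)[OF Q sub[OF s]]]) (use at in auto)
      from bounded_bilinear.has_vector_derivative[OF bounded_bilinear_blinfun_apply this du[OF s]]
      have "((\<lambda>s. Q s (u s)) has_vector_derivative Q s (z s + g s) + Q' s (u s)) (at s within {a..t})" .
      from bounded_bilinear.has_vector_derivative[OF bounded_bilinear_inner this du[OF s]]
      show ?thesis
        unfolding \<phi>_def \<phi>'_def
        by (rule has_vector_derivative_eq_rhs)
           (use Q_sym[OF sub[OF s], of "z s + g s" "u s"] in
              \<open>simp add: inner_add_left inner_commute[of "blinfun_apply (Q s) (u s)"] algebra_simps\<close>)
    qed
    have low: "q * (norm (u s))\<^sup>2 \<le> \<phi> s" if "s \<in> {a..t}" for s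
      using Q_coercive[OF sub[OF that], of "u s"] by (simp add: \<phi>_def dot_square_norm)
    have bd: "\<phi>' s \<le> C0 * \<phi> s + (2 + K) * (d s)\<^sup>2" if s: "s \<in> {a..t}" for s
    proof -
      have K': "norm (Q s x) \<le> K * norm x" "norm (Q' s x) \<le> K * norm x" for x
        by (intro norm_blinfun_le K sub[OF s])+
      have "Q' s (u s) \<bullet> u s \<le> (K * norm (u s)) * norm (u s)"
        by (rule order_trans[OF norm_cauchy_schwarz]) (intro mult_right_mono K' norm_ge_zero)
      moreover have "Q s (z s) \<bullet> u s \<le> (d s)\<^sup>2"
      proof -
        have "Q s (z s) \<bullet> u s = Q s (z s) \<bullet> R s (z s) + Q s (z s) \<bullet> r s"
          by (simp add: ur[OF s] inner_add_right)
        also have "Q s (z s) \<bullet> R s (z s) = 0"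
          by (rule Q_R_orthogonal[OF sub[OF s]])
        finally show ?thesis using zr[OF s] by simp
      qed
      moreover have "Q s (g s) \<bullet> u s \<le> (K * (M * norm (u s) + d s)) * norm (u s)"
      proof (rule order_trans[OF norm_cauchy_schwarz], rule mult_right_mono)
        show "norm (Q s (g s)) \<le> K * (M * norm (u s) + d s)"
          using order_trans[OF K'(1)[of "g s"] mult_left_mono[OF g[OF s], of K]] K(1) by simp
      qed simp
      ultimately have "\<phi>' s \<le> K * (norm (u s))\<^sup>2 + 2 * (d s)\<^sup>2 + 2 * (K * (M * norm (u s) + d s)) * norm (u s)"
        by (simp add: \<phi>'_def blinfun.add_right inner_add_left power2_eq_square)
      also have "\<dots> = (K + 2 * K * M) * (norm (u s))\<^sup>2 + 2 * (d s)\<^sup>2 + K * (2 * d s * norm (u s))"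
        by (simp add: algebra_simps power2_eq_square)
      also have "\<dots> \<le> (K + 2 * K * M) * (norm (u s))\<^sup>2 + 2 * (d s)\<^sup>2 + K * ((d s)\<^sup>2 + (norm (u s))\<^sup>2)"
        using K sum_squares_bound[of "d s" "norm (u s)"] by (intro add_left_mono mult_left_mono) auto
      also have "\<dots> = C0 * (q * (norm (u s))\<^sup>2) + (2 + K) * (d s)\<^sup>2"
        using q by (simp add: C0_def field_simps)
      also have "\<dots> \<le> C0 * \<phi> s + (2 + K) * (d s)\<^sup>2"
        using C0 low[OF s] by (simp add: mult_left_mono)
      finally show ?thesis .
    qed
    have dc2: "continuous_on {a..t} (\<lambda>s. (2 + K) * (d s)\<^sup>2)" "continuous_on {a..t} (\<lambda>s. (d s)\<^sup>2)"
      using dc by (auto intro!: continuous_intros)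
    have "\<phi> t \<le> exp (C0 * (t - a)) * (\<phi> a + integral {a..t} (\<lambda>s. (2 + K) * (d s)\<^sup>2))"
      by (rule gronwall_inequality[OF at(2) d\<phi> bd dc2(1)]) (use K C0 in auto)
    also have "integral {a..t} (\<lambda>s. (2 + K) * (d s)\<^sup>2) = (2 + K) * integral {a..t} (\<lambda>s. (d s)\<^sup>2)"
      by simp
    also have "exp (C0 * (t - a)) * (\<phi> a + (2 + K) * integral {a..t} (\<lambda>s. (d s)\<^sup>2))
        \<le> exp (C0 * \<tau>) * ((2 + K) * (norm (u a))\<^sup>2 + (2 + K) * integral {a..t} (\<lambda>s. (d s)\<^sup>2))"
    proof (rule mult_mono)
      show "exp (C0 * (t - a)) \<le> exp (C0 * \<tau>)" using at C0 by (simp add: mult_left_mono)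
      have "\<phi> a \<le> norm (Q a (u a)) * norm (u a)" unfolding \<phi>_def by (rule norm_cauchy_schwarz)
      also have "\<dots> \<le> (K * norm (u a)) * norm (u a)"
        using K(2)[of a] at by (intro mult_right_mono norm_blinfun_le) auto
      also have "\<dots> \<le> (2 + K) * (norm (u a))\<^sup>2" by (simp add: power2_eq_square algebra_simps)
      finally show "\<phi> a + (2 + K) * integral {a..t} (\<lambda>s. (d s)\<^sup>2)
          \<le> (2 + K) * (norm (u a))\<^sup>2 + (2 + K) * integral {a..t} (\<lambda>s. (d s)\<^sup>2)" by simp
      have "0 \<le> q * (norm (u a))\<^sup>2" using q by simp
      with low[of a] at have "0 \<le> \<phi> a" by auto
      moreover have "0 \<le> integral {a..t} (\<lambda>s. (d s)\<^sup>2)"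
        by (intro integral_nonneg integrable_continuous_real dc2) auto
      ultimately show "0 \<le> \<phi> a + (2 + K) * integral {a..t} (\<lambda>s. (d s)\<^sup>2)" using K by simp
    qed simp
    finally have "q * (norm (u t))\<^sup>2 \<le> exp (C0 * \<tau>) * ((2 + K) * (norm (u a))\<^sup>2 + (2 + K) * integral {a..t} (\<lambda>s. (d s)\<^sup>2))"
      using low[of t] at by auto
    then show "(norm (u t))\<^sup>2 \<le> C * ((norm (u a))\<^sup>2 + integral {a..t} (\<lambda>s. (d s)\<^sup>2))"
      using q by (simp add: C_def field_simps)
  qed
qed

text \<open>
  The inverse of \<open>R t - \<epsilon>\<close>. With \<open>G = (R t)\<^sup>-\<^sup>1\<close> it equals \<open>G (1 - \<epsilon> G)\<^sup>-\<^sup>1\<close>, the Yosida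
  approximation of the generator.
\<close>

definition A :: "real \<Rightarrow> real \<Rightarrow> 'a \<Rightarrow>\<^sub>L 'a" where
  "A \<epsilon> t = (SOME a. (R t - \<epsilon> *\<^sub>R id_blinfun) o\<^sub>L a = id_blinfun \<and> a o\<^sub>L (R t - \<epsilon> *\<^sub>R id_blinfun) = id_blinfun \<and>
     (\<forall>K. norm (Q t) \<le> K \<longrightarrow> norm a \<le> K / (\<epsilon> * q)))"

text \<open>
  The operator \<open>\<epsilon> Q - Q R\<close> is coercive because \<open>Q R\<close> is skew, hence invertible, and
  \<open>R - \<epsilon> = - Q\<^sup>-\<^sup>1 (\<epsilon> Q - Q R)\<close>.
\<close>

lemma A_inverse:
  assumes "t \<in> {0..\<tau>}" "\<epsilon> > 0"
  shows "(R t - \<epsilon> *\<^sub>R id_blinfun) o\<^sub>L A \<epsilon> t = id_blinfun"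
    and "A \<epsilon> t o\<^sub>L (R t - \<epsilon> *\<^sub>R id_blinfun) = id_blinfun"
    and "norm (Q t) \<le> K \<Longrightarrow> norm (A \<epsilon> t) \<le> K / (\<epsilon> * q)"
proof -
  define T where "T = \<epsilon> *\<^sub>R Q t - (Q t o\<^sub>L R t)"
  have "\<epsilon> * q * (x \<bullet> x) \<le> T x \<bullet> x" for x
    using Q_coercive[OF assms(1), of x] skew[OF assms(1), of x] assms(2)
    by (simp add: T_def blinfun.diff_left blinfun.scaleR_left inner_diff_left mult.assoc mult_left_mono)
  then obtain W where W: "T o\<^sub>L W = id_blinfun" "W o\<^sub>L T = id_blinfun" "norm W \<le> 1 / (\<epsilon> * q)"
    using coercive_blinfun_inverse[of "\<epsilon> * q" T] assms q by auto
  have Winv: "T (W x) = x" "W (T x) = x" for x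
    using W by (metis blinfun_apply_blinfun_compose blinfun_apply_id_blinfun)+
  have Qinj: "x = 0" if "Q t x = 0" for x
    using Q_coercive[OF assms(1), of x] q that inner_ge_zero[of x] by (simp add: mult_le_0_iff)
  have TQ: "T x = - Q t ((R t - \<epsilon> *\<^sub>R id_blinfun) x)" for x
    by (simp add: T_def blinfun.bilinear_simps)
  define a where "a = - (W o\<^sub>L Q t)"
  have "(R t - \<epsilon> *\<^sub>R id_blinfun) o\<^sub>L a = id_blinfun"
  proof (rule blinfun_eqI)
    fix x
    have "Q t ((R t - \<epsilon> *\<^sub>R id_blinfun) (a x)) = Q t x"
      using TQ[of "a x"] by (simp add: a_def Winv blinfun.minus_left blinfun.minus_right minus_equation_iff)
    then show "((R t - \<epsilon> *\<^sub>R id_blinfun) o\<^sub>L a) x = id_blinfun x"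
      using Qinj[of "(R t - \<epsilon> *\<^sub>R id_blinfun) (a x) - x"] by (simp add: blinfun.diff_right)
  qed
  moreover have "a o\<^sub>L (R t - \<epsilon> *\<^sub>R id_blinfun) = id_blinfun"
  proof (rule blinfun_eqI)
    fix x
    have "Q t ((R t - \<epsilon> *\<^sub>R id_blinfun) x) = - T x" by (simp add: TQ)
    then show "(a o\<^sub>L (R t - \<epsilon> *\<^sub>R id_blinfun)) x = id_blinfun x"
      by (simp add: a_def blinfun.minus_left blinfun.minus_right Winv)
  qed
  moreover have "norm a \<le> K / (\<epsilon> * q)" if "norm (Q t) \<le> K" for K
  proof -
    have "norm a \<le> norm W * norm (Q t)" by (simp add: a_def norm_blinfun_compose)
    also have "\<dots> \<le> 1 / (\<epsilon> * q) * K" using W(3) that assms q by (intro mult_mono) auto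
    finally show ?thesis by simp
  qed
  ultimately have "\<exists>a. (R t - \<epsilon> *\<^sub>R id_blinfun) o\<^sub>L a = id_blinfun \<and> a o\<^sub>L (R t - \<epsilon> *\<^sub>R id_blinfun) = id_blinfun \<and>
     (\<forall>K. norm (Q t) \<le> K \<longrightarrow> norm a \<le> K / (\<epsilon> * q))" by blast
  from someI_ex[OF this] show "(R t - \<epsilon> *\<^sub>R id_blinfun) o\<^sub>L A \<epsilon> t = id_blinfun"
    "A \<epsilon> t o\<^sub>L (R t - \<epsilon> *\<^sub>R id_blinfun) = id_blinfun"
    "norm (Q t) \<le> K \<Longrightarrow> norm (A \<epsilon> t) \<le> K / (\<epsilon> * q)"
    unfolding A_def[symmetric] by blast+
qed

lemma R_A: "t \<in> {0..\<tau>} \<Longrightarrow> \<epsilon> > 0 \<Longrightarrow> R t (A \<epsilon> t x) = x + \<epsilon> *\<^sub>R A \<epsilon> t x"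
  using arg_cong[OF A_inverse(1), of t \<epsilon> "\<lambda>f. blinfun_apply f x"]
  by (simp add: blinfun.bilinear_simps algebra_simps)

lemma A_R: "t \<in> {0..\<tau>} \<Longrightarrow> \<epsilon> > 0 \<Longrightarrow> A \<epsilon> t (R t x) = x + \<epsilon> *\<^sub>R A \<epsilon> t x"
  using arg_cong[OF A_inverse(2), of t \<epsilon> "\<lambda>f. blinfun_apply f x"]
  by (simp add: blinfun.bilinear_simps algebra_simps)

lemma A_derivative:
  assumes "t \<in> {0..\<tau>}" "\<epsilon> > 0"
  shows "(A \<epsilon> has_vector_derivative - (A \<epsilon> t o\<^sub>L R' t o\<^sub>L A \<epsilon> t)) (at t within {0..\<tau>})"
proof -
  obtain K where K: "K \<ge> 1" "\<And>t. t \<in> {0..\<tau>} \<Longrightarrow> norm (Q t) \<le> K"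
    by (rule uniform_bound) blast
  have "((\<lambda>t. R t - \<epsilon> *\<^sub>R id_blinfun) has_vector_derivative R' t) (at t within {0..\<tau>})"
    using has_vector_derivative_diff[OF C1_onD(1)[OF R assms(1)] has_vector_derivative_const[of "\<epsilon> *\<^sub>R id_blinfun"]]
    by simp
  then show ?thesis
    by (rule has_vector_derivative_blinfun_inverse[where K = "K / (\<epsilon> * q)"])
       (use A_inverse assms K in auto)
qed

lemma A_continuous: "\<epsilon> > 0 \<Longrightarrow> continuous_on {0..\<tau>} (A \<epsilon>)"
  by (auto simp: continuous_on_eq_continuous_within intro: has_vector_derivative_continuous A_derivative)

text \<open>
  The resolvent \<open>(1 - \<epsilon> G)\<^sup>-\<^sup>1\<close> of the generator \<open>G\<close>.
\<close>

abbreviation J :: "real \<Rightarrow> real \<Rightarrow> 'a \<Rightarrow> 'a" where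
  "J \<epsilon> t x \<equiv> A \<epsilon> t (R t x)"

lemma J_energy:
  assumes "t \<in> {0..\<tau>}" "\<epsilon> > 0"
  shows "Q t (J \<epsilon> t x) \<bullet> J \<epsilon> t x = Q t x \<bullet> J \<epsilon> t x"
proof -
  define a where "a = A \<epsilon> t x"
  have p: "J \<epsilon> t x = R t a" "J \<epsilon> t x = x + \<epsilon> *\<^sub>R a"
    using R_A A_R assms by (auto simp: a_def)
  have "Q t (\<epsilon> *\<^sub>R a) \<bullet> R t a = 0"
    using Q_R_orthogonal[OF assms(1), of a] by (simp add: blinfun.scaleR_right)
  moreover have "J \<epsilon> t x - x = \<epsilon> *\<^sub>R a" using p(2) by simp
  ultimately have "Q t (J \<epsilon> t x - x) \<bullet> J \<epsilon> t x = 0" using p(1) by metis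
  then show ?thesis by (simp add: blinfun.diff_right inner_diff_left)
qed

lemma J_bound:
  assumes "t \<in> {0..\<tau>}" "\<epsilon> > 0" "norm (Q t) \<le> K"
  shows "norm (J \<epsilon> t x) \<le> K / q * norm x"
proof (cases "J \<epsilon> t x = 0")
  case False
  have "q * (norm (J \<epsilon> t x))\<^sup>2 \<le> Q t x \<bullet> J \<epsilon> t x"
    using Q_coercive[OF assms(1), of "J \<epsilon> t x"] J_energy[OF assms(1,2), of x] by (simp add: dot_square_norm)
  also have "\<dots> \<le> (K * norm x) * norm (J \<epsilon> t x)"
    by (intro order_trans[OF norm_cauchy_schwarz] mult_right_mono norm_blinfun_le assms norm_ge_zero)
  finally have "(q * norm (J \<epsilon> t x)) * norm (J \<epsilon> t x) \<le> (K * norm x) * norm (J \<epsilon> t x)"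
    by (simp add: power2_eq_square mult_ac)
  then have "q * norm (J \<epsilon> t x) \<le> K * norm x" using False by (simp only: mult_le_cancel_right) simp
  then show ?thesis using q by (simp add: field_simps)
next
  case True
  have "0 \<le> K" using assms(3) norm_ge_zero order_trans by blast
  then show ?thesis using q True by simp
qed

end

text \<open>
  \<open>has_derivative_sequence\<close> provides some limit function with derivative \<open>w\<close>; it is \<open>u\<close> because the
  pointwise limits are unique.
\<close>

lemma has_vector_derivative_uniform_limit:
  fixes us :: "nat \<Rightarrow> real \<Rightarrow> 'b::banach"
  assumes du: "\<And>n t. t \<in> {0..\<tau>} \<Longrightarrow> (us n has_vector_derivative ws n t) (at t within {0..\<tau>})"
    and u: "\<And>t. t \<in> {0..\<tau>} \<Longrightarrow> (\<lambda>n. us n t) \<longlonglongrightarrow> u t"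
    and w: "uniform_limit {0..\<tau>} ws w sequentially"
    and t: "t \<in> {0..\<tau>}"
  shows "(u has_vector_derivative w t) (at t within {0..\<tau>})"
proof -
  have "\<exists>g. \<forall>t\<in>{0..\<tau>}. (\<lambda>n. us n t) \<longlonglongrightarrow> g t \<and> (g has_derivative (\<lambda>h. h *\<^sub>R w t)) (at t within {0..\<tau>})"
  proof (rule has_derivative_sequence[where f = us and ?x0.0 = t and l = "u t" and f' = "\<lambda>n t h. h *\<^sub>R ws n t"])
    show "convex {0..\<tau>}" by simp
    show "(us n has_derivative (\<lambda>h. h *\<^sub>R ws n t)) (at t within {0..\<tau>})" if "t \<in> {0..\<tau>}" for n t
      using du[OF that] by (simp add: has_vector_derivative_def)
    fix e :: real assume "e > 0"
    then have "\<forall>\<^sub>F n in sequentially. \<forall>t\<in>{0..\<tau>}. dist (ws n t) (w t) < e"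
      using w by (simp add: uniform_limit_iff)
    then show "\<forall>\<^sub>F n in sequentially. \<forall>t\<in>{0..\<tau>}. \<forall>h. norm (h *\<^sub>R ws n t - h *\<^sub>R w t) \<le> e * norm h"
    proof eventually_elim
      case (elim n)
      show ?case
      proof (intro ballI allI)
        fix t h :: real assume "t \<in> {0..\<tau>}"
        with elim have "norm (ws n t - w t) \<le> e" by (auto simp: dist_norm less_imp_le)
        then have "norm (h *\<^sub>R (ws n t - w t)) \<le> norm h * e" by (simp add: mult_left_mono)
        then show "norm (h *\<^sub>R ws n t - h *\<^sub>R w t) \<le> e * norm h"
          by (simp add: scaleR_diff_right mult.commute)
      qed
    qed
  qed (use t u[OF t] in auto)
  then obtain g where gg: "\<forall>t\<in>{0..\<tau>}. (\<lambda>n. us n t) \<longlonglongrightarrow> g t \<and> (g has_derivative (\<lambda>h. h *\<^sub>R w t)) (at t within {0..\<tau>})"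
    by blast
  have g: "(\<lambda>n. us n t) \<longlonglongrightarrow> g t" "(g has_vector_derivative w t) (at t within {0..\<tau>})" if "t \<in> {0..\<tau>}" for t
    using bspec[OF gg that] by (auto simp: has_vector_derivative_def)
  have "g s = u s" if "s \<in> {0..\<tau>}" for s using LIMSEQ_unique[OF g(1) u] that by blast
  then show ?thesis by (intro has_vector_derivative_weaken[OF g(2)[OF t] t]) auto
qed

section \<open>The approximating equations\<close>

definition eps :: "nat \<Rightarrow> real" where "eps n = inverse (real (Suc n))"

lemma eps_pos [simp]: "0 < eps n" by (simp add: eps_def)

lemma eps_nonzero [simp]: "eps n \<noteq> 0" by (simp add: eps_def)

lemma eps_tendsto: "eps \<longlonglongrightarrow> 0"
  unfolding eps_def by (rule LIMSEQ_inverse_real_of_nat)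

context skew_family
begin

text \<open>
  With \<open>a\<^sub>n = A\<^sub>\<epsilon> x\<close> and \<open>e\<^sub>n = \<epsilon>\<^sub>n a\<^sub>n\<close> one has \<open>J x - x = e\<^sub>n\<close>, so \<open>e\<^sub>n \<longlonglongrightarrow> 0\<close> is to be
  shown. The range of \<open>R\<close> is not known to be dense at this point; density is a consequence. Skewness applied to
  \<open>a\<^sub>n - a\<^sub>m\<close> gives an identity that makes the energy of \<open>e\<^sub>n\<close> decreasing in \<open>n\<close> and bounds
  the energy of \<open>e\<^sub>n - e\<^sub>m\<close> by its decrease. So \<open>e\<^sub>n\<close> is a Cauchy sequence, and its limit is annihilated by
  the injective \<open>R\<close>.
\<close>

lemma J_tendsto:
  assumes t: "t \<in> {0..\<tau>}"
  shows "(\<lambda>n. J (eps n) t x) \<longlonglongrightarrow> x"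
proof -
  define a where "a n = A (eps n) t x" for n
  define e where "e n = eps n *\<^sub>R a n" for n
  have Ra: "R t (a n) = x + e n" and Jn: "J (eps n) t x = x + e n" for n
    using R_A[OF t, of "eps n"] A_R[OF t, of "eps n"] by (auto simp: a_def e_def)
  have sym: "Q t y \<bullet> z = Q t z \<bullet> y" for y z
    using Q_sym[OF t, of y z] by (simp add: inner_commute)
  define \<alpha> where "\<alpha> n = Q t (e n) \<bullet> e n" for n
  have \<alpha>0: "0 \<le> \<alpha> n" for n
    using Q_coercive[OF t, of "e n"] q inner_ge_zero[of "e n"] unfolding \<alpha>_def
    by (meson dual_order.trans less_imp_le mult_nonneg_nonneg)
  have key: "q * (norm (e n - e m))\<^sup>2 \<le> \<alpha> n - \<alpha> m" if "n \<le> m" for n m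
  proof -
    define \<epsilon> where "\<epsilon> = eps n"
    define \<delta> where "\<delta> = eps m"
    have \<epsilon>\<delta>: "0 < \<delta>" "\<delta> \<le> \<epsilon>" using that by (auto simp: \<delta>_def \<epsilon>_def eps_def)
    define c where "c = Q t (e n) \<bullet> e m"
    have "Q t (a n - a m) \<bullet> R t (a n - a m) = 0" by (rule Q_R_orthogonal[OF t])
    then have "Q t (a n - a m) \<bullet> (e n - e m) = 0" by (simp add: blinfun.diff_right Ra)
    moreover have "a n = (1 / \<epsilon>) *\<^sub>R e n" "a m = (1 / \<delta>) *\<^sub>R e m" by (auto simp: e_def \<epsilon>_def \<delta>_def)
    ultimately have "\<alpha> n / \<epsilon> - c / \<epsilon> - c / \<delta> + \<alpha> m / \<delta> = 0"
      using sym[of "e m" "e n"]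
      by (simp add: blinfun.bilinear_simps inner_diff_left inner_diff_right \<alpha>_def c_def algebra_simps)
    then have c: "(\<epsilon> + \<delta>) * c = \<delta> * \<alpha> n + \<epsilon> * \<alpha> m"
      using \<epsilon>\<delta> by (simp add: field_simps)
    define G where "G = Q t (e n - e m) \<bullet> (e n - e m)"
    have G: "G = \<alpha> n + \<alpha> m - 2 * c"
      using sym[of "e m" "e n"]
      by (simp add: G_def \<alpha>_def c_def blinfun.diff_right inner_diff_left inner_diff_right)
    have qG: "q * (norm (e n - e m))\<^sup>2 \<le> G"
      using Q_coercive[OF t, of "e n - e m"] by (simp add: G_def dot_square_norm)
    then have G0: "0 \<le> G" using q by (meson dual_order.trans less_imp_le mult_nonneg_nonneg zero_le_power2)
    have "(\<epsilon> + \<delta>) * G = (\<epsilon> - \<delta>) * (\<alpha> n - \<alpha> m)"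
      using c by (simp add: G algebra_simps)
    moreover from this have "0 \<le> (\<epsilon> - \<delta>) * (\<alpha> n - \<alpha> m)" using G0 \<epsilon>\<delta> by (metis add_nonneg_nonneg less_imp_le mult_nonneg_nonneg order_trans)
    moreover have "\<alpha> n \<ge> \<alpha> m"
    proof (cases "\<epsilon> = \<delta>")
      case True
      then have "n = m" by (simp add: \<epsilon>_def \<delta>_def eps_def)
      then show ?thesis by simp
    next
      case False
      then show ?thesis using \<epsilon>\<delta> \<open>0 \<le> (\<epsilon> - \<delta>) * (\<alpha> n - \<alpha> m)\<close> by (simp add: zero_le_mult_iff)
    qed
    ultimately have "(\<epsilon> + \<delta>) * G \<le> (\<epsilon> + \<delta>) * (\<alpha> n - \<alpha> m)"
      using \<epsilon>\<delta> by (simp add: mult_right_mono)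
    then have "G \<le> \<alpha> n - \<alpha> m" using \<epsilon>\<delta> by simp
    with qG show ?thesis by simp
  qed
  have "decseq \<alpha>"
  proof (rule decseq_SucI)
    show "\<alpha> (Suc n) \<le> \<alpha> n" for n
      using key[of n "Suc n"] q zero_le_power2[of "norm (e n - e (Suc n))"]
      by (meson diff_ge_0_iff_ge le_SucI less_imp_le mult_nonneg_nonneg order_refl order_trans)
  qed
  then have "Cauchy \<alpha>"
    using decseq_convergent[of \<alpha> 0] \<alpha>0 by (metis LIMSEQ_imp_Cauchy)
  have "Cauchy e"
  proof (rule metric_CauchyI)
    fix d :: real assume "0 < d"
    then have "0 < q * d\<^sup>2" using q by simp
    with \<open>Cauchy \<alpha>\<close> obtain M where M: "\<And>m n. m \<ge> M \<Longrightarrow> n \<ge> M \<Longrightarrow> dist (\<alpha> m) (\<alpha> n) < q * d\<^sup>2"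
      by (meson Cauchy_def)
    have *: "dist (e n) (e m) < d" if "n \<ge> M" "n \<le> m" for n m
    proof -
      have "q * (norm (e n - e m))\<^sup>2 < q * d\<^sup>2"
        using key[OF that(2)] M[of n m] that by (auto simp: dist_real_def)
      then have "(norm (e n - e m))\<^sup>2 < d\<^sup>2" using q by simp
      then show ?thesis using \<open>0 < d\<close> by (simp add: dist_norm power_less_imp_less_base)
    qed
    show "\<exists>M. \<forall>m\<ge>M. \<forall>n\<ge>M. dist (e m) (e n) < d"
    proof (intro exI allI impI)
      fix m n assume "m \<ge> M" "n \<ge> M"
      then show "dist (e m) (e n) < d" using *[of m n] *[of n m] by (cases "m \<le> n") (auto simp: dist_commute)
    qed
  qed
  then obtain l where l: "e \<longlonglongrightarrow> l" by (auto simp: Cauchy_convergent_iff convergent_def)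
  have "(\<lambda>n. R t (e n)) \<longlonglongrightarrow> R t l" by (intro tendsto_intros l)
  moreover have "R t (e n) = eps n *\<^sub>R (x + e n)" for n by (simp add: e_def blinfun.scaleR_right Ra)
  moreover have "(\<lambda>n. eps n *\<^sub>R (x + e n)) \<longlonglongrightarrow> 0 *\<^sub>R (x + l)"
    by (intro tendsto_intros l eps_tendsto)
  ultimately have "R t l = 0" using LIMSEQ_unique by force
  then have "l = 0" by (rule R_inj[OF t])
  then show ?thesis using tendsto_add[OF tendsto_const[of x] l] by (simp add: Jn)
qed

lemma J_continuous:
  assumes "\<epsilon> > 0" "continuous_on {0..\<tau>} p"
  shows "continuous_on {0..\<tau>} (\<lambda>t. J \<epsilon> t (p t))"
  by (intro bounded_bilinear.continuous_on[OF bounded_bilinear_blinfun_apply] A_continuous assms C1_onD(3)[OF R])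

text \<open>
  Dominated convergence replaces uniform convergence in time, which is all that the energy estimate needs.
\<close>

lemma J_integral_tendsto:
  assumes p: "continuous_on {0..\<tau>} p"
  shows "(\<lambda>n. integral {0..\<tau>} (\<lambda>t. (norm (J (eps n) t (p t) - p t))\<^sup>2)) \<longlonglongrightarrow> 0"
proof -
  obtain K where K: "K \<ge> 1" "\<And>t. t \<in> {0..\<tau>} \<Longrightarrow> norm (Q t) \<le> K" by (rule uniform_bound) blast
  obtain P where P: "P \<ge> 0" "\<And>t. t \<in> {0..\<tau>} \<Longrightarrow> norm (p t) \<le> P" by (rule continuous_on_Icc_bound[OF p]) blast
  define D where "D = (K / q + 1) * P"
  have "(\<lambda>n. integral {0..\<tau>} (\<lambda>t. (norm (J (eps n) t (p t) - p t))\<^sup>2)) \<longlonglongrightarrow> integral {0..\<tau>} (\<lambda>t. 0)"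
  proof (rule dominated_convergence(2)[where h = "\<lambda>t. D\<^sup>2"])
    show "(\<lambda>t. (norm (J (eps n) t (p t) - p t))\<^sup>2) integrable_on {0..\<tau>}" for n
      by (intro integrable_continuous_real continuous_intros J_continuous p) auto
    show "norm ((norm (J (eps n) t (p t) - p t))\<^sup>2) \<le> D\<^sup>2" if t: "t \<in> {0..\<tau>}" for n t
    proof -
      have "norm (J (eps n) t (p t) - p t) \<le> K / q * norm (p t) + norm (p t)"
        by (intro order_trans[OF norm_triangle_ineq4] add_right_mono J_bound t K) auto
      also have "\<dots> = (K / q + 1) * norm (p t)" by (simp add: algebra_simps)
      also have "\<dots> \<le> D" unfolding D_def using P(2)[OF t] K q by (intro mult_left_mono) auto
      finally show ?thesis by (simp add: power_mono)
    qed
    show "(\<lambda>n. (norm (J (eps n) t (p t) - p t))\<^sup>2) \<longlonglongrightarrow> 0" if "t \<in> {0..\<tau>}" for t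
    proof -
      have "(\<lambda>n. J (eps n) t (p t) - p t) \<longlonglongrightarrow> 0" using J_tendsto[OF that] by (rule LIM_zero)
      then show ?thesis by (rule tendsto_eq_rhs[OF tendsto_power[OF tendsto_norm]]) simp
    qed
  qed (rule integrable_const_ivl)
  then show ?thesis by simp
qed

definition approx_sol :: "real \<Rightarrow> (real \<Rightarrow> 'a \<Rightarrow>\<^sub>L 'a) \<Rightarrow> (real \<Rightarrow> 'a) \<Rightarrow> (real \<Rightarrow> 'a) \<Rightarrow> bool" where
  "approx_sol \<epsilon> F h u \<longleftrightarrow>
     (\<forall>t\<in>{0..\<tau>}. (u has_vector_derivative A \<epsilon> t (u t) + F t (u t) + h t) (at t within {0..\<tau>}))"

lemma approx_sol_continuous: "approx_sol \<epsilon> F h u \<Longrightarrow> continuous_on {0..\<tau>} u"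
  by (auto simp: approx_sol_def continuous_on_eq_continuous_within intro: has_vector_derivative_continuous)

lemma approx_sol_exists:
  assumes "\<epsilon> > 0" "continuous_on {0..\<tau>} F" "continuous_on {0..\<tau>} h"
  obtains u where "u 0 = f" "approx_sol \<epsilon> F h u"
proof -
  have "continuous_on {0..\<tau>} (\<lambda>t. A \<epsilon> t + F t)" by (intro continuous_intros A_continuous assms)
  from linear_ode_exists[OF \<tau> this assms(3), of f] obtain u where
    "u 0 = f" "\<And>t. t \<in> {0..\<tau>} \<Longrightarrow> (u has_vector_derivative (A \<epsilon> t + F t) (u t) + h t) (at t within {0..\<tau>})"
    by blast
  then show ?thesis by (intro that[of u]) (auto simp: approx_sol_def blinfun.add_left)
qed

text \<open>
  The constant is uniform in \<open>\<epsilon>\<close>, which is what allows passing to the limit.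
\<close>

definition stability_constant :: "(real \<Rightarrow> 'a \<Rightarrow>\<^sub>L 'a) \<Rightarrow> real \<Rightarrow> bool" where
  "stability_constant F C \<longleftrightarrow> C > 0 \<and> (\<forall>\<epsilon> h1 h2 u1 u2 \<delta> t. \<epsilon> > 0 \<longrightarrow> approx_sol \<epsilon> F h1 u1 \<longrightarrow> approx_sol \<epsilon> F h2 u2 \<longrightarrow>
     (\<forall>s\<in>{0..\<tau>}. norm (h1 s - h2 s) \<le> \<delta>) \<longrightarrow> t \<in> {0..\<tau>} \<longrightarrow>
     (norm (u1 t - u2 t))\<^sup>2 \<le> C * ((norm (u1 0 - u2 0))\<^sup>2 + \<delta>\<^sup>2))"

lemma stability_constantD:
  assumes "stability_constant F C" "\<epsilon> > 0" "approx_sol \<epsilon> F h1 u1" "approx_sol \<epsilon> F h2 u2"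
    "\<forall>s\<in>{0..\<tau>}. norm (h1 s - h2 s) \<le> \<delta>" "t \<in> {0..\<tau>}"
  shows "(norm (u1 t - u2 t))\<^sup>2 \<le> C * ((norm (u1 0 - u2 0))\<^sup>2 + \<delta>\<^sup>2)"
  using assms unfolding stability_constant_def by blast

lemma stability_constant_exists:
  assumes F: "continuous_on {0..\<tau>} F"
  obtains C where "stability_constant F C"
proof -
  obtain M where M: "M \<ge> 0" "\<And>t. t \<in> {0..\<tau>} \<Longrightarrow> norm (F t) \<le> M" by (rule continuous_on_Icc_bound[OF F]) blast
  obtain C where C: "C > 0" "\<And>a t u z r g d. energy_data M a t u z r g d
      \<Longrightarrow> (norm (u t))\<^sup>2 \<le> C * ((norm (u a))\<^sup>2 + integral {a..t} (\<lambda>s. (d s)\<^sup>2))"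
    using energy_estimate[OF M(1)] by blast
  show ?thesis
  proof (rule that[of "C * (1 + \<tau>)"], unfold stability_constant_def, intro conjI allI impI)
    show "C * (1 + \<tau>) > 0" using C \<tau> by simp
    fix \<epsilon> h1 h2 u1 u2 \<delta> t
    assume \<epsilon>: "\<epsilon> > 0" and u: "approx_sol \<epsilon> F h1 u1" "approx_sol \<epsilon> F h2 u2"
      and h: "\<forall>s\<in>{0..\<tau>}. norm (h1 s - h2 s) \<le> \<delta>" and t: "t \<in> {0..\<tau>}"
    have \<delta>: "0 \<le> \<delta>" using bspec[OF h t] norm_ge_zero order_trans by blast
    define z where "z s = A \<epsilon> s (u1 s - u2 s)" for s
    have "(norm (u1 t - u2 t))\<^sup>2 \<le> C * ((norm (u1 0 - u2 0))\<^sup>2 + integral {0..t} (\<lambda>s. \<delta>\<^sup>2))"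
    proof (rule C(2)[of 0 t "\<lambda>s. u1 s - u2 s" z "\<lambda>s. - \<epsilon> *\<^sub>R z s" "\<lambda>s. F s (u1 s - u2 s) + (h1 s - h2 s)"],
        unfold energy_data_def, intro conjI ballI)
      fix s assume "s \<in> {0..t}"
      then have s: "s \<in> {0..\<tau>}" using t by auto
      have "((\<lambda>s. u1 s - u2 s) has_vector_derivative (A \<epsilon> s (u1 s) + F s (u1 s) + h1 s) - (A \<epsilon> s (u2 s) + F s (u2 s) + h2 s)) (at s within {0..\<tau>})"
        using u s by (intro has_vector_derivative_diff) (auto simp: approx_sol_def)
      then have "((\<lambda>s. u1 s - u2 s) has_vector_derivative z s + (F s (u1 s - u2 s) + (h1 s - h2 s))) (at s within {0..\<tau>})"
        by (rule has_vector_derivative_eq_rhs) (simp add: z_def blinfun.diff_right)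
      then show "((\<lambda>s. u1 s - u2 s) has_vector_derivative z s + (F s (u1 s - u2 s) + (h1 s - h2 s))) (at s within {0..t})"
        by (rule has_vector_derivative_within_subset) (use t in auto)
      show "u1 s - u2 s = R s (z s) + - \<epsilon> *\<^sub>R z s"
        unfolding z_def using R_A[OF s \<epsilon>] by simp
      have "0 \<le> Q s (z s) \<bullet> z s"
        using Q_coercive[OF s, of "z s"] q inner_ge_zero[of "z s"] by (meson order_trans less_imp_le mult_nonneg_nonneg)
      then show "Q s (z s) \<bullet> (- \<epsilon> *\<^sub>R z s) \<le> \<delta>\<^sup>2" using \<epsilon> by (simp add: order_trans[of _ 0])
      show "norm (F s (u1 s - u2 s) + (h1 s - h2 s)) \<le> M * norm (u1 s - u2 s) + \<delta>"
        by (intro order_trans[OF norm_triangle_ineq] add_mono norm_blinfun_le M s bspec[OF h s])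
    qed (use t \<delta> in auto)
    also have "\<dots> \<le> C * (1 + \<tau>) * ((norm (u1 0 - u2 0))\<^sup>2 + \<delta>\<^sup>2)"
    proof -
      have "t * \<delta>\<^sup>2 \<le> \<tau> * \<delta>\<^sup>2" using t by (intro mult_right_mono) auto
      moreover have "0 \<le> \<tau> * (norm (u1 0 - u2 0))\<^sup>2" using \<tau> by simp
      moreover have "0 \<le> \<delta>\<^sup>2" by simp
      ultimately have "(norm (u1 0 - u2 0))\<^sup>2 + t * \<delta>\<^sup>2 \<le> (1 + \<tau>) * ((norm (u1 0 - u2 0))\<^sup>2 + \<delta>\<^sup>2)"
        unfolding distrib_left distrib_right mult_1 by linarith
      then show ?thesis using C(1) t by (simp add: mult.assoc)
    qed
    finally show "(norm (u1 t - u2 t))\<^sup>2 \<le> C * (1 + \<tau>) * ((norm (u1 0 - u2 0))\<^sup>2 + \<delta>\<^sup>2)" .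
  qed
qed

lemma approx_sol_unique:
  assumes "continuous_on {0..\<tau>} F" "\<epsilon> > 0" "approx_sol \<epsilon> F h u1" "approx_sol \<epsilon> F h u2" "u1 0 = u2 0" "t \<in> {0..\<tau>}"
  shows "u1 t = u2 t"
proof -
  obtain C where C: "stability_constant F C" by (rule stability_constant_exists[OF assms(1)])
  from stability_constantD[OF C assms(2-4), of 0 t] assms(5,6) show ?thesis by simp
qed

text \<open>
  This is where the assumption \<open>R'_eq\<close> is used. The derivative of \<open>z = A u\<close> contains the unbounded term
  \<open>- A R' A u = - A (R N z - \<sigma> R z) = - J N z + A \<sigma> R z\<close>. The first part is bounded, as \<open>J\<close> is; up to
  bounded terms the second is \<open>A \<sigma> u\<close>, which \<open>y\<close> absorbs through its summand \<open>\<sigma> u\<close>. The summands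
  \<open>F u + h\<close> absorb \<open>A (F u + h)\<close> in the same way.
\<close>

lemma approx_sol_generator_derivative:
  assumes \<epsilon>: "\<epsilon> > 0" and F: "C1_on {0..\<tau>} F F'" and h: "C1_on {0..\<tau>} h h'" and u: "approx_sol \<epsilon> F h u"
    and t: "t \<in> {0..\<tau>}"
  defines "z \<equiv> \<lambda>t. A \<epsilon> t (u t)"
  defines "y \<equiv> \<lambda>t. z t + (F t + \<sigma> t) (u t) + h t"
  shows "(y has_vector_derivative A \<epsilon> t (y t) + (J \<epsilon> t ((\<sigma> t - N t) (z t)) + F t (z t)
     + (F' t + \<sigma>' t) (u t) + (F t + \<sigma> t) (F t (u t) + h t) + h' t)) (at t within {0..\<tau>})"
proof -
  have du: "(u has_vector_derivative z t + F t (u t) + h t) (at t within {0..\<tau>})"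
    using u t by (simp add: approx_sol_def z_def)
  have dz: "(z has_vector_derivative A \<epsilon> t (z t + F t (u t) + h t) + (- (A \<epsilon> t o\<^sub>L R' t o\<^sub>L A \<epsilon> t)) (u t)) (at t within {0..\<tau>})"
    unfolding z_def
    using bounded_bilinear.has_vector_derivative[OF bounded_bilinear_blinfun_apply A_derivative[OF t \<epsilon>] du]
    by (simp add: z_def)
  have "((\<lambda>t. F t + \<sigma> t) has_vector_derivative F' t + \<sigma>' t) (at t within {0..\<tau>})"
    by (intro has_vector_derivative_add C1_onD(1)[OF F] C1_onD(1)[OF \<sigma>] t)
  from bounded_bilinear.has_vector_derivative[OF bounded_bilinear_blinfun_apply this du]
  have dFu: "((\<lambda>t. (F t + \<sigma> t) (u t)) has_vector_derivative
      (F t + \<sigma> t) (z t + F t (u t) + h t) + (F' t + \<sigma>' t) (u t)) (at t within {0..\<tau>})" .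
  have uz: "u t = R t (z t) - \<epsilon> *\<^sub>R z t" using R_A[OF t \<epsilon>, of "u t"] by (simp add: z_def)
  have J\<sigma>: "J \<epsilon> t (\<sigma> t (z t)) = \<sigma> t (z t) + \<epsilon> *\<^sub>R A \<epsilon> t (\<sigma> t (z t))" by (rule A_R[OF t \<epsilon>])
  have "(- (A \<epsilon> t o\<^sub>L R' t o\<^sub>L A \<epsilon> t)) (u t) = - A \<epsilon> t (R' t (z t))"
    by (simp add: z_def blinfun.minus_left)
  also have "R' t (z t) = R t (N t (z t)) - \<sigma> t (R t (z t))"
    by (simp add: R'_eq[OF t] blinfun.diff_left)
  also have "R t (z t) = u t + \<epsilon> *\<^sub>R z t" using uz by simp
  finally have "(- (A \<epsilon> t o\<^sub>L R' t o\<^sub>L A \<epsilon> t)) (u t)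
      = - J \<epsilon> t (N t (z t)) + A \<epsilon> t (\<sigma> t (u t)) + J \<epsilon> t (\<sigma> t (z t)) - \<sigma> t (z t)"
    by (simp add: blinfun.diff_right blinfun.add_right blinfun.scaleR_right J\<sigma> algebra_simps)
  with has_vector_derivative_add[OF has_vector_derivative_add[OF dz dFu] C1_onD(1)[OF h t]]
  show ?thesis
    unfolding y_def
    by (elim has_vector_derivative_eq_rhs)
       (simp add: blinfun.bilinear_simps algebra_simps)
qed

section \<open>Convergence of the approximations\<close>

text \<open>
  The energy estimate for \<open>y = z + (F + \<sigma>) u + h\<close> bounds \<open>y\<close> and therefore \<open>z\<close>. The initial value
  \<open>A u(0) = J g0\<close> is bounded uniformly in \<open>\<epsilon>\<close> since \<open>u(0)\<close> is in the range of \<open>R 0\<close>.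
\<close>

lemma generator_part_bound:
  assumes F: "C1_on {0..\<tau>} F F'" and h: "C1_on {0..\<tau>} h h'"
  obtains K where "K > 0"
    "\<And>\<epsilon> u t. \<epsilon> > 0 \<Longrightarrow> approx_sol \<epsilon> F h u \<Longrightarrow> u 0 = R 0 g0 \<Longrightarrow> t \<in> {0..\<tau>} \<Longrightarrow> norm (A \<epsilon> t (u t)) \<le> K"
proof -
  obtain K where K: "K \<ge> 1" "\<And>t. t \<in> {0..\<tau>} \<Longrightarrow> norm (Q t) \<le> K"
    "\<And>t. t \<in> {0..\<tau>} \<Longrightarrow> norm (N t) \<le> K" "\<And>t. t \<in> {0..\<tau>} \<Longrightarrow> norm (\<sigma> t) \<le> K"
    "\<And>t. t \<in> {0..\<tau>} \<Longrightarrow> norm (\<sigma>' t) \<le> K" by (rule uniform_bound) blast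
  obtain f where f: "f \<ge> 0" "\<And>t. t \<in> {0..\<tau>} \<Longrightarrow> norm (F t) \<le> f"
    by (rule continuous_on_Icc_bound[OF C1_onD(3)[OF F]]) blast
  obtain f' where f': "f' \<ge> 0" "\<And>t. t \<in> {0..\<tau>} \<Longrightarrow> norm (F' t) \<le> f'"
    by (rule continuous_on_Icc_bound[OF C1_onD(2)[OF F]]) blast
  obtain H where H: "H \<ge> 0" "\<And>t. t \<in> {0..\<tau>} \<Longrightarrow> norm (h t) \<le> H"
    by (rule continuous_on_Icc_bound[OF C1_onD(3)[OF h]]) blast
  obtain H' where H': "H' \<ge> 0" "\<And>t. t \<in> {0..\<tau>} \<Longrightarrow> norm (h' t) \<le> H'"
    by (rule continuous_on_Icc_bound[OF C1_onD(2)[OF h]]) blast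
  obtain C where C: "stability_constant F C" by (rule stability_constant_exists[OF C1_onD(3)[OF F]])
  have C0: "C > 0" using C by (simp add: stability_constant_def)
  define U where "U = sqrt (C * ((norm (R 0 g0))\<^sup>2 + H\<^sup>2))"
  have U0: "0 \<le> U" using C0 by (simp add: U_def)
  define KJ where "KJ = K / q"
  have KJ: "KJ \<ge> 0" using K q by (simp add: KJ_def)
  define M where "M = KJ * (2 * K) + f"
  have M: "M \<ge> 0" using KJ K f by (simp add: M_def)
  define E where "E = (f + K) * U + H"
  have E: "E \<ge> 0" using f K U0 H by (simp add: E_def)
  define D where "D = M * E + (f' + K) * U + (f + K) * (f * U + H) + H'"
  have D: "D \<ge> 0" using M E f f' K U0 H H' by (simp add: D_def)
  obtain Ce where Ce: "Ce > 0" "\<And>a t u z r g d. energy_data M a t u z r g d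
      \<Longrightarrow> (norm (u t))\<^sup>2 \<le> Ce * ((norm (u a))\<^sup>2 + integral {a..t} (\<lambda>s. (d s)\<^sup>2))"
    using energy_estimate[OF M] by blast
  define Y where "Y = sqrt (Ce * ((KJ * norm g0 + E)\<^sup>2 + \<tau> * D\<^sup>2))"
  show ?thesis
  proof (rule that[of "Y + E + 1"])
    have "0 \<le> Y" using Ce \<tau> by (simp add: Y_def)
    then show "Y + E + 1 > 0" using E by simp
    fix \<epsilon> u t assume \<epsilon>: "\<epsilon> > 0" and u: "approx_sol \<epsilon> F h u" "u 0 = R 0 g0" and t: "t \<in> {0..\<tau>}"
    define z where "z s = A \<epsilon> s (u s)" for s
    define y where "y s = z s + (F s + \<sigma> s) (u s) + h s" for s
    define g where "g s = J \<epsilon> s ((\<sigma> s - N s) (z s)) + F s (z s)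
      + (F' s + \<sigma>' s) (u s) + (F s + \<sigma> s) (F s (u s) + h s) + h' s" for s
    have "approx_sol \<epsilon> F (\<lambda>_. 0) (\<lambda>_. 0)" by (simp add: approx_sol_def blinfun.zero_right)
    then have uU: "norm (u s) \<le> U" if "s \<in> {0..\<tau>}" for s
      unfolding U_def u(2)[symmetric]
      using stability_constantD[OF C \<epsilon> u(1), of "\<lambda>_. 0" "\<lambda>_. 0" H s] H that
      by (intro real_le_rsqrt) auto
    have FS: "norm ((F s + \<sigma> s) x) \<le> (f + K) * norm x" if "s \<in> {0..\<tau>}" for s x
      by (intro norm_blinfun_le order_trans[OF norm_triangle_ineq] add_mono f K that)
    have yz: "norm (y s - z s) \<le> E" if s: "s \<in> {0..\<tau>}" for s
    proof -
      have "norm (y s - z s) \<le> norm ((F s + \<sigma> s) (u s)) + norm (h s)"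
        using norm_triangle_ineq[of "(F s + \<sigma> s) (u s)" "h s"] by (simp add: y_def add.assoc)
      also have "\<dots> \<le> (f + K) * U + H"
        using f K by (intro add_mono order_trans[OF FS[OF s]] mult_left_mono uU s H) auto
      finally show ?thesis by (simp add: E_def)
    qed
    have zy: "norm (z s) \<le> norm (y s) + E" if "s \<in> {0..\<tau>}" for s
      using yz[OF that] norm_triangle_sub[of "z s" "y s"] by (simp add: norm_minus_commute)
    have "(norm (y t))\<^sup>2 \<le> Ce * ((norm (y 0))\<^sup>2 + integral {0..t} (\<lambda>s. D\<^sup>2))"
    proof (rule Ce(2)[of 0 t y "\<lambda>s. A \<epsilon> s (y s)" "\<lambda>s. - \<epsilon> *\<^sub>R A \<epsilon> s (y s)" g], unfold energy_data_def, intro conjI ballI)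
      fix s assume "s \<in> {0..t}"
      then have s: "s \<in> {0..\<tau>}" using t by auto
      show "(y has_vector_derivative A \<epsilon> s (y s) + g s) (at s within {0..t})"
      proof (rule has_vector_derivative_within_subset)
        show "(y has_vector_derivative A \<epsilon> s (y s) + g s) (at s within {0..\<tau>})"
          using approx_sol_generator_derivative[OF \<epsilon> F h u(1) s]
          unfolding y_def[abs_def] g_def z_def .
      qed (use t in auto)
      show "y s = R s (A \<epsilon> s (y s)) + - \<epsilon> *\<^sub>R A \<epsilon> s (y s)" using R_A[OF s \<epsilon>] by simp
      have "0 \<le> Q s (A \<epsilon> s (y s)) \<bullet> A \<epsilon> s (y s)"
        using Q_coercive[OF s, of "A \<epsilon> s (y s)"] q inner_ge_zero[of "A \<epsilon> s (y s)"]
        by (meson order_trans less_imp_le mult_nonneg_nonneg)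
      then show "Q s (A \<epsilon> s (y s)) \<bullet> (- \<epsilon> *\<^sub>R A \<epsilon> s (y s)) \<le> D\<^sup>2" using \<epsilon> by (simp add: order_trans[of _ 0])
      have "norm (g s) \<le> KJ * (2 * K * norm (z s)) + f * norm (z s) + (f' + K) * U + (f + K) * (f * U + H) + H'"
        unfolding g_def
      proof (intro order_trans[OF norm_triangle_ineq] add_mono)
        have "norm ((\<sigma> s - N s) (z s)) \<le> (K + K) * norm (z s)"
          by (intro norm_blinfun_le order_trans[OF norm_triangle_ineq4] add_mono K s)
        then show "norm (J \<epsilon> s ((\<sigma> s - N s) (z s))) \<le> KJ * (2 * K * norm (z s))"
          using KJ unfolding KJ_def by (intro order_trans[OF J_bound[OF s \<epsilon> K(2)[OF s]]] mult_left_mono) auto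
        show "norm (F s (z s)) \<le> f * norm (z s)" by (intro norm_blinfun_le f s)
        have "norm ((F' s + \<sigma>' s) (u s)) \<le> (f' + K) * norm (u s)"
          by (intro norm_blinfun_le order_trans[OF norm_triangle_ineq] add_mono f' K s)
        also have "\<dots> \<le> (f' + K) * U" using f' K by (intro mult_left_mono uU s) auto
        finally show "norm ((F' s + \<sigma>' s) (u s)) \<le> (f' + K) * U" .
        have "norm (F s (u s) + h s) \<le> f * U + H"
          using f by (intro order_trans[OF norm_triangle_ineq] add_mono order_trans[OF norm_blinfun_le[OF f(2)[OF s]]]
             mult_left_mono uU s H) auto
        then show "norm ((F s + \<sigma> s) (F s (u s) + h s)) \<le> (f + K) * (f * U + H)"
          using f K by (intro order_trans[OF FS[OF s]] mult_left_mono) auto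
        show "norm (h' s) \<le> H'" by (intro H' s)
      qed
      also have "\<dots> = M * norm (z s) + (D - M * E)" by (simp add: M_def D_def algebra_simps)
      also have "\<dots> \<le> M * (norm (y s) + E) + (D - M * E)" using zy[OF s] M by (simp add: mult_left_mono)
      finally show "norm (g s) \<le> M * norm (y s) + D" by (simp add: algebra_simps)
    qed (use t D in auto)
    also have "\<dots> \<le> Ce * ((KJ * norm g0 + E)\<^sup>2 + \<tau> * D\<^sup>2)"
    proof -
      have z0: "0 \<in> {0..\<tau>}" using \<tau> by simp
      have "norm (z 0) \<le> KJ * norm g0"
        unfolding z_def u KJ_def using K z0 by (intro J_bound z0 \<epsilon>) auto
      then have "norm (y 0) \<le> KJ * norm g0 + E"
        using yz[OF z0] norm_triangle_sub[of "y 0" "z 0"] by simp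
      then have "(norm (y 0))\<^sup>2 \<le> (KJ * norm g0 + E)\<^sup>2" by (intro power_mono) auto
      moreover have "t * D\<^sup>2 \<le> \<tau> * D\<^sup>2" using t by (intro mult_right_mono) auto
      ultimately show ?thesis using Ce(1) t by simp
    qed
    finally have "norm (y t) \<le> Y" unfolding Y_def by (rule real_le_rsqrt)
    then show "norm (A \<epsilon> t (u t)) \<le> Y + E + 1" using zy[OF t] by (simp add: z_def)
  qed
qed

text \<open>
  The defect of \<open>u - v\<close> is \<open>\<delta> z\<^sub>2 - \<epsilon> z\<^sub>1\<close>; its pairing with \<open>Q (z\<^sub>1 - z\<^sub>2)\<close> is of order \<open>\<epsilon> + \<delta>\<close>
  because both \<open>z\<close> are bounded.
\<close>

lemma approx_sol_difference:
  assumes F: "continuous_on {0..\<tau>} F" and "K > 0"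
  obtains C where "C > 0"
    "\<And>\<epsilon> \<delta> u v t. \<lbrakk>\<epsilon> > 0; \<delta> > 0; approx_sol \<epsilon> F h u; approx_sol \<delta> F h v; u 0 = v 0;
       \<forall>s\<in>{0..\<tau>}. norm (A \<epsilon> s (u s)) \<le> K \<and> norm (A \<delta> s (v s)) \<le> K; t \<in> {0..\<tau>}\<rbrakk>
     \<Longrightarrow> (norm (u t - v t))\<^sup>2 \<le> C * (\<epsilon> + \<delta>)"
proof -
  obtain KQ where KQ: "KQ \<ge> 1" "\<And>t. t \<in> {0..\<tau>} \<Longrightarrow> norm (Q t) \<le> KQ" by (rule uniform_bound) blast
  obtain M where M: "M \<ge> 0" "\<And>t. t \<in> {0..\<tau>} \<Longrightarrow> norm (F t) \<le> M" by (rule continuous_on_Icc_bound[OF F]) blast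
  obtain C where C: "C > 0" "\<And>a t u z r g d. energy_data M a t u z r g d
      \<Longrightarrow> (norm (u t))\<^sup>2 \<le> C * ((norm (u a))\<^sup>2 + integral {a..t} (\<lambda>s. (d s)\<^sup>2))"
    using energy_estimate[OF M(1)] by blast
  define G where "G = KQ * (2 * K) * K"
  have G: "G > 0" using KQ \<open>K > 0\<close> by (simp add: G_def)
  show ?thesis
  proof (rule that[of "C * (1 + \<tau>) * G"])
    show "C * (1 + \<tau>) * G > 0" using C G \<tau> by simp
    fix \<epsilon> \<delta> u v t assume \<epsilon>: "\<epsilon> > 0" and \<delta>: "\<delta> > 0" and u: "approx_sol \<epsilon> F h u" and v: "approx_sol \<delta> F h v"
      and init: "u 0 = v 0" and K: "\<forall>s\<in>{0..\<tau>}. norm (A \<epsilon> s (u s)) \<le> K \<and> norm (A \<delta> s (v s)) \<le> K"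
      and t: "t \<in> {0..\<tau>}"
    define d where "d = sqrt (G * (\<epsilon> + \<delta>))"
    have d: "d \<ge> 0" "d\<^sup>2 = G * (\<epsilon> + \<delta>)" using G \<epsilon> \<delta> by (auto simp: d_def)
    define z1 where "z1 s = A \<epsilon> s (u s)" for s
    define z2 where "z2 s = A \<delta> s (v s)" for s
    have "(norm (u t - v t))\<^sup>2 \<le> C * ((norm (u 0 - v 0))\<^sup>2 + integral {0..t} (\<lambda>s. d\<^sup>2))"
    proof (rule C(2)[of 0 t "\<lambda>s. u s - v s" "\<lambda>s. z1 s - z2 s" "\<lambda>s. \<delta> *\<^sub>R z2 s - \<epsilon> *\<^sub>R z1 s" "\<lambda>s. F s (u s - v s)"],
        unfold energy_data_def, intro conjI ballI)
      fix s assume "s \<in> {0..t}"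
      then have s: "s \<in> {0..\<tau>}" using t by auto
      have "((\<lambda>s. u s - v s) has_vector_derivative (A \<epsilon> s (u s) + F s (u s) + h s) - (A \<delta> s (v s) + F s (v s) + h s)) (at s within {0..\<tau>})"
        using u v s by (intro has_vector_derivative_diff) (auto simp: approx_sol_def)
      then have "((\<lambda>s. u s - v s) has_vector_derivative z1 s - z2 s + F s (u s - v s)) (at s within {0..\<tau>})"
        by (rule has_vector_derivative_eq_rhs) (simp add: z1_def z2_def blinfun.diff_right)
      then show "((\<lambda>s. u s - v s) has_vector_derivative z1 s - z2 s + F s (u s - v s)) (at s within {0..t})"
        by (rule has_vector_derivative_within_subset) (use t in auto)
      show "u s - v s = R s (z1 s - z2 s) + (\<delta> *\<^sub>R z2 s - \<epsilon> *\<^sub>R z1 s)"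
        unfolding z1_def z2_def blinfun.diff_right R_A[OF s \<epsilon>] R_A[OF s \<delta>] by simp
      have z: "norm (z1 s) \<le> K" "norm (z2 s) \<le> K" using K s by (auto simp: z1_def z2_def)
      have "Q s (z1 s - z2 s) \<bullet> (\<delta> *\<^sub>R z2 s - \<epsilon> *\<^sub>R z1 s) \<le> norm (Q s (z1 s - z2 s)) * norm (\<delta> *\<^sub>R z2 s - \<epsilon> *\<^sub>R z1 s)"
        by (rule norm_cauchy_schwarz)
      also have "\<dots> \<le> (KQ * (2 * K)) * ((\<epsilon> + \<delta>) * K)"
      proof (rule mult_mono)
        have "norm (z1 s - z2 s) \<le> 2 * K" using norm_triangle_ineq4[of "z1 s" "z2 s"] z by simp
        then show "norm (Q s (z1 s - z2 s)) \<le> KQ * (2 * K)"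
          using KQ by (intro order_trans[OF norm_blinfun_le[OF KQ(2)[OF s]]] mult_left_mono) auto
        have "norm (\<delta> *\<^sub>R z2 s - \<epsilon> *\<^sub>R z1 s) \<le> \<delta> * norm (z2 s) + \<epsilon> * norm (z1 s)"
          using norm_triangle_ineq4[of "\<delta> *\<^sub>R z2 s" "\<epsilon> *\<^sub>R z1 s"] \<epsilon> \<delta> by simp
        also have "\<dots> \<le> \<delta> * K + \<epsilon> * K" using \<epsilon> \<delta> z by (intro add_mono mult_left_mono) auto
        finally show "norm (\<delta> *\<^sub>R z2 s - \<epsilon> *\<^sub>R z1 s) \<le> (\<epsilon> + \<delta>) * K" by (simp add: algebra_simps)
      qed (use KQ \<open>K > 0\<close> in auto)
      also have "\<dots> = d\<^sup>2" by (simp add: d G_def)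
      finally show "Q s (z1 s - z2 s) \<bullet> (\<delta> *\<^sub>R z2 s - \<epsilon> *\<^sub>R z1 s) \<le> d\<^sup>2" .
      show "norm (F s (u s - v s)) \<le> M * norm (u s - v s) + d"
        using norm_blinfun_le[OF M(2)[OF s], of "u s - v s"] d by simp
    qed (use t d in auto)
    also have "\<dots> = C * (t * (G * (\<epsilon> + \<delta>)))" using init t d by simp
    also have "\<dots> \<le> C * ((1 + \<tau>) * (G * (\<epsilon> + \<delta>)))"
      using C(1) G \<epsilon> \<delta> t by (intro mult_left_mono mult_right_mono) auto
    finally show "(norm (u t - v t))\<^sup>2 \<le> C * (1 + \<tau>) * G * (\<epsilon> + \<delta>)" by (simp add: mult.assoc)
  qed
qed

text \<open>
  For \<open>f\<close> in the range of \<open>R 0\<close> and smooth \<open>h\<close> the two preceding lemmas apply. In general \<open>f\<close> and \<open>h\<close> are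
  approximated by such data, at a cost that the stability constant bounds independently of \<open>\<epsilon>\<close>.
\<close>

lemma approx_sol_converges:
  assumes F: "C1_on {0..\<tau>} F F'" and h: "continuous_on {0..\<tau>} h"
    and us: "\<And>n. approx_sol (eps n) F h (us n)" "\<And>n. us n 0 = f"
  obtains u where "uniform_limit {0..\<tau>} us u sequentially" "continuous_on {0..\<tau>} u"
proof -
  have Fc: "continuous_on {0..\<tau>} F" using F by (rule C1_onD)
  obtain C where C: "stability_constant F C" by (rule stability_constant_exists[OF Fc])
  have C0: "C > 0" using C by (simp add: stability_constant_def)
  have "uniformly_Cauchy_on {0..\<tau>} us"
  proof (rule uniformly_Cauchy_onI)
    fix e :: real assume e: "0 < e"
    define \<delta> where "\<delta> = e / 4 / sqrt (2 * C)"
    have \<delta>: "\<delta> > 0" "C * (\<delta>\<^sup>2 + \<delta>\<^sup>2) = (e / 4)\<^sup>2"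
      using e C0 by (auto simp: \<delta>_def power_divide)
    have "0 \<in> {0..\<tau>}" using \<tau> by simp
    from J_tendsto[OF this, of f] obtain n0 where "dist (J (eps n0) 0 f) f < \<delta>"
      using \<delta> by (auto simp: LIMSEQ_def)
    then obtain g0 where g0: "norm (f - R 0 g0) \<le> \<delta>"
      using R_A[OF \<open>0 \<in> {0..\<tau>}\<close> eps_pos, of n0 f] A_R[OF \<open>0 \<in> {0..\<tau>}\<close> eps_pos, of n0 f]
      by (metis dist_norm less_imp_le norm_minus_commute)
    obtain k k' where k: "C1_on {0..\<tau>} k k'" "\<And>t. t \<in> {0..\<tau>} \<Longrightarrow> norm (h t - k t) \<le> \<delta>"
      by (rule C1_approximation[OF h \<tau> \<delta>(1)]) blast
    have "\<exists>v. v 0 = R 0 g0 \<and> approx_sol (eps n) F k v" for n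
      by (rule approx_sol_exists[OF eps_pos Fc C1_onD(3)[OF k(1)]]) blast
    then obtain vs where vs: "\<And>n. vs n 0 = R 0 g0" "\<And>n. approx_sol (eps n) F k (vs n)" by metis
    obtain K where K: "K > 0" "\<And>\<epsilon> u t. \<epsilon> > 0 \<Longrightarrow> approx_sol \<epsilon> F k u \<Longrightarrow> u 0 = R 0 g0 \<Longrightarrow> t \<in> {0..\<tau>} \<Longrightarrow> norm (A \<epsilon> t (u t)) \<le> K"
      using generator_part_bound[OF F k(1)] by metis
    obtain C' where C': "C' > 0" "\<And>\<epsilon> \<delta> u v t. \<lbrakk>\<epsilon> > 0; \<delta> > 0; approx_sol \<epsilon> F k u; approx_sol \<delta> F k v; u 0 = v 0;
       \<forall>s\<in>{0..\<tau>}. norm (A \<epsilon> s (u s)) \<le> K \<and> norm (A \<delta> s (v s)) \<le> K; t \<in> {0..\<tau>}\<rbrakk>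
     \<Longrightarrow> (norm (u t - v t))\<^sup>2 \<le> C' * (\<epsilon> + \<delta>)"
      by (rule approx_sol_difference[OF Fc K(1), of k]) metis
    have "(\<lambda>n. C' * (2 * eps n)) \<longlonglongrightarrow> C' * (2 * 0)" by (intro tendsto_intros eps_tendsto)
    then have "\<forall>\<^sub>F n in sequentially. C' * (2 * eps n) < (e / 4)\<^sup>2"
      using e by (intro order_tendstoD(2)) auto
    then obtain m0 where m0: "\<And>n. n \<ge> m0 \<Longrightarrow> C' * (2 * eps n) < (e / 4)\<^sup>2"
      by (auto simp: eventually_sequentially)
    have le: "norm a \<le> e / 4" if "(norm a)\<^sup>2 \<le> (e / 4)\<^sup>2" for a :: 'a
      using that e by (meson divide_nonneg_pos less_imp_le power2_le_imp_le zero_less_numeral)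
    have uv: "norm (us n t - vs n t) \<le> e / 4" if "t \<in> {0..\<tau>}" for n t
    proof (rule le)
      have "(norm (us n t - vs n t))\<^sup>2 \<le> C * ((norm (us n 0 - vs n 0))\<^sup>2 + \<delta>\<^sup>2)"
        by (rule stability_constantD[OF C eps_pos us(1) vs(2) _ that]) (use k in auto)
      also have "\<dots> \<le> C * (\<delta>\<^sup>2 + \<delta>\<^sup>2)"
        using C0 g0 unfolding us vs by (intro mult_left_mono add_right_mono power_mono) auto
      finally show "(norm (us n t - vs n t))\<^sup>2 \<le> (e / 4)\<^sup>2" unfolding \<delta>(2) .
    qed
    have vv: "norm (vs m t - vs n t) \<le> e / 4" if t: "t \<in> {0..\<tau>}" and mn: "m \<ge> m0" "n \<ge> m0" for m n t
    proof (rule le)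
      have "(norm (vs m t - vs n t))\<^sup>2 \<le> C' * (eps m + eps n)"
        by (rule C'(2)[OF eps_pos eps_pos vs(2) vs(2) _ _ t]) (use K(2)[OF eps_pos vs(2) vs(1)] vs(1) in auto)
      also have "\<dots> \<le> (e / 4)\<^sup>2" using m0[OF mn(1)] m0[OF mn(2)] by (simp add: algebra_simps)
      finally show "(norm (vs m t - vs n t))\<^sup>2 \<le> (e / 4)\<^sup>2" .
    qed
    show "\<exists>M. \<forall>t\<in>{0..\<tau>}. \<forall>m\<ge>M. \<forall>n\<ge>M. dist (us m t) (us n t) < e"
    proof (intro exI ballI allI impI)
      fix t m n assume t: "t \<in> {0..\<tau>}" and mn: "m \<ge> m0" "n \<ge> m0"
      have "us m t - us n t = (us m t - vs m t) + (vs m t - vs n t) + (vs n t - us n t)" by simp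
      then have "norm (us m t - us n t) \<le> norm (us m t - vs m t) + norm (vs m t - vs n t) + norm (us n t - vs n t)"
        by (metis norm_minus_commute norm_triangle_le norm_triangle_ineq add_right_mono)
      also have "\<dots> \<le> e / 4 + e / 4 + e / 4" by (intro add_mono uv vv t mn)
      finally show "dist (us m t) (us n t) < e" using e by (simp add: dist_norm)
    qed
  qed
  then obtain u where u: "uniform_limit {0..\<tau>} us u sequentially"
    by (auto simp: uniformly_convergent_eq_Cauchy[symmetric] uniformly_convergent_on_def)
  moreover have "continuous_on {0..\<tau>} u"
    by (rule uniform_limit_theorem[OF _ u]) (auto intro!: always_eventually approx_sol_continuous us)
  ultimately show ?thesis by (rule that)
qed

end

section \<open>Strong solutions\<close>

lemma uniform_limit_blinfun_apply:
  fixes F :: "'t \<Rightarrow> 'a::real_normed_vector \<Rightarrow>\<^sub>L 'b::real_normed_vector"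
  assumes F: "\<And>t. t \<in> I \<Longrightarrow> norm (F t) \<le> K" and u: "uniform_limit I us u X"
  shows "uniform_limit I (\<lambda>n t. F t (us n t)) (\<lambda>t. F t (u t)) X"
  unfolding uniform_limit_iff
proof (intro allI impI)
  fix e :: real assume e: "e > 0"
  define c where "c = \<bar>K\<bar> + 1"
  have "e / c > 0" using e by (simp add: c_def)
  with u have "\<forall>\<^sub>F n in X. \<forall>t\<in>I. dist (us n t) (u t) < e / c" by (simp add: uniform_limit_iff)
  then show "\<forall>\<^sub>F n in X. \<forall>t\<in>I. dist (F t (us n t)) (F t (u t)) < e"
  proof eventually_elim
    case (elim n)
    show ?case
    proof
      fix t assume t: "t \<in> I"
      have "dist (F t (us n t)) (F t (u t)) = norm (F t (us n t - u t))"
        by (simp add: dist_norm blinfun.diff_right)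
      also have "\<dots> \<le> c * norm (us n t - u t)"
        by (rule norm_blinfun_le) (use F[OF t] in \<open>simp add: c_def\<close>)
      also have "\<dots> < c * (e / c)"
        using elim t by (intro mult_strict_left_mono) (auto simp: dist_norm c_def)
      also have "\<dots> = e" by (simp add: c_def)
      finally show "dist (F t (us n t)) (F t (u t)) < e" .
    qed
  qed
qed

text \<open>
  A solution of \<open>u' = (R t)\<^sup>-\<^sup>1 u + B t u\<close> that stays in the domain and whose generator part \<open>z\<close> is continuous.
\<close>

definition strong_sol ::
    "(real \<Rightarrow> 'a::real_normed_vector \<Rightarrow>\<^sub>L 'a) \<Rightarrow> (real \<Rightarrow> 'a \<Rightarrow>\<^sub>L 'a) \<Rightarrow> real \<Rightarrow> real \<Rightarrow> (real \<Rightarrow> 'a) \<Rightarrow> bool" where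
  "strong_sol R B a b u \<longleftrightarrow> (\<exists>z. continuous_on {a..b} z \<and>
     (\<forall>t\<in>{a..b}. u t = R t (z t) \<and> (u has_vector_derivative z t + B t (u t)) (at t within {a..b})))"

context skew_family
begin

text \<open>
  It has to be shown that \<open>z\<^sub>n = A u\<^sub>n\<close> converges uniformly. By \<open>approx_sol_generator_derivative\<close>,
  \<open>y\<^sub>n = z\<^sub>n + Z u\<^sub>n\<close> with \<open>Z = B + \<sigma>\<close> nearly solves \<open>y' = A y + P y + h\<close>, where
  \<open>P = \<sigma> - N + B\<close> and \<open>h = G u\<close> is already known because \<open>u\<close> is. The solutions \<open>x\<^sub>n\<close> of the approximating
  equations for this problem converge by \<open>approx_sol_converges\<close>. In the equation for \<open>e\<^sub>n = y\<^sub>n - x\<^sub>n\<close> the error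
  terms are \<open>J p - p\<close> for a fixed curve \<open>p\<close>, which tends to \<open>0\<close> in the mean square, and terms controlled by
  \<open>u\<^sub>n - u\<close> and by \<open>x\<^sub>n\<close> minus its limit. So \<open>e\<^sub>n \<longlonglongrightarrow> 0\<close> by the energy estimate, and \<open>y\<^sub>n\<close> and \<open>z\<^sub>n\<close> converge.
\<close>

lemma approx_limit_strong_sol:
  assumes us: "\<And>n. approx_sol (eps n) B (\<lambda>_. 0) (us n)" "\<And>n. us n 0 = R 0 g0"
    and u: "uniform_limit {0..\<tau>} us u sequentially"
  shows "strong_sol R B 0 \<tau> u"
proof -
  have z0: "0 \<in> {0..\<tau>}" using \<tau> by simp
  have uc: "continuous_on {0..\<tau>} u"
    by (rule uniform_limit_theorem[OF _ u]) (auto intro!: always_eventually approx_sol_continuous us)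
  define Z where "Z t = B t + \<sigma> t" for t
  define W where "W t = \<sigma> t - N t" for t
  define P where "P t = W t + B t" for t
  have PC1: "C1_on {0..\<tau>} P (\<lambda>t. (\<sigma>' t - N' t) + B' t)"
    unfolding C1_on_def P_def[abs_def] W_def
    by (intro conjI ballI has_vector_derivative_add has_vector_derivative_diff continuous_intros
        C1_onD(1)[OF \<sigma>] C1_onD(1)[OF N] C1_onD(1)[OF B] C1_onD(2)[OF \<sigma>] C1_onD(2)[OF N] C1_onD(2)[OF B])
  define G where "G t = (B' t + \<sigma>' t) + (Z t o\<^sub>L B t) - (P t o\<^sub>L Z t)" for t
  have Zc: "continuous_on {0..\<tau>} Z" and Wc: "continuous_on {0..\<tau>} W" and Pc: "continuous_on {0..\<tau>} P"
    unfolding Z_def P_def W_def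
    by (intro continuous_intros C1_onD(3)[OF \<sigma>] C1_onD(3)[OF N] C1_onD(3)[OF B])+
  have Gc: "continuous_on {0..\<tau>} G"
    unfolding G_def
    by (intro continuous_intros bounded_bilinear.continuous_on[OF bounded_bilinear_blinfun_compose]
        C1_onD(2)[OF \<sigma>] C1_onD(2)[OF B] C1_onD(3)[OF B] Zc Pc)
  obtain K where K: "K \<ge> 1" "\<And>t. t \<in> {0..\<tau>} \<Longrightarrow> norm (Q t) \<le> K" by (rule uniform_bound) blast
  obtain KZ where KZ: "KZ \<ge> 0" "\<And>t. t \<in> {0..\<tau>} \<Longrightarrow> norm (Z t) \<le> KZ" by (rule continuous_on_Icc_bound[OF Zc]) blast
  obtain KW where KW: "KW \<ge> 0" "\<And>t. t \<in> {0..\<tau>} \<Longrightarrow> norm (W t) \<le> KW" by (rule continuous_on_Icc_bound[OF Wc]) blast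
  obtain KG where KG: "KG \<ge> 0" "\<And>t. t \<in> {0..\<tau>} \<Longrightarrow> norm (G t) \<le> KG" by (rule continuous_on_Icc_bound[OF Gc]) blast
  obtain KB where KB: "KB \<ge> 0" "\<And>t. t \<in> {0..\<tau>} \<Longrightarrow> norm (B t) \<le> KB"
    by (rule continuous_on_Icc_bound[OF C1_onD(3)[OF B]]) blast
  define z where "z n t = A (eps n) t (us n t)" for n t
  define y where "y n t = z n t + Z t (us n t)" for n t
  define h where "h t = G t (u t)" for t
  have hc: "continuous_on {0..\<tau>} h"
    unfolding h_def by (intro bounded_bilinear.continuous_on[OF bounded_bilinear_blinfun_apply] Gc uc)
  define y0 where "y0 = g0 + Z 0 (R 0 g0)"
  have "\<exists>v. v 0 = y0 \<and> approx_sol (eps n) P h v" for n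
    by (rule approx_sol_exists[OF eps_pos Pc hc]) blast
  then obtain x where x: "\<And>n. x n 0 = y0" "\<And>n. approx_sol (eps n) P h (x n)" by metis
  obtain xl where xl: "uniform_limit {0..\<tau>} x xl sequentially" "continuous_on {0..\<tau>} xl"
    by (rule approx_sol_converges[OF PC1 hc x(2) x(1)])
  define zl where "zl t = xl t - Z t (u t)" for t
  have zlc: "continuous_on {0..\<tau>} zl"
    unfolding zl_def by (intro continuous_intros bounded_bilinear.continuous_on[OF bounded_bilinear_blinfun_apply] xl Zc uc)
  define p where "p t = W t (zl t)" for t
  have pc: "continuous_on {0..\<tau>} p"
    unfolding p_def by (intro bounded_bilinear.continuous_on[OF bounded_bilinear_blinfun_apply] Wc zlc)
  define e where "e n t = y n t - x n t" for n t
  define KJ where "KJ = K / q"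
  have KJ: "KJ \<ge> 0" using K q by (simp add: KJ_def)
  define M where "M = KJ * KW + KB"
  have M: "M \<ge> 0" using KJ KW KB by (simp add: M_def)
  obtain Ce where Ce: "Ce > 0" "\<And>a t u z r g d. energy_data M a t u z r g d
      \<Longrightarrow> (norm (u t))\<^sup>2 \<le> Ce * ((norm (u a))\<^sup>2 + integral {a..t} (\<lambda>s. (d s)\<^sup>2))"
    using energy_estimate[OF M] by blast
  define c where "c = (KJ + 1) * KW * (1 + KZ) + KG"
  have c: "c \<ge> 0" using KJ KW KZ KG by (simp add: c_def)
  define I where "I n = integral {0..\<tau>} (\<lambda>t. (norm (J (eps n) t (p t) - p t))\<^sup>2)" for n
  have I: "I \<longlonglongrightarrow> 0" unfolding I_def by (rule J_integral_tendsto[OF pc])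
  have e_bound: "(norm (e n t))\<^sup>2 \<le> Ce * ((norm (e n 0))\<^sup>2 + (2 * I n + 2 * \<tau> * (c * \<eta>)\<^sup>2))"
    if \<eta>: "\<And>t. t \<in> {0..\<tau>} \<Longrightarrow> norm (us n t - u t) \<le> \<eta>" "\<And>t. t \<in> {0..\<tau>} \<Longrightarrow> norm (x n t - xl t) \<le> \<eta>"
    and t: "t \<in> {0..\<tau>}" for n \<eta> t
  proof -
    have \<eta>0: "\<eta> \<ge> 0" using \<eta>(1)[OF t] norm_ge_zero order_trans by blast
    define d where "d s = norm (J (eps n) s (p s) - p s) + c * \<eta>" for s
    define g where "g s = J (eps n) s (W s (z n s)) + B s (z n s) + (B' s + \<sigma>' s) (us n s) + Z s (B s (us n s))
      - P s (x n s) - h s" for s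
    have dc: "continuous_on {0..\<tau>} d"
      unfolding d_def by (intro continuous_intros J_continuous eps_pos pc)
    have "(norm (e n t))\<^sup>2 \<le> Ce * ((norm (e n 0))\<^sup>2 + integral {0..t} (\<lambda>s. (d s)\<^sup>2))"
    proof (rule Ce(2)[of 0 t "e n" "\<lambda>s. A (eps n) s (e n s)" "\<lambda>s. - eps n *\<^sub>R A (eps n) s (e n s)" g],
        unfold energy_data_def, intro conjI ballI)
      show "continuous_on {0..t} d" by (rule continuous_on_subset[OF dc]) (use t in auto)
      fix s assume "s \<in> {0..t}"
      then have s: "s \<in> {0..\<tau>}" using t by auto
      have C10: "C1_on {0..\<tau>} (\<lambda>_. 0::'a) (\<lambda>_. 0)" by (simp add: C1_on_def)
      have "(y n has_vector_derivative A (eps n) s (y n s) + (J (eps n) s (W s (z n s)) + B s (z n s)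
          + (B' s + \<sigma>' s) (us n s) + Z s (B s (us n s)))) (at s within {0..\<tau>})"
        using approx_sol_generator_derivative[OF eps_pos B C10 us(1) s]
        by (simp add: y_def[abs_def] z_def W_def Z_def)
      moreover have "(x n has_vector_derivative A (eps n) s (x n s) + P s (x n s) + h s) (at s within {0..\<tau>})"
        using x(2)[of n] s by (simp add: approx_sol_def)
      ultimately have "(e n has_vector_derivative A (eps n) s (y n s) + (J (eps n) s (W s (z n s)) + B s (z n s)
          + (B' s + \<sigma>' s) (us n s) + Z s (B s (us n s))) - (A (eps n) s (x n s) + P s (x n s) + h s)) (at s within {0..\<tau>})"
        unfolding e_def[abs_def] by (rule has_vector_derivative_diff)
      then have "(e n has_vector_derivative A (eps n) s (e n s) + g s) (at s within {0..\<tau>})"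
        by (rule has_vector_derivative_eq_rhs) (simp add: e_def g_def blinfun.diff_right)
      then show "(e n has_vector_derivative A (eps n) s (e n s) + g s) (at s within {0..t})"
        by (rule has_vector_derivative_within_subset) (use t in auto)
      show "e n s = R s (A (eps n) s (e n s)) + - eps n *\<^sub>R A (eps n) s (e n s)" using R_A[OF s eps_pos] by simp
      have "0 \<le> Q s (A (eps n) s (e n s)) \<bullet> A (eps n) s (e n s)"
        using Q_coercive[OF s, of "A (eps n) s (e n s)"] q inner_ge_zero[of "A (eps n) s (e n s)"]
        by (meson order_trans less_imp_le mult_nonneg_nonneg)
      then show "Q s (A (eps n) s (e n s)) \<bullet> (- eps n *\<^sub>R A (eps n) s (e n s)) \<le> (d s)\<^sup>2"
        by (simp add: order_trans[of _ 0] less_imp_le)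
      show "0 \<le> d s" using c \<eta>0 by (simp add: d_def)
      have zs: "z n s = e n s + x n s - Z s (us n s)" by (simp add: e_def y_def)
      define b where "b = (x n s - xl s) - Z s (us n s - u s)"
      have zb: "z n s = e n s + (zl s + b)" by (simp add: zs b_def zl_def blinfun.diff_right)
      have b: "norm b \<le> (1 + KZ) * \<eta>"
      proof -
        have "norm (Z s (us n s - u s)) \<le> KZ * \<eta>"
          using KZ by (intro order_trans[OF norm_blinfun_le[OF KZ(2)[OF s]]] mult_left_mono \<eta> s)
        then have "norm b \<le> \<eta> + KZ * \<eta>"
          unfolding b_def by (intro order_trans[OF norm_triangle_ineq4] add_mono \<eta> s)
        then show ?thesis by (simp add: algebra_simps)
      qed
      \<comment> \<open>The summands in \<open>e\<close> are the linear part of the estimate; the others tend to \<open>0\<close>.\<close>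
      have gs: "g s = (J (eps n) s (W s (e n s)) + B s (e n s)) + (J (eps n) s (p s) - p s)
          + (J (eps n) s (W s b) - W s b) + G s (us n s - u s)"
      proof -
        have 1: "J (eps n) s (W s (z n s)) = J (eps n) s (W s (e n s)) + J (eps n) s (p s) + J (eps n) s (W s b)"
          by (simp add: zb p_def blinfun.add_right)
        have 2: "B s (z n s) = B s (e n s) + P s (zl s + b) - W s (zl s) - W s b"
          by (simp add: zb P_def blinfun.add_right blinfun.add_left)
        have 3: "zl s + b = x n s - Z s (us n s)" by (simp add: b_def zl_def blinfun.diff_right)
        show ?thesis
          unfolding g_def 1 2 3
          by (simp add: p_def h_def G_def blinfun.add_left blinfun.diff_left blinfun.diff_right)
      qed
      have "norm (g s) \<le> (KJ * (KW * norm (e n s)) + KB * norm (e n s)) + norm (J (eps n) s (p s) - p s)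
          + (KJ * (KW * ((1 + KZ) * \<eta>)) + KW * ((1 + KZ) * \<eta>)) + KG * \<eta>"
      proof -
        have tri: "norm ((v1 + v2) + v3 + v4 + v5) \<le> (a1 + a2) + norm v3 + a4 + a5"
          if "norm v1 \<le> a1" "norm v2 \<le> a2" "norm v4 \<le> a4" "norm v5 \<le> a5" for v1 v2 v3 v4 v5 :: 'a and a1 a2 a4 a5
          using that norm_triangle_ineq[of v1 v2] norm_triangle_ineq[of "v1 + v2" v3]
            norm_triangle_ineq[of "v1 + v2 + v3" v4] norm_triangle_ineq[of "v1 + v2 + v3 + v4" v5] by linarith
        have W: "norm (W s v) \<le> KW * norm v" for v by (rule norm_blinfun_le[OF KW(2)[OF s]])
        have Jb: "norm (J (eps n) s v) \<le> KJ * norm v" for v unfolding KJ_def by (rule J_bound[OF s eps_pos K(2)[OF s]])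
        have 1: "norm (J (eps n) s (W s (e n s))) \<le> KJ * (KW * norm (e n s))"
          using KJ by (intro order_trans[OF Jb] mult_left_mono W)
        have 2: "norm (B s (e n s)) \<le> KB * norm (e n s)" by (rule norm_blinfun_le[OF KB(2)[OF s]])
        have Wb: "norm (W s b) \<le> KW * ((1 + KZ) * \<eta>)" using KW by (intro order_trans[OF W] mult_left_mono b)
        have JWb: "norm (J (eps n) s (W s b)) \<le> KJ * (KW * ((1 + KZ) * \<eta>))"
          using KJ by (intro order_trans[OF Jb] mult_left_mono Wb)
        have 4: "norm (J (eps n) s (W s b) - W s b) \<le> KJ * (KW * ((1 + KZ) * \<eta>)) + KW * ((1 + KZ) * \<eta>)"
          by (intro order_trans[OF norm_triangle_ineq4] add_mono Wb JWb)
        have 5: "norm (G s (us n s - u s)) \<le> KG * \<eta>"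
          using KG by (intro order_trans[OF norm_blinfun_le[OF KG(2)[OF s]]] mult_left_mono \<eta> s)
        show ?thesis unfolding gs by (rule tri[OF 1 2 4 5])
      qed
      also have "\<dots> = M * norm (e n s) + d s" by (simp add: M_def d_def c_def algebra_simps)
      finally show "norm (g s) \<le> M * norm (e n s) + d s" .
    qed (use t in auto)
    also have "\<dots> \<le> Ce * ((norm (e n 0))\<^sup>2 + (2 * I n + 2 * \<tau> * (c * \<eta>)\<^sup>2))"
    proof -
      have i1: "(\<lambda>s. (d s)\<^sup>2) integrable_on {0..r}" if "r \<le> \<tau>" for r
        by (intro integrable_continuous_real continuous_intros continuous_on_subset[OF dc]) (use that in auto)
      have i2: "(\<lambda>s. (norm (J (eps n) s (p s) - p s))\<^sup>2) integrable_on {0..\<tau>}"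
        by (intro integrable_continuous_real continuous_intros J_continuous eps_pos pc)
      have "integral {0..t} (\<lambda>s. (d s)\<^sup>2) \<le> integral {0..\<tau>} (\<lambda>s. (d s)\<^sup>2)"
        using t by (intro integral_subset_le i1) auto
      also have "\<dots> \<le> integral {0..\<tau>} (\<lambda>s. 2 * (norm (J (eps n) s (p s) - p s))\<^sup>2 + 2 * (c * \<eta>)\<^sup>2)"
      proof (intro integral_le i1 order_refl)
        show "(\<lambda>s. 2 * (norm (J (eps n) s (p s) - p s))\<^sup>2 + 2 * (c * \<eta>)\<^sup>2) integrable_on {0..\<tau>}"
          by (intro integrable_continuous_real continuous_intros J_continuous eps_pos pc)
        show "(d s)\<^sup>2 \<le> 2 * (norm (J (eps n) s (p s) - p s))\<^sup>2 + 2 * (c * \<eta>)\<^sup>2" for s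
          using sum_squares_bound[of "norm (J (eps n) s (p s) - p s)" "c * \<eta>"]
          unfolding d_def power2_sum by linarith
      qed
      also have "\<dots> = 2 * I n + 2 * \<tau> * (c * \<eta>)\<^sup>2"
        using \<tau> by (subst integral_add) (auto simp: I_def intro!: integrable_on_cmult_left i2)
      finally show ?thesis using Ce(1) by simp
    qed
    finally show ?thesis .
  qed
  have e0: "(\<lambda>n. norm (e n 0)) \<longlonglongrightarrow> 0"
  proof -
    have "e n 0 = J (eps n) 0 g0 - g0" for n by (simp add: e_def y_def z_def us x y0_def)
    then show ?thesis using LIM_zero[OF J_tendsto[OF z0, of g0]] by (simp add: tendsto_norm_zero)
  qed
  have e_lim: "uniform_limit {0..\<tau>} e (\<lambda>_. 0) sequentially"
    unfolding uniform_limit_iff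
  proof (intro allI impI)
    fix \<epsilon> :: real assume \<epsilon>: "\<epsilon> > 0"
    define b where "b = Ce * (2 * \<tau> * c\<^sup>2)"
    have b: "b \<ge> 0" using Ce \<tau> by (simp add: b_def)
    \<comment> \<open>Chosen such that \<open>b \<eta>\<^sup>2 \<le> \<epsilon>\<^sup>2 / 2\<close>, also when \<open>b = 0\<close>.\<close>
    define \<eta> where "\<eta> = \<epsilon> / sqrt (2 * (b + 1))"
    have \<eta>: "\<eta> > 0" using \<epsilon> b by (simp add: \<eta>_def)
    have "b * \<eta>\<^sup>2 = \<epsilon>\<^sup>2 / 2 * (b / (b + 1))" using b by (simp add: \<eta>_def power_divide field_simps)
    also have "\<dots> \<le> \<epsilon>\<^sup>2 / 2 * 1" using b by (intro mult_left_mono) auto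
    finally have b\<eta>: "b * \<eta>\<^sup>2 \<le> \<epsilon>\<^sup>2 / 2" by simp
    have "(\<lambda>n. Ce * ((norm (e n 0))\<^sup>2 + 2 * I n)) \<longlonglongrightarrow> Ce * (0\<^sup>2 + 2 * 0)"
      by (intro tendsto_intros e0 I)
    then have "\<forall>\<^sub>F n in sequentially. Ce * ((norm (e n 0))\<^sup>2 + 2 * I n) < \<epsilon>\<^sup>2 / 2"
      using \<epsilon> by (intro order_tendstoD(2)) auto
    moreover have "\<forall>\<^sub>F n in sequentially. \<forall>t\<in>{0..\<tau>}. dist (us n t) (u t) < \<eta>"
      "\<forall>\<^sub>F n in sequentially. \<forall>t\<in>{0..\<tau>}. dist (x n t) (xl t) < \<eta>"
      using u xl(1) \<eta> by (auto simp: uniform_limit_iff)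
    ultimately show "\<forall>\<^sub>F n in sequentially. \<forall>t\<in>{0..\<tau>}. dist (e n t) 0 < \<epsilon>"
    proof eventually_elim
      case (elim n)
      show ?case
      proof
        fix t assume t: "t \<in> {0..\<tau>}"
        have "(norm (e n t))\<^sup>2 \<le> Ce * ((norm (e n 0))\<^sup>2 + (2 * I n + 2 * \<tau> * (c * \<eta>)\<^sup>2))"
          by (rule e_bound[OF _ _ t]) (use elim in \<open>auto simp: dist_norm less_imp_le\<close>)
        also have "\<dots> = Ce * ((norm (e n 0))\<^sup>2 + 2 * I n) + b * \<eta>\<^sup>2"
          by (simp add: b_def algebra_simps)
        also have "\<dots> < \<epsilon>\<^sup>2" using elim(1) b\<eta> by linarith
        finally show "dist (e n t) 0 < \<epsilon>" using \<epsilon> by (simp add: power_less_imp_less_base)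
      qed
    qed
  qed
  have z_lim: "uniform_limit {0..\<tau>} z zl sequentially"
  proof -
    have "uniform_limit {0..\<tau>} (\<lambda>n t. e n t + x n t - Z t (us n t)) (\<lambda>t. 0 + xl t - Z t (u t)) sequentially"
      by (intro uniform_limit_intros e_lim xl uniform_limit_blinfun_apply[OF KZ(2) u])
    then show ?thesis by (simp add: e_def y_def zl_def[abs_def])
  qed
  have z_ptw: "(\<lambda>n. z n t) \<longlonglongrightarrow> zl t" and u_ptw: "(\<lambda>n. us n t) \<longlonglongrightarrow> u t" if "t \<in> {0..\<tau>}" for t
    using tendsto_uniform_limitI[OF z_lim that] tendsto_uniform_limitI[OF u that] by auto
  show ?thesis
    unfolding strong_sol_def
  proof (intro exI[of _ zl] conjI ballI zlc)
    fix t assume t: "t \<in> {0..\<tau>}"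
    have "(\<lambda>n. R t (z n t) - eps n *\<^sub>R z n t) \<longlonglongrightarrow> R t (zl t) - 0 *\<^sub>R zl t"
      by (intro tendsto_intros z_ptw[OF t] eps_tendsto)
    moreover have "R t (z n t) - eps n *\<^sub>R z n t = us n t" for n
      unfolding z_def using R_A[OF t eps_pos] by simp
    ultimately show "u t = R t (zl t)" using LIMSEQ_unique[OF u_ptw[OF t]] by simp
    show "(u has_vector_derivative zl t + B t (u t)) (at t within {0..\<tau>})"
    proof (rule has_vector_derivative_uniform_limit[OF _ u_ptw _ t])
      show "(us n has_vector_derivative z n t + B t (us n t)) (at t within {0..\<tau>})" if "t \<in> {0..\<tau>}" for n t
        using us(1)[of n] that by (simp add: approx_sol_def z_def)
      show "uniform_limit {0..\<tau>} (\<lambda>n t. z n t + B t (us n t)) (\<lambda>t. zl t + B t (u t)) sequentially"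
        by (intro uniform_limit_intros z_lim uniform_limit_blinfun_apply[OF KB(2) u])
    qed
  qed
qed

lemma strong_sol_estimate:
  obtains C where "C > 0"
    "\<And>a t b u. 0 \<le> a \<Longrightarrow> a \<le> t \<Longrightarrow> t \<le> b \<Longrightarrow> b \<le> \<tau> \<Longrightarrow> strong_sol R B a b u \<Longrightarrow> norm (u t) \<le> C * norm (u a)"
proof -
  obtain M where M: "M \<ge> 0" "\<And>t. t \<in> {0..\<tau>} \<Longrightarrow> norm (B t) \<le> M"
    by (rule continuous_on_Icc_bound[OF C1_onD(3)[OF B]]) blast
  obtain C where C: "C > 0" "\<And>a t u z r g d. energy_data M a t u z r g d
      \<Longrightarrow> (norm (u t))\<^sup>2 \<le> C * ((norm (u a))\<^sup>2 + integral {a..t} (\<lambda>s. (d s)\<^sup>2))"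
    using energy_estimate[OF M(1)] by blast
  show ?thesis
  proof (rule that[of "sqrt C"])
    show "sqrt C > 0" using C by simp
    fix a t b u assume atb: "0 \<le> a" "a \<le> t" "t \<le> b" "b \<le> \<tau>" and "strong_sol R B a b u"
    then obtain z where z: "\<And>s. s \<in> {a..b} \<Longrightarrow> u s = R s (z s)"
      "\<And>s. s \<in> {a..b} \<Longrightarrow> (u has_vector_derivative z s + B s (u s)) (at s within {a..b})"
      unfolding strong_sol_def by blast
    have "(norm (u t))\<^sup>2 \<le> C * ((norm (u a))\<^sup>2 + integral {a..t} (\<lambda>s. 0\<^sup>2))"
    proof (rule C(2)[of a t u z "\<lambda>_. 0" "\<lambda>s. B s (u s)"], unfold energy_data_def, intro conjI ballI)
      fix s assume s: "s \<in> {a..t}"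
      then have s': "s \<in> {a..b}" "s \<in> {0..\<tau>}" using atb by auto
      show "(u has_vector_derivative z s + B s (u s)) (at s within {a..t})"
        by (rule has_vector_derivative_within_subset[OF z(2)[OF s'(1)]]) (use atb in auto)
      show "u s = R s (z s) + 0" using z(1)[OF s'(1)] by simp
      show "norm (B s (u s)) \<le> M * norm (u s) + 0" using norm_blinfun_le[OF M(2)[OF s'(2)]] by simp
    qed (use atb in auto)
    then have "norm (u t) \<le> sqrt (C * (norm (u a))\<^sup>2)" by (intro real_le_rsqrt) simp
    then show "norm (u t) \<le> sqrt C * norm (u a)" by (simp add: real_sqrt_mult)
  qed
qed

lemma strong_sol_diff:
  assumes u: "strong_sol R B a b u" and v: "strong_sol R B a b v"
  shows "strong_sol R B a b (\<lambda>t. u t - v t)"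
proof -
  obtain z where z: "continuous_on {a..b} z" "\<And>s. s \<in> {a..b} \<Longrightarrow> u s = R s (z s)"
      "\<And>s. s \<in> {a..b} \<Longrightarrow> (u has_vector_derivative z s + B s (u s)) (at s within {a..b})"
    using u unfolding strong_sol_def by blast
  obtain w where w: "continuous_on {a..b} w" "\<And>s. s \<in> {a..b} \<Longrightarrow> v s = R s (w s)"
      "\<And>s. s \<in> {a..b} \<Longrightarrow> (v has_vector_derivative w s + B s (v s)) (at s within {a..b})"
    using v unfolding strong_sol_def by blast
  show "strong_sol R B a b (\<lambda>t. u t - v t)"
    unfolding strong_sol_def
  proof (intro exI[of _ "\<lambda>t. z t - w t"] conjI ballI)
    show "continuous_on {a..b} (\<lambda>t. z t - w t)" by (intro continuous_intros z w)
    fix t assume t: "t \<in> {a..b}"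
    show "u t - v t = R t (z t - w t)" using z(2)[OF t] w(2)[OF t] by (simp add: blinfun.diff_right)
    show "((\<lambda>t. u t - v t) has_vector_derivative z t - w t + B t (u t - v t)) (at t within {a..b})"
      by (rule has_vector_derivative_eq_rhs[OF has_vector_derivative_diff[OF z(3)[OF t] w(3)[OF t]]])
         (simp add: blinfun.diff_right)
  qed
qed

lemma strong_sol_unique:
  assumes "0 \<le> a" "b \<le> \<tau>" "strong_sol R B a b u" "strong_sol R B a b v" "u a = v a" "t \<in> {a..b}"
  shows "u t = v t"
proof -
  obtain C where C: "\<And>a t b u. 0 \<le> a \<Longrightarrow> a \<le> t \<Longrightarrow> t \<le> b \<Longrightarrow> b \<le> \<tau> \<Longrightarrow> strong_sol R B a b u \<Longrightarrow> norm (u t) \<le> C * norm (u a)"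
    using strong_sol_estimate by metis
  from C[OF assms(1) _ _ assms(2) strong_sol_diff[OF assms(3,4)], of t] assms(5,6) show ?thesis by simp
qed

lemma range_R_dense:
  assumes "t \<in> {0..\<tau>}" "e > 0"
  obtains g where "norm (f - R t g) < e"
proof -
  from J_tendsto[OF assms(1), of f] obtain n where "dist (J (eps n) t f) f < e"
    using assms(2) by (auto simp: LIMSEQ_def)
  moreover have "J (eps n) t f = R t (A (eps n) t f)" using R_A A_R assms(1) by simp
  ultimately show ?thesis by (intro that[of "A (eps n) t f"]) (simp add: dist_norm norm_minus_commute)
qed

text \<open>
  The approximate solutions exist and converge for every initial value. Linearity and the bound are inherited
  from the approximating equations, and the limit is strong for initial values in the domain.
\<close>

lemma propagator_exists:
  obtains \<Phi> :: "real \<Rightarrow> 'a \<Rightarrow>\<^sub>L 'a" where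
    "\<And>f. continuous_on {0..\<tau>} (\<lambda>t. \<Phi> t f)" "\<And>f. \<Phi> 0 f = f" "\<And>g. strong_sol R B 0 \<tau> (\<lambda>t. \<Phi> t (R 0 g))"
proof -
  have z0: "0 \<in> {0..\<tau>}" using \<tau> by simp
  have Bc: "continuous_on {0..\<tau>} B" by (rule C1_onD[OF B])
  define h :: "real \<Rightarrow> 'a" where "h = (\<lambda>_. 0)"
  have hc: "continuous_on {0..\<tau>} h" by (simp add: h_def)
  have "\<exists>v. v 0 = f \<and> approx_sol (eps n) B h v" for n f
    by (rule approx_sol_exists[OF eps_pos Bc hc]) blast
  note ex = this
  define s where "s n f = (SOME v. v 0 = f \<and> approx_sol (eps n) B h v)" for n f
  have s: "s n f 0 = f" "approx_sol (eps n) B h (s n f)" for n f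
    using someI_ex[OF ex[of f n]] by (auto simp: s_def)
  have "\<exists>u. uniform_limit {0..\<tau>} (\<lambda>n. s n f) u sequentially \<and> continuous_on {0..\<tau>} u" for f
    by (rule approx_sol_converges[OF B hc s(2) s(1)]) blast
  then obtain S where S: "\<And>f. uniform_limit {0..\<tau>} (\<lambda>n. s n f) (S f) sequentially"
    "\<And>f. continuous_on {0..\<tau>} (S f)" by metis
  have ptw: "(\<lambda>n. s n f t) \<longlonglongrightarrow> S f t" if "t \<in> {0..\<tau>}" for f t
    by (rule tendsto_uniform_limitI[OF S(1) that])
  obtain C where C: "stability_constant B C" by (rule stability_constant_exists[OF Bc])
  have C0: "C > 0" using C by (simp add: stability_constant_def)
  have bl: "bounded_linear (\<lambda>f. S f t)" if t: "t \<in> {0..\<tau>}" for t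
  proof (rule bounded_linear_intro[where K = "sqrt C"])
    fix f g :: 'a and r :: real
    have "s n (f + g) t = s n f t + s n g t" for n
    proof (rule approx_sol_unique[OF Bc eps_pos s(2) _ _ t])
      show "approx_sol (eps n) B h (\<lambda>t. s n f t + s n g t)"
        unfolding approx_sol_def
      proof
        fix r assume "r \<in> {0..\<tau>}"
        then have "((\<lambda>t. s n f t + s n g t) has_vector_derivative (A (eps n) r (s n f r) + B r (s n f r) + h r)
          + (A (eps n) r (s n g r) + B r (s n g r) + h r)) (at r within {0..\<tau>})"
          using s(2) by (intro has_vector_derivative_add) (auto simp: approx_sol_def)
        then show "((\<lambda>t. s n f t + s n g t) has_vector_derivative A (eps n) r (s n f r + s n g r) + B r (s n f r + s n g r) + h r) (at r within {0..\<tau>})"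
          by (rule has_vector_derivative_eq_rhs) (simp add: blinfun.add_right h_def)
      qed
    qed (simp add: s)
    then have "(\<lambda>n. s n (f + g) t) \<longlonglongrightarrow> S f t + S g t" using tendsto_add[OF ptw[OF t, of f] ptw[OF t, of g]] by simp
    then show "S (f + g) t = S f t + S g t" using LIMSEQ_unique ptw[OF t] by blast
    have "s n (r *\<^sub>R f) t = r *\<^sub>R s n f t" for n
    proof (rule approx_sol_unique[OF Bc eps_pos s(2) _ _ t])
      show "approx_sol (eps n) B h (\<lambda>t. r *\<^sub>R s n f t)"
        unfolding approx_sol_def
      proof
        fix x assume "x \<in> {0..\<tau>}"
        then have "((\<lambda>t. r *\<^sub>R s n f t) has_vector_derivative r *\<^sub>R (A (eps n) x (s n f x) + B x (s n f x) + h x)) (at x within {0..\<tau>})"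
          using s(2) by (intro bounded_linear.has_vector_derivative[OF bounded_linear_scaleR_right]) (auto simp: approx_sol_def)
        then show "((\<lambda>t. r *\<^sub>R s n f t) has_vector_derivative A (eps n) x (r *\<^sub>R s n f x) + B x (r *\<^sub>R s n f x) + h x) (at x within {0..\<tau>})"
          by (rule has_vector_derivative_eq_rhs) (simp add: blinfun.scaleR_right scaleR_add_right h_def)
      qed
    qed (simp add: s)
    then have "(\<lambda>n. s n (r *\<^sub>R f) t) \<longlonglongrightarrow> r *\<^sub>R S f t" using tendsto_scaleR[OF tendsto_const ptw[OF t, of f]] by simp
    then show "S (r *\<^sub>R f) t = r *\<^sub>R S f t" using LIMSEQ_unique ptw[OF t] by blast
    have zs: "approx_sol (eps n) B h (\<lambda>_. 0)" for n by (simp add: approx_sol_def h_def blinfun.zero_right)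
    have "norm (s n f t) \<le> norm f * sqrt C" for n
    proof -
      have "(norm (s n f t - 0))\<^sup>2 \<le> C * ((norm (s n f 0 - 0))\<^sup>2 + 0\<^sup>2)"
        by (rule stability_constantD[OF C eps_pos s(2) zs _ t]) simp
      then have "norm (s n f t) \<le> sqrt (C * (norm f)\<^sup>2)" by (intro real_le_rsqrt) (simp add: s)
      then show ?thesis by (simp add: real_sqrt_mult mult.commute)
    qed
    then show "norm (S f t) \<le> norm f * sqrt C"
      by (intro LIMSEQ_le_const2[OF tendsto_norm[OF ptw[OF t]]]) auto
  qed
  define \<Phi> where "\<Phi> t = Blinfun (\<lambda>f. S f t)" for t
  have \<Phi>: "\<Phi> t f = S f t" if "t \<in> {0..\<tau>}" for t f
    by (simp add: \<Phi>_def bounded_linear_Blinfun_apply[OF bl[OF that]])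
  show ?thesis
  proof (rule that[of \<Phi>])
    show "continuous_on {0..\<tau>} (\<lambda>t. \<Phi> t f)" for f
      by (rule continuous_on_eq[OF S(2)[of f]]) (simp add: \<Phi>)
    show "\<Phi> 0 f = f" for f
      using ptw[OF z0, of f] \<Phi>[OF z0] by (simp add: s LIMSEQ_const_iff)
    fix g
    have "strong_sol R B 0 \<tau> (S (R 0 g))"
      by (rule approx_limit_strong_sol[OF s(2)[unfolded h_def] s(1) S(1)])
    then obtain z where z: "continuous_on {0..\<tau>} z" "\<And>t. t \<in> {0..\<tau>} \<Longrightarrow> S (R 0 g) t = R t (z t)"
      "\<And>t. t \<in> {0..\<tau>} \<Longrightarrow> (S (R 0 g) has_vector_derivative z t + B t (S (R 0 g) t)) (at t within {0..\<tau>})"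
      unfolding strong_sol_def by blast
    show "strong_sol R B 0 \<tau> (\<lambda>t. \<Phi> t (R 0 g))"
      unfolding strong_sol_def
    proof (intro exI[of _ z] conjI ballI z(1))
      fix t assume t: "t \<in> {0..\<tau>}"
      show "\<Phi> t (R 0 g) = R t (z t)" using z(2)[OF t] \<Phi>[OF t] by simp
      show "((\<lambda>t. \<Phi> t (R 0 g)) has_vector_derivative z t + B t (\<Phi> t (R 0 g))) (at t within {0..\<tau>})"
        unfolding \<Phi>[OF t]
        by (rule has_vector_derivative_transform[OF t _ z(3)[OF t]]) (simp add: \<Phi>)
    qed
  qed
qed

end

section \<open>Reversal of time\<close>

lemma has_vector_derivative_reverse:
  fixes f :: "real \<Rightarrow> 'b::real_normed_vector"
  assumes "(f has_vector_derivative f') (at (\<tau> - r) within {a..b})" "r \<in> {\<tau> - b..\<tau> - a}"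
  shows "((\<lambda>r. f (\<tau> - r)) has_vector_derivative - f') (at r within {\<tau> - b..\<tau> - a})"
proof -
  have "(\<lambda>r. \<tau> - r) ` {\<tau> - b..\<tau> - a} \<subseteq> {a..b}" by auto
  with assms(1) have "(f has_vector_derivative f') (at (\<tau> - r) within (\<lambda>r. \<tau> - r) ` {\<tau> - b..\<tau> - a})"
    by (rule has_vector_derivative_within_subset)
  moreover have "((\<lambda>r. \<tau> - r) has_vector_derivative - 1) (at r within {\<tau> - b..\<tau> - a})"
    by (auto intro!: derivative_eq_intros)
  ultimately have "((f \<circ> (\<lambda>r. \<tau> - r)) has_vector_derivative (- 1) *\<^sub>R f') (at r within {\<tau> - b..\<tau> - a})"
    by (intro vector_diff_chain_within)
  then show ?thesis by (simp add: o_def)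
qed

lemma C1_on_reverse:
  fixes F :: "real \<Rightarrow> 'b::real_normed_vector"
  assumes "C1_on {0..} F F'" "0 \<le> \<tau>"
  shows "C1_on {0..\<tau>} (\<lambda>r. F (\<tau> - r)) (\<lambda>r. - F' (\<tau> - r))"
  unfolding C1_on_def
proof (intro conjI ballI)
  have F: "C1_on {0..\<tau>} F F'" by (rule C1_on_subset[OF assms(1)]) auto
  show "((\<lambda>r. F (\<tau> - r)) has_vector_derivative - F' (\<tau> - t)) (at t within {0..\<tau>})" if "t \<in> {0..\<tau>}" for t
    using has_vector_derivative_reverse[OF C1_onD(1)[OF F, of "\<tau> - t"]] that by simp
  show "continuous_on {0..\<tau>} (\<lambda>r. - F' (\<tau> - r))"
    by (intro continuous_intros continuous_on_compose2[OF C1_onD(2)[OF F]]) auto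
qed

lemma C1_on_uminus_reverse:
  fixes F :: "real \<Rightarrow> 'b::real_normed_vector"
  assumes "C1_on {0..} F F'" "0 \<le> \<tau>"
  shows "C1_on {0..\<tau>} (\<lambda>r. - F (\<tau> - r)) (\<lambda>r. F' (\<tau> - r))"
  using C1_on_uminus[OF C1_on_reverse[OF assms]] by simp

lemma strong_sol_subinterval:
  assumes "strong_sol R B a b u" "a \<le> c" "d \<le> b"
  shows "strong_sol R B c d u"
proof -
  have sub: "{c..d} \<subseteq> {a..b}" using assms(2,3) by auto
  obtain z where z: "continuous_on {a..b} z" "\<And>s. s \<in> {a..b} \<Longrightarrow> u s = R s (z s)"
      "\<And>s. s \<in> {a..b} \<Longrightarrow> (u has_vector_derivative z s + B s (u s)) (at s within {a..b})"
    using assms(1) unfolding strong_sol_def by blast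
  show ?thesis
    unfolding strong_sol_def
    by (intro exI[of _ z] conjI ballI continuous_on_subset[OF z(1) sub] z(2)
        has_vector_derivative_within_subset[OF z(3) sub]) (use sub in auto)
qed

lemma strong_sol_reverse:
  assumes "strong_sol R B a b u"
  shows "strong_sol (\<lambda>r. - R (\<tau> - r)) (\<lambda>r. - B (\<tau> - r)) (\<tau> - b) (\<tau> - a) (\<lambda>r. u (\<tau> - r))"
proof -
  obtain z where z: "continuous_on {a..b} z" "\<And>s. s \<in> {a..b} \<Longrightarrow> u s = R s (z s)"
      "\<And>s. s \<in> {a..b} \<Longrightarrow> (u has_vector_derivative z s + B s (u s)) (at s within {a..b})"
    using assms unfolding strong_sol_def by blast
  show ?thesis
    unfolding strong_sol_def
  proof (intro exI[of _ "\<lambda>r. - z (\<tau> - r)"] conjI ballI)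
    show "continuous_on {\<tau> - b..\<tau> - a} (\<lambda>r. - z (\<tau> - r))"
      by (intro continuous_intros continuous_on_compose2[OF z(1)]) auto
    fix r assume r: "r \<in> {\<tau> - b..\<tau> - a}"
    then have r': "\<tau> - r \<in> {a..b}" by auto
    show "u (\<tau> - r) = (- R (\<tau> - r)) (- z (\<tau> - r))"
      using z(2)[OF r'] by (simp add: blinfun.minus_left blinfun.minus_right)
    show "((\<lambda>r. u (\<tau> - r)) has_vector_derivative - z (\<tau> - r) + (- B (\<tau> - r)) (u (\<tau> - r))) (at r within {\<tau> - b..\<tau> - a})"
      by (rule has_vector_derivative_eq_rhs[OF has_vector_derivative_reverse[OF z(3)[OF r'] r]])
         (simp add: blinfun.minus_left)
  qed
qed

lemma blinfun_eq_on_dense: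
  fixes F G :: "'a::real_normed_vector \<Rightarrow>\<^sub>L 'b::real_normed_vector"
  assumes dense: "\<And>f e. e > 0 \<Longrightarrow> \<exists>g. norm (f - r g) < e" and eq: "\<And>g. F (r g) = G (r g)"
  shows "F = G"
proof (rule blinfun_eqI, rule ccontr)
  fix f assume ne: "F f \<noteq> G f"
  define H where "H = F - G"
  have H: "norm (H f) > 0" "H (r g) = 0" for g using ne eq by (auto simp: H_def blinfun.diff_left)
  then have "H \<noteq> 0" by auto
  then have "norm H > 0" by simp
  then obtain g where g: "norm (f - r g) < norm (H f) / norm H" using dense H(1) by (meson divide_pos_pos)
  have "norm (H f) = norm (H (f - r g))" by (simp add: blinfun.diff_right H)
  also have "\<dots> \<le> norm H * norm (f - r g)" by (rule norm_blinfun)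
  also have "\<dots> < norm H * (norm (H f) / norm H)" using g \<open>norm H > 0\<close> by (intro mult_strict_left_mono)
  also have "\<dots> = norm (H f)" using \<open>norm H > 0\<close> by simp
  finally show False by simp
qed

section \<open>The evolution family on the half line\<close>

locale skew_evolution =
  fixes q :: real and Q Q' R R' N N' \<sigma> \<sigma>' B B' :: "real \<Rightarrow> 'a::{real_inner,banach} \<Rightarrow>\<^sub>L 'a"
  assumes q: "0 < q"
    and Q: "C1_on {0..} Q Q'" and R: "C1_on {0..} R R'" and N: "C1_on {0..} N N'"
    and \<sigma>: "C1_on {0..} \<sigma> \<sigma>'" and B: "C1_on {0..} B B'"
    and Q_sym: "t \<ge> 0 \<Longrightarrow> Q t x \<bullet> y = x \<bullet> Q t y"
    and Q_coercive: "t \<ge> 0 \<Longrightarrow> q * (x \<bullet> x) \<le> Q t x \<bullet> x"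
    and skew: "t \<ge> 0 \<Longrightarrow> Q t (R t x) \<bullet> x = 0"
    and R_inj: "t \<ge> 0 \<Longrightarrow> R t x = 0 \<Longrightarrow> x = 0"
    and R'_eq: "t \<ge> 0 \<Longrightarrow> R' t = (R t o\<^sub>L N t) - (\<sigma> t o\<^sub>L R t)"
begin

lemma forward:
  assumes "\<tau> \<ge> 0"
  shows "skew_family \<tau> q Q Q' R R' N N' \<sigma> \<sigma>' B B'"
proof -
  have sub: "{0..\<tau>} \<subseteq> {0..}" by auto
  show ?thesis
  proof (rule skew_family.intro)
    fix t x assume t: "t \<in> {0..\<tau>}"
    then have t': "t \<ge> 0" by simp
    show "Q t x \<bullet> y = x \<bullet> Q t y" for y by (rule Q_sym[OF t'])
    show "q * (x \<bullet> x) \<le> Q t x \<bullet> x" by (rule Q_coercive[OF t'])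
    show "Q t (R t x) \<bullet> x = 0" by (rule skew[OF t'])
    show "R t x = 0 \<Longrightarrow> x = 0" by (rule R_inj[OF t'])
    show "R' t = (R t o\<^sub>L N t) - (\<sigma> t o\<^sub>L R t)" by (rule R'_eq[OF t'])
  qed (use assms q C1_on_subset[OF Q sub] C1_on_subset[OF R sub] C1_on_subset[OF N sub]
            C1_on_subset[OF \<sigma> sub] C1_on_subset[OF B sub] in auto)
qed

text \<open>
  Under \<open>t \<mapsto> \<tau> - t\<close> all of \<open>R\<close>, \<open>N\<close>, \<open>\<sigma>\<close> and \<open>B\<close> change sign, and the relation \<open>R' = R N - \<sigma> R\<close>
  survives because its left-hand side changes sign twice.
\<close>

lemma backward:
  assumes "\<tau> \<ge> 0"
  shows "skew_family \<tau> q (\<lambda>r. Q (\<tau> - r)) (\<lambda>r. - Q' (\<tau> - r)) (\<lambda>r. - R (\<tau> - r)) (\<lambda>r. R' (\<tau> - r))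
    (\<lambda>r. - N (\<tau> - r)) (\<lambda>r. N' (\<tau> - r)) (\<lambda>r. - \<sigma> (\<tau> - r)) (\<lambda>r. \<sigma>' (\<tau> - r))
    (\<lambda>r. - B (\<tau> - r)) (\<lambda>r. B' (\<tau> - r))"
proof (unfold_locales)
  fix t x y assume t: "t \<in> {0..\<tau>}"
  then have t': "\<tau> - t \<ge> 0" by simp
  show "Q (\<tau> - t) x \<bullet> y = x \<bullet> Q (\<tau> - t) y" by (rule Q_sym[OF t'])
  show "q * (x \<bullet> x) \<le> Q (\<tau> - t) x \<bullet> x" by (rule Q_coercive[OF t'])
  show "Q (\<tau> - t) ((- R (\<tau> - t)) x) \<bullet> x = 0"
    using skew[OF t', of x] by (simp add: blinfun.minus_left blinfun.minus_right)
  show "(- R (\<tau> - t)) x = 0 \<Longrightarrow> x = 0" using R_inj[OF t', of x] by (simp add: blinfun.minus_left)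
  show "R' (\<tau> - t) = (- R (\<tau> - t) o\<^sub>L - N (\<tau> - t)) - (- \<sigma> (\<tau> - t) o\<^sub>L - R (\<tau> - t))"
    unfolding R'_eq[OF t'] by (intro blinfun_eqI) (simp add: blinfun.bilinear_simps)
qed (use assms q in \<open>auto intro!: C1_on_uminus_reverse C1_on_reverse Q R N \<sigma> B\<close>)

lemma range_dense: "t \<ge> 0 \<Longrightarrow> e > 0 \<Longrightarrow> \<exists>g. norm (f - R t g) < e"
  using skew_family.range_R_dense[OF forward[of t], of t e f] by auto

lemma strong_sol_eq:
  assumes "0 \<le> a" "strong_sol R B a b u" "strong_sol R B a b v" "u a = v a" "t \<in> {a..b}"
  shows "u t = v t"
  using skew_family.strong_sol_unique[OF forward[of b] assms(1) order_refl assms(2-5)] assms(1,5) by auto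

text \<open>
  The propagators on the intervals \<open>{0..\<tau>}\<close> agree on the dense range of \<open>R 0\<close> by uniqueness, hence everywhere, and
  can be glued together.
\<close>

lemma forward_propagator:
  obtains \<Phi> :: "real \<Rightarrow> 'a \<Rightarrow>\<^sub>L 'a" where
    "\<And>f. continuous_on {0..} (\<lambda>t. \<Phi> t f)" "\<And>f. \<Phi> 0 f = f" "\<And>\<tau> g. \<tau> \<ge> 0 \<Longrightarrow> strong_sol R B 0 \<tau> (\<lambda>t. \<Phi> t (R 0 g))"
proof -
  have ex: "\<exists>\<Phi> :: real \<Rightarrow> 'a \<Rightarrow>\<^sub>L 'a. (\<forall>f. continuous_on {0..\<tau>} (\<lambda>t. \<Phi> t f)) \<and> (\<forall>f. \<Phi> 0 f = f) \<and>
      (\<forall>g. strong_sol R B 0 \<tau> (\<lambda>t. \<Phi> t (R 0 g)))" if "\<tau> \<ge> 0" for \<tau>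
    by (rule skew_family.propagator_exists[OF forward[OF that]]) blast
  define \<Xi> where "\<Xi> \<tau> = (SOME \<Phi> :: real \<Rightarrow> 'a \<Rightarrow>\<^sub>L 'a. (\<forall>f. continuous_on {0..\<tau>} (\<lambda>t. \<Phi> t f)) \<and> (\<forall>f. \<Phi> 0 f = f) \<and>
      (\<forall>g. strong_sol R B 0 \<tau> (\<lambda>t. \<Phi> t (R 0 g))))" for \<tau>
  have \<Xi>: "continuous_on {0..\<tau>} (\<lambda>t. \<Xi> \<tau> t f)" "\<Xi> \<tau> 0 f = f" "strong_sol R B 0 \<tau> (\<lambda>t. \<Xi> \<tau> t (R 0 g))"
    if "\<tau> \<ge> 0" for \<tau> f g
    using someI_ex[OF ex[OF that]] unfolding \<Xi>_def by blast+
  define \<Phi> where "\<Phi> t = \<Xi> t t" for t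
  have agree: "\<Xi> \<tau> t = \<Phi> t" if t: "0 \<le> t" "t \<le> \<tau>" for \<tau> t
    unfolding \<Phi>_def
  proof (rule blinfun_eq_on_dense[of "R 0"])
    show "\<exists>g. norm (f - R 0 g) < e" if "e > 0" for f e by (rule range_dense[OF order_refl that])
    show "\<Xi> \<tau> t (R 0 g) = \<Xi> t t (R 0 g)" for g
      by (rule strong_sol_eq[of 0 t "\<lambda>t. \<Xi> \<tau> t (R 0 g)" "\<lambda>s. \<Xi> t s (R 0 g)"])
         (use t in \<open>auto intro!: \<Xi> strong_sol_subinterval[OF \<Xi>(3), of \<tau>] simp: \<Xi>(2)\<close>)
  qed
  show ?thesis
  proof (rule that[of \<Phi>])
    show "\<Phi> 0 f = f" for f using \<Xi>(2)[of 0] by (simp add: \<Phi>_def)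
    show "continuous_on {0..} (\<lambda>t. \<Phi> t f)" for f
      unfolding continuous_on_eq_continuous_within
    proof
      fix t :: real assume t: "t \<in> {0..}"
      have "continuous_on {0..t + 1} (\<lambda>s. \<Phi> s f)"
        by (rule continuous_on_eq[OF \<Xi>(1)[of "t + 1"]]) (use t in \<open>auto simp: agree\<close>)
      then have "continuous (at t within {0..t + 1}) (\<lambda>s. \<Phi> s f)"
        using t by (simp add: continuous_on_eq_continuous_within)
      moreover have "at t within {0..t + 1} = at t within {0..}"
        by (rule at_within_nhd[of t "{..<t + 1}"]) auto
      ultimately show "continuous (at t within {0..}) (\<lambda>s. \<Phi> s f)" by simp
    qed
    fix \<tau> :: real and g assume \<tau>: "\<tau> \<ge> 0"
    obtain z where z: "continuous_on {0..\<tau>} z" "\<And>s. s \<in> {0..\<tau>} \<Longrightarrow> \<Xi> \<tau> s (R 0 g) = R s (z s)"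
        "\<And>s. s \<in> {0..\<tau>} \<Longrightarrow> ((\<lambda>s. \<Xi> \<tau> s (R 0 g)) has_vector_derivative z s + B s (\<Xi> \<tau> s (R 0 g))) (at s within {0..\<tau>})"
      using \<Xi>(3)[OF \<tau>, of g] unfolding strong_sol_def by blast
    show "strong_sol R B 0 \<tau> (\<lambda>t. \<Phi> t (R 0 g))"
      unfolding strong_sol_def
    proof (intro exI[of _ z] conjI ballI z(1))
      fix t assume t: "t \<in> {0..\<tau>}"
      then have a: "\<Xi> \<tau> t = \<Phi> t" by (simp add: agree)
      show "\<Phi> t (R 0 g) = R t (z t)" using z(2)[OF t] by (simp add: a)
      show "((\<lambda>t. \<Phi> t (R 0 g)) has_vector_derivative z t + B t (\<Phi> t (R 0 g))) (at t within {0..\<tau>})"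
        using z(3)[OF t] unfolding a
        by (rule has_vector_derivative_transform[OF t, rotated]) (simp add: agree)
    qed
  qed
qed

lemma backward_solution:
  assumes "\<tau> \<ge> 0"
  obtains \<Psi> :: "'a \<Rightarrow>\<^sub>L 'a" where
    "\<And>g. \<exists>u. strong_sol R B 0 \<tau> u \<and> u \<tau> = R \<tau> g \<and> u 0 = \<Psi> (R \<tau> g)"
proof -
  obtain \<Phi> :: "real \<Rightarrow> 'a \<Rightarrow>\<^sub>L 'a" where \<Phi>: "\<And>f. \<Phi> 0 f = f"
    "\<And>g. strong_sol (\<lambda>r. - R (\<tau> - r)) (\<lambda>r. - B (\<tau> - r)) 0 \<tau> (\<lambda>t. \<Phi> t ((- R (\<tau> - 0)) g))"
    by (rule skew_family.propagator_exists[OF backward[OF assms]]) blast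
  show ?thesis
  proof (rule that[of "\<Phi> \<tau>"])
    fix g
    have "(- R (\<tau> - 0)) (- g) = R \<tau> g" by (simp add: blinfun.minus_left blinfun.minus_right)
    then have "strong_sol (\<lambda>r. - R (\<tau> - r)) (\<lambda>r. - B (\<tau> - r)) 0 \<tau> (\<lambda>t. \<Phi> t (R \<tau> g))"
      using \<Phi>(2)[of "- g"] by simp
    from strong_sol_reverse[OF this, of \<tau>]
    have "strong_sol R B 0 \<tau> (\<lambda>r. \<Phi> (\<tau> - r) (R \<tau> g))" by simp
    then show "\<exists>u. strong_sol R B 0 \<tau> u \<and> u \<tau> = R \<tau> g \<and> u 0 = \<Phi> \<tau> (R \<tau> g)"
      by (intro exI[of _ "\<lambda>r. \<Phi> (\<tau> - r) (R \<tau> g)"]) (simp add: \<Phi>)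
  qed
qed

lemma forward_estimate:
  assumes "\<tau> \<ge> 0"
  obtains C where "C > 0" "\<And>u t. t \<in> {0..\<tau>} \<Longrightarrow> strong_sol R B 0 t u \<Longrightarrow> norm (u t) \<le> C * norm (u 0)"
proof -
  obtain C where "C > 0" and C: "\<And>a t b u. 0 \<le> a \<Longrightarrow> a \<le> t \<Longrightarrow> t \<le> b \<Longrightarrow> b \<le> \<tau> \<Longrightarrow> strong_sol R B a b u \<Longrightarrow> norm (u t) \<le> C * norm (u a)"
    by (rule skew_family.strong_sol_estimate[OF forward[OF assms]]) blast
  show ?thesis
  proof (rule that[OF \<open>C > 0\<close>])
    show "norm (u t) \<le> C * norm (u 0)" if "t \<in> {0..\<tau>}" "strong_sol R B 0 t u" for u t
      by (rule C[OF _ _ order_refl _ that(2)]) (use that in auto)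
  qed
qed

lemma backward_estimate:
  assumes "\<tau> \<ge> 0"
  obtains C where "C > 0" "\<And>u t. t \<in> {0..\<tau>} \<Longrightarrow> strong_sol R B 0 t u \<Longrightarrow> norm (u 0) \<le> C * norm (u t)"
proof -
  obtain C where "C > 0" and C: "\<And>a t b u. 0 \<le> a \<Longrightarrow> a \<le> t \<Longrightarrow> t \<le> b \<Longrightarrow> b \<le> \<tau> \<Longrightarrow>
      strong_sol (\<lambda>r. - R (\<tau> - r)) (\<lambda>r. - B (\<tau> - r)) a b u \<Longrightarrow> norm (u t) \<le> C * norm (u a)"
    by (rule skew_family.strong_sol_estimate[OF backward[OF assms]]) blast
  show ?thesis
  proof (rule that[OF \<open>C > 0\<close>])
    fix u t assume t: "t \<in> {0..\<tau>}" and u: "strong_sol R B 0 t u"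
    from C[OF _ _ _ _ strong_sol_reverse[OF u, of \<tau>], of \<tau>] t show "norm (u 0) \<le> C * norm (u t)" by simp
  qed
qed

text \<open>
  Put \<open>U t s = \<Phi> t (\<Psi> s)\<close>, where \<open>\<Phi> t\<close> is the propagator from \<open>0\<close> to \<open>t\<close> and \<open>\<Psi> s\<close> solves backwards
  from \<open>s\<close> to \<open>0\<close>. Uniqueness makes \<open>\<Psi> t\<close> the inverse of \<open>\<Phi> t\<close>, first on the dense domains; both are bounded
  locally uniformly in time by the energy estimate, which also gives the joint continuity. The last property serves to
  restrict the evolution to the closed subspace of states that are supported in the interval.
\<close>

theorem evolution_family_exists:
  obtains U :: "real \<Rightarrow> real \<Rightarrow> 'a \<Rightarrow>\<^sub>L 'a" where
    "\<And>s f. s \<ge> 0 \<Longrightarrow> U s s f = f"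
    "\<And>s r t f. s \<ge> 0 \<Longrightarrow> r \<ge> 0 \<Longrightarrow> t \<ge> 0 \<Longrightarrow> U t r (U r s f) = U t s f"
    "\<And>f. continuous_on ({0..} \<times> {0..}) (\<lambda>(t, s). U t s f)"
    "\<And>s t. s \<ge> 0 \<Longrightarrow> t \<ge> 0 \<Longrightarrow> U t s ` range (R s) = range (R t)"
    "\<And>s \<tau> g. 0 \<le> s \<Longrightarrow> strong_sol R B s \<tau> (\<lambda>t. U t s (R s g))"
    "\<And>(P :: 'a \<Rightarrow>\<^sub>L 'a) s t f. (\<And>t x. t \<ge> 0 \<Longrightarrow> P (R t x) = R t (P x)) \<Longrightarrow> (\<And>t x. t \<ge> 0 \<Longrightarrow> P (B t x) = B t (P x)) \<Longrightarrow>
      s \<ge> 0 \<Longrightarrow> t \<ge> 0 \<Longrightarrow> U t s (P f) = P (U t s f)"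
proof -
  obtain \<Phi> :: "real \<Rightarrow> 'a \<Rightarrow>\<^sub>L 'a" where \<Phi>: "\<And>f. continuous_on {0..} (\<lambda>t. \<Phi> t f)" "\<And>f. \<Phi> 0 f = f"
    "\<And>\<tau> g. \<tau> \<ge> 0 \<Longrightarrow> strong_sol R B 0 \<tau> (\<lambda>t. \<Phi> t (R 0 g))"
    using forward_propagator by blast
  have "\<exists>\<Psi> :: 'a \<Rightarrow>\<^sub>L 'a. \<forall>g. \<exists>u. strong_sol R B 0 \<tau> u \<and> u \<tau> = R \<tau> g \<and> u 0 = \<Psi> (R \<tau> g)" if "\<tau> \<ge> 0" for \<tau>
    by (rule backward_solution[OF that]) blast
  then obtain \<Psi> :: "real \<Rightarrow> 'a \<Rightarrow>\<^sub>L 'a" where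
    \<Psi>: "\<And>\<tau> g. \<tau> \<ge> 0 \<Longrightarrow> \<exists>u. strong_sol R B 0 \<tau> u \<and> u \<tau> = R \<tau> g \<and> u 0 = \<Psi> \<tau> (R \<tau> g)" by metis
  have sol_range: "u t \<in> range (R t)" if "strong_sol R B a b u" "t \<in> {a..b}" for u a b t
    using that unfolding strong_sol_def by auto
  have \<Phi>_sol: "\<Phi> t (u 0) = u t" if u: "strong_sol R B 0 \<tau> u" "t \<in> {0..\<tau>}" for u \<tau> t
  proof -
    have "0 \<le> \<tau>" using that by auto
    then obtain g where "u 0 = R 0 g" using sol_range[OF u(1), of 0] by auto
    then show ?thesis
      using strong_sol_eq[OF order_refl \<Phi>(3)[OF \<open>0 \<le> \<tau>\<close>] u(1) _ u(2), of g] by (simp add: \<Phi>(2))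
  qed
  have \<Phi>\<Psi>R: "\<Phi> t (\<Psi> t (R t g)) = R t g" "\<Psi> t (R t g) \<in> range (R 0)" if t: "t \<ge> 0" for t g
  proof -
    obtain u where u: "strong_sol R B 0 t u" "u t = R t g" "u 0 = \<Psi> t (R t g)" using \<Psi>[OF t] by blast
    show "\<Phi> t (\<Psi> t (R t g)) = R t g" using \<Phi>_sol[OF u(1), of t] t u by simp
    show "\<Psi> t (R t g) \<in> range (R 0)" using sol_range[OF u(1), of 0] t u by simp
  qed
  have \<Phi>R: "\<Phi> t (R 0 g) \<in> range (R t)" if t: "t \<ge> 0" for t g
    by (rule sol_range[OF \<Phi>(3)[OF t]]) (use t in auto)
  have "\<Phi> t o\<^sub>L \<Psi> t = id_blinfun" if t: "t \<ge> 0" for t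
    by (rule blinfun_eq_on_dense[of "R t"]) (use range_dense[OF t] \<Phi>\<Psi>R[OF t] in auto)
  then have \<Phi>\<Psi>: "\<Phi> t (\<Psi> t x) = x" if "t \<ge> 0" for t x
    using that by (metis blinfun_apply_blinfun_compose blinfun_apply_id_blinfun)
  \<comment> \<open>The backward estimate for strong solutions extends from the dense range of \<open>R 0\<close> to all initial values.\<close>
  have below: "norm f \<le> C * norm (\<Phi> t f)"
    if C: "\<And>u t. t \<in> {0..\<tau>} \<Longrightarrow> strong_sol R B 0 t u \<Longrightarrow> norm (u 0) \<le> C * norm (u t)"
      and "C > 0" and t: "t \<in> {0..\<tau>}" for C \<tau> t f
  proof (rule field_le_epsilon)
    fix e :: real assume e: "e > 0"
    define d where "d = e / (1 + C * norm (\<Phi> t))"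
    have pos: "1 + C * norm (\<Phi> t) > 0" using \<open>C > 0\<close> by (simp add: add_pos_nonneg)
    then have "d > 0" using e by (simp add: d_def)
    then obtain g where g: "norm (f - R 0 g) < d" using range_dense by blast
    have "norm (R 0 g) \<le> C * norm (\<Phi> t (R 0 g))"
      using C[OF t \<Phi>(3), of g] t by (simp add: \<Phi>(2))
    also have "\<dots> \<le> C * (norm (\<Phi> t f) + norm (\<Phi> t) * norm (f - R 0 g))"
    proof (rule mult_left_mono)
      have "\<Phi> t (R 0 g) = \<Phi> t f - \<Phi> t (f - R 0 g)" by (simp add: blinfun.diff_right)
      then show "norm (\<Phi> t (R 0 g)) \<le> norm (\<Phi> t f) + norm (\<Phi> t) * norm (f - R 0 g)"
        using norm_triangle_ineq4[of "\<Phi> t f" "\<Phi> t (f - R 0 g)"] norm_blinfun[of "\<Phi> t" "f - R 0 g"] by simp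
    qed (use \<open>C > 0\<close> in simp)
    finally have "norm f \<le> norm (f - R 0 g) + C * (norm (\<Phi> t f) + norm (\<Phi> t) * norm (f - R 0 g))"
      using norm_triangle_sub[of f "R 0 g"] by (simp add: norm_minus_commute)
    also have "\<dots> = C * norm (\<Phi> t f) + (1 + C * norm (\<Phi> t)) * norm (f - R 0 g)" by (simp add: algebra_simps)
    also have "\<dots> \<le> C * norm (\<Phi> t f) + (1 + C * norm (\<Phi> t)) * d"
      using g pos by (intro add_left_mono mult_left_mono) auto
    also have "\<dots> = C * norm (\<Phi> t f) + e" using pos by (simp add: d_def)
    finally show "norm f \<le> C * norm (\<Phi> t f) + e" .
  qed
  have inj: "f = g" if t: "t \<ge> 0" and eq: "\<Phi> t f = \<Phi> t g" for t f g
  proof -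
    obtain C where C: "C > 0" "\<And>u s. s \<in> {0..t} \<Longrightarrow> strong_sol R B 0 s u \<Longrightarrow> norm (u 0) \<le> C * norm (u s)"
      by (rule backward_estimate[OF t]) blast
    have "norm (f - g) \<le> C * norm (\<Phi> t (f - g))"
      by (rule below[OF C(2) C(1), of t t]) (use t in auto)
    then show ?thesis using eq by (simp add: blinfun.diff_right)
  qed
  have \<Psi>\<Phi>: "\<Psi> t (\<Phi> t x) = x" if "t \<ge> 0" for t x
    by (rule inj[OF that]) (simp add: \<Phi>\<Psi>[OF that])
  have \<Psi>_bound: "\<exists>C. \<forall>t\<in>{0..\<tau>}. \<forall>x. norm (\<Psi> t x) \<le> C * norm x" if \<tau>: "\<tau> \<ge> 0" for \<tau>
  proof -
    obtain C where C: "C > 0" "\<And>u s. s \<in> {0..\<tau>} \<Longrightarrow> strong_sol R B 0 s u \<Longrightarrow> norm (u 0) \<le> C * norm (u s)"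
      by (rule backward_estimate[OF \<tau>]) blast
    have "norm (\<Psi> t x) \<le> C * norm x" if "t \<in> {0..\<tau>}" for t x
      using below[OF C(2) C(1) that, of "\<Psi> t x"] \<Phi>\<Psi>[of t x] that by simp
    then show ?thesis by blast
  qed
  have \<Phi>_bound: "\<exists>C>0. \<forall>t\<in>{0..\<tau>}. \<forall>x. norm (\<Phi> t x) \<le> C * norm x" if \<tau>: "\<tau> \<ge> 0" for \<tau>
  proof -
    obtain C where C: "C > 0" "\<And>u s. s \<in> {0..\<tau>} \<Longrightarrow> strong_sol R B 0 s u \<Longrightarrow> norm (u s) \<le> C * norm (u 0)"
      by (rule forward_estimate[OF \<tau>]) blast
    have "norm (\<Phi> t x) \<le> C * norm x" if t: "t \<in> {0..\<tau>}" for t x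
    proof (rule field_le_epsilon)
      fix e :: real assume e: "e > 0"
      define d where "d = e / (norm (\<Phi> t) + C)"
      have pos: "norm (\<Phi> t) + C > 0" using C(1) by (simp add: add_nonneg_pos)
      then have "d > 0" using e by (simp add: d_def)
      then obtain g where g: "norm (x - R 0 g) < d" using range_dense by blast
      have "\<Phi> t x = \<Phi> t (x - R 0 g) + \<Phi> t (R 0 g)" by (simp add: blinfun.diff_right)
      then have "norm (\<Phi> t x) \<le> norm (\<Phi> t (x - R 0 g)) + norm (\<Phi> t (R 0 g))" by (metis norm_triangle_ineq)
      also have "\<dots> \<le> norm (\<Phi> t) * norm (x - R 0 g) + C * norm (R 0 g)"
        using C(2)[OF t \<Phi>(3), of g] t by (intro add_mono norm_blinfun) (simp add: \<Phi>(2))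
      also have "C * norm (R 0 g) \<le> C * (norm x + norm (x - R 0 g))"
        using C(1) norm_triangle_sub[of "R 0 g" x] by (intro mult_left_mono) (auto simp: norm_minus_commute)
      finally have "norm (\<Phi> t x) \<le> C * norm x + (norm (\<Phi> t) + C) * norm (x - R 0 g)" by (simp add: algebra_simps)
      also have "\<dots> \<le> C * norm x + (norm (\<Phi> t) + C) * d" using g pos by (intro add_left_mono mult_left_mono) auto
      also have "\<dots> = C * norm x + e" using pos by (simp add: d_def)
      finally show "norm (\<Phi> t x) \<le> C * norm x + e" .
    qed
    then show ?thesis using C(1) by blast
  qed
  define U where "U t s = \<Phi> t o\<^sub>L \<Psi> s" for t s
  have U: "U t s f = \<Phi> t (\<Psi> s f)" for t s f by (simp add: U_def)
  show ?thesis
  proof (rule that[of U])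
    show "U s s f = f" if "s \<ge> 0" for s f using \<Phi>\<Psi>[OF that] by (simp add: U)
    show "U t r (U r s f) = U t s f" if "s \<ge> 0" "r \<ge> 0" "t \<ge> 0" for s r t f
      using \<Psi>\<Phi>[OF that(2)] by (simp add: U)
    show "U t s ` range (R s) = range (R t)" if s: "s \<ge> 0" and t: "t \<ge> 0" for s t
    proof
      have "U t s x \<in> range (R t)" if s: "s \<ge> 0" and t: "t \<ge> 0" and x: "x \<in> range (R s)" for s t x
      proof -
        obtain g where "x = R s g" using x by blast
        then obtain g' where "\<Psi> s x = R 0 g'" using \<Phi>\<Psi>R(2)[OF s, of g] by auto
        then show ?thesis using \<Phi>R[OF t, of g'] by (simp add: U)
      qed
      note inc = this
      show "U t s ` range (R s) \<subseteq> range (R t)" using inc[OF s t] by blast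
      show "range (R t) \<subseteq> U t s ` range (R s)"
      proof
        fix x assume x: "x \<in> range (R t)"
        have "U t s (U s t x) = x" using \<Psi>\<Phi>[OF s] \<Phi>\<Psi>[OF t] by (simp add: U)
        then show "x \<in> U t s ` range (R s)" using inc[OF t s x] by (metis imageI)
      qed
    qed
    show "strong_sol R B s \<tau> (\<lambda>t. U t s (R s g))" if s: "0 \<le> s" for s \<tau> g
    proof (cases "s \<le> \<tau>")
      case True
      obtain g' where "\<Psi> s (R s g) = R 0 g'" using \<Phi>\<Psi>R(2)[OF s, of g] by auto
      then show ?thesis using strong_sol_subinterval[OF \<Phi>(3)[of \<tau> g'] s order_refl] s True by (simp add: U)
    next
      case False
      then show ?thesis by (simp add: strong_sol_def)
    qed
    show "continuous_on ({0..} \<times> {0..}) (\<lambda>(t, s). U t s f)" for f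
    proof -
      have \<Psi>c: "(\<lambda>n. \<Psi> (s n) f) \<longlonglongrightarrow> \<Psi> s0 f" if s: "s \<longlonglongrightarrow> s0" "s0 \<ge> 0" "\<And>n. s n \<ge> 0" for s s0
      proof -
        obtain T where T: "\<And>n. norm (s n) \<le> T" using convergent_imp_Bseq[OF convergentI[OF s(1)]] by (auto simp: Bseq_def)
        have T': "s n \<in> {0..T}" for n using T[of n] s(3)[of n] by auto
        then have "T \<ge> 0" using s(3) by (metis atLeastAtMost_iff order_trans)
        then obtain C where C: "\<And>t x. t \<in> {0..T} \<Longrightarrow> norm (\<Psi> t x) \<le> C * norm x" using \<Psi>_bound by blast
        define g where "g = \<Psi> s0 f"
        have fg: "f = \<Phi> s0 g" by (simp add: g_def \<Phi>\<Psi>[OF s(2)])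
        have "(\<lambda>n. \<Phi> (s n) g) \<longlonglongrightarrow> \<Phi> s0 g"
          by (rule continuous_on_tendsto_compose[OF \<Phi>(1)[of g] s(1)]) (use s in auto)
        then have lim: "(\<lambda>n. \<Phi> s0 g - \<Phi> (s n) g) \<longlonglongrightarrow> 0" 
          using tendsto_diff[OF tendsto_const[of "\<Phi> s0 g"]] by fastforce
        show ?thesis
        proof (rule LIM_zero_cancel, rule Lim_null_comparison)
          show "\<forall>\<^sub>F n in sequentially. norm (\<Psi> (s n) f - \<Psi> s0 f) \<le> C * norm (\<Phi> s0 g - \<Phi> (s n) g)"
          proof (intro always_eventually allI)
            fix n
            have "\<Psi> (s n) f - \<Psi> s0 f = \<Psi> (s n) (\<Phi> s0 g - \<Phi> (s n) g)"
              using \<Psi>\<Phi>[OF s(3), of n g] by (simp add: blinfun.diff_right fg[symmetric]) (simp add: g_def)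
            then show "norm (\<Psi> (s n) f - \<Psi> s0 f) \<le> C * norm (\<Phi> s0 g - \<Phi> (s n) g)" using C[OF T'] by simp
          qed
          show "(\<lambda>n. C * norm (\<Phi> s0 g - \<Phi> (s n) g)) \<longlonglongrightarrow> 0"
            using tendsto_mult_right_zero[OF tendsto_norm_zero[OF lim]] .
        qed
      qed
      show ?thesis
        unfolding continuous_on_sequentially
      proof (intro allI ballI impI, elim conjE)
        fix x :: "nat \<Rightarrow> real \<times> real" and a
        assume a: "a \<in> {0..} \<times> {0..}" and x: "\<forall>n. x n \<in> {0..} \<times> {0..}" "x \<longlonglongrightarrow> a"
        define t s where "t n = fst (x n)" and "s n = snd (x n)" for n
        define t0 s0 where "t0 = fst a" and "s0 = snd a"
        have t: "t \<longlonglongrightarrow> t0" "t0 \<ge> 0" "t n \<ge> 0" and s: "s \<longlonglongrightarrow> s0" "s0 \<ge> 0" "s n \<ge> 0" for n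
          using a x tendsto_fst[OF x(2)] tendsto_snd[OF x(2)]
          by (auto simp: t_def[abs_def] s_def[abs_def] t0_def s0_def mem_Times_iff)
        obtain T where T: "\<And>n. norm (t n) \<le> T" using convergent_imp_Bseq[OF convergentI[OF t(1)]] by (auto simp: Bseq_def)
        have T': "t n \<in> {0..T}" for n using T[of n] t(3)[of n] by auto
        then have "T \<ge> 0" using t(3) by (metis atLeastAtMost_iff order_trans)
        then obtain C where C: "\<And>t x. t \<in> {0..T} \<Longrightarrow> norm (\<Phi> t x) \<le> C * norm x" using \<Phi>_bound by blast
        define w where "w = \<Psi> s0 f"
        have w: "(\<lambda>n. \<Psi> (s n) f - w) \<longlonglongrightarrow> 0" unfolding w_def by (rule LIM_zero[OF \<Psi>c[OF s]])
        have \<Phi>w: "(\<lambda>n. \<Phi> (t n) w) \<longlonglongrightarrow> \<Phi> t0 w"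
          by (rule continuous_on_tendsto_compose[OF \<Phi>(1)[of w] t(1)]) (use t in auto)
        have "(\<lambda>n. \<Phi> (t n) (\<Psi> (s n) f - w)) \<longlonglongrightarrow> 0"
        proof (rule Lim_null_comparison)
          show "\<forall>\<^sub>F n in sequentially. norm (\<Phi> (t n) (\<Psi> (s n) f - w)) \<le> C * norm (\<Psi> (s n) f - w)"
            using C[OF T'] by simp
          show "(\<lambda>n. C * norm (\<Psi> (s n) f - w)) \<longlonglongrightarrow> 0"
            by (rule tendsto_mult_right_zero[OF tendsto_norm_zero[OF w]])
        qed
        from tendsto_add[OF this \<Phi>w] have "(\<lambda>n. \<Phi> (t n) (\<Psi> (s n) f)) \<longlonglongrightarrow> \<Phi> t0 w"
          by (simp add: blinfun.diff_right)
        then show "((\<lambda>(t, s). U t s f) \<circ> x) \<longlonglongrightarrow> (\<lambda>(t, s). U t s f) a"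
          by (simp add: o_def case_prod_beta U t_def s_def t0_def s0_def w_def)
      qed
    qed
    fix P :: "'a \<Rightarrow>\<^sub>L 'a" and s t :: real and f
    assume PR: "\<And>t x. t \<ge> 0 \<Longrightarrow> P (R t x) = R t (P x)" and PB: "\<And>t x. t \<ge> 0 \<Longrightarrow> P (B t x) = B t (P x)"
      and s: "s \<ge> 0" and t: "t \<ge> 0"
    have P\<Phi>: "P (\<Phi> t x) = \<Phi> t (P x)" if t: "t \<ge> 0" for t x
    proof -
      have "P o\<^sub>L \<Phi> t = \<Phi> t o\<^sub>L P"
      proof (rule blinfun_eq_on_dense[of "R 0"])
        show "\<exists>g. norm (f - R 0 g) < e" if "e > 0" for f e by (rule range_dense[OF order_refl that])
        fix g
        obtain z where z: "continuous_on {0..t} z" "\<And>s. s \<in> {0..t} \<Longrightarrow> \<Phi> s (R 0 g) = R s (z s)"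
          "\<And>s. s \<in> {0..t} \<Longrightarrow> ((\<lambda>s. \<Phi> s (R 0 g)) has_vector_derivative z s + B s (\<Phi> s (R 0 g))) (at s within {0..t})"
          using \<Phi>(3)[OF t, of g] unfolding strong_sol_def by blast
        have "strong_sol R B 0 t (\<lambda>s. P (\<Phi> s (R 0 g)))"
          unfolding strong_sol_def
        proof (intro exI[of _ "\<lambda>s. P (z s)"] conjI ballI)
          show "continuous_on {0..t} (\<lambda>s. P (z s))" by (intro continuous_intros z)
          fix s assume s: "s \<in> {0..t}"
          then have "s \<ge> 0" by simp
          show "P (\<Phi> s (R 0 g)) = R s (P (z s))" using z(2)[OF s] PR[OF \<open>s \<ge> 0\<close>] by simp
          show "((\<lambda>s. P (\<Phi> s (R 0 g))) has_vector_derivative P (z s) + B s (P (\<Phi> s (R 0 g)))) (at s within {0..t})"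
            by (rule has_vector_derivative_eq_rhs[OF bounded_linear.has_vector_derivative[OF blinfun.bounded_linear_right z(3)[OF s]]])
               (simp add: blinfun.add_right PB[OF \<open>s \<ge> 0\<close>])
        qed
        from \<Phi>_sol[OF this, of t] t show "(P o\<^sub>L \<Phi> t) (R 0 g) = (\<Phi> t o\<^sub>L P) (R 0 g)" by (simp add: \<Phi>(2))
      qed
      then show ?thesis by (metis blinfun_apply_blinfun_compose)
    qed
    have "P (\<Psi> s f) = \<Psi> s (P f)"
      by (rule inj[OF s]) (simp add: P\<Phi>[OF s, symmetric] \<Phi>\<Psi>[OF s])
    then show "U t s (P f) = P (U t s f)" by (simp add: U P\<Phi>[OF t])
  qed
qed

end

section \<open>An abstract primitive operator\<close>

definition blinfun_Pair ::
    "('a::real_normed_vector \<Rightarrow>\<^sub>L 'b::real_normed_vector) \<Rightarrow> ('a \<Rightarrow>\<^sub>L 'c::real_normed_vector) \<Rightarrow> ('a \<Rightarrow>\<^sub>L ('b \<times> 'c))" where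
  "blinfun_Pair f g = Blinfun (\<lambda>x. (f x, g x))"

lemma blinfun_Pair_apply: "blinfun_Pair f g x = (f x, g x)"
  unfolding blinfun_Pair_def
  by (simp add: bounded_linear_Blinfun_apply bounded_linear_Pair blinfun.bounded_linear_right)

text \<open>
  The model is the space of square-integrable functions on the line, with \<open>I\<close> the primitive on \<open>(0, L)\<close>
  vanishing at \<open>0\<close>, \<open>P\<close> the restriction to \<open>(0, L)\<close> and \<open>e\<close> the indicator function of \<open>(0, L)\<close>. The assumption
  \<open>parts\<close> is integration by parts, \<open>f \<bullet> e\<close> being the value at \<open>L\<close> of the primitive of \<open>f\<close>. Everything about the
  operators of the beam follows from these identities.
\<close>

locale primitive_space =
  fixes L :: real and I P :: "'y::{real_inner,banach} \<Rightarrow>\<^sub>L 'y" and e :: 'y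
  assumes L: "0 < L"
    and parts: "I f \<bullet> g + f \<bullet> I g = (f \<bullet> e) * (g \<bullet> e)"
    and P_I: "P (I f) = I f" and I_P: "I (P f) = I f" and P_P: "P (P f) = P f"
    and P_sym: "P f \<bullet> g = f \<bullet> P g" and P_e: "P e = e" and e_e: "e \<bullet> e = L"
    and I_inj: "I m + r *\<^sub>R e = 0 \<Longrightarrow> r = 0 \<and> P m = 0"
begin

text \<open>
  A pair \<open>p = (w\<^sub>x\<^sub>x, w\<^sub>x(0))\<close> stands for a function \<open>w\<close> with \<open>w(0) = 0\<close>; then \<open>D p = w\<^sub>x\<close>, \<open>W p = w\<close>
  and \<open>tr p = w\<^sub>x(L)\<close>.
\<close>

definition D :: "('y \<times> real) \<Rightarrow>\<^sub>L 'y" where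
  "D = (I o\<^sub>L fst_blinfun) + (blinfun_scaleR_left e o\<^sub>L snd_blinfun)"

lemma D_apply: "D p = I (fst p) + snd p *\<^sub>R e"
  by (simp add: D_def blinfun.add_left)

definition W :: "('y \<times> real) \<Rightarrow>\<^sub>L 'y" where "W = I o\<^sub>L D"

lemma W_apply: "W p = I (D p)" by (simp add: W_def)

definition tr :: "('y \<times> real) \<Rightarrow>\<^sub>L real" where
  "tr = (blinfun_inner_left e o\<^sub>L fst_blinfun) + snd_blinfun"

lemma tr_apply: "tr p = fst p \<bullet> e + snd p"
  by (simp add: tr_def blinfun.add_left blinfun_inner_left.rep_eq inner_commute)

definition Istar :: "'y \<Rightarrow>\<^sub>L 'y" where
  "Istar = (blinfun_scaleR_left e o\<^sub>L blinfun_inner_left e) - I"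

lemma Istar_apply: "Istar f = (f \<bullet> e) *\<^sub>R e - I f"
  by (simp add: Istar_def blinfun.diff_left blinfun_inner_left.rep_eq inner_commute)

lemma inner_Istar: "I f \<bullet> g = f \<bullet> Istar g"
  using parts[of f g] by (simp add: Istar_apply inner_diff_right mult.commute)

text \<open>
  \<open>Ds\<close> and \<open>Ws\<close> are the adjoints of \<open>D\<close> and \<open>W\<close>, and \<open>Th\<close> represents the antisymmetric form
  \<open>\<integral> (w\<^sub>x \<phi> - w \<phi>\<^sub>x)\<close>, which is the weak form of \<open>2 w\<^sub>x\<close> together with the boundary term \<open>- w(L) \<phi>(L)\<close>.
\<close>

definition Ds :: "'y \<Rightarrow>\<^sub>L ('y \<times> real)" where "Ds = blinfun_Pair Istar (blinfun_inner_left e)"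

lemma Ds_apply: "Ds f = (Istar f, f \<bullet> e)"
  by (simp add: Ds_def blinfun_Pair_apply blinfun_inner_left.rep_eq inner_commute)

lemma inner_Ds: "Ds f \<bullet> p = f \<bullet> D p"
  by (simp add: Ds_apply D_apply inner_prod_def inner_add_right inner_Istar[of "fst p" f, symmetric] inner_commute)

definition Ws :: "'y \<Rightarrow>\<^sub>L ('y \<times> real)" where "Ws = Ds o\<^sub>L Istar"

lemma inner_Ws: "Ws f \<bullet> p = f \<bullet> W p"
  using inner_Ds[of "Istar f" p] inner_Istar[of "D p" f] by (simp add: Ws_def W_apply inner_commute)

definition Th :: "('y \<times> real) \<Rightarrow>\<^sub>L ('y \<times> real)" where "Th = (Ws o\<^sub>L D) - (Ds o\<^sub>L W)"

lemma inner_Th: "Th p \<bullet> r = D p \<bullet> W r - W p \<bullet> D r"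
  by (simp add: Th_def blinfun.diff_left inner_diff_left inner_Ws inner_Ds)

lemma P_D: "P (D p) = D p" by (simp add: D_apply blinfun.add_right blinfun.scaleR_right P_I P_e)
lemma P_W: "P (W p) = W p" by (simp add: W_apply P_I)
lemma D_P: "D (P m, r) = D (m, r)" by (simp add: D_apply I_P)
lemma W_P: "W (P m, r) = W (m, r)" by (simp add: W_apply D_P)
lemma P_Istar: "P (Istar f) = Istar f"
  by (simp add: Istar_apply blinfun.diff_right blinfun.scaleR_right P_I P_e)
lemma inner_P_e: "P f \<bullet> e = f \<bullet> e" by (simp add: P_sym P_e)
lemma Istar_P: "Istar (P f) = Istar f" by (simp add: Istar_apply I_P inner_P_e)
lemma Ws_P: "Ws (P f) = Ws f" by (simp add: Ws_def Istar_P)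
lemma Th_P: "Th (P m, r) = Th (m, r)" by (simp add: Th_def blinfun.diff_left D_P W_P)

text \<open>
  The coordinates of the function \<open>x / L\<close>.
\<close>

definition \<Phi>1 :: "'y \<times> real" where "\<Phi>1 = (0, 1 / L)"

lemma Th_\<Phi>1: "Th \<Phi>1 \<bullet> p = (2 / L) * (e \<bullet> W p) - D p \<bullet> e"
proof -
  have D\<Phi>: "D \<Phi>1 = (1 / L) *\<^sub>R e" and W\<Phi>: "W \<Phi>1 = (1 / L) *\<^sub>R I e"
    by (simp_all add: D_apply W_apply \<Phi>1_def blinfun.zero_right blinfun.scaleR_right)
  have "I e \<bullet> D p = L * (D p \<bullet> e) - e \<bullet> W p" using parts[of e "D p"] by (simp add: e_e W_apply)
  then show ?thesis using L by (simp add: inner_Th D\<Phi> W\<Phi> field_simps)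
qed

text \<open>
  The weak form of \<open>- w\<^sub>x\<^sub>x\<close> with its boundary term: \<open>\<integral> w\<^sub>x \<phi>\<^sub>x = w\<^sub>x(L) \<phi>(L) - \<integral> w\<^sub>x\<^sub>x \<phi>\<close>. The point evaluation
  \<open>\<phi>(L)\<close> is not of the form \<open>Ws f\<close>, but \<open>Th_\<Phi>1\<close> expresses it by \<open>Ws e\<close> and \<open>Th \<Phi>1\<close>.
\<close>

lemma Ds_D_eq: "Ds (D p) = tr p *\<^sub>R ((2 / L) *\<^sub>R Ws e - Th \<Phi>1) - Ws (fst p)"
proof (rule vector_eq_rdot[THEN iffD1], rule allI)
  fix r
  have "D p \<bullet> D r = tr p * (D r \<bullet> e) - fst p \<bullet> W r"
    using parts[of "fst p" "D r"] by (simp add: D_apply[of p] inner_add_left W_apply tr_apply algebra_simps inner_commute)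
  then show "Ds (D p) \<bullet> r = (tr p *\<^sub>R ((2 / L) *\<^sub>R Ws e - Th \<Phi>1) - Ws (fst p)) \<bullet> r"
    by (simp add: inner_Ds inner_diff_left inner_Ws Th_\<Phi>1 algebra_simps)
qed

lemma D_inj: "D p = 0 \<Longrightarrow> P (fst p) = 0 \<and> snd p = 0"
  using I_inj[of "fst p" "snd p"] by (simp add: D_apply)

lemma W_inj: assumes "W p = 0" shows "P (fst p) = 0 \<and> snd p = 0"
proof -
  have "P (D p) = 0" using I_inj[of "D p" 0] assms by (simp add: W_apply)
  then show ?thesis using D_inj by (simp add: P_D)
qed

lemma Istar_inj: assumes "Istar f = 0" shows "P f = 0"
  using I_inj[of f "- (f \<bullet> e)"] assms by (simp add: Istar_apply)

lemma Ws_inj: assumes "Ws f = (x, 0)" "P x = 0" shows "P f = 0"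
proof -
  have "Istar (Istar f) = x" using assms(1) by (simp add: Ws_def Ds_apply)
  then have "Istar (Istar f) = 0" using assms(2) P_Istar by metis
  then show ?thesis using Istar_inj P_Istar by metis
qed

end

section \<open>The inverse of the beam operator\<close>

text \<open>
  The constants are those of the beam equation: mass \<open>M\<close>, stiffness \<open>a\<close>, damping \<open>c\<close>, and the time-dependent
  coefficients \<open>k = 2 m\<^sub>f V\<close> and \<open>b = T - 2 m\<^sub>f V\<^sup>2\<close>.
\<close>

locale beam = primitive_space L I P e for L :: real and I P :: "'y::{real_inner,banach} \<Rightarrow>\<^sub>L 'y" and e +
  fixes M a \<beta> c :: real and k k' k'' b b' b'' :: "real \<Rightarrow> real"
  assumes M: "0 < M" and a: "0 < a" and \<beta>: "0 < \<beta>"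
    and k: "C1_on {0..} k k'" and k': "C1_on {0..} k' k''"
    and b: "C1_on {0..} b b'" and b': "C1_on {0..} b' b''"
    and k_nz: "t \<ge> 0 \<Longrightarrow> k t \<noteq> 0" and b_ge: "t \<ge> 0 \<Longrightarrow> \<beta> \<le> b t"
begin

type_synonym 'z state = "('z \<times> real) \<times> 'z"

text \<open>
  The equation \<open>Q t u = S t g\<close> for \<open>u = (w, v)\<close> and \<open>g = (w', v')\<close> is the weak form of \<open>A\<^sub>0(t) u = g\<close>. Its first
  component is \<open>\<integral> (a w\<^sub>x\<^sub>x \<phi>\<^sub>x\<^sub>x + b w\<^sub>x \<phi>\<^sub>x) = - \<integral> M v' \<phi> - k \<integral> (w'\<^sub>x \<phi> - w' \<phi>\<^sub>x)\<close> for all \<open>\<phi>\<close> with \<open>\<phi>(0) = 0\<close>,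
  whose natural boundary conditions are those of the beam; its second component is \<open>M v = M w'\<close>. The summands with
  \<open>id - P\<close> only concern functions vanishing on the interval: there \<open>S t\<close> is a rotation, which keeps it
  antisymmetric and makes it injective on the whole space.
\<close>

definition Q0 :: "'y state \<Rightarrow>\<^sub>L 'y state" where
  "Q0 = blinfun_Pair (blinfun_Pair (a *\<^sub>R (fst_blinfun o\<^sub>L fst_blinfun)) 0) (M *\<^sub>R snd_blinfun)"

definition Q1 :: "'y state \<Rightarrow>\<^sub>L 'y state" where
  "Q1 = blinfun_Pair (Ds o\<^sub>L (D o\<^sub>L fst_blinfun)) 0"

definition Q :: "real \<Rightarrow> 'y state \<Rightarrow>\<^sub>L 'y state" where "Q t = Q0 + b t *\<^sub>R Q1"

definition S0 :: "'y state \<Rightarrow>\<^sub>L 'y state" where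
  "S0 = blinfun_Pair
     (- (M *\<^sub>R (Ws o\<^sub>L snd_blinfun)) - blinfun_Pair ((id_blinfun - P) o\<^sub>L snd_blinfun) 0)
     (M *\<^sub>R (W o\<^sub>L fst_blinfun) + ((id_blinfun - P) o\<^sub>L (fst_blinfun o\<^sub>L fst_blinfun)))"

definition S1 :: "'y state \<Rightarrow>\<^sub>L 'y state" where
  "S1 = blinfun_Pair (- (Th o\<^sub>L fst_blinfun)) 0"

definition S :: "real \<Rightarrow> 'y state \<Rightarrow>\<^sub>L 'y state" where "S t = S0 + k t *\<^sub>R S1"

lemma Q_apply: "Q t x = ((a *\<^sub>R fst (fst x), 0) + b t *\<^sub>R Ds (D (fst x)), M *\<^sub>R snd x)"
  by (simp add: Q_def Q0_def Q1_def blinfun.add_left blinfun.scaleR_left blinfun_Pair_apply zero_blinfun.rep_eq)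

lemma S_apply: "S t x = (- (M *\<^sub>R Ws (snd x)) - (snd x - P (snd x), 0) - k t *\<^sub>R Th (fst x),
    M *\<^sub>R W (fst x) + (fst (fst x) - P (fst (fst x))))"
  by (simp add: S_def S0_def S1_def blinfun.add_left blinfun.diff_left blinfun.minus_left blinfun.scaleR_left
      blinfun_Pair_apply zero_blinfun.rep_eq)

lemma Q_inner: "Q t x \<bullet> y = a * (fst (fst x) \<bullet> fst (fst y)) + b t * (D (fst x) \<bullet> D (fst y)) + M * (snd x \<bullet> snd y)"
proof -
  have "(((a *\<^sub>R fst (fst x), 0) + b t *\<^sub>R Ds (D (fst x)), M *\<^sub>R snd x) :: 'y state) \<bullet> y
     = (a *\<^sub>R fst (fst x), 0) \<bullet> fst y + b t * (Ds (D (fst x)) \<bullet> fst y) + M * (snd x \<bullet> snd y)"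
    by (simp add: inner_prod_def[of "(_, M *\<^sub>R _)"] inner_add_left)
  then show ?thesis unfolding Q_apply inner_Ds by (simp add: inner_prod_def[of "(_, 0)"])
qed

text \<open>
  \<open>M W\<close> and \<open>- M Ws\<close> are negative adjoints of each other, \<open>Th\<close> is antisymmetric, and \<open>P\<close> is symmetric.
\<close>

lemma S_skew: "S t x \<bullet> x = 0"
proof -
  have "S t x \<bullet> x = - M * (Ws (snd x) \<bullet> fst x) - ((snd x - P (snd x)) \<bullet> fst (fst x)) - k t * (Th (fst x) \<bullet> fst x)
      + M * (W (fst x) \<bullet> snd x) + (fst (fst x) - P (fst (fst x))) \<bullet> snd x"
    unfolding S_apply by (simp add: inner_prod_def[of "(_, M *\<^sub>R _ + _)"] inner_add_left inner_diff_left inner_prod_def[of "(_, 0)"])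
  also have "\<dots> = 0"
  proof -
    have Th: "Th (fst x) \<bullet> fst x = 0" unfolding inner_Th by (simp add: inner_commute)
    have P: "P (snd x) \<bullet> fst (fst x) = P (fst (fst x)) \<bullet> snd x" by (metis P_sym inner_commute)
    show ?thesis
      unfolding Th inner_Ws inner_diff_left P inner_commute[of "W (fst x)" "snd x"]
        inner_commute[of "fst (fst x)" "snd x"] by simp
  qed
  finally show ?thesis .
qed

lemma S_inj: assumes "S t x = 0" shows "x = 0"
proof -
  have 1: "M *\<^sub>R W (fst x) + (fst (fst x) - P (fst (fst x))) = 0"
    and 2: "- (M *\<^sub>R Ws (snd x)) - (snd x - P (snd x), 0) - k t *\<^sub>R Th (fst x) = 0"
    using assms by (simp_all add: S_apply zero_prod_def)
  have "P (M *\<^sub>R W (fst x) + (fst (fst x) - P (fst (fst x)))) = 0" by (simp only: 1 blinfun.zero_right)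
  then have "W (fst x) = 0" using M by (simp add: blinfun.add_right blinfun.diff_right blinfun.scaleR_right P_W P_P)
  then have "P (fst (fst x)) = 0" "snd (fst x) = 0" using W_inj by blast+
  moreover have "fst (fst x) - P (fst (fst x)) = 0" using 1 \<open>W (fst x) = 0\<close> by simp
  ultimately have f: "fst x = 0" by (simp add: prod_eq_iff)
  then have "Th (fst x) = 0" by (simp add: blinfun.zero_right)
  with 2 have "- (M *\<^sub>R Ws (snd x)) = (snd x - P (snd x), 0)" by simp
  then have "M *\<^sub>R Ws (snd x) = - (snd x - P (snd x), 0)" by (metis minus_minus)
  then have 3: "M *\<^sub>R Ws (snd x) = (P (snd x) - snd x, 0)" by simp
  then have "Ws (snd x) = ((1 / M) *\<^sub>R (P (snd x) - snd x), 0)"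
    using M by (metis (no_types, lifting) divide_self_if less_numeral_extra(3) scaleR_Pair scaleR_one scaleR_scaleR scaleR_zero_right times_divide_eq_left mult_1)
  then have "P (snd x) = 0" by (rule Ws_inj) (simp add: blinfun.scaleR_right blinfun.diff_right P_P)
  moreover have "Ws (snd x) = 0" using Ws_P[of "snd x"] \<open>P (snd x) = 0\<close> by (simp add: blinfun.zero_right)
  ultimately have "snd x = 0" using 3 by (simp add: zero_prod_def)
  with f show ?thesis by (simp add: prod_eq_iff)
qed

text \<open>
  Only the coordinate \<open>\<mu> = w\<^sub>x(0)\<close> is missing from the energy. It is recovered from
  \<open>\<mu> e = w\<^sub>x - I w\<^sub>x\<^sub>x\<close>, at the price of a small multiple of the other terms; the bound is uniform in time because
  \<open>b t \<ge> \<beta>\<close>.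
\<close>

lemma Q_coercive_ex: obtains q where "q > 0" "\<And>t x. t \<ge> 0 \<Longrightarrow> q * (x \<bullet> x) \<le> Q t x \<bullet> x"
proof -
  define K where "K = norm I + 1"
  have K: "K > 0" by (simp add: K_def add_nonneg_pos)
  define \<theta> where "\<theta> = min \<beta> (a / 2 / K\<^sup>2)"
  have \<theta>: "\<theta> > 0" "\<theta> \<le> \<beta>" "\<theta> * K\<^sup>2 \<le> a / 2"
    using a \<beta> K by (auto simp: \<theta>_def min_def field_simps)
  define q where "q = min (a / 2) (min (\<theta> * L / 2) M)"
  have q: "q > 0" "q \<le> a / 2" "q \<le> \<theta> * L / 2" "q \<le> M" using a \<theta> L M by (auto simp: q_def)
  show ?thesis
  proof (rule that[OF q(1)])
    fix t :: real and x :: "'y state" assume t: "t \<ge> 0"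
    define m r v where "m = fst (fst x)" and "r = snd (fst x)" and "v = snd x"
    have "norm (r *\<^sub>R e) \<le> norm (D (fst x)) + K * norm m"
    proof -
      have "r *\<^sub>R e = D (fst x) - I m" by (simp add: D_apply m_def r_def)
      then have "norm (r *\<^sub>R e) \<le> norm (D (fst x)) + norm (I m)" by (metis norm_triangle_ineq4)
      moreover have "norm (I m) \<le> K * norm m" by (rule norm_blinfun_le) (simp add: K_def)
      ultimately show ?thesis by simp
    qed
    then have "(norm (r *\<^sub>R e))\<^sup>2 \<le> (norm (D (fst x)) + K * norm m)\<^sup>2" by (intro power_mono) auto
    also have "\<dots> \<le> 2 * (norm (D (fst x)))\<^sup>2 + 2 * (K * norm m)\<^sup>2"
      using sum_squares_bound[of "norm (D (fst x))" "K * norm m"] by (simp add: power2_sum)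
    also have "(norm (r *\<^sub>R e))\<^sup>2 = L * r\<^sup>2"
      using power2_norm_eq_inner[of e] by (simp add: power_mult_distrib e_e mult.commute)
    finally have "\<theta> * (L * r\<^sup>2) \<le> \<theta> * (2 * (norm (D (fst x)))\<^sup>2 + 2 * (K * norm m)\<^sup>2)"
      using \<theta> by (intro mult_left_mono) auto
    then have 1: "\<theta> * L / 2 * r\<^sup>2 \<le> \<theta> * (norm (D (fst x)))\<^sup>2 + (\<theta> * K\<^sup>2) * (norm m)\<^sup>2"
      by (simp add: power_mult_distrib algebra_simps)
    have "\<theta> * (norm (D (fst x)))\<^sup>2 \<le> b t * (norm (D (fst x)))\<^sup>2"
      using \<theta> b_ge[OF t] by (intro mult_right_mono) auto
    moreover have "(\<theta> * K\<^sup>2) * (norm m)\<^sup>2 \<le> a / 2 * (norm m)\<^sup>2" using \<theta> by (intro mult_right_mono) auto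
    moreover have "q * (norm m)\<^sup>2 \<le> a / 2 * (norm m)\<^sup>2" "q * r\<^sup>2 \<le> \<theta> * L / 2 * r\<^sup>2" "q * (norm v)\<^sup>2 \<le> M * (norm v)\<^sup>2"
      by (intro mult_right_mono q zero_le_power2)+
    ultimately have "q * (norm m)\<^sup>2 + q * r\<^sup>2 + q * (norm v)\<^sup>2 \<le> a * (norm m)\<^sup>2 + b t * (norm (D (fst x)))\<^sup>2 + M * (norm v)\<^sup>2"
      using 1 by (simp add: field_simps)
    moreover have "x \<bullet> x = (norm m)\<^sup>2 + r\<^sup>2 + (norm v)\<^sup>2"
      by (simp add: inner_prod_def m_def r_def v_def dot_square_norm power2_eq_square[of "snd (fst x)"])
    ultimately show "q * (x \<bullet> x) \<le> Q t x \<bullet> x"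
      unfolding Q_inner by (simp add: m_def v_def power2_norm_eq_inner distrib_left)
  qed
qed

definition Qi :: "real \<Rightarrow> 'y state \<Rightarrow>\<^sub>L 'y state" where
  "Qi t = (SOME G. Q t o\<^sub>L G = id_blinfun \<and> G o\<^sub>L Q t = id_blinfun)"

lemma Qi: assumes "t \<ge> 0" shows "Q t o\<^sub>L Qi t = id_blinfun" "Qi t o\<^sub>L Q t = id_blinfun"
proof -
  obtain q where "q > 0" and q: "\<And>x. q * (x \<bullet> x) \<le> Q t x \<bullet> x" using Q_coercive_ex assms by metis
  obtain G where "Q t o\<^sub>L G = id_blinfun" "G o\<^sub>L Q t = id_blinfun"
    using coercive_blinfun_inverse[OF \<open>q > 0\<close> q] by metis
  then have "\<exists>G. Q t o\<^sub>L G = id_blinfun \<and> G o\<^sub>L Q t = id_blinfun" by blast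
  from someI_ex[OF this] show "Q t o\<^sub>L Qi t = id_blinfun" "Qi t o\<^sub>L Q t = id_blinfun"
    unfolding Qi_def by blast+
qed

lemma Qi_apply: assumes "t \<ge> 0" shows "Q t (Qi t x) = x" "Qi t (Q t x) = x"
  using Qi[OF assms] by (metis blinfun_apply_blinfun_compose blinfun_apply_id_blinfun)+

lemma Q_inj: "t \<ge> 0 \<Longrightarrow> Q t x = Q t y \<Longrightarrow> x = y"
  by (metis Qi_apply(2))

lemma Qi_bound: obtains K where "\<And>t. t \<ge> 0 \<Longrightarrow> norm (Qi t) \<le> K"
proof -
  obtain q where "q > 0" and q: "\<And>t x. t \<ge> 0 \<Longrightarrow> q * (x \<bullet> x) \<le> Q t x \<bullet> x" using Q_coercive_ex by metis
  have "norm (Qi t) \<le> 1 / q" if t: "t \<ge> 0" for t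
  proof (rule norm_blinfun_bound)
    fix x
    have "q * (norm (Qi t x))\<^sup>2 \<le> x \<bullet> Qi t x" using q[OF t, of "Qi t x"] by (simp add: Qi_apply[OF t] dot_square_norm)
    also have "\<dots> \<le> norm x * norm (Qi t x)" by (rule norm_cauchy_schwarz)
    finally have "(q * norm (Qi t x)) * norm (Qi t x) \<le> norm x * norm (Qi t x)" by (simp add: power2_eq_square)
    then have "q * norm (Qi t x) \<le> norm x" by (cases "Qi t x = 0") auto
    then show "norm (Qi t x) \<le> 1 / q * norm x" using \<open>q > 0\<close> by (simp add: field_simps)
  qed (use \<open>q > 0\<close> in simp)
  then show ?thesis by (rule that)
qed

lemma Q_C1: "C1_on {0..} Q (\<lambda>t. b' t *\<^sub>R Q1)"
  using C1_on_add[OF C1_on_const[of _ Q0] C1_on_scaleR_const[OF b, of Q1]] by (simp add: Q_def[abs_def])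

lemma S_C1: "C1_on {0..} S (\<lambda>t. k' t *\<^sub>R S1)"
  using C1_on_add[OF C1_on_const[of _ S0] C1_on_scaleR_const[OF k, of S1]] by (simp add: S_def[abs_def])

lemma Qi_C1: "C1_on {0..} Qi (\<lambda>t. - (Qi t o\<^sub>L (b' t *\<^sub>R Q1) o\<^sub>L Qi t))"
proof -
  obtain K where K: "\<And>t. t \<ge> 0 \<Longrightarrow> norm (Qi t) \<le> K" by (rule Qi_bound) blast
  have d: "(Qi has_vector_derivative - (Qi t o\<^sub>L (b' t *\<^sub>R Q1) o\<^sub>L Qi t)) (at t within {0..})" if "t \<in> {0..}" for t
    by (rule has_vector_derivative_blinfun_inverse[OF C1_onD(1)[OF Q_C1 that] _ _ K that]) (auto simp: Qi)
  then have c: "continuous_on {0..} Qi"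
    by (auto simp: continuous_on_eq_continuous_within intro: has_vector_derivative_continuous)
  show ?thesis
    unfolding C1_on_def
    by (intro conjI ballI d continuous_intros bounded_bilinear.continuous_on[OF bounded_bilinear_blinfun_compose] c C1_onD(2)[OF b])
qed

definition R :: "real \<Rightarrow> 'y state \<Rightarrow>\<^sub>L 'y state" where "R t = Qi t o\<^sub>L S t"

lemma R_iff: "t \<ge> 0 \<Longrightarrow> u = R t g \<longleftrightarrow> Q t u = S t g"
  unfolding R_def by (metis blinfun_apply_blinfun_compose Qi_apply)

lemma Q_R: "t \<ge> 0 \<Longrightarrow> Q t (R t g) = S t g"
  using R_iff by blast

definition R' :: "real \<Rightarrow> 'y state \<Rightarrow>\<^sub>L 'y state" where
  "R' t = (Qi t o\<^sub>L (k' t *\<^sub>R S1)) + (- (Qi t o\<^sub>L (b' t *\<^sub>R Q1) o\<^sub>L Qi t) o\<^sub>L S t)"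

lemma R_C1: "C1_on {0..} R R'"
  using C1_on_compose[OF Qi_C1 S_C1] unfolding R_def[abs_def] R'_def[abs_def] .

lemma Q_R': assumes "t \<ge> 0" shows "Q t (R' t x) = k' t *\<^sub>R S1 x - b' t *\<^sub>R Q1 (R t x)"
  by (simp add: R'_def R_def blinfun.add_left blinfun.add_right blinfun.diff_right blinfun.minus_left blinfun.minus_right
      blinfun.scaleR_left blinfun.scaleR_right Qi_apply[OF assms])

text \<open>
  The operators \<open>\<sigma>\<close> and \<open>N\<close> are found by solving \<open>S N - Q \<sigma> R = Q R' = k' S1 - b' Q1 R\<close>. For the first
  term on the right, \<open>N\<close> multiplies the first component by \<open>k' / k\<close>, and \<open>\<sigma>\<close> removes the contribution to the second
  component that this causes. For the second term, \<open>Ds_D_eq\<close> writes \<open>Ds (D w)\<close> by \<open>Ws\<close> and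
  \<open>w\<^sub>x(L) Th \<Phi>1\<close>; \<open>S\<close> produces \<open>Ws\<close> from the second component of \<open>N\<close>, and \<open>Th\<close>, with factor \<open>k\<close>, from the
  first. Dividing by \<open>k\<close> is possible because the velocity does not vanish.
\<close>

definition \<sigma>0 :: "'y state \<Rightarrow>\<^sub>L 'y state" where "\<sigma>0 = blinfun_Pair 0 (P o\<^sub>L snd_blinfun)"
definition \<sigma>1 :: "'y state \<Rightarrow>\<^sub>L 'y state" where
  "\<sigma>1 = blinfun_Pair 0 (- (blinfun_scaleR_left (W \<Phi>1) o\<^sub>L (tr o\<^sub>L fst_blinfun)))"
definition \<sigma> :: "real \<Rightarrow> 'y state \<Rightarrow>\<^sub>L 'y state" where
  "\<sigma> t = (k' t / k t) *\<^sub>R \<sigma>0 + (b' t / k t) *\<^sub>R \<sigma>1"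

lemma \<sigma>_apply: "\<sigma> t x = (0, (k' t / k t) *\<^sub>R P (snd x) - (b' t / k t * tr (fst x)) *\<^sub>R W \<Phi>1)"
  by (simp add: \<sigma>_def \<sigma>0_def \<sigma>1_def blinfun.add_left blinfun.scaleR_left blinfun.minus_left blinfun_Pair_apply zero_blinfun.rep_eq)

definition N0 :: "'y state \<Rightarrow>\<^sub>L 'y state" where
  "N0 = blinfun_Pair (blinfun_Pair (P o\<^sub>L (fst_blinfun o\<^sub>L fst_blinfun)) (snd_blinfun o\<^sub>L fst_blinfun)) 0"
definition N1 :: "'y state \<Rightarrow>\<^sub>L 'y state" where
  "N1 = blinfun_Pair (- (blinfun_scaleR_left \<Phi>1 o\<^sub>L (tr o\<^sub>L fst_blinfun))) 0"
definition N2 :: "'y state \<Rightarrow>\<^sub>L 'y state" where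
  "N2 = blinfun_Pair 0 ((1 / M) *\<^sub>R ((2 / L) *\<^sub>R (blinfun_scaleR_left e o\<^sub>L (tr o\<^sub>L fst_blinfun)) - (P o\<^sub>L (fst_blinfun o\<^sub>L fst_blinfun))))"
definition N :: "real \<Rightarrow> 'y state \<Rightarrow>\<^sub>L 'y state" where
  "N t = (k' t / k t) *\<^sub>R N0 + (b' t / k t) *\<^sub>R (N1 o\<^sub>L R t) + b' t *\<^sub>R (N2 o\<^sub>L R t)"

lemma N_apply: "N t x = ((k' t / k t) *\<^sub>R (P (fst (fst x)), snd (fst x)) - (b' t / k t * tr (fst (R t x))) *\<^sub>R \<Phi>1,
   (b' t / M) *\<^sub>R ((2 / L * tr (fst (R t x))) *\<^sub>R e - P (fst (fst (R t x)))))"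
  by (simp add: N_def N0_def N1_def N2_def blinfun.add_left blinfun.diff_left blinfun.scaleR_left blinfun.minus_left
      blinfun_Pair_apply zero_blinfun.rep_eq)

definition B0 :: "'y state \<Rightarrow>\<^sub>L 'y state" where "B0 = blinfun_Pair 0 ((- (c / M)) *\<^sub>R snd_blinfun)"
definition B1 :: "'y state \<Rightarrow>\<^sub>L 'y state" where "B1 = blinfun_Pair 0 ((- (1 / M)) *\<^sub>R (D o\<^sub>L fst_blinfun))"
definition B :: "real \<Rightarrow> 'y state \<Rightarrow>\<^sub>L 'y state" where "B t = B0 + k' t *\<^sub>R B1"

lemma B_apply: "B t x = (0, - (c / M) *\<^sub>R snd x - (k' t / M) *\<^sub>R D (fst x))"
  by (simp add: B_def B0_def B1_def blinfun.add_left blinfun.minus_left blinfun.scaleR_left blinfun_Pair_apply zero_blinfun.rep_eq)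

lemma B_C1: "C1_on {0..} B (\<lambda>t. k'' t *\<^sub>R B1)"
  using C1_on_add[OF C1_on_const[of _ B0] C1_on_scaleR_const[OF k', of B1]] by (simp add: B_def[abs_def])

lemma k'_k_C1: "\<exists>f'. C1_on {0..} (\<lambda>t. k' t / k t) f'" and b'_k_C1: "\<exists>f'. C1_on {0..} (\<lambda>t. b' t / k t) f'"
  using C1_on_divide[OF k' k] C1_on_divide[OF b' k] k_nz by auto

lemma \<sigma>_C1: "\<exists>\<sigma>'. C1_on {0..} \<sigma> \<sigma>'"
proof -
  obtain f' g' where f: "C1_on {0..} (\<lambda>t. k' t / k t) f'" and g: "C1_on {0..} (\<lambda>t. b' t / k t) g'"
    using k'_k_C1 b'_k_C1 by blast
  show ?thesis
    using C1_on_add[OF C1_on_scaleR_const[OF f, of \<sigma>0] C1_on_scaleR_const[OF g, of \<sigma>1]]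
    unfolding \<sigma>_def[abs_def] by blast
qed

lemma N_C1: "\<exists>N'. C1_on {0..} N N'"
proof -
  obtain f' g' where f: "C1_on {0..} (\<lambda>t. k' t / k t) f'" and g: "C1_on {0..} (\<lambda>t. b' t / k t) g'"
    using k'_k_C1 b'_k_C1 by blast
  note c1 = C1_on_scaleR[OF g C1_on_compose[OF C1_on_const[of _ N1] R_C1]]
  note c2 = C1_on_scaleR[OF b' C1_on_compose[OF C1_on_const[of _ N2] R_C1]]
  show ?thesis
    using C1_on_add[OF C1_on_add[OF C1_on_scaleR_const[OF f, of N0] c1] c2]
    unfolding N_def[abs_def] by blast
qed

text \<open>
  Since \<open>Q t\<close> is injective, it suffices to compare \<open>Q R'\<close> with \<open>S N - Q \<sigma> R\<close>; the second component of
  \<open>R t x\<close> is \<open>W (fst x)\<close> up to a function vanishing on the interval, which is where \<open>\<sigma>\<close> takes effect.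
\<close>

lemma R'_eq: assumes t: "t \<ge> 0" shows "R' t = (R t o\<^sub>L N t) - (\<sigma> t o\<^sub>L R t)"
proof (rule blinfun_eqI)
  fix x
  define w v where "w = fst (R t x)" and "v = snd (R t x)"
  define \<rho> where "\<rho> = tr w"
  have kt: "k t \<noteq> 0" by (rule k_nz[OF t])
  have "Q t (R t x) = S t x" by (rule Q_R[OF t])
  then have "M *\<^sub>R v = M *\<^sub>R W (fst x) + (fst (fst x) - P (fst (fst x)))"
    by (simp add: Q_apply S_apply v_def)
  then have "P (M *\<^sub>R v) = P (M *\<^sub>R W (fst x) + (fst (fst x) - P (fst (fst x))))" by simp
  then have Pv: "P v = W (fst x)"
    using M by (simp add: blinfun.add_right blinfun.diff_right blinfun.scaleR_right P_W P_P)
  define n1 where "n1 = (k' t / k t) *\<^sub>R (P (fst (fst x)), snd (fst x)) - (b' t / k t * \<rho>) *\<^sub>R \<Phi>1"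
  define n2 where "n2 = (b' t / M) *\<^sub>R ((2 / L * \<rho>) *\<^sub>R e - P (fst w))"
  have N: "N t x = (n1, n2)" by (simp add: N_apply n1_def n2_def \<rho>_def w_def)
  have Pn2: "P n2 = n2" by (simp add: n2_def blinfun.scaleR_right blinfun.diff_right P_e P_P)
  have Pn1: "P (fst n1) = fst n1"
    by (simp add: n1_def \<Phi>1_def blinfun.scaleR_right P_P)
  have Ws_n2: "M *\<^sub>R Ws n2 = b' t *\<^sub>R (Ds (D w) + \<rho> *\<^sub>R Th \<Phi>1)"
    using M unfolding Ds_D_eq[of w] \<rho>_def[symmetric]
    by (simp add: n2_def blinfun.scaleR_right blinfun.diff_right Ws_P scaleR_diff_right)
  have Th_n1: "k t *\<^sub>R Th n1 = k' t *\<^sub>R Th (fst x) - (b' t * \<rho>) *\<^sub>R Th \<Phi>1"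
    using kt Th_P[of "fst (fst x)" "snd (fst x)"]
    by (simp add: n1_def blinfun.scaleR_right blinfun.diff_right scaleR_diff_right del: scaleR_Pair)
  have W_n1: "W n1 = (k' t / k t) *\<^sub>R W (fst x) - (b' t / k t * \<rho>) *\<^sub>R W \<Phi>1"
    using W_P[of "fst (fst x)" "snd (fst x)"]
    by (simp add: n1_def blinfun.scaleR_right blinfun.diff_right del: scaleR_Pair)
  have SN: "S t (N t x) = (- (b' t *\<^sub>R Ds (D w)) - k' t *\<^sub>R Th (fst x),
      M *\<^sub>R ((k' t / k t) *\<^sub>R W (fst x) - (b' t / k t * \<rho>) *\<^sub>R W \<Phi>1))"
    unfolding N S_apply fst_conv snd_conv Ws_n2 Th_n1 W_n1 Pn1 Pn2
    by (simp add: algebra_simps zero_prod_def[symmetric])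
  have Q\<sigma>: "Q t (\<sigma> t (R t x)) = (0, M *\<^sub>R ((k' t / k t) *\<^sub>R W (fst x) - (b' t / k t * \<rho>) *\<^sub>R W \<Phi>1))"
    by (simp add: Q_apply \<sigma>_apply w_def[symmetric] v_def[symmetric] Pv \<rho>_def blinfun.zero_right zero_prod_def[symmetric])
  have "Q t (R' t x) = (- (k' t *\<^sub>R Th (fst x)) - b' t *\<^sub>R Ds (D w), 0)"
    unfolding Q_R'[OF t]
    by (simp add: S1_def Q1_def blinfun_Pair_apply blinfun.minus_left zero_blinfun.rep_eq w_def)
  also have "\<dots> = Q t (R t (N t x) - \<sigma> t (R t x))"
    unfolding blinfun.diff_right Q_R[OF t] SN Q\<sigma> by simp
  finally show "R' t x = ((R t o\<^sub>L N t) - (\<sigma> t o\<^sub>L R t)) x"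
    using Q_inj[OF t] by (simp add: blinfun.diff_left)
qed

text \<open>
  The states supported in the interval form the range of this projection.
\<close>

definition Prj :: "'y state \<Rightarrow>\<^sub>L 'y state" where
  "Prj = blinfun_Pair (blinfun_Pair (P o\<^sub>L (fst_blinfun o\<^sub>L fst_blinfun)) (snd_blinfun o\<^sub>L fst_blinfun)) (P o\<^sub>L snd_blinfun)"

lemma Prj_apply: "Prj x = ((P (fst (fst x)), snd (fst x)), P (snd x))"
  by (simp add: Prj_def blinfun_Pair_apply)

lemma fst_Prj: "D (fst (Prj x)) = D (fst x)" "W (fst (Prj x)) = W (fst x)" "Th (fst (Prj x)) = Th (fst x)"
  by (simp_all add: Prj_apply D_P[of _ "snd (fst x)"] W_P[of _ "snd (fst x)"] Th_P[of _ "snd (fst x)"])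

lemma P_fst_Ds: "P (fst (Ds f)) = fst (Ds f)" by (simp add: Ds_apply P_Istar)
lemma P_fst_Th: "P (fst (Th p)) = fst (Th p)"
  by (simp add: Th_def Ws_def blinfun.diff_left blinfun.diff_right P_fst_Ds)

lemma Prj_Q: "Prj (Q t x) = Q t (Prj x)"
  unfolding Q_apply[of t "Prj x"] fst_Prj
  by (simp add: Q_apply Prj_apply blinfun.add_right blinfun.scaleR_right P_fst_Ds)
     (simp add: Ds_apply prod_eq_iff)

lemma Prj_S: "Prj (S t x) = S t (Prj x)"
  unfolding S_apply[of t "Prj x"] fst_Prj
  by (simp add: S_apply Prj_apply blinfun.add_right blinfun.diff_right blinfun.minus_right blinfun.scaleR_right
      P_W P_P P_fst_Th Ws_P Ws_def P_fst_Ds Istar_P)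
     (simp add: prod_eq_iff)

lemma Prj_R: assumes "t \<ge> 0" shows "Prj (R t x) = R t (Prj x)"
  by (rule Q_inj[OF assms]) (simp add: Prj_Q[symmetric] Q_R[OF assms] Prj_S)

lemma Prj_B: "Prj (B t x) = B t (Prj x)"
  unfolding B_apply[of t "Prj x"] fst_Prj
  by (simp add: B_apply Prj_apply blinfun.diff_right blinfun.scaleR_right blinfun.minus_right P_D blinfun.zero_right)
     (simp add: zero_prod_def)

lemma skew_evolution_beam:
  obtains q \<sigma>' N' where "skew_evolution q Q (\<lambda>t. b' t *\<^sub>R Q1) R R' N N' \<sigma> \<sigma>' B (\<lambda>t. k'' t *\<^sub>R B1)"
proof -
  obtain q where q: "q > 0" "\<And>t x. t \<ge> 0 \<Longrightarrow> q * (x \<bullet> x) \<le> Q t x \<bullet> x" using Q_coercive_ex by metis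
  obtain \<sigma>' where \<sigma>: "C1_on {0..} \<sigma> \<sigma>'" using \<sigma>_C1 by blast
  obtain N' where N: "C1_on {0..} N N'" using N_C1 by blast
  have "skew_evolution q Q (\<lambda>t. b' t *\<^sub>R Q1) R R' N N' \<sigma> \<sigma>' B (\<lambda>t. k'' t *\<^sub>R B1)"
  proof
    fix t :: real and x y :: "'y state" assume t: "t \<ge> 0"
    show "Q t x \<bullet> y = x \<bullet> Q t y" unfolding Q_inner inner_commute[of x] by (simp add: inner_commute)
    show "q * (x \<bullet> x) \<le> Q t x \<bullet> x" by (rule q(2)[OF t])
    show "Q t (R t x) \<bullet> x = 0" by (simp add: Q_R[OF t] S_skew)
    show "R t x = 0 \<Longrightarrow> x = 0" using Q_R[OF t, of x] S_inj[of t x] by (simp add: blinfun.zero_right)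
    show "R' t = (R t o\<^sub>L N t) - (\<sigma> t o\<^sub>L R t)" by (rule R'_eq[OF t])
  qed (rule q Q_C1 R_C1 N \<sigma> B_C1)+
  then show ?thesis by (rule that)
qed

theorem beam_propagator:
  obtains U :: "real \<Rightarrow> real \<Rightarrow> 'y state \<Rightarrow>\<^sub>L 'y state" where
    "\<And>s f. s \<ge> 0 \<Longrightarrow> U s s f = f"
    "\<And>s r t f. s \<ge> 0 \<Longrightarrow> r \<ge> 0 \<Longrightarrow> t \<ge> 0 \<Longrightarrow> U t r (U r s f) = U t s f"
    "\<And>f. continuous_on ({0..} \<times> {0..}) (\<lambda>(t, s). U t s f)"
    "\<And>s t. s \<ge> 0 \<Longrightarrow> t \<ge> 0 \<Longrightarrow> U t s ` range (R s) = range (R t)"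
    "\<And>s \<tau> g. 0 \<le> s \<Longrightarrow> strong_sol R B s \<tau> (\<lambda>t. U t s (R s g))"
    "\<And>s t f. s \<ge> 0 \<Longrightarrow> t \<ge> 0 \<Longrightarrow> U t s (Prj f) = Prj (U t s f)"
proof -
  obtain q \<sigma>' N' where "skew_evolution q Q (\<lambda>t. b' t *\<^sub>R Q1) R R' N N' \<sigma> \<sigma>' B (\<lambda>t. k'' t *\<^sub>R B1)"
    by (rule skew_evolution_beam)
  then interpret skew_evolution q Q "\<lambda>t. b' t *\<^sub>R Q1" R R' N N' \<sigma> \<sigma>' B "\<lambda>t. k'' t *\<^sub>R B1" .
  show ?thesis
  proof (rule evolution_family_exists)
    fix U :: "real \<Rightarrow> real \<Rightarrow> 'y state \<Rightarrow>\<^sub>L 'y state"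
    assume U: "\<And>s f. s \<ge> 0 \<Longrightarrow> U s s f = f"
      "\<And>s r t f. s \<ge> 0 \<Longrightarrow> r \<ge> 0 \<Longrightarrow> t \<ge> 0 \<Longrightarrow> U t r (U r s f) = U t s f"
      "\<And>f. continuous_on ({0..} \<times> {0..}) (\<lambda>(t, s). U t s f)"
      "\<And>s t. s \<ge> 0 \<Longrightarrow> t \<ge> 0 \<Longrightarrow> U t s ` range (R s) = range (R t)"
      "\<And>s \<tau> g. 0 \<le> s \<Longrightarrow> strong_sol R B s \<tau> (\<lambda>t. U t s (R s g))"
    assume comm: "\<And>(P :: 'y state \<Rightarrow>\<^sub>L 'y state) s t f. (\<And>t x. t \<ge> 0 \<Longrightarrow> P (R t x) = R t (P x)) \<Longrightarrow>
      (\<And>t x. t \<ge> 0 \<Longrightarrow> P (B t x) = B t (P x)) \<Longrightarrow> s \<ge> 0 \<Longrightarrow> t \<ge> 0 \<Longrightarrow> U t s (P f) = P (U t s f)"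
    show ?thesis
    proof (rule that[of U])
      show "U t s (Prj f) = Prj (U t s f)" if "s \<ge> 0" "t \<ge> 0" for s t f
        by (rule comm[OF Prj_R Prj_B that])
    qed (rule U; assumption)+
  qed
qed

lemma beam_strong_sol_unique:
  assumes "0 \<le> s" "strong_sol R B s \<tau> u" "strong_sol R B s \<tau> v" "u s = v s" "t \<in> {s..\<tau>}"
  shows "u t = v t"
proof -
  obtain q \<sigma>' N' where "skew_evolution q Q (\<lambda>t. b' t *\<^sub>R Q1) R R' N N' \<sigma> \<sigma>' B (\<lambda>t. k'' t *\<^sub>R B1)"
    by (rule skew_evolution_beam)
  then show ?thesis by (rule skew_evolution.strong_sol_eq) fact+
qed

lemma beam_range_dense:
  assumes "0 \<le> t" "0 < r"
  shows "\<exists>g. norm (f - R t g) < r"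
proof -
  obtain q \<sigma>' N' where "skew_evolution q Q (\<lambda>t. b' t *\<^sub>R Q1) R R' N N' \<sigma> \<sigma>' B (\<lambda>t. k'' t *\<^sub>R B1)"
    by (rule skew_evolution_beam)
  then show ?thesis by (rule skew_evolution.range_dense) fact+
qed

end

section \<open>Representatives of square-integrable functions\<close>

lemma square_integrable_rep: "square_integrable (rep_l2 f)"
  using Quotient3_rep_reflp[OF Quotient3_l2, of f] by (simp add: l2_rel_def)

lemma rep_abs_l2: "square_integrable f \<Longrightarrow> AE x in lborel. rep_l2 (abs_l2 f) x = f x"
  using rep_abs_rsp_left[OF Quotient3_l2, of f f] by (simp add: l2_rel_def)

lemma rep_l2_borel [measurable]: "rep_l2 f \<in> borel_measurable borel"
  using square_integrable_rep[of f] by (simp add: square_integrable_def)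

lemma l2_eqI: "(AE x in lborel. rep_l2 f x = rep_l2 g x) \<Longrightarrow> f = g"
  using Quotient3_rel_rep[OF Quotient3_l2, of f g] by (simp add: l2_rel_def square_integrable_rep)

lemma rep_add: "AE x in lborel. rep_l2 (f + g) x = rep_l2 f x + rep_l2 g x"
  unfolding plus_l2_def map_fun_def o_def id_def
  by (rule rep_abs_l2) (intro square_integrable_add square_integrable_rep)

lemma rep_scaleR: "AE x in lborel. rep_l2 (c *\<^sub>R f) x = c * rep_l2 f x"
  unfolding scaleR_l2_def map_fun_def o_def id_def
  by (rule rep_abs_l2) (intro square_integrable_scale square_integrable_rep)

lemma rep_zero: "AE x in lborel. rep_l2 0 x = 0"
  unfolding zero_l2_def by (rule rep_abs_l2) (rule square_integrable_zero)

lemma rep_diff: "AE x in lborel. rep_l2 (f - g) x = rep_l2 f x - rep_l2 g x"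
  using rep_add[of f "(- 1) *\<^sub>R g"] rep_scaleR[of "- 1" g] by eventually_elim simp

lemma inner_l2_eq: "f \<bullet> g = (\<integral>x. rep_l2 f x * rep_l2 g x \<partial>lborel)"
  by (simp add: inner_l2_def)

lemma inner_l2_AE:
  assumes "AE x in lborel. rep_l2 f x * rep_l2 g x = h x" "h \<in> borel_measurable borel"
  shows "f \<bullet> g = (\<integral>x. h x \<partial>lborel)"
  unfolding inner_l2_eq by (rule integral_cong_AE) (use assms in auto)

lemma integrable_rep_mult: "integrable lborel (\<lambda>x. rep_l2 f x * rep_l2 g x)"
  by (rule square_integrable_mult[OF square_integrable_rep square_integrable_rep])

lemma nn_integral_rep_diff:
  "(\<integral>\<^sup>+x. ennreal ((rep_l2 f x - rep_l2 g x)\<^sup>2) \<partial>lborel) = ennreal ((norm (f - g))\<^sup>2)"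
proof -
  have "(\<integral>\<^sup>+x. ennreal ((rep_l2 f x - rep_l2 g x)\<^sup>2) \<partial>lborel) = (\<integral>\<^sup>+x. ennreal ((rep_l2 (f - g) x)\<^sup>2) \<partial>lborel)"
    using rep_diff[of f g] by (intro nn_integral_cong_AE) (auto elim: eventually_mono)
  also have "\<dots> = ennreal (\<integral>x. (rep_l2 (f - g) x)\<^sup>2 \<partial>lborel)"
    using square_integrable_rep[of "f - g"] by (intro nn_integral_eq_integral) (auto simp: square_integrable_def)
  also have "(\<integral>x. (rep_l2 (f - g) x)\<^sup>2 \<partial>lborel) = (norm (f - g))\<^sup>2"
    by (simp add: power2_norm_eq_inner inner_l2_eq) (simp add: power2_eq_square)
  finally show ?thesis .
qed

section \<open>Completeness of the space of square-integrable functions\<close>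

text \<open>
  The weights \<open>4\<^sup>k\<close> turn summability of squares into a geometric bound for the increments.
\<close>

lemma convergent_of_weighted_square_sum:
  fixes F :: "nat \<Rightarrow> real"
  assumes fin: "(\<Sum>k. ennreal (4 ^ k * (F (Suc k) - F k)\<^sup>2)) \<noteq> \<infinity>"
  shows "convergent F"
proof -
  define d where "d k = F (Suc k) - F k" for k
  define s where "s = enn2real (\<Sum>k. ennreal (4 ^ k * (d k)\<^sup>2))"
  have bound: "norm (d k) \<le> sqrt s * (1 / 2) ^ k" for k
  proof -
    have "(\<Sum>k\<in>{k}. ennreal (4 ^ k * (d k)\<^sup>2)) \<le> (\<Sum>k. ennreal (4 ^ k * (d k)\<^sup>2))"
      by (rule sum_le_suminf) auto
    moreover have "(\<Sum>k. ennreal (4 ^ k * (d k)\<^sup>2)) = ennreal s"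
      unfolding s_def by (rule ennreal_enn2real[symmetric]) (use fin in \<open>simp add: less_top d_def\<close>)
    ultimately have "ennreal (4 ^ k * (d k)\<^sup>2) \<le> ennreal s" by simp
    moreover have "0 \<le> s" unfolding s_def by (rule enn2real_nonneg)
    ultimately have "4 ^ k * (d k)\<^sup>2 \<le> s" by (simp add: ennreal_le_iff)
    moreover have "4 ^ k * (d k)\<^sup>2 = (2 ^ k * d k)\<^sup>2"
      using power_mult_distrib[of "2::real" 2 k] by (simp add: power2_eq_square mult_ac)
    ultimately have "\<bar>2 ^ k * d k\<bar> \<le> sqrt s" by (metis real_sqrt_abs real_sqrt_le_iff)
    then show ?thesis
      by (simp add: abs_mult power_one_over pos_le_divide_eq mult.commute divide_inverse[symmetric])
  qed
  have "summable (\<lambda>k. (1 / 2 :: real) ^ k)" by (rule summable_geometric) simp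
  from summable_mult[OF this, of "sqrt s"] have "summable d"
    by (rule summable_comparison_test'[of _ 0]) (rule bound)
  then have "convergent (\<lambda>n. F 0 + (\<Sum>k<n. d k))"
    by (intro convergent_add convergent_const) (simp add: summable_iff_convergent)
  moreover have "(\<Sum>k<n. d k) = F n - F 0" for n
    unfolding d_def by (rule sum_lessThan_telescope)
  ultimately show ?thesis by simp
qed

text \<open>
  The argument of Riesz and Fischer: a rapidly converging subsequence has representatives that converge almost
  everywhere, and Fatou's lemma shows that their limit is the limit in the norm.
\<close>

instance l2 :: banach
proof
  fix X :: "nat \<Rightarrow> l2" assume X: "Cauchy X"
  have "\<exists>M. \<forall>m\<ge>M. \<forall>n\<ge>M. norm (X m - X n) < (1 / 8) ^ k" for k
    using CauchyD[OF X, of "(1 / 8) ^ k"] by simp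
  \<comment> \<open>The rate \<open>1 / 8\<close> is such that its square still beats the weights \<open>4\<^sup>k\<close>.\<close>
  then obtain M where M: "\<And>k m n. m \<ge> M k \<Longrightarrow> n \<ge> M k \<Longrightarrow> norm (X m - X n) < (1 / 8) ^ k" by metis
  define r where "r k = k + (\<Sum>i\<le>k. M i)" for k
  have r: "strict_mono r" by (rule strict_monoI_Suc) (simp add: r_def)
  have rM: "M k \<le> r k" for k
    using member_le_sum[of k "{..k}" M] by (simp add: r_def trans_le_add2)
  have rM': "M k \<le> r n" if "k \<le> n" for k n
    using rM[of k] strict_mono_less_eq[OF r, of k n] that by simp
  define F where "F k = rep_l2 (X (r k))" for k
  have [measurable]: "F k \<in> borel_measurable borel" for k by (simp add: F_def)
  define d where "d k x = F (Suc k) x - F k x" for k x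
  have [measurable]: "d k \<in> borel_measurable borel" for k unfolding d_def[abs_def] by measurable
  have "(\<integral>\<^sup>+x. (\<Sum>k. ennreal (4 ^ k * (d k x)\<^sup>2)) \<partial>lborel) = (\<Sum>k. \<integral>\<^sup>+x. ennreal (4 ^ k * (d k x)\<^sup>2) \<partial>lborel)"
    by (rule nn_integral_suminf) simp
  also have "\<dots> \<le> (\<Sum>k. ennreal ((1 / 16) ^ k))"
  proof (rule suminf_le)
    fix k
    have "(\<integral>\<^sup>+x. ennreal (4 ^ k * (d k x)\<^sup>2) \<partial>lborel) = ennreal (4 ^ k) * (\<integral>\<^sup>+x. ennreal ((d k x)\<^sup>2) \<partial>lborel)"
      by (subst nn_integral_cmult[symmetric]) (auto simp: ennreal_mult)
    also have "\<dots> = ennreal (4 ^ k * (norm (X (r (Suc k)) - X (r k)))\<^sup>2)"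
      unfolding d_def F_def nn_integral_rep_diff by (simp add: ennreal_mult)
    also have "\<dots> \<le> ennreal (4 ^ k * ((1 / 8) ^ k)\<^sup>2)"
      using M[OF rM'[of k "Suc k"] rM[of k]] by (intro ennreal_leI mult_left_mono power_mono) auto
    also have "(4 ^ k * ((1 / 8) ^ k)\<^sup>2 :: real) = (4 * (1 / 8) * (1 / 8)) ^ k"
      unfolding power_mult_distrib power2_eq_square by simp
    also have "\<dots> = (1 / 16) ^ k" by simp
    finally show "(\<integral>\<^sup>+x. ennreal (4 ^ k * (d k x)\<^sup>2) \<partial>lborel) \<le> ennreal ((1 / 16) ^ k)" .
  qed auto
  also have "\<dots> = ennreal (\<Sum>k. (1 / 16) ^ k)"
    by (rule suminf_ennreal2) (auto intro: summable_geometric)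
  finally have fin: "(\<integral>\<^sup>+x. (\<Sum>k. ennreal (4 ^ k * (d k x)\<^sup>2)) \<partial>lborel) \<noteq> \<infinity>"
    by (metis ennreal_neq_top infinity_ennreal_def neq_top_trans)
  have dm: "(\<lambda>x. ennreal (4 ^ k * (d k x)\<^sup>2)) \<in> borel_measurable lborel" for k by measurable
  have "AE x in lborel. (\<Sum>k. ennreal (4 ^ k * (d k x)\<^sup>2)) \<noteq> \<infinity>"
    using nn_integral_PInf_AE[OF borel_measurable_suminf_order[OF dm] fin] .
  then have conv: "AE x in lborel. convergent (\<lambda>n. F n x)"
    by (rule eventually_mono) (rule convergent_of_weighted_square_sum, simp add: d_def)
  define G where "G x = lim (\<lambda>n. F n x)" for x
  have [measurable]: "G \<in> borel_measurable borel" unfolding G_def[abs_def] by measurable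
  have fatou: "(\<integral>\<^sup>+x. ennreal ((G x - F k x)\<^sup>2) \<partial>lborel) \<le> ennreal (((1 / 8) ^ j)\<^sup>2)" if "j \<le> k" for j k
  proof -
    have "AE x in lborel. ennreal ((G x - F k x)\<^sup>2) = liminf (\<lambda>n. ennreal ((F n x - F k x)\<^sup>2))"
      using conv
    proof eventually_elim
      case (elim x)
      then have "(\<lambda>n. F n x) \<longlonglongrightarrow> G x" by (simp add: G_def convergent_LIMSEQ_iff)
      then have "(\<lambda>n. ennreal ((F n x - F k x)\<^sup>2)) \<longlonglongrightarrow> ennreal ((G x - F k x)\<^sup>2)"
        by (intro tendsto_intros)
      then show ?case by (intro lim_imp_Liminf[symmetric]) auto
    qed
    then have "(\<integral>\<^sup>+x. ennreal ((G x - F k x)\<^sup>2) \<partial>lborel) = (\<integral>\<^sup>+x. liminf (\<lambda>n. ennreal ((F n x - F k x)\<^sup>2)) \<partial>lborel)"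
      by (rule nn_integral_cong_AE)
    also have "\<dots> \<le> liminf (\<lambda>n. \<integral>\<^sup>+x. ennreal ((F n x - F k x)\<^sup>2) \<partial>lborel)"
      by (rule nn_integral_liminf) simp
    also have "\<dots> = liminf (\<lambda>n. ennreal ((norm (X (r n) - X (r k)))\<^sup>2))"
      unfolding F_def nn_integral_rep_diff ..
    also have "\<dots> \<le> liminf (\<lambda>n. ennreal (((1 / 8) ^ j)\<^sup>2))"
    proof (rule Liminf_mono, rule eventually_sequentiallyI[of k])
      fix n assume "n \<ge> k"
      then show "ennreal ((norm (X (r n) - X (r k)))\<^sup>2) \<le> ennreal (((1 / 8) ^ j)\<^sup>2)"
        using M[OF rM'[of j n] rM'[of j k]] that by (intro ennreal_leI power_mono) auto
    qed
    finally show ?thesis by (simp add: Liminf_const)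
  qed
  have sq: "square_integrable (\<lambda>x. G x - F k x)" for k
    unfolding square_integrable_def
  proof
    show "integrable lborel (\<lambda>x. (G x - F k x)\<^sup>2)"
    proof (rule integrableI_bounded)
      have "(\<integral>\<^sup>+x. ennreal (norm ((G x - F k x)\<^sup>2)) \<partial>lborel) \<le> ennreal (((1 / 8) ^ 0)\<^sup>2)"
        using fatou[of 0 k] by simp
      then show "(\<integral>\<^sup>+x. ennreal (norm ((G x - F k x)\<^sup>2)) \<partial>lborel) < \<infinity>"
        by (rule le_less_trans) simp
    qed measurable
  qed measurable
  have "square_integrable (\<lambda>x. (G x - F 0 x) + F 0 x)"
    by (intro square_integrable_add sq) (simp add: F_def square_integrable_rep)
  then have G: "square_integrable G" by simp
  define l where "l = abs_l2 G"
  have lk: "norm (l - X (r k)) \<le> (1 / 8) ^ k" for k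
  proof -
    have "ennreal ((norm (l - X (r k)))\<^sup>2) = (\<integral>\<^sup>+x. ennreal ((G x - F k x)\<^sup>2) \<partial>lborel)"
      unfolding nn_integral_rep_diff[symmetric] F_def l_def using rep_abs_l2[OF G]
      by (intro nn_integral_cong_AE) (auto elim: eventually_mono)
    also have "\<dots> \<le> ennreal (((1 / 8) ^ k)\<^sup>2)" by (rule fatou) simp
    finally have "(norm (l - X (r k)))\<^sup>2 \<le> ((1 / 8) ^ k)\<^sup>2" by simp
    then show ?thesis by (rule power2_le_imp_le) simp
  qed
  have "(X \<circ> r) \<longlonglongrightarrow> l"
  proof (rule LIM_zero_cancel, rule Lim_null_comparison)
    show "\<forall>\<^sub>F k in sequentially. norm ((X \<circ> r) k - l) \<le> (1 / 8) ^ k"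
      using lk by (simp add: norm_minus_commute)
    show "(\<lambda>k. (1 / 8) ^ k :: real) \<longlonglongrightarrow> 0" by (rule LIMSEQ_power_zero) simp
  qed
  then have "X \<longlonglongrightarrow> l" by (rule Cauchy_converges_subseq[OF X r])
  then show "convergent X" by (rule convergentI)
qed

section \<open>Indicator functions of intervals\<close>

lemma integrable_indicator_Ioo:
  fixes a b :: real
  shows "integrable lborel (indicat_real {a<..<b})"
proof (rule integrable_real_indicator)
  show "emeasure lborel {a<..<b} < \<infinity>" by (cases "a \<le> b") auto
qed auto

lemma indicator_square_integrable:
  fixes a b :: real
  shows "square_integrable (indicat_real {a<..<b})"
proof -
  have "(\<lambda>x. (indicat_real {a<..<b} x)\<^sup>2) = indicat_real {a<..<b}" by (auto simp: indicator_def)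
  then show ?thesis using integrable_indicator_Ioo by (simp add: square_integrable_def)
qed

text \<open>
  The primitive of \<open>f\<close> at \<open>x\<close> is \<open>f \<bullet> seg 0 x\<close>, so that statements about primitives become
  statements about these vectors.
\<close>

definition seg :: "real \<Rightarrow> real \<Rightarrow> l2" where
  "seg a b = abs_l2 (indicat_real {a<..<b})"

lemma rep_seg: "AE x in lborel. rep_l2 (seg a b) x = indicat_real {a<..<b} x"
  unfolding seg_def by (rule rep_abs_l2[OF indicator_square_integrable])

lemma inner_seg: "f \<bullet> seg a b = (\<integral>x. rep_l2 f x * indicat_real {a<..<b} x \<partial>lborel)"
  by (rule inner_l2_AE) (use rep_seg[of a b] in \<open>auto elim: eventually_mono\<close>)

lemma integrable_rep_seg: "integrable lborel (\<lambda>x. rep_l2 f x * indicat_real {a<..<b} x)"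
  by (rule integrable_cong_AE_imp[OF integrable_rep_mult[of f "seg a b"]])
     (use rep_seg[of a b] in \<open>auto elim: eventually_mono\<close>)

lemma seg_degenerate: "b \<le> a \<Longrightarrow> seg a b = 0"
  by (rule l2_eqI) (use rep_seg[of a b] rep_zero in \<open>eventually_elim, simp\<close>)

lemma seg_split: assumes "a \<le> b" "b \<le> c" shows "seg a c = seg a b + seg b c"
proof (rule l2_eqI)
  show "AE x in lborel. rep_l2 (seg a c) x = rep_l2 (seg a b + seg b c) x"
    using rep_seg[of a c] rep_seg[of a b] rep_seg[of b c] rep_add[of "seg a b" "seg b c"] AE_lborel_singleton[of b]
    by eventually_elim (use assms in \<open>auto simp: indicator_def\<close>)
qed

lemma norm_seg: assumes "a \<le> b" shows "norm (seg a b) = sqrt (b - a)"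
proof -
  have "seg a b \<bullet> seg a b = (\<integral>x. indicat_real {a<..<b} x \<partial>lborel)"
    by (rule inner_l2_AE) (use rep_seg[of a b] in \<open>auto elim!: eventually_mono simp: indicator_def\<close>)
  also have "\<dots> = b - a" using assms by simp
  finally show ?thesis by (simp add: norm_eq_sqrt_inner)
qed

lemma norm_seg_diff:
  assumes "0 \<le> x" "0 \<le> y"
  shows "norm (seg 0 x - seg 0 y) = sqrt \<bar>x - y\<bar>"
proof (cases "x \<le> y")
  case True
  then have "seg 0 x - seg 0 y = - seg x y" using seg_split[of 0 x y] assms by simp
  then show ?thesis using norm_seg[OF True] True by (simp add: norm_minus_commute)
next
  case False
  then have "seg 0 x - seg 0 y = seg y x" using seg_split[of 0 y x] assms by simp
  then show ?thesis using norm_seg[of y x] False by simp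
qed

lemma continuous_inner_seg: "continuous_on {0..} (\<lambda>x. f \<bullet> seg 0 x)"
proof -
  have "continuous_on {0..} (\<lambda>x. seg 0 x)"
    unfolding continuous_on_iff
  proof (intro ballI allI impI)
    fix x e :: real assume x: "x \<in> {0..}" and e: "0 < e"
    show "\<exists>d>0. \<forall>x'\<in>{0..}. dist x' x < d \<longrightarrow> dist (seg 0 x') (seg 0 x) < e"
    proof (intro exI[of _ "e\<^sup>2"] conjI ballI impI)
      fix y :: real assume y: "y \<in> {0..}" "dist y x < e\<^sup>2"
      then have "sqrt \<bar>y - x\<bar> < sqrt (e\<^sup>2)" by (intro real_sqrt_less_mono) (simp add: dist_real_def)
      then show "dist (seg 0 y) (seg 0 x) < e"
        using x y e by (simp add: dist_norm norm_seg_diff)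
    qed (use e in simp)
  qed
  then show ?thesis by (intro continuous_intros)
qed

lemma continuous_inner_seg': "continuous_on UNIV (\<lambda>x. f \<bullet> seg 0 (max 0 x))"
  by (rule continuous_on_compose2[OF continuous_inner_seg]) (auto intro!: continuous_intros)

section \<open>Restriction to the interval\<close>

definition restr :: "real \<Rightarrow> l2 \<Rightarrow> l2" where
  "restr L f = abs_l2 (\<lambda>x. indicat_real {0<..<L} x * rep_l2 f x)"

lemma rep_restr: "AE x in lborel. rep_l2 (restr L f) x = indicat_real {0<..<L} x * rep_l2 f x"
  unfolding restr_def
proof (rule rep_abs_l2)
  show "square_integrable (\<lambda>x. indicat_real {0<..<L} x * rep_l2 f x)"
    unfolding square_integrable_def
  proof
    show "integrable lborel (\<lambda>x. (indicat_real {0<..<L} x * rep_l2 f x)\<^sup>2)"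
      by (rule Bochner_Integration.integrable_bound[of _ "\<lambda>x. (rep_l2 f x)\<^sup>2"])
         (use square_integrable_rep[of f] in \<open>auto simp: square_integrable_def indicator_def\<close>)
  qed measurable
qed

lemma restr_eq_self_iff: "restr L f = f \<longleftrightarrow> f \<in> L2_on L"
proof
  assume eq: "restr L f = f"
  show "f \<in> L2_on L"
    using rep_restr[of L f] unfolding eq L2_on_def by (auto elim!: eventually_mono)
next
  assume f: "f \<in> L2_on L"
  then have "AE x in lborel. x \<notin> {0<..<L} \<longrightarrow> rep_l2 f x = 0" by (simp add: L2_on_def)
  with rep_restr[of L f] have "AE x in lborel. rep_l2 (restr L f) x = rep_l2 f x"
    by eventually_elim (auto simp: indicator_def)
  then show "restr L f = f" by (rule l2_eqI)
qed

lemma restr_restr: "restr L (restr L f) = restr L f"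
  by (rule l2_eqI) (use rep_restr[of L f] rep_restr[of L "restr L f"] in \<open>eventually_elim, auto simp: indicator_def\<close>)

lemma inner_restr: "restr L f \<bullet> g = f \<bullet> restr L g"
proof -
  have "restr L f \<bullet> g = (\<integral>x. indicat_real {0<..<L} x * rep_l2 f x * rep_l2 g x \<partial>lborel)"
    by (rule inner_l2_AE) (use rep_restr[of L f] in \<open>auto elim: eventually_mono\<close>)
  also have "\<dots> = f \<bullet> restr L g"
    by (rule inner_l2_AE[symmetric]) (use rep_restr[of L g] in \<open>auto elim!: eventually_mono\<close>)
  finally show ?thesis .
qed

lemma restr_add: "restr L (f + g) = restr L f + restr L g"
  by (rule l2_eqI)
     (use rep_restr[of L "f + g"] rep_restr[of L f] rep_restr[of L g] rep_add[of f g] rep_add[of "restr L f" "restr L g"]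
       in \<open>eventually_elim, simp add: algebra_simps\<close>)

lemma restr_scaleR: "restr L (c *\<^sub>R f) = c *\<^sub>R restr L f"
  by (rule l2_eqI)
     (use rep_restr[of L "c *\<^sub>R f"] rep_restr[of L f] rep_scaleR[of c f] rep_scaleR[of c "restr L f"]
       in \<open>eventually_elim, simp add: algebra_simps\<close>)

lemma norm_restr_le: "norm (restr L f) \<le> norm f"
proof -
  have "(norm (restr L f))\<^sup>2 = f \<bullet> restr L f" by (simp add: power2_norm_eq_inner inner_restr restr_restr)
  also have "\<dots> \<le> norm f * norm (restr L f)" by (rule norm_cauchy_schwarz)
  finally show ?thesis by (cases "restr L f = 0") (auto simp: power2_eq_square)
qed

lemma bounded_linear_restr: "bounded_linear (restr L)"
  by (rule bounded_linear_intro[where K = 1]) (auto simp: restr_add restr_scaleR norm_restr_le)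

lemma restr_seg: assumes "0 \<le> a" "b \<le> L" shows "restr L (seg a b) = seg a b"
  unfolding restr_eq_self_iff L2_on_def using rep_seg[of a b] assms
  by (auto elim!: eventually_mono simp: indicator_def)

section \<open>The primitive\<close>

definition prim :: "real \<Rightarrow> l2 \<Rightarrow> l2" where
  "prim L f = abs_l2 (\<lambda>x. indicat_real {0<..<L} x * (f \<bullet> seg 0 x))"

lemma prim_borel: "(\<lambda>x. indicat_real {0<..<L} x * (f \<bullet> seg 0 x)) \<in> borel_measurable borel"
proof -
  have "(\<lambda>x. f \<bullet> seg 0 (max 0 x)) \<in> borel_measurable borel"
    by (rule borel_measurable_continuous_onI[OF continuous_inner_seg'])
  then have "(\<lambda>x. indicat_real {0<..<L} x * (f \<bullet> seg 0 (max 0 x))) \<in> borel_measurable borel" by measurable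
  moreover have "(\<lambda>x. indicat_real {0<..<L} x * (f \<bullet> seg 0 (max 0 x))) = (\<lambda>x. indicat_real {0<..<L} x * (f \<bullet> seg 0 x))"
    by (auto simp: indicator_def)
  ultimately show ?thesis by simp
qed

lemma prim_bound: assumes "x \<in> {0<..<L}" shows "\<bar>f \<bullet> seg 0 x\<bar> \<le> norm f * sqrt L"
proof -
  have "\<bar>f \<bullet> seg 0 x\<bar> \<le> norm f * norm (seg 0 x)" by (rule Cauchy_Schwarz_ineq2)
  also have "\<dots> \<le> norm f * sqrt L" using assms by (intro mult_left_mono) (auto simp: norm_seg)
  finally show ?thesis .
qed

lemma prim_square_bound: "(indicat_real {0<..<L} x * (f \<bullet> seg 0 x))\<^sup>2 \<le> (norm f * sqrt L)\<^sup>2 * indicat_real {0<..<L} x"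
  using power_mono[OF prim_bound[of x L f], of 2] by (auto simp: indicator_def)

lemma integrable_const_indicator:
  fixes a b :: real
  shows "integrable lborel (\<lambda>x. c * indicat_real {a<..<b} x)"
  by (rule integrable_mult_right) (rule integrable_indicator_Ioo)

lemma prim_square_integrable: "square_integrable (\<lambda>x. indicat_real {0<..<L} x * (f \<bullet> seg 0 x))"
  unfolding square_integrable_def
proof
  show "integrable lborel (\<lambda>x. (indicat_real {0<..<L} x * (f \<bullet> seg 0 x))\<^sup>2)"
  proof (rule Bochner_Integration.integrable_bound)
    show "integrable lborel (\<lambda>x. (norm f * sqrt L)\<^sup>2 * indicat_real {0<..<L} x)" by (rule integrable_const_indicator)
    show "(\<lambda>x. (indicat_real {0<..<L} x * (f \<bullet> seg 0 x))\<^sup>2) \<in> borel_measurable lborel"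
      using prim_borel by measurable
    show "AE x in lborel. norm ((indicat_real {0<..<L} x * (f \<bullet> seg 0 x))\<^sup>2) \<le> norm ((norm f * sqrt L)\<^sup>2 * indicat_real {0<..<L} x)"
      using prim_square_bound by (auto simp: indicator_def)
  qed
qed (rule prim_borel)

lemma rep_prim: "AE x in lborel. rep_l2 (prim L f) x = indicat_real {0<..<L} x * (f \<bullet> seg 0 x)"
  unfolding prim_def by (rule rep_abs_l2[OF prim_square_integrable])

lemma prim_add: "prim L (f + g) = prim L f + prim L g"
  by (rule l2_eqI)
     (use rep_prim[of L "f + g"] rep_prim[of L f] rep_prim[of L g] rep_add[of "prim L f" "prim L g"]
       in \<open>eventually_elim, simp add: inner_add_left algebra_simps\<close>)

lemma prim_scaleR: "prim L (c *\<^sub>R f) = c *\<^sub>R prim L f"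
  by (rule l2_eqI)
     (use rep_prim[of L "c *\<^sub>R f"] rep_prim[of L f] rep_scaleR[of c "prim L f"]
       in \<open>eventually_elim, simp add: algebra_simps\<close>)

lemma norm_prim_le: assumes "0 \<le> L" shows "norm (prim L f) \<le> norm f * L"
proof -
  have "(norm (prim L f))\<^sup>2 = (\<integral>x. (indicat_real {0<..<L} x * (f \<bullet> seg 0 x))\<^sup>2 \<partial>lborel)"
    unfolding power2_norm_eq_inner
    by (rule inner_l2_AE) (use rep_prim[of L f] prim_borel in \<open>auto elim!: eventually_mono simp: power2_eq_square\<close>)
  also have "\<dots> \<le> (\<integral>x. (norm f * sqrt L)\<^sup>2 * indicat_real {0<..<L} x \<partial>lborel)"
    using prim_square_integrable[of L f] unfolding square_integrable_def
    by (intro integral_mono integrable_const_indicator prim_square_bound) auto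
  also have "\<dots> = (norm f * sqrt L)\<^sup>2 * (\<integral>x. indicat_real {0<..<L} x \<partial>lborel)"
    by (rule integral_mult_right_zero)
  also have "\<dots> = (norm f)\<^sup>2 * L * L" using assms by (simp add: power_mult_distrib)
  also have "\<dots> = (norm f * L)\<^sup>2" by (simp add: power2_eq_square)
  finally show ?thesis by (rule power2_le_imp_le) (use assms in simp)
qed

lemma bounded_linear_prim: assumes "0 \<le> L" shows "bounded_linear (prim L)"
  by (rule bounded_linear_intro[where K = L]) (auto simp: prim_add prim_scaleR norm_prim_le assms)

lemma prim_in: "prim L f \<in> L2_on L"
  unfolding L2_on_def using rep_prim[of L f] by (auto elim!: eventually_mono)

lemma restr_prim: "restr L (prim L f) = prim L f"
  using restr_eq_self_iff prim_in by blast

lemma prim_restr: "prim L (restr L f) = prim L f"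
proof (rule l2_eqI)
  have eq: "restr L f \<bullet> seg 0 x = f \<bullet> seg 0 x" if "x \<in> {0<..<L}" for x
    using restr_seg[of 0 x L] that by (simp add: inner_restr)
  show "AE x in lborel. rep_l2 (prim L (restr L f)) x = rep_l2 (prim L f) x"
    using rep_prim[of L f] rep_prim[of L "restr L f"] by eventually_elim (auto simp: indicator_def eq)
qed

text \<open>
  Fubini's theorem: the two summands are the integrals of \<open>f(y) g(x)\<close> over the triangles \<open>y < x\<close> and \<open>x < y\<close> of
  the square.
\<close>

lemma prim_parts:
  assumes "0 \<le> L"
  shows "prim L f \<bullet> g + f \<bullet> prim L g = (f \<bullet> seg 0 L) * (g \<bullet> seg 0 L)"
proof -
  define f1 where "f1 x = rep_l2 f x * indicat_real {0<..<L} x" for x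
  define g1 where "g1 x = rep_l2 g x * indicat_real {0<..<L} x" for x
  have f1: "integrable lborel f1" and g1: "integrable lborel g1"
    unfolding f1_def[abs_def] g1_def[abs_def] by (rule integrable_rep_seg)+
  have [measurable]: "f1 \<in> borel_measurable borel" "g1 \<in> borel_measurable borel"
    using f1 g1 by (auto dest: borel_measurable_integrable)
  define k where "k x y = (if y < x then f1 y * g1 x else 0)" for x y
  define k' where "k' x y = (if x < y then f1 y * g1 x else 0)" for x y
  have k_y: "integrable lborel (k x)" "integrable lborel (k' x)" for x
    unfolding k_def[abs_def] k'_def[abs_def]
    by (rule Bochner_Integration.integrable_bound[OF integrable_mult_left[OF f1, of "g1 x"]]; auto)+
  have prod: "integrable (lborel \<Otimes>\<^sub>M lborel) (\<lambda>(x, y). f1 y * g1 x)"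
  proof (rule lborel_pair.Fubini_integrable)
    show "integrable lborel (\<lambda>x. \<integral>y. norm (case (x, y) of (x, y) \<Rightarrow> f1 y * g1 x) \<partial>lborel)"
      using g1 by (simp add: abs_mult)
  qed (use f1 in auto)
  have K: "integrable (lborel \<Otimes>\<^sub>M lborel) (case_prod k)" "integrable (lborel \<Otimes>\<^sub>M lborel) (case_prod k')"
    unfolding k_def[abs_def] k'_def[abs_def]
    by (rule Bochner_Integration.integrable_bound[OF prod]; auto split: prod.splits)+
  have 1: "prim L f \<bullet> g = (\<integral>x. (\<integral>y. k x y \<partial>lborel) \<partial>lborel)"
  proof -
    have inner: "(\<integral>y. k x y \<partial>lborel) = indicat_real {0<..<L} x * (f \<bullet> seg 0 x) * rep_l2 g x" for x
    proof (cases "x \<in> {0<..<L}")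
      case True
      have "(\<integral>y. k x y \<partial>lborel) = (\<integral>y. (rep_l2 f y * indicat_real {0<..<x} y) * rep_l2 g x \<partial>lborel)"
        by (rule Bochner_Integration.integral_cong) (use True in \<open>auto simp: k_def f1_def g1_def indicator_def\<close>)
      then show ?thesis using True by (simp add: inner_seg)
    next
      case False
      then have "k x y = 0" for y by (auto simp: k_def g1_def indicator_def)
      then show ?thesis using False by simp
    qed
    show ?thesis unfolding inner
      by (rule inner_l2_AE) (use rep_prim[of L f] prim_borel[of L f] in \<open>auto elim!: eventually_mono\<close>)
  qed
  have 2: "f \<bullet> prim L g = (\<integral>y. (\<integral>x. k' x y \<partial>lborel) \<partial>lborel)"
  proof -
    have inner: "(\<integral>x. k' x y \<partial>lborel) = rep_l2 f y * (indicat_real {0<..<L} y * (g \<bullet> seg 0 y))" for y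
    proof (cases "y \<in> {0<..<L}")
      case True
      have "(\<integral>x. k' x y \<partial>lborel) = (\<integral>x. (rep_l2 g x * indicat_real {0<..<y} x) * rep_l2 f y \<partial>lborel)"
        by (rule Bochner_Integration.integral_cong) (use True in \<open>auto simp: k'_def f1_def g1_def indicator_def\<close>)
      then show ?thesis using True by (simp add: inner_seg)
    next
      case False
      then have "k' x y = 0" for x by (auto simp: k'_def f1_def indicator_def)
      then show ?thesis using False by simp
    qed
    show ?thesis unfolding inner
      by (rule inner_l2_AE) (use rep_prim[of L g] prim_borel[of L g] in \<open>auto elim!: eventually_mono\<close>)
  qed
  have "prim L f \<bullet> g + f \<bullet> prim L g = (\<integral>x. (\<integral>y. k x y \<partial>lborel) \<partial>lborel) + (\<integral>x. (\<integral>y. k' x y \<partial>lborel) \<partial>lborel)"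
    unfolding 1 2 lborel_pair.Fubini_integral[OF K(2)] ..
  also have "\<dots> = (\<integral>x. (\<integral>y. k x y \<partial>lborel) + (\<integral>y. k' x y \<partial>lborel) \<partial>lborel)"
    by (intro Bochner_Integration.integral_add[symmetric] lborel_pair.integrable_fst K)
  also have "\<dots> = (\<integral>x. (\<integral>y. f1 y \<partial>lborel) * g1 x \<partial>lborel)"
  proof (rule Bochner_Integration.integral_cong[OF refl])
    fix x :: real
    have "(\<integral>y. k x y \<partial>lborel) + (\<integral>y. k' x y \<partial>lborel) = (\<integral>y. k x y + k' x y \<partial>lborel)"
      by (intro Bochner_Integration.integral_add[symmetric] k_y)
    also have "\<dots> = (\<integral>y. f1 y * g1 x \<partial>lborel)"
    proof (rule integral_cong_AE)
      show "AE y in lborel. k x y + k' x y = f1 y * g1 x"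
        using AE_lborel_singleton[of x] by eventually_elim (auto simp: k_def k'_def)
    qed (auto simp: k_def[abs_def] k'_def[abs_def])
    also have "\<dots> = (\<integral>y. f1 y \<partial>lborel) * g1 x" by simp
    finally show "(\<integral>y. k x y \<partial>lborel) + (\<integral>y. k' x y \<partial>lborel) = (\<integral>y. f1 y \<partial>lborel) * g1 x" .
  qed
  also have "\<dots> = (f \<bullet> seg 0 L) * (g \<bullet> seg 0 L)" by (simp add: inner_seg f1_def g1_def)
  finally show ?thesis .
qed

section \<open>Functions with vanishing primitive\<close>

lemma integrable_mult_indicator':
  fixes h :: "real \<Rightarrow> real"
  assumes "integrable lborel h" "S \<in> sets borel"
  shows "integrable lborel (\<lambda>y. h y * indicat_real S y)"
  using integrable_mult_indicator[of S lborel h] assms by (simp add: mult.commute)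

text \<open>
  The positive and the negative part of \<open>f\<close> on the interval are densities of two measures which agree on all half
  lines and therefore coincide.
\<close>

lemma restr_zeroI:
  assumes zero: "\<And>x. x \<in> {0<..L} \<Longrightarrow> f \<bullet> seg 0 x = 0"
  shows "restr L f = 0"
proof -
  define f1 where "f1 x = rep_l2 f x * indicat_real {0<..<L} x" for x
  have f1: "integrable lborel f1" unfolding f1_def[abs_def] by (rule integrable_rep_seg)
  then have [measurable]: "f1 \<in> borel_measurable borel" by (auto dest: borel_measurable_integrable)
  have tail: "(\<integral>y. f1 y * indicat_real {x<..} y \<partial>lborel) = 0" for x
  proof -
    define z where "z = max 0 x"
    have "(\<integral>y. f1 y * indicat_real {x<..} y \<partial>lborel) = f \<bullet> seg z L"
      unfolding inner_seg by (rule Bochner_Integration.integral_cong) (auto simp: f1_def z_def indicator_def)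
    also have "\<dots> = 0"
    proof (cases "z < L")
      case True
      have "f \<bullet> seg 0 z = 0" using zero[of z] seg_degenerate[of z 0] True by (cases "z = 0") (auto simp: z_def)
      moreover have "f \<bullet> seg 0 L = 0" using zero[of L] True by (simp add: z_def)
      moreover have "seg 0 L = seg 0 z + seg z L" using True by (intro seg_split) (auto simp: z_def)
      ultimately show ?thesis by (simp add: inner_add_right)
    qed (simp add: seg_degenerate)
    finally show ?thesis .
  qed
  define p where "p y = max 0 (f1 y)" for y
  define n where "n y = max 0 (- f1 y)" for y
  have p0: "0 \<le> p y" "0 \<le> n y" for y by (auto simp: p_def n_def)
  have pn: "integrable lborel p" "integrable lborel n"
    unfolding p_def[abs_def] n_def[abs_def] using f1 by auto
  have [measurable]: "p \<in> borel_measurable borel" "n \<in> borel_measurable borel"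
    using pn by (auto dest: borel_measurable_integrable)
  have em: "emeasure (density lborel (\<lambda>y. ennreal (h y))) {x<..} = ennreal (\<integral>y. h y * indicat_real {x<..} y \<partial>lborel)"
    if h: "integrable lborel h" "\<And>y. 0 \<le> h y" for h :: "real \<Rightarrow> real" and x
  proof -
    have [measurable]: "h \<in> borel_measurable borel" using h by (auto dest: borel_measurable_integrable)
    have "emeasure (density lborel (\<lambda>y. ennreal (h y))) {x<..} = (\<integral>\<^sup>+y. ennreal (h y * indicat_real {x<..} y) \<partial>lborel)"
      by (subst emeasure_density) (auto intro!: nn_integral_cong borel_open simp: indicator_def)
    also have "\<dots> = ennreal (\<integral>y. h y * indicat_real {x<..} y \<partial>lborel)"
      using h by (intro nn_integral_eq_integral integrable_mult_indicator' borel_open) auto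
    finally show ?thesis .
  qed
  have "density lborel (\<lambda>y. ennreal (p y)) = density lborel (\<lambda>y. ennreal (n y))"
  proof (rule measure_eqI_lessThan)
    fix x :: real
    have S: "{x<..} \<in> sets borel" by (rule borel_open) simp
    show "emeasure (density lborel (\<lambda>y. ennreal (p y))) {x<..} < \<infinity>"
      by (simp add: em[OF pn(1) p0(1)])
    have "(\<integral>y. p y * indicat_real {x<..} y \<partial>lborel) - (\<integral>y. n y * indicat_real {x<..} y \<partial>lborel)
        = (\<integral>y. p y * indicat_real {x<..} y - n y * indicat_real {x<..} y \<partial>lborel)"
      by (rule Bochner_Integration.integral_diff[symmetric])
         (rule integrable_mult_indicator'[OF pn(1) S], rule integrable_mult_indicator'[OF pn(2) S])
    also have "\<dots> = (\<integral>y. f1 y * indicat_real {x<..} y \<partial>lborel)"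
      by (rule Bochner_Integration.integral_cong) (auto simp: p_def n_def indicator_def)
    finally have "(\<integral>y. p y * indicat_real {x<..} y \<partial>lborel) = (\<integral>y. n y * indicat_real {x<..} y \<partial>lborel)"
      by (simp add: tail)
    then show "emeasure (density lborel (\<lambda>y. ennreal (p y))) {x<..} = emeasure (density lborel (\<lambda>y. ennreal (n y))) {x<..}"
      by (simp add: em[OF pn(1) p0(1)] em[OF pn(2) p0(2)])
  qed auto
  moreover have "(\<integral>\<^sup>+y. ennreal (p y) \<partial>lborel) \<noteq> \<infinity>"
    using pn(1) by (subst nn_integral_eq_integral) (auto simp: p_def)
  ultimately have "AE y in lborel. ennreal (p y) = ennreal (n y)"
    by (subst finite_density_unique[symmetric]) auto
  then have "AE y in lborel. f1 y = 0"
    by eventually_elim (auto simp: p_def n_def max_def split: if_splits)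
  note zero_AE = this
  show ?thesis
  proof (rule l2_eqI)
    show "AE x in lborel. rep_l2 (restr L f) x = rep_l2 0 x"
      using zero_AE rep_restr[of L f] rep_zero by eventually_elim (simp add: f1_def mult.commute)
  qed
qed

lemma continuous_AE_eq:
  fixes g h :: "real \<Rightarrow> real"
  assumes "0 < L" and g: "continuous_on {0..L} g" and h: "continuous_on {0..L} h"
    and eq: "AE x in lborel. x \<in> {0<..<L} \<longrightarrow> g x = h x" and x: "x \<in> {0..L}"
  shows "g x = h x"
proof -
  have gh: "continuous_on {0..L} (\<lambda>x. g x - h x)" by (intro continuous_intros g h)
  have inner: "g y - h y = 0" if y: "y \<in> {0<..<L}" for y
  proof (rule ccontr)
    assume ne: "g y - h y \<noteq> 0"
    have "continuous_on {0<..<L} (\<lambda>x. g x - h x)" by (rule continuous_on_subset[OF gh]) auto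
    then have "open ((\<lambda>x. g x - h x) -` (- {0}) \<inter> {0<..<L})"
      by (subst (asm) continuous_on_open_vimage) auto
    moreover have "y \<in> (\<lambda>x. g x - h x) -` (- {0}) \<inter> {0<..<L}" using ne y by auto
    ultimately obtain e where e: "e > 0" "ball y e \<subseteq> (\<lambda>x. g x - h x) -` (- {0}) \<inter> {0<..<L}"
      by (rule openE)
    have "AE x in lborel. \<not> x \<in> {y - e<..<y + e}"
      using eq
    proof eventually_elim
      case (elim x)
      show ?case using e(2) elim by (auto simp: dist_real_def subset_eq)
    qed
    then have "emeasure lborel {x \<in> space lborel. x \<in> {y - e<..<y + e}} = 0" by (rule emeasure_eq_0_AE)
    also have "{x \<in> space lborel. x \<in> {y - e<..<y + e}} = {y - e<..<y + e}" by auto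
    finally show False using e(1) by simp
  qed
  have "g x - h x = 0"
    by (rule continuous_constant_on_closure[of "{0<..<L}" "\<lambda>x. g x - h x"]) (use assms gh inner in auto)
  then show ?thesis by simp
qed

section \<open>Smooth functions\<close>

fun smooth_upto :: "nat \<Rightarrow> (real \<Rightarrow> real) \<Rightarrow> bool" where
  "smooth_upto 0 f \<longleftrightarrow> f differentiable_on UNIV"
| "smooth_upto (Suc k) f \<longleftrightarrow> f differentiable_on UNIV \<and> smooth_upto k (deriv f)"

lemma differentiable_on_UNIV_DERIV:
  fixes f :: "real \<Rightarrow> real"
  shows "f differentiable_on UNIV \<Longrightarrow> (f has_field_derivative deriv f x) (at x)"
  by (metis DERIV_deriv_iff_real_differentiable differentiable_on_def iso_tuple_UNIV_I)

lemma differentiable_on_UNIV_I: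
  fixes f :: "real \<Rightarrow> real"
  assumes "\<And>x. (f has_field_derivative f' x) (at x)"
  shows "f differentiable_on UNIV" "deriv f = f'"
  using assms by (auto simp: differentiable_on_def real_differentiable_def intro!: ext DERIV_imp_deriv)

lemma smooth_uptoI:
  assumes "\<And>x. (f has_field_derivative f' x) (at x)" "smooth_upto k f'"
  shows "smooth_upto (Suc k) f"
  using differentiable_on_UNIV_I[OF assms(1)] assms(2) by simp

lemma smooth_upto_Suc_D: "smooth_upto (Suc k) f \<Longrightarrow> smooth_upto k f"
  by (induction k arbitrary: f) auto

lemma smooth_upto_iff: "smooth_upto k f \<longleftrightarrow> (\<forall>i\<le>k. (deriv ^^ i) f differentiable_on UNIV)"
proof (induction k arbitrary: f)
  case (Suc k)
  have "(\<forall>i\<le>Suc k. (deriv ^^ i) f differentiable_on UNIV) \<longleftrightarrow>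
      f differentiable_on UNIV \<and> (\<forall>i\<le>k. (deriv ^^ Suc i) f differentiable_on UNIV)"
    by (metis (no_types, lifting) Suc_le_mono funpow_0 le0 not0_implies_Suc)
  then show ?case by (simp only: smooth_upto.simps Suc funpow_Suc_right o_def)
qed simp

lemma smooth_upto_const: "smooth_upto k (\<lambda>_. c)"
proof (induction k arbitrary: c)
  case (Suc k)
  show ?case by (rule smooth_uptoI[of _ "\<lambda>_. 0"]) (auto intro: Suc)
qed simp

lemma smooth_upto_add: "smooth_upto k f \<Longrightarrow> smooth_upto k g \<Longrightarrow> smooth_upto k (\<lambda>x. f x + g x)"
proof (induction k arbitrary: f g)
  case (Suc k)
  then show ?case
    by (intro smooth_uptoI[of _ "\<lambda>x. deriv f x + deriv g x"] DERIV_add differentiable_on_UNIV_DERIV) auto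
qed (auto intro: differentiable_on_add)

lemma smooth_upto_mult: "smooth_upto k f \<Longrightarrow> smooth_upto k g \<Longrightarrow> smooth_upto k (\<lambda>x. f x * g x)"
proof (induction k arbitrary: f g)
  case (Suc k)
  have "smooth_upto k f" "smooth_upto k g" using Suc.prems smooth_upto_Suc_D by blast+
  moreover have "smooth_upto k (deriv f)" "smooth_upto k (deriv g)" using Suc.prems by auto
  ultimately have "smooth_upto k (\<lambda>x. deriv f x * g x + deriv g x * f x)"
    by (intro smooth_upto_add Suc.IH)
  moreover have "(f has_field_derivative deriv f x) (at x)" "(g has_field_derivative deriv g x) (at x)" for x
    using Suc.prems by (auto intro: differentiable_on_UNIV_DERIV)
  ultimately show ?case by (intro smooth_uptoI[OF DERIV_mult]) auto
qed (auto intro: differentiable_on_mult)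

lemma smooth_upto_affine: "smooth_upto k f \<Longrightarrow> smooth_upto k (\<lambda>x. f (a * x + b))"
proof (induction k arbitrary: f)
  case 0
  then have "(f has_field_derivative deriv f x) (at x)" for x by (intro differentiable_on_UNIV_DERIV) simp
  then have "((\<lambda>x. f (a * x + b)) has_field_derivative deriv f (a * x + b) * a) (at x)" for x
    by (rule DERIV_chain2) (auto intro!: derivative_eq_intros)
  from differentiable_on_UNIV_I(1)[OF this] show ?case by simp
next
  case (Suc k)
  then have "(f has_field_derivative deriv f x) (at x)" for x by (intro differentiable_on_UNIV_DERIV) simp
  then have "((\<lambda>x. f (a * x + b)) has_field_derivative deriv f (a * x + b) * a) (at x)" for x
    by (rule DERIV_chain2) (auto intro!: derivative_eq_intros)
  then show ?case
    by (rule smooth_uptoI) (use Suc in \<open>auto intro!: smooth_upto_mult smooth_upto_const\<close>)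
qed

text \<open>
  For \<open>s > 0\<close> these functions, with all their derivatives, vanish at \<open>0\<close>. The power \<open>j\<close> makes the family closed under
  differentiation, and as \<open>s\<close> tends to \<open>0\<close> the function \<open>flat s 0\<close> tends to the indicator function of the positive half line.
\<close>

definition flat :: "real \<Rightarrow> nat \<Rightarrow> real \<Rightarrow> real" where
  "flat s j x = (if x > 0 then inverse x ^ j * exp (- (s * inverse x)) else 0)"

lemma flat_tendsto_0: assumes "s > 0" shows "((\<lambda>x. flat s j x) \<longlongrightarrow> 0) (at_right 0)"
proof -
  have "((\<lambda>y. (1 / s) ^ j * (y ^ j / exp y)) \<longlongrightarrow> (1 / s) ^ j * 0) at_top"
    by (intro tendsto_intros tendsto_power_div_exp_0)
  moreover have "filterlim (\<lambda>x. s * inverse x) at_top (at_right 0)"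
    by (rule filterlim_tendsto_pos_mult_at_top[OF tendsto_const assms filterlim_inverse_at_top_right])
  ultimately have "((\<lambda>x. (1 / s) ^ j * ((s * inverse x) ^ j / exp (s * inverse x))) \<longlongrightarrow> 0) (at_right 0)"
    by (auto dest: filterlim_compose)
  then show ?thesis
  proof (rule Lim_transform_eventually)
    show "\<forall>\<^sub>F x in at_right 0. (1 / s) ^ j * ((s * inverse x) ^ j / exp (s * inverse x)) = flat s j x"
      unfolding eventually_at_filter
      using assms by (auto simp: flat_def power_mult_distrib exp_minus divide_inverse power_inverse intro!: always_eventually)
  qed
qed

lemma flat_derivative:
  assumes "s > 0"
  shows "(flat s j has_field_derivative - real j * flat s (Suc j) x + s * flat s (Suc (Suc j)) x) (at x)"
proof -
  consider "x > 0" | "x < 0" | "x = 0" by linarith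
  then show ?thesis
  proof cases
    case 1
    have "((\<lambda>x. inverse x ^ j * exp (- (s * inverse x))) has_field_derivative
        - real j * flat s (Suc j) x + s * flat s (Suc (Suc j)) x) (at x)"
      using 1 by (auto intro!: derivative_eq_intros simp: flat_def power2_eq_square field_simps)
         (cases j; simp add: field_simps)
    then show ?thesis
      by (rule has_field_derivative_transform_within_open[of _ _ _ "{0<..}"]) (use 1 in \<open>auto simp: flat_def\<close>)
  next
    case 2
    have "((\<lambda>x. 0) has_field_derivative - real j * flat s (Suc j) x + s * flat s (Suc (Suc j)) x) (at x)"
      using 2 by (simp add: flat_def)
    then show ?thesis
      by (rule has_field_derivative_transform_within_open[of _ _ _ "{..<0}"]) (use 2 in \<open>auto simp: flat_def\<close>)
  next
    case 3
    have "((\<lambda>h. flat s (Suc j) h) \<longlongrightarrow> 0) (at 0)"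
    proof (rule filterlim_split_at)
      show "((\<lambda>h. flat s (Suc j) h) \<longlongrightarrow> 0) (at_left 0)"
        by (rule tendsto_eventually) (auto simp: eventually_at_filter flat_def)
    qed (rule flat_tendsto_0[OF assms])
    moreover have "flat s (Suc j) h = flat s j h / h" for h by (simp add: flat_def divide_inverse)
    ultimately have "((\<lambda>h. (flat s j (0 + h) - flat s j 0) / h) \<longlongrightarrow> 0) (at 0)" by (simp add: flat_def[of s j 0])
    then show ?thesis unfolding 3 DERIV_def by (simp add: flat_def[of s _ 0])
  qed
qed

lemma flat_smooth: assumes "s > 0" shows "smooth_upto k (flat s j)"
proof (induction k arbitrary: j)
  case 0
  show ?case using differentiable_on_UNIV_I(1)[OF flat_derivative[OF assms]] by simp
next
  case (Suc k)
  show ?case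
    by (rule smooth_uptoI[OF flat_derivative[OF assms]])
       (intro smooth_upto_add smooth_upto_mult smooth_upto_const Suc)
qed

section \<open>Test functions\<close>

lemma test_function_iff:
  "test_function L \<phi> \<longleftrightarrow> (\<forall>k. smooth_upto k \<phi>) \<and> (\<exists>a b. 0 < a \<and> b < L \<and> (\<forall>x. x \<notin> {a..b} \<longrightarrow> \<phi> x = 0))"
proof
  assume \<phi>: "test_function L \<phi>"
  define S where "S = closure {x. \<phi> x \<noteq> 0}"
  have S: "compact S" "S \<subseteq> {0<..<L}" "\<And>x. x \<notin> S \<Longrightarrow> \<phi> x = 0"
    using \<phi> closure_subset[of "{x. \<phi> x \<noteq> 0}"] by (auto simp: test_function_def S_def)
  have "\<exists>a b. 0 < a \<and> b < L \<and> (\<forall>x. x \<notin> {a..b} \<longrightarrow> \<phi> x = 0)"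
  proof (cases "S = {}")
    case True
    then show ?thesis using S(3) by (intro exI[of _ 1] exI[of _ "L - 1"]) auto
  next
    case False
    obtain a where a: "a \<in> S" "\<And>x. x \<in> S \<Longrightarrow> a \<le> x" using compact_attains_inf[OF S(1) False] by blast
    obtain b where b: "b \<in> S" "\<And>x. x \<in> S \<Longrightarrow> x \<le> b" using compact_attains_sup[OF S(1) False] by blast
    have "\<phi> x = 0" if "x \<notin> {a..b}" for x using a(2) b(2) that by (intro S(3)) auto
    then show ?thesis using a(1) b(1) S(2) by (intro exI[of _ a] exI[of _ b]) auto
  qed
  then show "(\<forall>k. smooth_upto k \<phi>) \<and> (\<exists>a b. 0 < a \<and> b < L \<and> (\<forall>x. x \<notin> {a..b} \<longrightarrow> \<phi> x = 0))"
    using \<phi> by (auto simp: test_function_def smooth_upto_iff)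
next
  assume \<phi>: "(\<forall>k. smooth_upto k \<phi>) \<and> (\<exists>a b. 0 < a \<and> b < L \<and> (\<forall>x. x \<notin> {a..b} \<longrightarrow> \<phi> x = 0))"
  then obtain a b where ab: "0 < a" "b < L" "\<And>x. x \<notin> {a..b} \<Longrightarrow> \<phi> x = 0" by blast
  have sub: "closure {x. \<phi> x \<noteq> 0} \<subseteq> {a..b}"
  proof (rule closure_minimal)
    show "{x. \<phi> x \<noteq> 0} \<subseteq> {a..b}" using ab(3) by blast
  qed simp
  have "compact (closure {x. \<phi> x \<noteq> 0})"
    using compact_Int_closed[OF compact_Icc[of a b] closed_closure[of "{x. \<phi> x \<noteq> 0}"]] sub
    by (simp add: Int_absorb1)
  then show "test_function L \<phi>"
    using \<phi> sub ab(1,2) by (auto simp: test_function_def smooth_upto_iff)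
qed

lemma test_functionD:
  assumes "test_function L \<phi>"
  shows "(\<phi> has_field_derivative deriv \<phi> x) (at x)" "isCont \<phi> x" "x \<notin> {0<..<L} \<Longrightarrow> \<phi> x = 0"
proof -
  have "smooth_upto 0 \<phi>" using assms test_function_iff by blast
  then show d: "(\<phi> has_field_derivative deriv \<phi> x) (at x)" by (intro differentiable_on_UNIV_DERIV) simp
  then show "isCont \<phi> x" by (rule DERIV_isCont)
  show "x \<notin> {0<..<L} \<Longrightarrow> \<phi> x = 0" using assms unfolding test_function_iff by force
qed

lemma test_function_deriv:
  assumes "test_function L \<phi>"
  shows "test_function L (deriv \<phi>)"
proof -
  obtain a b where ab: "0 < a" "b < L" "\<And>x. x \<notin> {a..b} \<Longrightarrow> \<phi> x = 0"
    using assms test_function_iff by blast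
  have "smooth_upto k (deriv \<phi>)" for k
    using assms unfolding test_function_iff by (metis smooth_upto.simps(2))
  moreover have "deriv \<phi> x = 0" if "x \<notin> {a..b}" for x
  proof -
    have "((\<lambda>x. 0) has_field_derivative 0) (at x)" by simp
    then have "(\<phi> has_field_derivative 0) (at x)"
      by (rule has_field_derivative_transform_within_open[of _ _ _ "- {a..b}"]) (use that ab in auto)
    then show ?thesis by (rule DERIV_imp_deriv)
  qed
  ultimately show ?thesis using ab test_function_iff by blast
qed

lemma test_function_deriv_funpow: "test_function L \<phi> \<Longrightarrow> test_function L ((deriv ^^ k) \<phi>)"
  by (induction k) (auto intro: test_function_deriv)

lemma test_function_square_integrable:
  assumes "test_function L \<phi>"
  shows "square_integrable \<phi>"
proof -
  have c: "continuous_on S \<phi>" for S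
    using test_functionD(2)[OF assms] by (simp add: continuous_at_imp_continuous_on)
  have "bounded (\<phi> ` {0..L})" by (rule compact_imp_bounded[OF compact_continuous_image[OF c compact_Icc]])
  then obtain K where "\<forall>y\<in>\<phi> ` {0..L}. norm y \<le> K" unfolding bounded_iff by blast
  then have K: "norm (\<phi> x) \<le> K" if "x \<in> {0..L}" for x using that by blast
  have [measurable]: "\<phi> \<in> borel_measurable borel" by (rule borel_measurable_continuous_onI[OF c])
  show ?thesis
    unfolding square_integrable_def
  proof
    show "integrable lborel (\<lambda>x. (\<phi> x)\<^sup>2)"
    proof (rule Bochner_Integration.integrable_bound[OF integrable_const_indicator[of "K\<^sup>2" 0 L]])
      show "AE x in lborel. norm ((\<phi> x)\<^sup>2) \<le> norm (K\<^sup>2 * indicat_real {0<..<L} x)"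
      proof (rule AE_I2)
        fix x
        show "norm ((\<phi> x)\<^sup>2) \<le> norm (K\<^sup>2 * indicat_real {0<..<L} x)"
          using K[of x] test_functionD(3)[OF assms, of x] power_mono[of "\<bar>\<phi> x\<bar>" K 2]
          by (cases "x \<in> {0<..<L}") auto
      qed
    qed measurable
  qed measurable
qed

definition tf :: "(real \<Rightarrow> real) \<Rightarrow> l2" where "tf \<phi> = abs_l2 \<phi>"

lemma rep_tf: "test_function L \<phi> \<Longrightarrow> AE x in lborel. rep_l2 (tf \<phi>) x = \<phi> x"
  unfolding tf_def by (rule rep_abs_l2[OF test_function_square_integrable])

lemma inner_tf:
  assumes "test_function L \<phi>"
  shows "f \<bullet> tf \<phi> = (\<integral>x. rep_l2 f x * \<phi> x \<partial>lborel)"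
  by (rule inner_l2_AE)
     (use rep_tf[OF assms] test_function_square_integrable[OF assms] in \<open>auto elim: eventually_mono simp: square_integrable_def\<close>)

lemma tf_seg_FTC:
  assumes "test_function L \<kappa>" "\<And>x. (\<phi> has_field_derivative \<kappa> x) (at x)" "0 \<le> x"
  shows "tf \<kappa> \<bullet> seg 0 x = \<phi> x - \<phi> 0"
proof -
  have m [measurable]: "\<kappa> \<in> borel_measurable borel"
    using test_function_square_integrable[OF assms(1)] by (simp add: square_integrable_def)
  have "tf \<kappa> \<bullet> seg 0 x = (\<integral>y. \<kappa> y * indicat_real {0..x} y \<partial>lborel)"
    by (rule inner_l2_AE)
       (use rep_tf[OF assms(1)] rep_seg[of 0 x] AE_lborel_singleton[of 0] AE_lborel_singleton[of x] in
         \<open>eventually_elim, auto simp: indicator_def\<close>, measurable)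
  also have "\<dots> = \<phi> x - \<phi> 0"
    by (rule integral_FTC_Icc_real) (use assms(2,3) test_functionD(2)[OF assms(1)] in auto)
  finally show ?thesis .
qed

lemma tf_deriv_seg:
  assumes "test_function L \<phi>" "0 \<le> x"
  shows "tf (deriv \<phi>) \<bullet> seg 0 x = \<phi> x"
  using tf_seg_FTC[OF test_function_deriv[OF assms(1)] test_functionD(1)[OF assms(1)] assms(2)]
    test_functionD(3)[OF assms(1), of 0] by simp

text \<open>
  For test functions the abstract primitive inverts differentiation.
\<close>

lemma tf_eq_prim:
  assumes "test_function L \<phi>"
  shows "tf \<phi> = prim L (tf (deriv \<phi>))" "tf (deriv \<phi>) \<bullet> seg 0 L = 0"
proof -
  show "tf \<phi> = prim L (tf (deriv \<phi>))"
  proof (rule l2_eqI)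
    show "AE x in lborel. rep_l2 (tf \<phi>) x = rep_l2 (prim L (tf (deriv \<phi>))) x"
      using rep_tf[OF assms] rep_prim[of L "tf (deriv \<phi>)"]
      by eventually_elim (use tf_deriv_seg[OF assms] test_functionD(3)[OF assms] in \<open>auto simp: indicator_def\<close>)
  qed
  show "tf (deriv \<phi>) \<bullet> seg 0 L = 0"
    using tf_deriv_seg[OF assms, of L] test_functionD(3)[OF assms, of L] seg_degenerate[of L 0] by (cases "0 \<le> L") auto
qed

definition bump :: "real \<Rightarrow> real \<Rightarrow> real \<Rightarrow> real \<Rightarrow> real" where
  "bump s a b x = flat s 0 (x - a) * flat s 0 (b - x)"

lemma bump_test: assumes "s > 0" "0 < a" "b < L" shows "test_function L (bump s a b)"
  unfolding test_function_iff
proof (intro conjI allI)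
  show "smooth_upto k (bump s a b)" for k
  proof -
    have "smooth_upto k (\<lambda>x. flat s 0 (1 * x + - a))" "smooth_upto k (\<lambda>x. flat s 0 (- 1 * x + b))"
      by (rule smooth_upto_affine[OF flat_smooth[OF assms(1)]])+
    from smooth_upto_mult[OF this] show ?thesis by (simp add: bump_def[abs_def] algebra_simps)
  qed
  show "\<exists>a' b'. 0 < a' \<and> b' < L \<and> (\<forall>x. x \<notin> {a'..b'} \<longrightarrow> bump s a b x = 0)"
    using assms by (intro exI[of _ a] exI[of _ b]) (auto simp: bump_def flat_def)
qed

lemma bump_bounds: assumes "s > 0" shows "0 \<le> bump s a b x" "bump s a b x \<le> indicat_real {a<..<b} x"
  using assms by (auto simp: bump_def flat_def indicator_def intro!: mult_le_one)

lemma bump_tendsto: "(\<lambda>n. bump (inverse (real (Suc n))) a b x) \<longlonglongrightarrow> indicat_real {a<..<b} x"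
proof (cases "x \<in> {a<..<b}")
  case True
  have "(\<lambda>n. exp (- (inverse (real (Suc n)) * inverse (x - a))) * exp (- (inverse (real (Suc n)) * inverse (b - x))))
      \<longlonglongrightarrow> exp (- (0 * inverse (x - a))) * exp (- (0 * inverse (b - x)))"
    by (intro tendsto_intros LIMSEQ_inverse_real_of_nat)
  then show ?thesis using True by (simp add: bump_def flat_def)
next
  case False
  then show ?thesis by (auto simp: bump_def flat_def)
qed

text \<open>
  Vanishing of the integral is what makes the antiderivative vanish near the right end point.
\<close>

lemma test_function_antiderivative:
  assumes \<kappa>: "test_function L \<kappa>" and zero: "tf \<kappa> \<bullet> seg 0 L = 0" and "0 < L"
  obtains \<phi> where "test_function L \<phi>" "deriv \<phi> = \<kappa>"
proof -
  obtain a b where ab: "0 < a" "b < L" "\<And>x. x \<notin> {a..b} \<Longrightarrow> \<kappa> x = 0"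
    using \<kappa> test_function_iff by blast
  have c: "continuous_on S \<kappa>" for S
    using test_functionD(2)[OF \<kappa>] by (simp add: continuous_at_imp_continuous_on)
  define \<phi> where "\<phi> x = integral {-1..x} \<kappa>" for x
  have left: "\<phi> x = 0" if "x < a" for x
  proof -
    have "\<phi> x = integral {-1..x} (\<lambda>_. 0)"
      unfolding \<phi>_def by (rule Henstock_Kurzweil_Integration.integral_cong) (use that ab(3) in auto)
    then show ?thesis by simp
  qed
  have d: "(\<phi> has_field_derivative \<kappa> x) (at x)" for x
  proof (cases "x < a")
    case True
    then have "((\<lambda>x. 0) has_field_derivative \<kappa> x) (at x)" using ab(3)[of x] by simp
    then show ?thesis
      by (rule has_field_derivative_transform_within_open[of _ _ _ "{..<a}"]) (use True left in auto)
  next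
    case False
    then have x: "x \<in> {-1<..<x + 1}" using ab(1) by auto
    have "(\<phi> has_vector_derivative \<kappa> x) (at x within {-1..x + 1})"
      unfolding \<phi>_def by (rule integral_has_vector_derivative[OF c]) (use x in auto)
    then show ?thesis
      using x by (simp add: at_within_Icc_at has_real_derivative_iff_has_vector_derivative)
  qed
  have \<phi>L: "\<phi> L = 0"
    using tf_seg_FTC[OF \<kappa> d, of L] zero \<open>0 < L\<close> left[of 0] ab(1) by simp
  have right: "\<phi> x = 0" if "x > b" for x
  proof -
    have "(\<phi> has_field_derivative 0) (at y within {b<..})" if "y \<in> {b<..}" for y
      using has_field_derivative_at_within[OF d[of y]] ab(3)[of y] that by simp
    then have "\<exists>c. \<forall>x\<in>{b<..}. \<phi> x = c" by (intro has_field_derivative_zero_constant) auto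
    then obtain c where "\<And>x. x > b \<Longrightarrow> \<phi> x = c" by auto
    then show ?thesis using \<phi>L that ab(2) by metis
  qed
  have dd: "deriv \<phi> = \<kappa>" and diff: "\<phi> differentiable_on UNIV"
    using differentiable_on_UNIV_I[OF d] by auto
  have "smooth_upto k \<kappa>" for k using \<kappa> test_function_iff by blast
  then have "smooth_upto (Suc k) \<phi>" for k using dd diff by simp
  then have "smooth_upto k \<phi>" for k using smooth_upto_Suc_D by blast
  moreover have "\<phi> x = 0" if "x \<notin> {a..b}" for x
  proof -
    have "x < a \<or> x > b" using that by auto
    then show ?thesis using left right by blast
  qed
  ultimately have "test_function L \<phi>" using ab(1,2) test_function_iff by blast
  then show ?thesis using dd by (rule that)
qed

lemma bump_inner_tendsto:
  assumes "0 < a" "b < L"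
  shows "(\<lambda>n. f \<bullet> tf (bump (inverse (real (Suc n))) a b)) \<longlonglongrightarrow> f \<bullet> seg a b"
proof -
  have t: "test_function L (bump (inverse (real (Suc n))) a b)" for n
    using assms by (intro bump_test) auto
  have [measurable]: "bump (inverse (real (Suc n))) a b \<in> borel_measurable borel" for n
    using test_function_square_integrable[OF t] by (simp add: square_integrable_def)
  have "(\<lambda>n. \<integral>x. rep_l2 f x * bump (inverse (real (Suc n))) a b x \<partial>lborel)
      \<longlonglongrightarrow> (\<integral>x. rep_l2 f x * indicat_real {a<..<b} x \<partial>lborel)"
  proof (rule integral_dominated_convergence[where w = "\<lambda>x. \<bar>rep_l2 f x * indicat_real {a<..<b} x\<bar>"])
    show "integrable lborel (\<lambda>x. \<bar>rep_l2 f x * indicat_real {a<..<b} x\<bar>)"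
      by (intro integrable_abs integrable_rep_seg)
    show "AE x in lborel. (\<lambda>n. rep_l2 f x * bump (inverse (real (Suc n))) a b x) \<longlonglongrightarrow> rep_l2 f x * indicat_real {a<..<b} x"
      by (intro AE_I2 tendsto_mult_left bump_tendsto)
    fix n
    show "AE x in lborel. norm (rep_l2 f x * bump (inverse (real (Suc n))) a b x) \<le> \<bar>rep_l2 f x * indicat_real {a<..<b} x\<bar>"
    proof (rule AE_I2)
      fix x
      have "\<bar>bump (inverse (real (Suc n))) a b x\<bar> \<le> \<bar>indicat_real {a<..<b} x\<bar>"
        using bump_bounds[of "inverse (real (Suc n))" a b x] by simp
      then show "norm (rep_l2 f x * bump (inverse (real (Suc n))) a b x) \<le> \<bar>rep_l2 f x * indicat_real {a<..<b} x\<bar>"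
        unfolding real_norm_def abs_mult by (rule mult_left_mono) simp
    qed
  qed measurable
  then show ?thesis by (simp only: inner_tf[OF t] inner_seg)
qed

text \<open>
  Bump functions converge to indicator functions of intervals, so the primitive of \<open>f\<close> is constant on
  \<open>(0, L)\<close>; being continuous on the closed interval and \<open>0\<close> at \<open>0\<close>, it vanishes.
\<close>

lemma test_orthogonal:
  assumes "0 < L" and f: "f \<in> L2_on L" and orth: "\<And>\<phi>. test_function L \<phi> \<Longrightarrow> f \<bullet> tf \<phi> = 0"
  shows "f = 0"
proof -
  define F where "F x = f \<bullet> seg 0 x" for x
  have seg0: "f \<bullet> seg a b = 0" if "0 < a" "b < L" for a b
  proof -
    have "f \<bullet> tf (bump (inverse (real (Suc n))) a b) = 0" for n
      using that by (intro orth bump_test) auto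
    then show ?thesis using bump_inner_tendsto[OF that, of f] by (simp add: LIMSEQ_const_iff)
  qed
  have const: "F x = F y" if "0 < x" "x \<le> y" "y < L" for x y
    using seg_split[of 0 x y] seg0[of x y] that by (simp add: F_def inner_add_right)
  have F: "continuous_on {0..L} F"
    unfolding F_def by (rule continuous_on_subset[OF continuous_inner_seg]) auto
  have "F x = F (L / 2)" if "x \<in> {0..L}" for x
  proof (rule continuous_constant_on_closure[of "{0<..<L}" F])
    show "F y = F (L / 2)" if "y \<in> {0<..<L}" for y
      using const[of y "L / 2"] const[of "L / 2" y] that by (cases "y \<le> L / 2") auto
  qed (use \<open>0 < L\<close> F that in auto)
  from this[of 0] this have "F x = 0" if "x \<in> {0..L}" for x
    using that \<open>0 < L\<close> by (simp add: F_def seg_degenerate)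
  then have "restr L f = 0" by (intro restr_zeroI) (auto simp: F_def)
  then show ?thesis using f restr_eq_self_iff by metis
qed

section \<open>Weak derivatives\<close>

lemma has_weak_deriv_iff:
  "has_weak_deriv L k f g \<longleftrightarrow> f \<in> L2_on L \<and> g \<in> L2_on L \<and>
     (\<forall>\<phi>. test_function L \<phi> \<longrightarrow> f \<bullet> tf ((deriv ^^ k) \<phi>) = (-1) ^ k * (g \<bullet> tf \<phi>))"
  unfolding has_weak_deriv_def by (auto simp: inner_tf[of L] test_function_deriv_funpow)

lemma has_weak_deriv_unique:
  assumes "0 < L" "has_weak_deriv L k f g" "has_weak_deriv L k f g'"
  shows "g = g'"
proof -
  have "g - g' \<in> L2_on L"
    using assms restr_eq_self_iff bounded_linear.linear[OF bounded_linear_restr]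
    by (metis has_weak_deriv_iff linear_diff)
  moreover have "(g - g') \<bullet> tf \<phi> = 0" if "test_function L \<phi>" for \<phi>
    using assms that by (auto simp: has_weak_deriv_iff inner_diff_left)
  ultimately have "g - g' = 0" by (intro test_orthogonal[OF assms(1)])
  then show ?thesis by simp
qed

lemma weak_deriv_eq: "0 < L \<Longrightarrow> has_weak_deriv L k f g \<Longrightarrow> weak_deriv L k f = g"
  unfolding weak_deriv_def by (rule the_equality) (auto intro: has_weak_deriv_unique)

lemma has_weak_deriv_0: "f \<in> L2_on L \<Longrightarrow> has_weak_deriv L 0 f f"
  by (simp add: has_weak_deriv_iff)

lemma has_weak_deriv_Suc:
  assumes "0 < L" "has_weak_deriv L k f h"
  shows "has_weak_deriv L (Suc k) f g \<longleftrightarrow> has_weak_deriv L 1 h g"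
proof -
  have eq: "f \<bullet> tf ((deriv ^^ Suc k) \<phi>) = (- 1) ^ Suc k * (g \<bullet> tf \<phi>) \<longleftrightarrow>
      h \<bullet> tf ((deriv ^^ 1) \<phi>) = (- 1) ^ 1 * (g \<bullet> tf \<phi>)" if "test_function L \<phi>" for \<phi>
  proof -
    define s where "s = (- 1 :: real) ^ Suc k"
    have s: "s \<noteq> 0" by (simp add: s_def)
    have "f \<bullet> tf ((deriv ^^ k) (deriv \<phi>)) = (- 1) ^ k * (h \<bullet> tf (deriv \<phi>))"
      using assms(2) test_function_deriv[OF that] unfolding has_weak_deriv_iff by blast
    then have "f \<bullet> tf ((deriv ^^ Suc k) \<phi>) = s * (- (h \<bullet> tf (deriv \<phi>)))"
      by (simp add: funpow_Suc_right s_def del: funpow.simps)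
    then have "f \<bullet> tf ((deriv ^^ Suc k) \<phi>) = s * (g \<bullet> tf \<phi>) \<longleftrightarrow> - (h \<bullet> tf (deriv \<phi>)) = g \<bullet> tf \<phi>"
      using s by (simp only: mult_cancel_left) simp
    then show ?thesis unfolding s_def by auto
  qed
  have "f \<in> L2_on L" "h \<in> L2_on L" using assms(2) unfolding has_weak_deriv_iff by blast+
  then show ?thesis unfolding has_weak_deriv_iff using eq by blast
qed

text \<open>
  The element of \<open>H\<^sup>1((0, L))\<close> with derivative \<open>g\<close> and value \<open>c\<close> at \<open>0\<close>.
\<close>

definition h1 :: "real \<Rightarrow> real \<Rightarrow> l2 \<Rightarrow> l2" where
  "h1 L c g = prim L g + c *\<^sub>R seg 0 L"

lemma h1_in: "h1 L c g \<in> L2_on L"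
proof -
  have "restr L (h1 L c g) = h1 L c g"
    using restr_seg[of 0 L L] by (simp add: h1_def restr_add restr_scaleR restr_prim)
  then show ?thesis by (simp add: restr_eq_self_iff)
qed

lemma rep_h1: "AE x in lborel. x \<in> {0<..<L} \<longrightarrow> rep_l2 (h1 L c g) x = c + g \<bullet> seg 0 x"
  unfolding h1_def
  using rep_add[of "prim L g" "c *\<^sub>R seg 0 L"] rep_prim[of L g] rep_scaleR[of c "seg 0 L"] rep_seg[of 0 L]
  by eventually_elim (auto simp: indicator_def)

lemma continuous_h1: "continuous_on {0..L} (\<lambda>x. c + g \<bullet> seg 0 x)"
  by (intro continuous_intros continuous_on_subset[OF continuous_inner_seg]) auto

lemma point_value_h1:
  assumes "0 < L" "x \<in> {0..L}"
  shows "point_value L (h1 L c g) x = c + g \<bullet> seg 0 x"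
  unfolding point_value_def
proof (rule the_equality)
  show "\<exists>k. continuous_on {0..L} k \<and> (AE \<xi> in lborel. \<xi> \<in> {0<..<L} \<longrightarrow> rep_l2 (h1 L c g) \<xi> = k \<xi>) \<and>
      c + g \<bullet> seg 0 x = k x"
    by (intro exI[of _ "\<lambda>x. c + g \<bullet> seg 0 x"] conjI continuous_h1 rep_h1 refl)
  fix y assume "\<exists>k. continuous_on {0..L} k \<and> (AE \<xi> in lborel. \<xi> \<in> {0<..<L} \<longrightarrow> rep_l2 (h1 L c g) \<xi> = k \<xi>) \<and> y = k x"
  then obtain k where k: "continuous_on {0..L} k"
    "AE \<xi> in lborel. \<xi> \<in> {0<..<L} \<longrightarrow> rep_l2 (h1 L c g) \<xi> = k \<xi>" "y = k x" by blast
  have "AE \<xi> in lborel. \<xi> \<in> {0<..<L} \<longrightarrow> k \<xi> = c + g \<bullet> seg 0 \<xi>"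
    using k(2) rep_h1[of L c g] by eventually_elim auto
  from continuous_AE_eq[OF assms(1) k(1) continuous_h1 this assms(2)] show "y = c + g \<bullet> seg 0 x"
    using k(3) by simp
qed

lemma h1_zero:
  assumes "0 < L" "h1 L c g = 0"
  shows "c = 0" "restr L g = 0"
proof -
  have zero: "c + g \<bullet> seg 0 x = 0" if "x \<in> {0..L}" for x
  proof (rule continuous_AE_eq[OF assms(1) continuous_h1 continuous_on_const _ that])
    show "AE x in lborel. x \<in> {0<..<L} \<longrightarrow> c + g \<bullet> seg 0 x = 0"
      using rep_h1[of L c g] rep_zero unfolding assms(2) by eventually_elim auto
  qed
  from zero[of 0] show "c = 0" using assms(1) by (simp add: seg_degenerate)
  then show "restr L g = 0" using zero by (intro restr_zeroI) auto
qed

lemma has_weak_deriv_1_h1: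
  assumes "0 < L" "g \<in> L2_on L"
  shows "has_weak_deriv L 1 (h1 L c g) g"
  unfolding has_weak_deriv_iff
proof (intro conjI allI impI h1_in assms(2))
  fix \<phi> assume t: "test_function L \<phi>"
  have "h1 L c g \<bullet> tf (deriv \<phi>) = prim L g \<bullet> tf (deriv \<phi>)"
    using tf_eq_prim(2)[OF t] by (simp add: h1_def inner_add_left inner_commute[of "seg 0 L"])
  also have "\<dots> = - (g \<bullet> tf \<phi>)"
    using prim_parts[of L g "tf (deriv \<phi>)"] tf_eq_prim[OF t] assms(1) by simp
  finally show "h1 L c g \<bullet> tf ((deriv ^^ 1) \<phi>) = (- 1) ^ 1 * (g \<bullet> tf \<phi>)" by simp
qed

lemma tf_linear:
  assumes "test_function L \<phi>" "test_function L \<psi>"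
  shows "test_function L (\<lambda>x. \<phi> x + k * \<psi> x)" "tf (\<lambda>x. \<phi> x + k * \<psi> x) = tf \<phi> + k *\<^sub>R tf \<psi>"
proof -
  obtain a b where ab: "0 < a" "b < L" "\<And>x. x \<notin> {a..b} \<Longrightarrow> \<phi> x = 0" using assms(1) test_function_iff by blast
  obtain a' b' where ab': "0 < a'" "b' < L" "\<And>x. x \<notin> {a'..b'} \<Longrightarrow> \<psi> x = 0" using assms(2) test_function_iff by blast
  have "smooth_upto j (\<lambda>x. \<phi> x + k * \<psi> x)" for j
    using assms unfolding test_function_iff by (intro smooth_upto_add smooth_upto_mult smooth_upto_const) auto
  moreover have "\<phi> x + k * \<psi> x = 0" if "x \<notin> {min a a'..max b b'}" for x
  proof -
    have "x \<notin> {a..b}" "x \<notin> {a'..b'}" using that by auto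
    then show ?thesis using ab(3) ab'(3) by simp
  qed
  moreover have "0 < min a a'" "max b b' < L" using ab(1,2) ab'(1,2) by auto
  ultimately show t: "test_function L (\<lambda>x. \<phi> x + k * \<psi> x)" unfolding test_function_iff by blast
  show "tf (\<lambda>x. \<phi> x + k * \<psi> x) = tf \<phi> + k *\<^sub>R tf \<psi>"
    by (rule l2_eqI)
       (use rep_tf[OF t] rep_tf[OF assms(1)] rep_tf[OF assms(2)] rep_add[of "tf \<phi>" "k *\<^sub>R tf \<psi>"] rep_scaleR[of k "tf \<psi>"]
         in \<open>eventually_elim, simp\<close>)
qed

text \<open>
  Du Bois-Reymond: every test function differs by a multiple of a fixed one, \<open>\<theta>0\<close>, from the derivative of a
  test function, and \<open>h\<close> is orthogonal to derivatives.
\<close>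

lemma weak_deriv_zero_imp_const:
  assumes "0 < L" and h: "h \<in> L2_on L" and zero: "\<And>\<phi>. test_function L \<phi> \<Longrightarrow> h \<bullet> tf (deriv \<phi>) = 0"
  obtains c where "h = c *\<^sub>R seg 0 L"
proof -
  define e where "e = seg 0 L"
  obtain \<theta>0 where \<theta>0: "test_function L \<theta>0" "tf \<theta>0 \<bullet> e \<noteq> 0"
  proof -
    have lim: "(\<lambda>n. e \<bullet> tf (bump (inverse (real (Suc n))) (L / 4) (L / 2))) \<longlonglongrightarrow> e \<bullet> seg (L / 4) (L / 2)"
      by (rule bump_inner_tendsto[of _ _ L]) (use assms(1) in auto)
    have "e \<bullet> seg (L / 4) (L / 2) = (\<integral>x. indicat_real {L / 4<..<L / 2} x \<partial>lborel)"
      unfolding e_def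
      by (rule inner_l2_AE) (use rep_seg[of 0 L] rep_seg[of "L / 4" "L / 2"] in
          \<open>eventually_elim, use assms(1) in \<open>auto simp: indicator_def\<close>\<close>, measurable)
    also have "\<dots> = L / 4" using assms(1) by simp
    finally have pos: "e \<bullet> seg (L / 4) (L / 2) > 0" using assms(1) by simp
    from order_tendstoD(1)[OF lim this] obtain n where
      "e \<bullet> tf (bump (inverse (real (Suc n))) (L / 4) (L / 2)) > 0"
      by (auto simp: eventually_sequentially)
    then show ?thesis
      by (intro that[of "bump (inverse (real (Suc n))) (L / 4) (L / 2)"] bump_test)
         (use assms(1) in \<open>auto simp: inner_commute\<close>)
  qed
  define c where "c = (h \<bullet> tf \<theta>0) / (tf \<theta>0 \<bullet> e)"
  have "h - c *\<^sub>R e = 0"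
  proof (rule test_orthogonal[OF assms(1)])
    have "restr L (h - c *\<^sub>R e) = h - c *\<^sub>R e"
      using restr_add[of L h "- c *\<^sub>R e"] restr_scaleR[of L "- c" e] restr_seg[of 0 L L] h
      by (simp add: restr_eq_self_iff[symmetric] e_def)
    then show "h - c *\<^sub>R e \<in> L2_on L" by (simp add: restr_eq_self_iff)
    fix \<eta> assume \<eta>: "test_function L \<eta>"
    define k where "k = - (tf \<eta> \<bullet> e) / (tf \<theta>0 \<bullet> e)"
    define \<kappa> where "\<kappa> x = \<eta> x + k * \<theta>0 x" for x
    have \<kappa>: "test_function L \<kappa>" "tf \<kappa> = tf \<eta> + k *\<^sub>R tf \<theta>0"
      using tf_linear[OF \<eta> \<theta>0(1), of k] by (simp_all add: \<kappa>_def[abs_def])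
    have "tf \<kappa> \<bullet> seg 0 L = 0" using \<theta>0(2) by (simp add: \<kappa>(2) inner_add_left inner_diff_left k_def e_def[symmetric])
    then obtain \<phi> where "test_function L \<phi>" "deriv \<phi> = \<kappa>"
      by (rule test_function_antiderivative[OF \<kappa>(1) _ assms(1)])
    then have "h \<bullet> tf \<kappa> = 0" using zero by blast
    then have "h \<bullet> tf \<eta> = (tf \<eta> \<bullet> e) * c" using \<theta>0(2) by (simp add: \<kappa>(2) inner_add_right inner_diff_right k_def c_def field_simps)
    then show "(h - c *\<^sub>R e) \<bullet> tf \<eta> = 0" by (simp add: inner_diff_left inner_commute[of e] mult.commute)
  qed
  then show ?thesis by (intro that[of c]) (simp add: e_def)
qed

lemma has_weak_deriv_1_iff:
  assumes "0 < L"
  shows "has_weak_deriv L 1 f g \<longleftrightarrow> g \<in> L2_on L \<and> (\<exists>c. f = h1 L c g)"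
proof
  assume fg: "has_weak_deriv L 1 f g"
  then have g: "g \<in> L2_on L" and f: "f \<in> L2_on L" by (auto simp: has_weak_deriv_iff)
  have 0: "has_weak_deriv L 1 (h1 L 0 g) g" by (rule has_weak_deriv_1_h1[OF assms g])
  have "restr L (f - prim L g) = f - prim L g"
    using linear_diff[OF bounded_linear.linear[OF bounded_linear_restr], of L f "prim L g"] f
    by (simp add: restr_eq_self_iff[symmetric] restr_prim)
  then have "f - prim L g \<in> L2_on L" by (simp add: restr_eq_self_iff)
  moreover have "(f - prim L g) \<bullet> tf (deriv \<phi>) = 0" if "test_function L \<phi>" for \<phi>
    using fg 0 that by (auto simp: has_weak_deriv_iff inner_diff_left h1_def)
  ultimately obtain c where "f - prim L g = c *\<^sub>R seg 0 L"
    by (rule weak_deriv_zero_imp_const[OF assms])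
  then have "f = h1 L c g" by (simp add: h1_def algebra_simps)
  with g show "g \<in> L2_on L \<and> (\<exists>c. f = h1 L c g)" by blast
qed (auto intro: has_weak_deriv_1_h1[OF assms] simp del: One_nat_def)

section \<open>Sobolev functions as iterated primitives\<close>

lemma has_weak_deriv_2_h1:
  assumes "0 < L" "g \<in> L2_on L"
  shows "has_weak_deriv L 2 (h1 L d (h1 L c g)) g"
  using has_weak_deriv_Suc[OF assms(1) has_weak_deriv_1_h1[OF assms(1) h1_in], of d c g g]
    has_weak_deriv_1_h1[OF assms, of c] by (simp add: numeral_2_eq_2)

lemma sobolev_2_iff:
  assumes "0 < L"
  shows "w \<in> sobolev L 2 \<longleftrightarrow> (\<exists>m\<in>L2_on L. \<exists>c d. w = h1 L d (h1 L c m))"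
proof
  assume w: "w \<in> sobolev L 2"
  then have "\<exists>g. has_weak_deriv L 1 w g" "\<exists>g. has_weak_deriv L 2 w g"
    unfolding sobolev_def by (blast intro: one_le_numeral order_refl)+
  then obtain g m where g: "has_weak_deriv L 1 w g" "has_weak_deriv L 2 w m" by blast
  then have "has_weak_deriv L 1 g m" using has_weak_deriv_Suc[OF assms g(1)] by (simp add: numeral_2_eq_2)
  with g(1) show "\<exists>m\<in>L2_on L. \<exists>c d. w = h1 L d (h1 L c m)"
    unfolding has_weak_deriv_1_iff[OF assms] by blast
next
  assume "\<exists>m\<in>L2_on L. \<exists>c d. w = h1 L d (h1 L c m)"
  then obtain m c d where m: "m \<in> L2_on L" and w: "w = h1 L d (h1 L c m)" by blast
  have "\<exists>g. has_weak_deriv L j w g" if "j \<le> 2" for j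
  proof -
    consider "j = 0" | "j = 1" | "j = 2" using \<open>j \<le> 2\<close> by linarith
    then show ?thesis
      using has_weak_deriv_0[OF h1_in] has_weak_deriv_1_h1[OF assms h1_in] has_weak_deriv_2_h1[OF assms m]
      unfolding w by cases blast+
  qed
  then show "w \<in> sobolev L 2" by (simp add: sobolev_def w h1_in)
qed

lemma weak_deriv_h1:
  assumes "0 < L" "g \<in> L2_on L"
  shows "weak_deriv L 1 (h1 L d g) = g" "weak_deriv L 2 (h1 L d (h1 L c g)) = g"
  using weak_deriv_eq[OF assms(1)] has_weak_deriv_1_h1[OF assms] has_weak_deriv_2_h1[OF assms] by blast+

lemma V_space_iff:
  assumes "0 < L"
  shows "w \<in> V_space L \<longleftrightarrow> (\<exists>m\<in>L2_on L. \<exists>c. w = h1 L 0 (h1 L c m))"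
proof -
  have "point_value L (h1 L d (h1 L c m)) 0 = d" for d c m
    using point_value_h1[OF assms, of 0] assms by (simp add: seg_degenerate)
  note pv = this
  show ?thesis
  proof
    assume "w \<in> V_space L"
    then obtain m c d where "m \<in> L2_on L" "w = h1 L d (h1 L c m)" "point_value L w 0 = 0"
      unfolding V_space_def sobolev_2_iff[OF assms] by blast
    then show "\<exists>m\<in>L2_on L. \<exists>c. w = h1 L 0 (h1 L c m)" using pv by auto
  next
    assume "\<exists>m\<in>L2_on L. \<exists>c. w = h1 L 0 (h1 L c m)"
    then obtain m c where "m \<in> L2_on L" "w = h1 L 0 (h1 L c m)" by blast
    then show "w \<in> V_space L"
      using sobolev_2_iff[OF assms, of w] pv unfolding V_space_def by blast
  qed
qed

text \<open>
  The function has a second weak derivative by construction, so that its third and fourth ones are the first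
  and second one of \<open>m\<close>.
\<close>

lemma has_weak_deriv_34_h1:
  fixes c d :: real
  assumes "0 < L" "m \<in> L2_on L"
  defines "w \<equiv> h1 L d (h1 L c m)"
  shows "has_weak_deriv L 3 w m3 \<longleftrightarrow> has_weak_deriv L 1 m m3"
    and "has_weak_deriv L 3 w m3 \<Longrightarrow> has_weak_deriv L 4 w m4 \<longleftrightarrow> has_weak_deriv L 1 m3 m4"
proof -
  show "has_weak_deriv L 3 w m3 \<longleftrightarrow> has_weak_deriv L 1 m m3"
    using has_weak_deriv_Suc[OF assms(1) has_weak_deriv_2_h1[OF assms(1,2)], of d c m3]
    by (simp add: w_def numeral_3_eq_3 numeral_2_eq_2)
  show "has_weak_deriv L 4 w m4 \<longleftrightarrow> has_weak_deriv L 1 m3 m4" if "has_weak_deriv L 3 w m3"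
    using has_weak_deriv_Suc[OF assms(1) that, of m4] by simp
qed

lemma sobolev_4_iff:
  assumes "0 < L" "m \<in> L2_on L"
  shows "h1 L d (h1 L c m) \<in> sobolev L 4 \<longleftrightarrow> (\<exists>r\<in>L2_on L. \<exists>p k. m = h1 L p (h1 L k r))"
proof
  let ?w = "h1 L d (h1 L c m)"
  assume w: "?w \<in> sobolev L 4"
  have "\<exists>g. has_weak_deriv L 3 ?w g" "\<exists>g. has_weak_deriv L 4 ?w g"
    using w by (simp_all add: sobolev_def)
  then obtain m3 m4 where g: "has_weak_deriv L 3 ?w m3" "has_weak_deriv L 4 ?w m4" by blast
  have "has_weak_deriv L 1 m m3" "has_weak_deriv L 1 m3 m4"
    using g has_weak_deriv_34_h1[OF assms] by blast+
  then show "\<exists>r\<in>L2_on L. \<exists>p k. m = h1 L p (h1 L k r)"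
    unfolding has_weak_deriv_1_iff[OF assms(1)] by blast
next
  let ?w = "h1 L d (h1 L c m)"
  assume "\<exists>r\<in>L2_on L. \<exists>p k. m = h1 L p (h1 L k r)"
  then obtain r p k where r: "r \<in> L2_on L" and m: "m = h1 L p (h1 L k r)" by blast
  have m3: "has_weak_deriv L 3 ?w (h1 L k r)"
    using has_weak_deriv_34_h1(1)[OF assms] has_weak_deriv_1_h1[OF assms(1) h1_in] by (simp add: m)
  have m4: "has_weak_deriv L 4 ?w r"
    using has_weak_deriv_34_h1(2)[OF assms m3] has_weak_deriv_1_h1[OF assms(1) r] by simp
  have "\<exists>g. has_weak_deriv L j ?w g" if "j \<le> 4" for j
  proof -
    consider "j = 0" | "j = 1" | "j = 2" | "j = 3" | "j = 4" using \<open>j \<le> 4\<close> by linarith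
    then show ?thesis
      using has_weak_deriv_0[OF h1_in] has_weak_deriv_1_h1[OF assms(1) h1_in] has_weak_deriv_2_h1[OF assms] m3 m4
      by cases blast+
  qed
  then show "?w \<in> sobolev L 4" by (simp add: sobolev_def h1_in)
qed

lemma weak_deriv_34_h1:
  fixes c d k p :: real
  assumes "0 < L" "r \<in> L2_on L"
  defines "w \<equiv> h1 L d (h1 L c (h1 L p (h1 L k r)))"
  shows "weak_deriv L 3 w = h1 L k r" "weak_deriv L 4 w = r"
proof -
  have m3: "has_weak_deriv L 3 w (h1 L k r)"
    using has_weak_deriv_34_h1(1)[OF assms(1) h1_in] has_weak_deriv_1_h1[OF assms(1) h1_in] by (simp add: w_def)
  have m4: "has_weak_deriv L 4 w r"
    using has_weak_deriv_34_h1(2)[OF assms(1) h1_in] m3 has_weak_deriv_1_h1[OF assms(1,2)] by (simp add: w_def)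
  show "weak_deriv L 3 w = h1 L k r" "weak_deriv L 4 w = r"
    using m3 m4 weak_deriv_eq[OF assms(1)] by blast+
qed

section \<open>The beam\<close>

lemma deriv_halfline_works:
  "V differentiable_on {0..} \<Longrightarrow> t \<in> {0..} \<Longrightarrow> (V has_vector_derivative deriv_halfline V t) (at t within {0..})"
  unfolding deriv_halfline_def differentiable_on_def by (subst vector_derivative_works[symmetric]) blast

locale beam_problem =
  fixes L m\<^sub>p m\<^sub>f EI c T :: real and V :: "real \<Rightarrow> real"
  assumes L_pos: "L > 0" and mp: "m\<^sub>p > 0" and mf: "m\<^sub>f > 0" and EI: "EI > 0" and c: "c > 0"
    and V: "C2_halfline V"
    and V_sign: "(\<forall>t\<ge>0. V t > 0) \<or> (\<forall>t\<ge>0. V t < 0)"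
    and V_bdd: "bdd_above ((\<lambda>t. (V t)\<^sup>2) ` {0..})"
    and T: "T > 2 * m\<^sub>f * (SUP t\<in>{0..}. (V t)\<^sup>2)"
begin

definition M where "M = m\<^sub>p + 2 * m\<^sub>f"
definition k where "k t = 2 * m\<^sub>f * V t"
definition k' where "k' t = 2 * m\<^sub>f * deriv_halfline V t"
definition k'' where "k'' t = 2 * m\<^sub>f * deriv_halfline (deriv_halfline V) t"
definition b where "b t = T - 2 * m\<^sub>f * (V t)\<^sup>2"
definition b' where "b' t = - (4 * m\<^sub>f) * (V t * deriv_halfline V t)"
definition b'' where "b'' t = - (4 * m\<^sub>f) * (V t * deriv_halfline (deriv_halfline V) t + deriv_halfline V t * deriv_halfline V t)"
definition \<beta> where "\<beta> = T - 2 * m\<^sub>f * (SUP t\<in>{0..}. (V t)\<^sup>2)"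
definition I where "I = Blinfun (prim L)"
definition P where "P = Blinfun (restr L)"
definition e where "e = seg 0 L"

lemma V_C1: "C1_on {0..} V (deriv_halfline V)"
  and V'_C1: "C1_on {0..} (deriv_halfline V) (deriv_halfline (deriv_halfline V))"
proof -
  have d: "V differentiable_on {0..}" "deriv_halfline V differentiable_on {0..}"
    and c: "continuous_on {0..} (deriv_halfline (deriv_halfline V))"
    using V by (auto simp: C2_halfline_def)
  show "C1_on {0..} V (deriv_halfline V)"
    using d by (auto simp: C1_on_def deriv_halfline_works intro: differentiable_imp_continuous_on)
  show "C1_on {0..} (deriv_halfline V) (deriv_halfline (deriv_halfline V))"
    using d c by (auto simp: C1_on_def deriv_halfline_works)
qed

lemma V_nz: "t \<ge> 0 \<Longrightarrow> V t \<noteq> 0"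
  using V_sign by force

lemma C1_on_cmult:
  fixes f :: "real \<Rightarrow> real"
  shows "C1_on A f f' \<Longrightarrow> C1_on A (\<lambda>t. r * f t) (\<lambda>t. r * f' t)"
  using C1_on_scaleR[OF C1_on_const[of A r], of f f'] by simp

lemma I_apply: "blinfun_apply I = prim L"
  unfolding I_def by (rule bounded_linear_Blinfun_apply[OF bounded_linear_prim]) (use L_pos in simp)

lemma P_apply: "blinfun_apply P = restr L"
  unfolding P_def by (rule bounded_linear_Blinfun_apply[OF bounded_linear_restr])

lemma h1_eq: "h1 L r m = I m + r *\<^sub>R e"
  by (simp add: h1_def I_apply e_def)

text \<open>
  The bound on \<open>V\<^sup>2\<close> enters as \<open>b t \<ge> \<beta> > 0\<close>, the constant sign of \<open>V\<close> as \<open>k t \<noteq> 0\<close>.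
\<close>

sublocale beam L I P e M EI \<beta> c k k' k'' b b' b''
proof
  show "0 < L" by (rule L_pos)
  show "I f \<bullet> g + f \<bullet> I g = f \<bullet> e * (g \<bullet> e)" for f g
    using prim_parts[of L f g] L_pos by (simp add: I_apply e_def)
  show "P (I f) = I f" "I (P f) = I f" "P (P f) = P f" "P f \<bullet> g = f \<bullet> P g" for f g
    by (simp_all add: I_apply P_apply restr_prim prim_restr restr_restr inner_restr)
  show "P e = e" using restr_seg[of 0 L L] by (simp add: P_apply e_def)
  show "e \<bullet> e = L" using norm_seg[of 0 L] L_pos by (simp add: e_def norm_eq_sqrt_inner)
  show "I m + r *\<^sub>R e = 0 \<Longrightarrow> r = 0 \<and> P m = 0" for m r
    using h1_zero[OF L_pos, of r m] by (simp add: h1_eq P_apply)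
  show "0 < M" using mp mf by (simp add: M_def)
  show "0 < EI" by (rule EI)
  show "0 < \<beta>" using T by (simp add: \<beta>_def)
  show "C1_on {0..} k k'" unfolding k_def[abs_def] k'_def[abs_def] by (rule C1_on_cmult[OF V_C1])
  show "C1_on {0..} k' k''" unfolding k'_def[abs_def] k''_def[abs_def] by (rule C1_on_cmult[OF V'_C1])
  show "C1_on {0..} b b'"
    using C1_on_add[OF C1_on_const[of _ T] C1_on_cmult[OF C1_on_bilinear[OF bounded_bilinear_mult V_C1 V_C1], of "- 2 * m\<^sub>f"]]
    by (simp add: b_def[abs_def] b'_def[abs_def] power2_eq_square algebra_simps)
  show "C1_on {0..} b' b''"
    unfolding b'_def[abs_def] b''_def[abs_def]
    by (rule C1_on_cmult[OF C1_on_bilinear[OF bounded_bilinear_mult V_C1 V'_C1]])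
  show "t \<ge> 0 \<Longrightarrow> k t \<noteq> 0" for t using V_nz mf by (simp add: k_def)
  show "\<beta> \<le> b t" if "t \<ge> 0" for t
  proof -
    have "(V t)\<^sup>2 \<le> (SUP t\<in>{0..}. (V t)\<^sup>2)" using that by (intro cSUP_upper V_bdd) auto
    then show ?thesis using mf by (simp add: \<beta>_def b_def)
  qed
qed

section \<open>Coordinates of the state space\<close>

type_synonym coord = "(l2 \<times> real) \<times> l2"

text \<open>
  The coordinates range over functions on the whole line; the states of the beam correspond to those supported in the
  interval.
\<close>

definition X0 :: "coord set" where "X0 = {x. Prj x = x}"

lemma X0_iff: "x \<in> X0 \<longleftrightarrow> fst (fst x) \<in> L2_on L \<and> snd x \<in> L2_on L"
  by (auto simp: X0_def Prj_apply P_apply prod_eq_iff restr_eq_self_iff)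

lemma Prj_in_X0: "Prj x \<in> X0"
  by (simp add: X0_def Prj_apply P_P)

lemma X0_add: "x \<in> X0 \<Longrightarrow> y \<in> X0 \<Longrightarrow> x + y \<in> X0"
  and X0_diff: "x \<in> X0 \<Longrightarrow> y \<in> X0 \<Longrightarrow> x - y \<in> X0"
  and X0_scaleR: "x \<in> X0 \<Longrightarrow> r *\<^sub>R x \<in> X0"
  by (simp_all add: X0_def blinfun.add_right blinfun.diff_right blinfun.scaleR_right)

lemma norm_Prj: "norm (Prj x) \<le> norm x"
proof -
  have "Prj x \<bullet> Prj x = x \<bullet> Prj x"
    by (simp add: inner_prod_def Prj_apply P_sym P_P)
  also have "\<dots> \<le> norm x * norm (Prj x)" by (rule norm_cauchy_schwarz)
  finally have "norm (Prj x) * norm (Prj x) \<le> norm x * norm (Prj x)"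
    by (simp add: dot_square_norm power2_eq_square)
  then show ?thesis by (cases "Prj x = 0") auto
qed

text \<open>
  \<open>enc\<close> is a linear isomorphism from \<open>X0\<close> onto \<open>\<H>\<close> with inverse \<open>dec\<close>. By \<open>H_norm_upper\<close> and \<open>H_norm_lower\<close>
  it is bounded in both directions, and thereby translates the notions of limit, continuity and derivative.
\<close>

definition enc :: "coord \<Rightarrow> l2 \<times> l2" where "enc x = (W (fst x), snd x)"

definition dec :: "l2 \<times> l2 \<Rightarrow> coord" where
  "dec z = ((weak_deriv L 2 (fst z), point_value L (weak_deriv L 1 (fst z)) 0), snd z)"

lemma D_h1: "D p = h1 L (snd p) (fst p)" by (simp add: D_apply h1_eq)
lemma W_h1: "W p = h1 L 0 (h1 L (snd p) (fst p))" by (simp add: W_apply D_h1 h1_eq)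

lemma point_value_0: "point_value L (h1 L r g) 0 = r"
  using point_value_h1[OF L_pos, of 0] L_pos by (simp add: seg_degenerate)

lemma point_value_L: "point_value L (h1 L r g) L = r + g \<bullet> e"
  using point_value_h1[OF L_pos, of L] L_pos by (simp add: e_def)

lemma weak_deriv_W:
  assumes "fst p \<in> L2_on L"
  shows "weak_deriv L 1 (W p) = D p" "weak_deriv L 2 (W p) = fst p"
  using weak_deriv_h1[OF L_pos h1_in] weak_deriv_h1(2)[OF L_pos assms] by (auto simp: W_h1 D_h1)

lemma dec_enc: "x \<in> X0 \<Longrightarrow> dec (enc x) = x"
  using weak_deriv_W[of "fst x"] by (auto simp: X0_iff dec_def enc_def D_h1 point_value_0 prod_eq_iff)

lemma enc_in_H: "x \<in> X0 \<Longrightarrow> enc x \<in> H_space L"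
  by (auto simp: X0_iff enc_def H_space_def V_space_iff[OF L_pos] W_h1)

lemma H_space_enc: "z \<in> H_space L \<longleftrightarrow> (\<exists>x\<in>X0. z = enc x)"
proof
  assume "z \<in> H_space L"
  then obtain m r where m: "m \<in> L2_on L" "fst z = h1 L 0 (h1 L r m)" "snd z \<in> L2_on L"
    by (auto simp: H_space_def V_space_iff[OF L_pos])
  then show "\<exists>x\<in>X0. z = enc x"
    by (intro bexI[of _ "((m, r), snd z)"]) (auto simp: X0_iff enc_def W_h1 prod_eq_iff)
qed (auto intro: enc_in_H)

lemma dec_in_X0: "z \<in> H_space L \<Longrightarrow> dec z \<in> X0" and enc_dec: "z \<in> H_space L \<Longrightarrow> enc (dec z) = z"
  by (auto simp: H_space_enc dec_enc)

lemma enc_add: "enc (x + y) = enc x + enc y"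
  and enc_diff: "enc (x - y) = enc x - enc y"
  and enc_scaleR: "enc (r *\<^sub>R x) = r *\<^sub>R enc x"
  by (simp_all add: enc_def blinfun.add_right blinfun.diff_right blinfun.scaleR_right)

lemma dec_add: "y \<in> H_space L \<Longrightarrow> z \<in> H_space L \<Longrightarrow> dec (y + z) = dec y + dec z"
  by (metis H_space_enc dec_enc X0_add enc_add)

lemma dec_scaleR: "z \<in> H_space L \<Longrightarrow> dec (r *\<^sub>R z) = r *\<^sub>R dec z"
  by (metis H_space_enc dec_enc X0_scaleR enc_scaleR)

lemma H_norm_enc:
  assumes "x \<in> X0"
  shows "(H_norm L (enc x))\<^sup>2 = (norm (fst (fst x)))\<^sup>2 + (norm (D (fst x)))\<^sup>2 + (norm (snd x))\<^sup>2"
    and "0 \<le> H_norm L (enc x)"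
proof -
  have m: "fst (fst x) \<in> L2_on L" using assms by (simp add: X0_iff)
  have "H_inner L (enc x) (enc x) = (norm (fst (fst x)))\<^sup>2 + (norm (D (fst x)))\<^sup>2 + (norm (snd x))\<^sup>2"
    unfolding enc_def H_inner_def prod.case weak_deriv_W[OF m] by (simp add: power2_norm_eq_inner)
  then show "(H_norm L (enc x))\<^sup>2 = (norm (fst (fst x)))\<^sup>2 + (norm (D (fst x)))\<^sup>2 + (norm (snd x))\<^sup>2"
    "0 \<le> H_norm L (enc x)"
    by (auto simp: H_norm_def)
qed

lemma H_norm_upper: obtains C where "C > 0" "\<And>x. x \<in> X0 \<Longrightarrow> H_norm L (enc x) \<le> C * norm x"
proof -
  define C where "C = 2 + norm D"
  show ?thesis
  proof (rule that[of C])
    show "C > 0" by (simp add: C_def add_pos_nonneg)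
    fix x assume x: "x \<in> X0"
    have fs: "norm (fst x) \<le> norm x" "norm (snd x) \<le> norm x" "norm (fst (fst x)) \<le> norm x"
      using norm_fst_le[of "fst x" "snd x"] norm_snd_le[of "snd x" "fst x"]
        order_trans[OF norm_fst_le[of "fst (fst x)" "snd (fst x)"]] by auto
    have D: "norm (D (fst x)) \<le> norm D * norm x"
      by (rule order_trans[OF norm_blinfun]) (intro mult_left_mono fs norm_ge_zero)
    have "(H_norm L (enc x))\<^sup>2 \<le> (norm x)\<^sup>2 + (norm D * norm x)\<^sup>2 + (norm x)\<^sup>2"
      unfolding H_norm_enc(1)[OF x] by (intro add_mono power_mono fs D norm_ge_zero)
    also have "\<dots> \<le> (C * norm x)\<^sup>2"
      by (simp add: C_def power2_eq_square algebra_simps)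
    finally show "H_norm L (enc x) \<le> C * norm x"
      by (rule power2_le_imp_le) (simp add: C_def)
  qed
qed

text \<open>
  The squares in the norm of \<open>\<H>\<close> are those of the energy, which \<open>Q_coercive_ex\<close> bounds below at time \<open>0\<close>.
\<close>

lemma H_norm_lower: obtains C where "C > 0" "\<And>x. x \<in> X0 \<Longrightarrow> norm x \<le> C * H_norm L (enc x)"
proof -
  obtain q where q: "q > 0" "\<And>t x. t \<ge> 0 \<Longrightarrow> q * (x \<bullet> x) \<le> Q t x \<bullet> x" by (rule Q_coercive_ex) blast
  define K where "K = max EI (max (b 0) M)"
  have K: "EI \<le> K" "b 0 \<le> K" "M \<le> K" by (auto simp: K_def)
  then have K0: "K > 0" using EI by linarith
  show ?thesis
  proof (rule that[of "sqrt (K / q)"])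
    show "sqrt (K / q) > 0" using K0 q by simp
    fix x assume x: "x \<in> X0"
    have "q * (norm x)\<^sup>2 \<le> Q 0 x \<bullet> x" using q(2)[of 0 x] by (simp add: dot_square_norm)
    also have "\<dots> = EI * (norm (fst (fst x)))\<^sup>2 + b 0 * (norm (D (fst x)))\<^sup>2 + M * (norm (snd x))\<^sup>2"
      by (simp add: Q_inner dot_square_norm)
    also have "\<dots> \<le> K * (norm (fst (fst x)))\<^sup>2 + K * (norm (D (fst x)))\<^sup>2 + K * (norm (snd x))\<^sup>2"
      by (intro add_mono mult_right_mono K zero_le_power2)
    also have "\<dots> = K * (H_norm L (enc x))\<^sup>2" by (simp add: H_norm_enc(1)[OF x] algebra_simps)
    finally have "(norm x)\<^sup>2 \<le> K / q * (H_norm L (enc x))\<^sup>2" using q by (simp add: field_simps)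
    then have "norm x \<le> sqrt (K / q * (H_norm L (enc x))\<^sup>2)" by (rule real_le_rsqrt)
    then show "norm x \<le> sqrt (K / q) * H_norm L (enc x)" 
      using H_norm_enc(2)[OF x] by (simp only: real_sqrt_mult real_sqrt_abs abs_of_nonneg)
  qed
qed

lemma H_tendsto_enc:
  assumes u: "\<forall>\<^sub>F x in F. u x \<in> X0" and z: "z \<in> X0"
  shows "H_tendsto L (\<lambda>x. enc (u x)) (enc z) F \<longleftrightarrow> (u \<longlongrightarrow> z) F"
proof -
  obtain C1 where C1: "C1 > 0" "\<And>x. x \<in> X0 \<Longrightarrow> H_norm L (enc x) \<le> C1 * norm x" by (rule H_norm_upper) blast
  obtain C2 where C2: "C2 > 0" "\<And>x. x \<in> X0 \<Longrightarrow> norm x \<le> C2 * H_norm L (enc x)" by (rule H_norm_lower) blast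
  have H: "\<forall>\<^sub>F x in F. enc (u x) \<in> H_space L" using u by eventually_elim (rule enc_in_H)
  have "((\<lambda>x. H_norm L (enc (u x) - enc z)) \<longlongrightarrow> 0) F \<longleftrightarrow> (u \<longlongrightarrow> z) F"
  proof
    assume "(u \<longlongrightarrow> z) F"
    then have lim: "((\<lambda>x. C1 * norm (u x - z)) \<longlongrightarrow> 0) F"
      using tendsto_mult_right_zero tendsto_norm_zero LIM_zero by blast
    show "((\<lambda>x. H_norm L (enc (u x) - enc z)) \<longlongrightarrow> 0) F"
    proof (rule Lim_null_comparison[OF _ lim])
      show "\<forall>\<^sub>F x in F. norm (H_norm L (enc (u x) - enc z)) \<le> C1 * norm (u x - z)"
        using u by eventually_elim (use X0_diff z C1(2) H_norm_enc(2) in \<open>simp add: enc_diff[symmetric]\<close>)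
    qed
  next
    assume "((\<lambda>x. H_norm L (enc (u x) - enc z)) \<longlongrightarrow> 0) F"
    then have lim: "((\<lambda>x. C2 * H_norm L (enc (u x) - enc z)) \<longlongrightarrow> 0) F" by (rule tendsto_mult_right_zero)
    show "(u \<longlongrightarrow> z) F"
    proof (rule LIM_zero_cancel, rule Lim_null_comparison[OF _ lim])
      show "\<forall>\<^sub>F x in F. norm (u x - z) \<le> C2 * H_norm L (enc (u x) - enc z)"
        using u by eventually_elim (use X0_diff z C2(2) in \<open>simp add: enc_diff[symmetric]\<close>)
    qed
  qed
  then show ?thesis using H enc_in_H[OF z] by (simp add: H_tendsto_def)
qed

lemma H_tendsto_cong:
  assumes "\<forall>\<^sub>F x in F. u x = v x"
  shows "H_tendsto L u z F \<longleftrightarrow> H_tendsto L v z F"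
proof -
  have "(\<forall>\<^sub>F x in F. u x \<in> H_space L) \<longleftrightarrow> (\<forall>\<^sub>F x in F. v x \<in> H_space L)"
    by (rule eventually_cong[OF assms]) simp
  moreover have "((\<lambda>x. H_norm L (u x - z)) \<longlongrightarrow> 0) F \<longleftrightarrow> ((\<lambda>x. H_norm L (v x - z)) \<longlongrightarrow> 0) F"
    by (rule tendsto_cong) (use assms in \<open>auto elim: eventually_mono\<close>)
  ultimately show ?thesis by (simp add: H_tendsto_def)
qed

section \<open>The operator in coordinates\<close>

text \<open>
  The shear force \<open>- EI w\<^sub>x\<^sub>x\<^sub>x\<close> that the equation \<open>A\<^sub>0(t) x = g\<close> dictates in terms of \<open>g\<close> and the lower derivatives
  of \<open>w\<close>, followed by its value at \<open>0\<close> and its derivative.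
\<close>

definition shear :: "real \<Rightarrow> coord \<Rightarrow> coord \<Rightarrow> l2" where
  "shear t x g = - (b t *\<^sub>R D (fst x)) - M *\<^sub>R Istar (snd g) - k t *\<^sub>R (Istar (D (fst g)) - I (D (fst g)))"

definition shear_at_0 :: "real \<Rightarrow> coord \<Rightarrow> coord \<Rightarrow> real" where
  "shear_at_0 t x g = - (b t * snd (fst x)) - M * (snd g \<bullet> e) - k t * (D (fst g) \<bullet> e)"

definition shear_deriv :: "real \<Rightarrow> coord \<Rightarrow> coord \<Rightarrow> l2" where
  "shear_deriv t x g = - (b t *\<^sub>R fst (fst x)) + M *\<^sub>R snd g + (2 * k t) *\<^sub>R D (fst g)"

lemma shear_h1: "shear t x g = h1 L (shear_at_0 t x g) (shear_deriv t x g)"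
  by (simp add: shear_def shear_at_0_def shear_deriv_def h1_eq Istar_apply D_apply[of "fst x"] blinfun.add_right blinfun.minus_right
      blinfun.diff_right blinfun.scaleR_right algebra_simps)
     (simp add: scaleR_2[symmetric] mult.commute)

text \<open>
  The first component of the weak equation, read as an identity between \<open>(EI w\<^sub>x\<^sub>x, 0)\<close> and \<open>Ds\<close> of the shear force. It says
  that the bending moment \<open>EI w\<^sub>x\<^sub>x\<close> is minus the primitive of the shear force, in particular \<open>0\<close> at \<open>0\<close>, and
  is \<open>0\<close> at \<open>L\<close> as well.
\<close>

lemma R_eq_iff:
  assumes x: "x \<in> X0" and g: "g \<in> X0" and t: "t \<ge> 0"
  shows "x = R t g \<longleftrightarrow> shear t x g \<bullet> e = 0 \<and> EI *\<^sub>R fst (fst x) = - I (shear t x g) \<and> snd x = W (fst g)"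
proof -
  have P: "P (snd g) = snd g" "P (fst (fst g)) = fst (fst g)"
    using g by (simp_all add: X0_iff P_apply restr_eq_self_iff)
  have Ds: "Ds (shear t x g) = - (b t *\<^sub>R Ds (D (fst x))) - M *\<^sub>R Ws (snd g) - k t *\<^sub>R Th (fst g)"
    unfolding shear_def blinfun.diff_right blinfun.minus_right blinfun.scaleR_right
    by (simp add: Ws_def Th_def W_def blinfun.diff_left del: scaleR_Pair)
  have "x = R t g \<longleftrightarrow> (EI *\<^sub>R fst (fst x), 0) + b t *\<^sub>R Ds (D (fst x)) = - (M *\<^sub>R Ws (snd g)) - k t *\<^sub>R Th (fst g)
      \<and> M *\<^sub>R snd x = M *\<^sub>R W (fst g)"
    unfolding R_iff[OF t] Q_apply S_apply P by (simp add: zero_prod_def[symmetric])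
  also have "\<dots> \<longleftrightarrow> (EI *\<^sub>R fst (fst x), 0) = Ds (shear t x g) \<and> snd x = W (fst g)"
  proof -
    have diff: "- Y - Z - V = (- Z - V) - Y" for Y Z V :: "l2 \<times> real" by (simp add: algebra_simps)
    show ?thesis
      unfolding Ds diff[of "b t *\<^sub>R _"] eq_diff_eq using M by simp
  qed
  also have "\<dots> \<longleftrightarrow> shear t x g \<bullet> e = 0 \<and> EI *\<^sub>R fst (fst x) = - I (shear t x g) \<and> snd x = W (fst g)"
    unfolding Ds_apply Istar_apply by auto
  finally show ?thesis .
qed

lemma L2_on_P: "f \<in> L2_on L \<longleftrightarrow> P f = f" by (simp add: P_apply restr_eq_self_iff)

lemma h1_scaleR: "r *\<^sub>R h1 L d f = h1 L (r * d) (r *\<^sub>R f)"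
  by (simp add: h1_eq blinfun.scaleR_right algebra_simps)

lemma h1_0: "h1 L 0 f = I f" by (simp add: h1_eq)

lemma A0_enc:
  assumes r: "r \<in> L2_on L" and m: "m = h1 L p (h1 L q r)" and v: "v = W g1" and g1: "fst g1 \<in> L2_on L"
  shows "A0 L m\<^sub>p m\<^sub>f EI T V t (enc ((m, \<mu>), v))
     = (W g1, - (EI / M) *\<^sub>R r + (b t / M) *\<^sub>R m - (2 * k t / M) *\<^sub>R D g1)"
    and "enc ((m, \<mu>), v) \<in> dom_A0 L m\<^sub>f EI T V t \<longleftrightarrow> p = 0 \<and> h1 L q r \<bullet> e = 0
       \<and> k t * (D g1 \<bullet> e) = - EI * (q + r \<bullet> e) + b t * (\<mu> + m \<bullet> e)"
proof -
  have W: "W (m, \<mu>) = h1 L 0 (h1 L \<mu> m)" by (simp add: W_h1)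
  have m': "m \<in> L2_on L" unfolding m by (rule h1_in)
  have w1: "weak_deriv L 1 (W (m, \<mu>)) = h1 L \<mu> m" "weak_deriv L 2 (W (m, \<mu>)) = m"
    using weak_deriv_W[of "(m, \<mu>)"] m' by (simp_all add: D_h1)
  have w3: "weak_deriv L 3 (W (m, \<mu>)) = h1 L q r" "weak_deriv L 4 (W (m, \<mu>)) = r"
    using weak_deriv_34_h1[OF L_pos r, where d=0 and c=\<mu> and p=p and k=q] unfolding W m[symmetric] by auto
  have v1: "weak_deriv L 1 (W g1) = D g1" by (rule weak_deriv_W[OF g1])
  show "A0 L m\<^sub>p m\<^sub>f EI T V t (enc ((m, \<mu>), v))
     = (W g1, - (EI / M) *\<^sub>R r + (b t / M) *\<^sub>R m - (2 * k t / M) *\<^sub>R D g1)"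
    by (simp add: A0_def enc_def v w1(2) w3 v1 M_def b_def k_def mult.assoc del: One_nat_def)
  have in4: "W (m, \<mu>) \<in> sobolev L 4"
    unfolding W sobolev_4_iff[OF L_pos m'] using r m by blast
  have WV: "W (m, \<mu>) \<in> V_space L" "W g1 \<in> V_space L"
    using m' g1 by (auto simp: V_space_iff[OF L_pos] W_h1)
  then have H: "(W (m, \<mu>), W g1) \<in> H_space L" by (auto simp: H_space_def V_space_def sobolev_def)
  have pv: "point_value L m 0 = p" "point_value L m L = p + h1 L q r \<bullet> e"
    unfolding m by (rule point_value_0 point_value_L)+
  have pvW: "point_value L (W g1) L = D g1 \<bullet> e"
    using point_value_L[of 0 "D g1"] by (simp add: h1_0 W_apply)
  show "enc ((m, \<mu>), v) \<in> dom_A0 L m\<^sub>f EI T V t \<longleftrightarrow> p = 0 \<and> h1 L q r \<bullet> e = 0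
       \<and> k t * (D g1 \<bullet> e) = - EI * (q + r \<bullet> e) + b t * (\<mu> + m \<bullet> e)"
    using H WV in4 by (auto simp: dom_A0_def enc_def v w1 w3 pv pvW point_value_L k_def b_def simp del: One_nat_def)
qed

lemma shear_deriv_in: "x \<in> X0 \<Longrightarrow> g \<in> X0 \<Longrightarrow> shear_deriv t x g \<in> L2_on L"
  by (simp add: X0_iff shear_deriv_def L2_on_P blinfun.add_right blinfun.diff_right blinfun.minus_right blinfun.scaleR_right P_D)

text \<open>
  Both directions compare \<open>w\<^sub>x\<^sub>x = I (h1 q r)\<close> with minus the primitive of the shear force: the differential equation
  determines \<open>r = w\<^sub>x\<^sub>x\<^sub>x\<^sub>x\<close>, and the boundary condition on \<open>w\<^sub>x\<^sub>x\<^sub>x(L)\<close> determines the constant \<open>q = w\<^sub>x\<^sub>x\<^sub>x(0)\<close>.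
\<close>

lemma A0_iff:
  assumes x: "x \<in> X0" and g: "g \<in> X0" and t: "t \<ge> 0"
  shows "enc x \<in> dom_A0 L m\<^sub>f EI T V t \<and> A0 L m\<^sub>p m\<^sub>f EI T V t (enc x) = enc g \<longleftrightarrow> x = R t g"
proof -
  obtain m \<mu> v where xe: "x = ((m, \<mu>), v)" by (metis prod.exhaust)
  obtain g1 v1 where ge: "g = (g1, v1)" by (metis prod.exhaust)
  have g1: "fst g1 \<in> L2_on L" using g by (simp add: ge X0_iff)
  have M0: "M \<noteq> 0" and E0: "EI \<noteq> 0" using M EI by auto
  let ?F = "shear t x g" and ?v = "shear_at_0 t x g" and ?d = "shear_deriv t x g"
  show ?thesis
  proof
    assume A: "enc x \<in> dom_A0 L m\<^sub>f EI T V t \<and> A0 L m\<^sub>p m\<^sub>f EI T V t (enc x) = enc g"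
    have "W (m, \<mu>) \<in> sobolev L 4" using A by (auto simp: xe dom_A0_def enc_def)
    then obtain p q r where r: "r \<in> L2_on L" and m: "m = h1 L p (h1 L q r)"
      using sobolev_4_iff[OF L_pos, of m 0 \<mu>] x by (auto simp: xe X0_iff W_h1)
    have v: "v = W g1" using A by (simp add: xe ge A0_def enc_def)
    note A0 = A0_enc[OF r m v g1, where \<mu>=\<mu>]
    have dom: "p = 0" "h1 L q r \<bullet> e = 0"
       "k t * (D g1 \<bullet> e) = - EI * (q + r \<bullet> e) + b t * (\<mu> + m \<bullet> e)"
      using A A0(2)[of t] by (auto simp: xe)
    have v1: "v1 = - (EI / M) *\<^sub>R r + (b t / M) *\<^sub>R m - (2 * k t / M) *\<^sub>R D g1"
      using A A0(1)[of t] by (simp add: xe ge enc_def)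
    have d: "?d = - (EI *\<^sub>R r)"
      unfolding shear_deriv_def using M0 by (simp add: xe ge v1 algebra_simps)
    then have "?d \<bullet> e = - EI * (r \<bullet> e)" by simp
    then have "- b t * (m \<bullet> e) + M * (v1 \<bullet> e) + 2 * k t * (D g1 \<bullet> e) = - EI * (r \<bullet> e)"
      by (simp add: shear_deriv_def xe ge inner_add_left inner_diff_left)
    then have "?v = - (EI * q)"
      unfolding shear_at_0_def using dom(3) by (simp add: xe ge algebra_simps)
    then have F: "?F = - (EI *\<^sub>R h1 L q r)" using d unfolding shear_h1 by (simp add: h1_eq blinfun.minus_right blinfun.scaleR_right algebra_simps)
    show "x = R t g"
      unfolding R_eq_iff[OF x g t] F using dom(2) v m dom(1)
      by (simp add: xe ge blinfun.minus_right blinfun.scaleR_right h1_0)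
  next
    assume "x = R t g"
    then have "?F \<bullet> e = 0 \<and> EI *\<^sub>R fst (fst x) = - I ?F \<and> snd x = W (fst g)"
      using R_eq_iff[OF x g t] by blast
    then have F: "?F \<bullet> e = 0" "EI *\<^sub>R m = - I ?F" and v: "v = W g1"
      unfolding xe ge fst_conv snd_conv by blast+
    define q r where "q = - (?v / EI)" and "r = (- (1 / EI)) *\<^sub>R ?d"
    have r: "r \<in> L2_on L" using shear_deriv_in[OF x g, of t] by (simp add: r_def L2_on_P blinfun.scaleR_right blinfun.minus_right)
    have qr: "h1 L q r = (- (1 / EI)) *\<^sub>R ?F"
      unfolding shear_h1 h1_scaleR by (simp add: q_def r_def)
    have "m = (1 / EI) *\<^sub>R (EI *\<^sub>R m)" using E0 by simp
    then have m: "m = h1 L 0 (h1 L q r)"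
      unfolding F qr by (simp add: h1_0 blinfun.scaleR_right blinfun.minus_right)
    note A0 = A0_enc[OF r m v g1, where \<mu>=\<mu>]
    have "EI * (r \<bullet> e) = - (?d \<bullet> e)" "EI * q = - ?v" using E0 by (simp_all add: r_def q_def)
    moreover have "?d \<bullet> e = - b t * (m \<bullet> e) + M * (v1 \<bullet> e) + 2 * k t * (D g1 \<bullet> e)"
      by (simp add: shear_deriv_def xe ge inner_add_left inner_diff_left)
    moreover have "?v = - (b t * \<mu>) - M * (v1 \<bullet> e) - k t * (D g1 \<bullet> e)" by (simp add: shear_at_0_def xe ge)
    ultimately have "k t * (D g1 \<bullet> e) = - EI * (q + r \<bullet> e) + b t * (\<mu> + m \<bullet> e)"
      by (simp add: algebra_simps)
    then have dom: "enc x \<in> dom_A0 L m\<^sub>f EI T V t"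
      unfolding xe A0(2) using F(1) by (simp add: qr)
    have "EI *\<^sub>R r = - ?d" using E0 by (simp add: r_def)
    then have "EI *\<^sub>R r = b t *\<^sub>R m - M *\<^sub>R v1 - (2 * k t) *\<^sub>R D g1"
      by (simp add: shear_deriv_def xe ge algebra_simps)
    then have "- ((1 / M) *\<^sub>R (EI *\<^sub>R r)) + (b t / M) *\<^sub>R m - (2 * k t / M) *\<^sub>R D g1 = v1"
      using M0 by (simp only:) (simp add: scaleR_diff_right)
    then have "A0 L m\<^sub>p m\<^sub>f EI T V t (enc x) = enc g"
      unfolding xe A0(1) by (simp add: ge enc_def)
    with dom show "enc x \<in> dom_A0 L m\<^sub>f EI T V t \<and> A0 L m\<^sub>p m\<^sub>f EI T V t (enc x) = enc g" ..
  qed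
qed

lemma R_X0: "t \<ge> 0 \<Longrightarrow> g \<in> X0 \<Longrightarrow> R t g \<in> X0"
  by (simp add: X0_def Prj_R)

lemma R_inj: "t \<ge> 0 \<Longrightarrow> R t g = R t h \<Longrightarrow> g = h"
proof -
  assume t: "t \<ge> 0" and "R t g = R t h"
  then have "S t g = S t h" using Q_R[OF t] by metis
  then have "S t (g - h) = 0" by (simp add: blinfun.diff_right)
  then show "g = h" using S_inj by fastforce
qed

lemma R_X0_cancel: "t \<ge> 0 \<Longrightarrow> R t g \<in> X0 \<Longrightarrow> g \<in> X0"
  using R_inj[of t "Prj g" g] by (simp add: X0_def Prj_R)

lemma dom_A0_iff:
  assumes t: "t \<ge> 0"
  shows "z \<in> dom_A0 L m\<^sub>f EI T V t \<longleftrightarrow> (\<exists>g\<in>X0. z = enc (R t g))"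
proof
  assume z: "z \<in> dom_A0 L m\<^sub>f EI T V t"
  then have "z \<in> H_space L" by (auto simp: dom_A0_def)
  then obtain x where x: "x \<in> X0" and zx: "z = enc x" by (auto simp: H_space_enc)
  obtain m \<mu> v where xe: "x = ((m, \<mu>), v)" by (metis prod.exhaust)
  have "W (m, \<mu>) \<in> sobolev L 4" "v \<in> V_space L" using z by (auto simp: zx xe dom_A0_def enc_def)
  then obtain p q r m1 \<mu>1 where r: "r \<in> L2_on L" and m: "m = h1 L p (h1 L q r)"
    and g1: "m1 \<in> L2_on L" and v: "v = h1 L 0 (h1 L \<mu>1 m1)"
    using sobolev_4_iff[OF L_pos, of m 0 \<mu>] V_space_iff[OF L_pos, of v] x by (auto simp: xe X0_iff W_h1)
  define g :: coord where "g = ((m1, \<mu>1), - (EI / M) *\<^sub>R r + (b t / M) *\<^sub>R m - (2 * k t / M) *\<^sub>R D (m1, \<mu>1))"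
  have g: "g \<in> X0"
    using r g1 x by (simp add: g_def X0_iff xe L2_on_P blinfun.add_right blinfun.diff_right blinfun.minus_right blinfun.scaleR_right P_D)
  have "v = W (m1, \<mu>1)" by (simp add: v W_h1)
  from A0_enc(1)[OF r m this, of t \<mu>] g1 have "A0 L m\<^sub>p m\<^sub>f EI T V t (enc x) = enc g"
    by (simp add: xe g_def enc_def)
  then have "x = R t g" using A0_iff[OF x g t] z zx by simp
  with g zx show "\<exists>g\<in>X0. z = enc (R t g)" by blast
next
  assume "\<exists>g\<in>X0. z = enc (R t g)"
  then show "z \<in> dom_A0 L m\<^sub>f EI T V t" using A0_iff R_X0 t by blast
qed

lemma A_op_enc_R:
  assumes t: "t \<ge> 0" and g: "g \<in> X0"
  shows "A_op L m\<^sub>p m\<^sub>f EI c T V t (enc (R t g)) = enc (g + B t (R t g))"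
proof -
  have x: "R t g \<in> X0" by (rule R_X0[OF t g])
  have "weak_deriv L 1 (W (fst (R t g))) = D (fst (R t g))" using x unfolding X0_iff by (intro weak_deriv_W(1)) simp
  then have "B_op L m\<^sub>p m\<^sub>f c V t (enc (R t g)) = enc (B t (R t g))"
    by (simp add: B_op_def enc_def B_apply k'_def M_def[symmetric] blinfun.zero_right del: One_nat_def)
  moreover have "A0 L m\<^sub>p m\<^sub>f EI T V t (enc (R t g)) = enc g" using A0_iff[OF x g t] by simp
  ultimately show ?thesis by (simp add: A_op_def enc_add)
qed

lemma B_X0: "x \<in> X0 \<Longrightarrow> B t x \<in> X0"
  by (simp add: X0_def Prj_B)

section \<open>Existence and uniqueness of the evolution system\<close>

lemma at_within_halfline: "s \<le> t \<Longrightarrow> t < \<tau> \<Longrightarrow> at t within {s..\<tau>} = at t within {s..}" for s t \<tau> :: real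
  by (rule at_within_nhd[of _ "{..<\<tau>}"]) auto

text \<open>
  The generator part \<open>g\<close> is the same on all intervals since \<open>R t\<close> is injective.
\<close>

lemma strong_sol_global:
  assumes s: "0 \<le> s" and sol: "\<And>\<tau>. strong_sol R B s \<tau> u" and X: "\<And>t. s \<le> t \<Longrightarrow> u t \<in> X0"
  obtains g where "continuous_on {s..} g" "\<And>t. s \<le> t \<Longrightarrow> g t \<in> X0" "\<And>t. s \<le> t \<Longrightarrow> u t = R t (g t)"
    "\<And>t. s \<le> t \<Longrightarrow> (u has_vector_derivative g t + B t (u t)) (at t within {s..})"
proof -
  have "\<exists>z. continuous_on {s..\<tau>} z \<and> (\<forall>t\<in>{s..\<tau>}. u t = R t (z t) \<and>
      (u has_vector_derivative z t + B t (u t)) (at t within {s..\<tau>}))" for \<tau>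
    using sol unfolding strong_sol_def by blast
  then obtain z where z: "\<And>\<tau>. continuous_on {s..\<tau>} (z \<tau>)" "\<And>\<tau> t. t \<in> {s..\<tau>} \<Longrightarrow> u t = R t (z \<tau> t)"
    "\<And>\<tau> t. t \<in> {s..\<tau>} \<Longrightarrow> (u has_vector_derivative z \<tau> t + B t (u t)) (at t within {s..\<tau>})"
    by metis
  define g where "g t = z (t + 1) t" for t
  have gz: "g t = z \<tau> t" if "t \<in> {s..\<tau>}" for t \<tau>
    using that s z(2)[OF that] z(2)[of t "t + 1"] R_inj[of t "g t" "z \<tau> t"] by (simp add: g_def)
  show ?thesis
  proof (rule that[of g])
    fix t assume t: "s \<le> t"
    then have t': "t \<in> {s..t + 1}" by simp
    show u: "u t = R t (g t)" unfolding g_def by (rule z(2)[OF t'])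
    show "g t \<in> X0" using R_X0_cancel[of t "g t"] X[OF t] s t by (simp add: u)
    show "(u has_vector_derivative g t + B t (u t)) (at t within {s..})"
      using z(3)[OF t'] at_within_halfline[OF t, of "t + 1"] by (simp add: g_def)
  next
    show "continuous_on {s..} g"
      unfolding continuous_on_eq_continuous_within
    proof
      fix t assume t: "t \<in> {s..}"
      have "continuous_on {s..t + 1} g"
        using z(1)[of "t + 1"] by (rule continuous_on_eq) (rule gz[symmetric])
      then have "continuous (at t within {s..t + 1}) g"
        using t by (simp add: continuous_on_eq_continuous_within)
      then show "continuous (at t within {s..}) g"
        using t by (simp add: at_within_halfline)
    qed
  qed
qed

lemma H_tendsto_dec:
  assumes "\<forall>\<^sub>F x in F. u x \<in> H_space L" "z \<in> H_space L"
  shows "H_tendsto L u z F \<longleftrightarrow> ((\<lambda>x. dec (u x)) \<longlongrightarrow> dec z) F"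
proof -
  have "H_tendsto L u z F \<longleftrightarrow> H_tendsto L (\<lambda>x. enc (dec (u x))) z F"
    by (rule H_tendsto_cong) (use assms(1) in \<open>eventually_elim, simp add: enc_dec\<close>)
  also have "\<dots> \<longleftrightarrow> H_tendsto L (\<lambda>x. enc (dec (u x))) (enc (dec z)) F"
    using assms(2) by (simp add: enc_dec)
  also have "\<dots> \<longleftrightarrow> ((\<lambda>x. dec (u x)) \<longlongrightarrow> dec z) F"
    by (rule H_tendsto_enc) (use assms in \<open>auto intro: dec_in_X0 elim: eventually_mono\<close>)
  finally show ?thesis .
qed

lemma H_continuous_on_dec:
  assumes "\<And>x. x \<in> A \<Longrightarrow> u x \<in> H_space L"
  shows "H_continuous_on L A u \<longleftrightarrow> continuous_on A (\<lambda>x. dec (u x))"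
proof -
  have "H_tendsto L u (u x) (at x within A) \<longleftrightarrow> ((\<lambda>x. dec (u x)) \<longlongrightarrow> dec (u x)) (at x within A)" if "x \<in> A" for x
    using assms that by (intro H_tendsto_dec) (auto simp: eventually_at_filter)
  then show ?thesis by (auto simp: H_continuous_on_def continuous_on_def)
qed

lemma H_has_derivative_dec:
  assumes u: "\<And>r. r \<in> A \<Longrightarrow> u r \<in> H_space L" and "t \<in> A" "z \<in> H_space L"
  shows "H_has_derivative L u z t A \<longleftrightarrow> ((\<lambda>r. dec (u r)) has_vector_derivative dec z) (at t within A)"
proof -
  have q: "(u r - u t) /\<^sub>R (r - t) \<in> H_space L" "dec ((u r - u t) /\<^sub>R (r - t)) = (dec (u r) - dec (u t)) /\<^sub>R (r - t)"
    if "r \<in> A" for r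
  proof -
    have "u r = enc (dec (u r))" "u t = enc (dec (u t))" and X: "dec (u r) \<in> X0" "dec (u t) \<in> X0"
      using u[OF that] u[OF \<open>t \<in> A\<close>] by (simp_all add: enc_dec dec_in_X0)
    then have eq: "(u r - u t) /\<^sub>R (r - t) = enc ((dec (u r) - dec (u t)) /\<^sub>R (r - t))"
      by (metis enc_diff enc_scaleR)
    show "(u r - u t) /\<^sub>R (r - t) \<in> H_space L" "dec ((u r - u t) /\<^sub>R (r - t)) = (dec (u r) - dec (u t)) /\<^sub>R (r - t)"
      unfolding eq by (simp_all add: X0_diff X0_scaleR X dec_enc enc_in_H)
  qed
  have "H_tendsto L (\<lambda>r. (u r - u t) /\<^sub>R (r - t)) z (at t within A)
     \<longleftrightarrow> ((\<lambda>r. dec ((u r - u t) /\<^sub>R (r - t))) \<longlongrightarrow> dec z) (at t within A)"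
    using assms q by (intro H_tendsto_dec) (auto simp: eventually_at_filter)
  also have "\<dots> \<longleftrightarrow> ((\<lambda>r. (dec (u r) - dec (u t)) /\<^sub>R (r - t)) \<longlongrightarrow> dec z) (at t within A)"
    by (rule filterlim_cong) (auto simp: eventually_at_filter q)
  finally show ?thesis
    using assms by (simp add: H_has_derivative_def has_vector_derivative_iff_quotient)
qed

lemma H_bounded_linear_dec:
  assumes F: "H_bounded_linear L F"
  obtains C where "C > 0" "\<And>x. x \<in> X0 \<Longrightarrow> norm (dec (F (enc x))) \<le> C * norm x"
proof -
  obtain C1 where C1: "C1 > 0" "\<And>x. x \<in> X0 \<Longrightarrow> H_norm L (enc x) \<le> C1 * norm x" by (rule H_norm_upper) blast
  obtain C2 where C2: "C2 > 0" "\<And>x. x \<in> X0 \<Longrightarrow> norm x \<le> C2 * H_norm L (enc x)" by (rule H_norm_lower) blast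
  obtain K where K: "\<And>f. f \<in> H_space L \<Longrightarrow> H_norm L (F f) \<le> K * H_norm L f"
    and PH: "\<And>f. f \<in> H_space L \<Longrightarrow> F f \<in> H_space L"
    using F unfolding H_bounded_linear_def by blast
  \<comment> \<open>The constant in the definition of boundedness need not be nonnegative.\<close>
  define K' where "K' = \<bar>K\<bar> + 1"
  show ?thesis
  proof (rule that[of "C2 * (K' * C1)"])
    show "0 < C2 * (K' * C1)" using C1 C2 by (simp add: K'_def)
    fix x assume x: "x \<in> X0"
    then have H: "enc x \<in> H_space L" by (rule enc_in_H)
    have "norm (dec (F (enc x))) \<le> C2 * H_norm L (F (enc x))"
      using C2(2)[OF dec_in_X0[OF PH[OF H]]] by (simp add: enc_dec PH[OF H])
    also have "H_norm L (F (enc x)) \<le> K' * H_norm L (enc x)"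
      using K[OF H] H_norm_enc(2)[OF x] by (intro order_trans[OF K[OF H] mult_right_mono]) (auto simp: K'_def)
    also have "\<dots> \<le> K' * (C1 * norm x)" using C1(2)[OF x] by (intro mult_left_mono) (auto simp: K'_def)
    finally show "norm (dec (F (enc x))) \<le> C2 * (K' * C1) * norm x" using C2(1) by (simp add: mult.assoc)
  qed
qed

text \<open>
  The domain is dense since the range of \<open>R s\<close> is; the projection onto \<open>X0\<close> commutes with \<open>R s\<close> and does not increase
  the norm.
\<close>

lemma H_bounded_linear_eq:
  assumes P1: "H_bounded_linear L P1" and P2: "H_bounded_linear L P2" and s: "0 \<le> s"
    and eq: "\<And>z. z \<in> dom_A0 L m\<^sub>f EI T V s \<Longrightarrow> P1 z = P2 z" and f: "f \<in> H_space L"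
  shows "P1 f = P2 f"
proof -
  obtain C1 where C1: "C1 > 0" "\<And>x. x \<in> X0 \<Longrightarrow> norm (dec (P1 (enc x))) \<le> C1 * norm x"
    by (rule H_bounded_linear_dec[OF P1]) blast
  obtain C2 where C2: "C2 > 0" "\<And>x. x \<in> X0 \<Longrightarrow> norm (dec (P2 (enc x))) \<le> C2 * norm x"
    by (rule H_bounded_linear_dec[OF P2]) blast
  define x where "x = dec f"
  have x: "x \<in> X0" "f = enc x" using f by (simp_all add: x_def dec_in_X0 enc_dec)
  have small: "norm (dec (P1 f) - dec (P2 f)) \<le> (C1 + C2) * r" if pos: "r > 0" for r
  proof -
    obtain g0 where "norm (x - R s g0) < r" using beam_range_dense[OF s pos] by blast
    moreover define g where "g = Prj g0"
    moreover have "x - R s (Prj g0) = Prj (x - R s g0)"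
      using x(1) by (simp add: blinfun.diff_right Prj_R[OF s] X0_def)
    ultimately have r: "norm (x - R s g) < r" using norm_Prj[of "x - R s g0"] by simp
    have g: "g \<in> X0" "R s g \<in> X0" using R_X0[OF s] by (simp_all add: g_def Prj_in_X0)
    have d: "x - R s g \<in> X0" by (rule X0_diff[OF x(1) g(2)])
    have lin: "dec (Pa f) = dec (Pa (enc (x - R s g))) + dec (Pa (enc (R s g)))" if "H_bounded_linear L Pa" for Pa
    proof -
      have "Pa (enc (x - R s g) + enc (R s g)) = Pa (enc (x - R s g)) + Pa (enc (R s g))"
        "Pa (enc (x - R s g)) \<in> H_space L" "Pa (enc (R s g)) \<in> H_space L"
        using that enc_in_H[OF d] enc_in_H[OF g(2)] unfolding H_bounded_linear_def by blast+
      then show ?thesis by (simp add: dec_add[symmetric] enc_add[symmetric] x(2))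
    qed
    have "enc (R s g) \<in> dom_A0 L m\<^sub>f EI T V s" unfolding dom_A0_iff[OF s] using g(1) by blast
    then have "P1 (enc (R s g)) = P2 (enc (R s g))" by (rule eq)
    then have d12: "dec (P1 f) - dec (P2 f) = dec (P1 (enc (x - R s g))) - dec (P2 (enc (x - R s g)))"
      unfolding lin[OF P1] lin[OF P2] by (simp only: add_diff_cancel_right)
    have "norm (dec (P1 f) - dec (P2 f)) \<le> C1 * norm (x - R s g) + C2 * norm (x - R s g)"
      unfolding d12 by (rule norm_triangle_le_diff[OF add_mono[OF C1(2)[OF d] C2(2)[OF d]]])
    also have "\<dots> = (C1 + C2) * norm (x - R s g)" by (simp only: distrib_right)
    also have "\<dots> \<le> (C1 + C2) * r"
      by (rule mult_left_mono) (use r C1(1) C2(1) in auto)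
    finally show ?thesis .
  qed
  have "norm (dec (P1 f) - dec (P2 f)) \<le> 0"
  proof (rule field_le_epsilon)
    fix r :: real assume "0 < r"
    then show "norm (dec (P1 f) - dec (P2 f)) \<le> 0 + r"
      using small[of "r / (C1 + C2)"] C1(1) C2(1) by simp
  qed
  moreover have "P1 f \<in> H_space L" "P2 f \<in> H_space L"
    using P1 P2 f by (auto simp: H_bounded_linear_def)
  ultimately show ?thesis by (metis enc_dec norm_le_zero_iff right_minus_eq)
qed

text \<open>
  For any evolution system with the two required properties, the continuity of \<open>\<A>(t) U(t, s) f\<close> gives the
  continuity of the generator part, as \<open>B\<close> and the solution are continuous.
\<close>

lemma beam_evolution_strong_sol:
  assumes U: "beam_evolution L m\<^sub>p m\<^sub>f EI c T V U" and s: "0 \<le> s" and f: "f \<in> dom_A0 L m\<^sub>f EI T V s"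
  shows "strong_sol R B s \<tau> (\<lambda>t. dec (U t s f))"
proof -
  have dom: "U t s f \<in> dom_A0 L m\<^sub>f EI T V t" if "s \<le> t" for t
    using U f s that unfolding beam_evolution_def by blast
  define u where "u t = dec (U t s f)" for t
  define y where "y t = A_op L m\<^sub>p m\<^sub>f EI c T V t (U t s f)" for t
  have *: "U t s f \<in> H_space L \<and> y t \<in> H_space L \<and> u t = R t (dec (y t) - B t (u t))" if t: "s \<le> t" for t
  proof -
    have t0: "0 \<le> t" using s t by simp
    then obtain g where g: "g \<in> X0" "U t s f = enc (R t g)" using dom[OF t] dom_A0_iff by blast
    have R: "R t g \<in> X0" by (rule R_X0[OF t0 g(1)])
    have X: "g + B t (R t g) \<in> X0" by (intro X0_add g(1) B_X0 R)
    have "y t = enc (g + B t (R t g))" unfolding y_def g(2) by (rule A_op_enc_R[OF t0 g(1)])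
    then show ?thesis using X R by (simp add: u_def g(2) dec_enc enc_in_H)
  qed
  have der: "(u has_vector_derivative dec (y t)) (at t within {s..})" if "s \<le> t" for t
  proof -
    have "H_has_derivative L (\<lambda>r. U r s f) (y t) t {s..}"
      using U s f that unfolding beam_evolution_def y_def by blast
    then show ?thesis unfolding u_def[abs_def] using * that by (subst (asm) H_has_derivative_dec) auto
  qed
  have "H_continuous_on L {s..} y"
    using U s f unfolding beam_evolution_def y_def by blast
  then have "continuous_on {s..} (\<lambda>t. dec (y t))" using * by (subst (asm) H_continuous_on_dec) auto
  moreover have "continuous_on {s..} u"
    using der by (intro continuous_on_vector_derivative) auto
  moreover have "continuous_on {s..} B" by (rule continuous_on_subset[OF C1_onD(3)[OF B_C1]]) (use s in auto)
  ultimately have "continuous_on {s..} (\<lambda>t. dec (y t) - B t (u t))"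
    by (intro continuous_on_diff bounded_bilinear.continuous_on[OF bounded_bilinear_blinfun_apply])
  then have "continuous_on {s..\<tau>} (\<lambda>t. dec (y t) - B t (u t))" by (rule continuous_on_subset) auto
  moreover have "(u has_vector_derivative dec (y t)) (at t within {s..\<tau>})" if "t \<in> {s..\<tau>}" for t
    by (rule has_vector_derivative_within_subset[OF der]) (use that in auto)
  ultimately have "strong_sol R B s \<tau> u"
    unfolding strong_sol_def using * by (intro exI[of _ "\<lambda>t. dec (y t) - B t (u t)"]) auto
  then show ?thesis by (simp add: u_def[abs_def])
qed

lemma beam_evolution_unique:
  assumes U1: "beam_evolution L m\<^sub>p m\<^sub>f EI c T V U1" and U2: "beam_evolution L m\<^sub>p m\<^sub>f EI c T V U2"
    and st: "0 \<le> s" "s \<le> t" and f: "f \<in> H_space L"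
  shows "U1 t s f = U2 t s f"
proof (rule H_bounded_linear_eq[OF _ _ st(1) _ f])
  show "H_bounded_linear L (U1 t s)" "H_bounded_linear L (U2 t s)"
    using U1 U2 st by (auto simp: beam_evolution_def evolution_system_def)
  fix z assume z: "z \<in> dom_A0 L m\<^sub>f EI T V s"
  then have zH: "z \<in> H_space L" by (auto simp: dom_A0_def)
  have "dec (U1 s s z) = dec (U2 s s z)"
    using U1 U2 st zH by (auto simp: beam_evolution_def evolution_system_def)
  then have "dec (U1 t s z) = dec (U2 t s z)"
    using beam_strong_sol_unique[OF st(1) beam_evolution_strong_sol[OF U1 st(1) z, of t]
        beam_evolution_strong_sol[OF U2 st(1) z, of t]] st by simp
  moreover have "U1 t s z \<in> H_space L" "U2 t s z \<in> H_space L"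
    using U1 U2 st zH by (auto simp: beam_evolution_def evolution_system_def H_bounded_linear_def)
  ultimately show "U1 t s z = U2 t s z" by (metis enc_dec)
qed

text \<open>
  The abstract evolution family is conjugated with \<open>enc\<close>; it preserves \<open>X0\<close> because it commutes with the projection.
\<close>

lemma beam_evolution_exists: "\<exists>U. beam_evolution L m\<^sub>p m\<^sub>f EI c T V U"
proof (rule beam_propagator)
  fix U :: "real \<Rightarrow> real \<Rightarrow> coord \<Rightarrow>\<^sub>L coord"
  assume id: "\<And>s f. s \<ge> 0 \<Longrightarrow> U s s f = f"
    and comp: "\<And>s r t f. s \<ge> 0 \<Longrightarrow> r \<ge> 0 \<Longrightarrow> t \<ge> 0 \<Longrightarrow> U t r (U r s f) = U t s f"
    and cont: "\<And>f. continuous_on ({0..} \<times> {0..}) (\<lambda>(t, s). U t s f)"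
    and range: "\<And>s t. s \<ge> 0 \<Longrightarrow> t \<ge> 0 \<Longrightarrow> U t s ` range (R s) = range (R t)"
    and sol: "\<And>s \<tau> g. 0 \<le> s \<Longrightarrow> strong_sol R B s \<tau> (\<lambda>t. U t s (R s g))"
    and Prj: "\<And>s t f. s \<ge> 0 \<Longrightarrow> t \<ge> 0 \<Longrightarrow> U t s (Prj f) = Prj (U t s f)"
  have UX: "U t s x \<in> X0" if "0 \<le> s" "0 \<le> t" "x \<in> X0" for s t x
    using Prj[OF that(1,2), of x] that(3) by (simp add: X0_def)
  define UH where "UH t s z = enc (U t s (dec z))" for t s z
  have UH: "UH t s z \<in> H_space L" "dec (UH t s z) = U t s (dec z)" if "0 \<le> s" "0 \<le> t" "z \<in> H_space L" for t s z
    using UX[OF that(1,2) dec_in_X0[OF that(3)]] by (simp_all add: UH_def enc_in_H dec_enc)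
  have sub: "UH t s z \<in> dom_A0 L m\<^sub>f EI T V t" if st: "0 \<le> s" "0 \<le> t" and z: "z \<in> dom_A0 L m\<^sub>f EI T V s" for s t z
  proof -
    obtain g where g: "g \<in> X0" "z = enc (R s g)" using z dom_A0_iff[OF st(1)] by blast
    have "U t s (R s g) \<in> range (R t)" using range[OF st] by blast
    then obtain h where h: "U t s (R s g) = R t h" by blast
    have "R t h \<in> X0" using UX[OF st R_X0[OF st(1) g(1)]] by (simp add: h)
    then have "h \<in> X0" by (rule R_X0_cancel[OF st(2)])
    then show ?thesis unfolding dom_A0_iff[OF st(2)]
      using h g by (auto simp: UH_def dec_enc R_X0[OF st(1) g(1)])
  qed
  have UH_id: "UH s s z = z" if "0 \<le> s" "z \<in> H_space L" for s z
    using that by (simp add: UH_def id enc_dec)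
  have UH_comp: "UH t r (UH r s z) = UH t s z" if "0 \<le> s" "0 \<le> r" "0 \<le> t" "z \<in> H_space L" for s r t z
    using comp[OF that(1-3)] UH(2)[OF that(1,2,4)] by (simp add: UH_def)
  have "beam_evolution L m\<^sub>p m\<^sub>f EI c T V UH"
    unfolding beam_evolution_def evolution_system_def
  proof (intro conjI allI impI ballI)
    fix s t :: real assume st: "0 \<le> s \<and> s \<le> t"
    then have st0: "0 \<le> s" "0 \<le> t" by auto
    obtain C1 where C1: "C1 > 0" "\<And>x. x \<in> X0 \<Longrightarrow> H_norm L (enc x) \<le> C1 * norm x" by (rule H_norm_upper) blast
    obtain C2 where C2: "C2 > 0" "\<And>x. x \<in> X0 \<Longrightarrow> norm x \<le> C2 * H_norm L (enc x)" by (rule H_norm_lower) blast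
    show "H_bounded_linear L (UH t s)"
      unfolding H_bounded_linear_def
    proof (intro conjI ballI allI exI)
      fix f g a assume f: "f \<in> H_space L"
      show "UH t s f \<in> H_space L" by (rule UH(1)[OF st0 f])
      show "UH t s (a *\<^sub>R f) = a *\<^sub>R UH t s f"
        by (simp add: UH_def dec_scaleR f blinfun.scaleR_right enc_scaleR)
      show "UH t s (f + g) = UH t s f + UH t s g" if "g \<in> H_space L"
        by (simp add: UH_def dec_add f that blinfun.add_right enc_add)
      have X: "dec f \<in> X0" "U t s (dec f) \<in> X0" using dec_in_X0[OF f] UX[OF st0] by auto
      have "H_norm L (UH t s f) \<le> C1 * norm (U t s (dec f))" unfolding UH_def by (rule C1(2)[OF X(2)])
      also have "\<dots> \<le> C1 * (norm (U t s) * norm (dec f))" using C1 by (intro mult_left_mono norm_blinfun) auto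
      also have "\<dots> \<le> C1 * (norm (U t s) * (C2 * H_norm L f))"
        using C1 C2(2)[OF X(1)] by (intro mult_left_mono) (auto simp: enc_dec f)
      finally show "H_norm L (UH t s f) \<le> (C1 * norm (U t s) * C2) * H_norm L f" by (simp add: mult.assoc)
    qed
    show "UH t s ` dom_A0 L m\<^sub>f EI T V s = dom_A0 L m\<^sub>f EI T V t"
    proof (intro set_eqI iffI)
      fix z assume z: "z \<in> dom_A0 L m\<^sub>f EI T V t"
      then have "z \<in> H_space L" by (auto simp: dom_A0_def)
      then have "z = UH t s (UH s t z)" using UH_comp[OF st0(2,1,2)] UH_id[OF st0(2)] by simp
      with sub[OF st0(2,1) z] show "z \<in> UH t s ` dom_A0 L m\<^sub>f EI T V s" by blast
    qed (use sub[OF st0] in auto)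
  next
    fix s :: real and f assume "0 \<le> s" "f \<in> H_space L"
    then show "UH s s f = f" by (rule UH_id)
  next
    fix s r t :: real and f assume "0 \<le> s \<and> s \<le> r \<and> r \<le> t" "f \<in> H_space L"
    then show "UH t r (UH r s f) = UH t s f" by (intro UH_comp) auto
  next
    fix f assume f: "f \<in> H_space L"
    have "continuous_on {(t, s). 0 \<le> s \<and> s \<le> t} (\<lambda>(t, s). U t s (dec f))"
      by (rule continuous_on_subset[OF cont]) auto
    then have "continuous_on {(t, s). 0 \<le> s \<and> s \<le> t} (\<lambda>x. dec (case x of (t, s) \<Rightarrow> UH t s f))"
      by (rule continuous_on_eq) (auto simp: UH(2)[OF _ _ f])
    then show "H_continuous_on L {(t, s). 0 \<le> s \<and> s \<le> t} (\<lambda>(t, s). UH t s f)"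
      by (subst H_continuous_on_dec) (auto simp: UH(1)[OF _ _ f])
  next
    fix s :: real and f assume s: "0 \<le> s" and f: "f \<in> dom_A0 L m\<^sub>f EI T V s"
    then have fH: "f \<in> H_space L" by (auto simp: dom_A0_def)
    obtain g0 where g0: "g0 \<in> X0" "f = enc (R s g0)" using f dom_A0_iff[OF s] by blast
    define u where "u t = U t s (R s g0)" for t
    have uU: "UH t s f = enc (u t)" for t
      by (simp add: UH_def u_def g0(2) dec_enc R_X0[OF s g0(1)])
    have X: "u t \<in> X0" if "s \<le> t" for t unfolding u_def using s that by (intro UX R_X0 g0) auto
    have "strong_sol R B s \<tau> u" for \<tau> unfolding u_def[abs_def] by (rule sol[OF s])
    from strong_sol_global[OF s this X] obtain g where g: "continuous_on {s..} g"
      "\<And>t. s \<le> t \<Longrightarrow> g t \<in> X0" "\<And>t. s \<le> t \<Longrightarrow> u t = R t (g t)"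
      "\<And>t. s \<le> t \<Longrightarrow> (u has_vector_derivative g t + B t (u t)) (at t within {s..})"
      by blast
    have A: "A_op L m\<^sub>p m\<^sub>f EI c T V t (UH t s f) = enc (g t + B t (u t))" if "s \<le> t" for t
      using A_op_enc_R[of t "g t"] g(2,3)[OF that] s that by (simp add: uU)
    have X': "g t + B t (u t) \<in> X0" if "s \<le> t" for t using X g(2) that by (intro X0_add B_X0) auto
    show "H_has_derivative L (\<lambda>r. UH r s f) (A_op L m\<^sub>p m\<^sub>f EI c T V t (UH t s f)) t {s..}" if t: "s \<le> t" for t
    proof -
      have "((\<lambda>r. dec (UH r s f)) has_vector_derivative dec (enc (g t + B t (u t)))) (at t within {s..})"
        unfolding dec_enc[OF X'[OF t]]
        by (rule has_vector_derivative_transform[OF _ _ g(4)[OF t]]) (use t X in \<open>auto simp: uU dec_enc\<close>)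
      then show ?thesis
        unfolding A[OF t] by (subst H_has_derivative_dec) (use t X X' in \<open>auto simp: uU enc_in_H\<close>)
    qed
    have "continuous_on {s..} u"
      using g(4) by (intro continuous_on_vector_derivative) auto
    moreover have "continuous_on {s..} B" by (rule continuous_on_subset[OF C1_onD(3)[OF B_C1]]) (use s in auto)
    ultimately have "continuous_on {s..} (\<lambda>t. g t + B t (u t))"
      by (intro continuous_on_add g(1) bounded_bilinear.continuous_on[OF bounded_bilinear_blinfun_apply])
    then have "continuous_on {s..} (\<lambda>t. dec (A_op L m\<^sub>p m\<^sub>f EI c T V t (UH t s f)))"
      by (rule continuous_on_eq) (simp add: A dec_enc X')
    then show "H_continuous_on L {s..} (\<lambda>t. A_op L m\<^sub>p m\<^sub>f EI c T V t (UH t s f))"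
      by (subst H_continuous_on_dec) (auto simp: A X' enc_in_H)
  qed
  then show ?thesis by blast
qed

end

theorem theorem2p2:
  fixes L m\<^sub>p m\<^sub>f EI c T :: real and V :: "real \<Rightarrow> real"
  assumes "L > 0" "m\<^sub>p > 0" "m\<^sub>f > 0" "EI > 0" "c > 0"
    and "C2_halfline V"
    and "(\<forall>t\<ge>0. V t > 0) \<or> (\<forall>t\<ge>0. V t < 0)"
    and "T > 0"
    and "bdd_above ((\<lambda>t. (V t)\<^sup>2) ` {0..})"
    and "T > 2 * m\<^sub>f * (SUP t\<in>{0..}. (V t)\<^sup>2)"
  shows "\<exists>U. beam_evolution L m\<^sub>p m\<^sub>f EI c T V U \<and>
    (\<forall>U'. beam_evolution L m\<^sub>p m\<^sub>f EI c T V U' \<longrightarrow>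
      (\<forall>s t. 0 \<le> s \<and> s \<le> t \<longrightarrow> (\<forall>f\<in>H_space L. U' t s f = U t s f)))"
proof -
  interpret beam_problem L m\<^sub>p m\<^sub>f EI c T V using assms by unfold_locales auto
  obtain U where "beam_evolution L m\<^sub>p m\<^sub>f EI c T V U" using beam_evolution_exists by blast
  then show ?thesis using beam_evolution_unique by blast
qed

end
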